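(* Let $\widehat H_{cc}=\{g\in\widetilde H^{-1}\otimes\mathbb S:\operatorname{curl}g\in\widetilde H^{-1}\otimes\mathbb M,\ \operatorname{inc}g\in\widetilde H^{-1}\otimes\mathbb S\}$ with norm $\|g\|_{cc}$. There exist continuous linear operators $S^{cc}_0:\widehat H_{cc}\to\mathring H^1\otimes\mathbb S$, $S^{cc}_1:\widehat H_{cc}\to\mathring H^1\otimes\mathbb V$, $S^{cc}_2:\widehat H_{cc}\to\mathring H^1$ such that every $g\in\widehat H_{cc}$ satisfies \[ g=S^{cc}_0g+\operatorname{def}S^{cc}_1g+\operatorname{hess}S^{cc}_2g . \] Consequently $\widehat H_{cc}=\widetilde H_{cc}$.
   Context: $\Omega\subset\mathbb R^3$ is bounded, open, connected and simply connected, with Lipschitz boundary, and $\partial\Omega$ is connected. $\mathbb V=\mathbb R^3$, $\mathbb M=\mathbb R^{3\times3}$, $\mathbb S$ = symmetric matrices. $(\operatorname{grad}u)_{ij}=\partial_ju_i$, $\operatorname{def}u=\frac12(\operatorname{grad}u+(\operatorname{grad}u)^\top)$, $\operatorname{hess}w=(\partial_i\partial_jw)$; curl of matrix fields acts row-wise; $\operatorname{inc}g=\operatorname{curl}((\operatorname{curl}g)^\top)$; derivatives are distributional on $\mathbb R^3$. $\mathring H^1$ is the closure of $\mathcal D(\Omega)$ (smooth functions compactly supported in $\Omega$) in $H^1(\Omega)$. $\widetilde H^{-1}=\{u\in H^{-1}(\mathbb R^3):\operatorname{supp}u\subset\overline\Omega\}$ with the $H^{-1}(\mathbb R^3)$ norm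 (componentwise). $\|g\|_{cc}^2=\|g\|_{\widetilde H^{-1}}^2+\|\operatorname{curl}g\|_{\widetilde H^{-1}}^2+\|\operatorname{inc}g\|_{\widetilde H^{-1}}^2$, and $\widetilde H_{cc}$ is the closure of $\mathcal D(\Omega)\otimes\mathbb S$ (extended by zero) in this norm. *)

theory Defs
  imports "HOL-Analysis.Analysis"
begin

type_synonym R3 = "real^3"
(* a (real) distribution on R^3 is represented by a functional on functions R^3 -> real;
   only its values on test functions matter *)
type_synonym distr = "(R3 \<Rightarrow> real) \<Rightarrow> real"

definition pd :: "3 \<Rightarrow> (R3 \<Rightarrow> real) \<Rightarrow> R3 \<Rightarrow> real" where
  "pd j f = (\<lambda>x. frechet_derivative f (at x) (axis j 1))"

fun iter_pd :: "3 list \<Rightarrow> (R3 \<Rightarrow> real) \<Rightarrow> R3 \<Rightarrow> real" where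
  "iter_pd [] f = f"
| "iter_pd (j # js) f = pd j (iter_pd js f)"

definition smooth_fun :: "(R3 \<Rightarrow> real) \<Rightarrow> bool" where
  "smooth_fun f \<longleftrightarrow> (\<forall>js x. iter_pd js f differentiable (at x))"

definition tsupp :: "(R3 \<Rightarrow> real) \<Rightarrow> R3 set" where
  "tsupp f = closure {x. f x \<noteq> 0}"

definition test_on :: "R3 set \<Rightarrow> (R3 \<Rightarrow> real) \<Rightarrow> bool" where
  "test_on U f \<longleftrightarrow> smooth_fun f \<and> compact (tsupp f) \<and> tsupp f \<subseteq> U"

abbreviation test :: "(R3 \<Rightarrow> real) \<Rightarrow> bool" where
  "test \<equiv> test_on UNIV"

definition L2 :: "(R3 \<Rightarrow> real) \<Rightarrow> bool" where
  "L2 f \<longleftrightarrow> f \<in> borel_measurable lborel \<and> integrable lborel (\<lambda>x. (f x)\<^sup>2)"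

definition L2n :: "(R3 \<Rightarrow> real) \<Rightarrow> real" where
  "L2n f = sqrt (\<integral>x. (f x)\<^sup>2 \<partial>lborel)"

definition h1n :: "(R3 \<Rightarrow> real) \<Rightarrow> real" where
  "h1n f = sqrt ((L2n f)\<^sup>2 + (\<Sum>j\<in>UNIV. (L2n (pd j f))\<^sup>2))"

(* H^1 norm of an L2 function, the L2 norm of the weak derivative being computed by duality *)
definition h1norm :: "(R3 \<Rightarrow> real) \<Rightarrow> real" where
  "h1norm w = sqrt ((L2n w)\<^sup>2 + (\<Sum>j\<in>UNIV.
      (SUP \<psi>\<in>{\<psi>. test \<psi> \<and> \<psi> \<noteq> (\<lambda>_. 0)}.
          \<bar>\<integral>x. w x * pd j \<psi> x \<partial>lborel\<bar> / L2n \<psi>)\<^sup>2))"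

(* \<open>H\<^sup>1_0(\<Omega>)\<close>: L2(R^3) functions (i.e. extended by zero) that are H^1-limits of test functions in \<Omega> *)
definition H10 :: "R3 set \<Rightarrow> (R3 \<Rightarrow> real) \<Rightarrow> bool" where
  "H10 \<Omega> w \<longleftrightarrow> L2 w \<and> (\<exists>\<phi> :: nat \<Rightarrow> R3 \<Rightarrow> real.
      (\<forall>n. test_on \<Omega> (\<phi> n)) \<and>
      (\<lambda>n. L2n (\<lambda>x. \<phi> n x - w x)) \<longlonglongrightarrow> 0 \<and>
      (\<forall>j. \<exists>G. L2 G \<and> (\<lambda>n. L2n (\<lambda>x. pd j (\<phi> n) x - G x)) \<longlonglongrightarrow> 0))"

definition fd :: "(R3 \<Rightarrow> real) \<Rightarrow> distr" where
  "fd w = (\<lambda>\<phi>. \<integral>x. w x * \<phi> x \<partial>lborel)"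

definition lin_test :: "distr \<Rightarrow> bool" where
  "lin_test u \<longleftrightarrow> (\<forall>\<phi> \<psi> a b. test \<phi> \<longrightarrow> test \<psi> \<longrightarrow>
      u (\<lambda>x. a * \<phi> x + b * \<psi> x) = a * u \<phi> + b * u \<psi>)"

definition Hm1norm :: "distr \<Rightarrow> real" where
  "Hm1norm u = (SUP \<phi>\<in>{\<phi>. test \<phi> \<and> \<phi> \<noteq> (\<lambda>_. 0)}. \<bar>u \<phi>\<bar> / h1n \<phi>)"

definition in_Hm1 :: "distr \<Rightarrow> bool" where
  "in_Hm1 u \<longleftrightarrow> lin_test u \<and>
     bdd_above ((\<lambda>\<phi>. \<bar>u \<phi>\<bar> / h1n \<phi>) ` {\<phi>. test \<phi> \<and> \<phi> \<noteq> (\<lambda>_. 0)})"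

definition supp_in :: "distr \<Rightarrow> R3 set \<Rightarrow> bool" where
  "supp_in u K \<longleftrightarrow> (\<forall>\<phi>. test_on (- K) \<phi> \<longrightarrow> u \<phi> = 0)"

definition Htm1 :: "R3 set \<Rightarrow> distr \<Rightarrow> bool" where
  "Htm1 \<Omega> u \<longleftrightarrow> in_Hm1 u \<and> supp_in u (closure \<Omega>)"

definition dd :: "3 \<Rightarrow> distr \<Rightarrow> distr" where
  "dd j u = (\<lambda>\<phi>. - u (pd j \<phi>))"

definition eps :: "3 \<Rightarrow> 3 \<Rightarrow> 3 \<Rightarrow> real" where
  "eps i j k = (if (i, j, k) \<in> {(1,2,3), (2,3,1), (3,1,2)} then 1
     else if (i, j, k) \<in> {(1,3,2), (3,2,1), (2,1,3)} then -1 else 0)"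

definition curlV :: "(3 \<Rightarrow> distr) \<Rightarrow> 3 \<Rightarrow> distr" where
  "curlV v i = (\<lambda>\<phi>. \<Sum>j\<in>UNIV. \<Sum>k\<in>UNIV. eps i j k * dd j (v k) \<phi>)"

(* matrices g i j (row i, column j); curl acts row-wise *)
definition curlM :: "(3 \<Rightarrow> 3 \<Rightarrow> distr) \<Rightarrow> 3 \<Rightarrow> 3 \<Rightarrow> distr" where
  "curlM g i = curlV (g i)"

definition inc :: "(3 \<Rightarrow> 3 \<Rightarrow> distr) \<Rightarrow> 3 \<Rightarrow> 3 \<Rightarrow> distr" where
  "inc g = curlM (\<lambda>i j. curlM g j i)"

definition defV :: "(3 \<Rightarrow> distr) \<Rightarrow> 3 \<Rightarrow> 3 \<Rightarrow> distr" where
  "defV u i j = (\<lambda>\<phi>. (dd j (u i) \<phi> + dd i (u j) \<phi>) / 2)"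

definition hess :: "distr \<Rightarrow> 3 \<Rightarrow> 3 \<Rightarrow> distr" where
  "hess w i j = dd i (dd j w)"

definition ccnorm :: "(3 \<Rightarrow> 3 \<Rightarrow> distr) \<Rightarrow> real" where
  "ccnorm g = sqrt ((\<Sum>i\<in>UNIV. \<Sum>j\<in>UNIV. (Hm1norm (g i j))\<^sup>2)
                  + (\<Sum>i\<in>UNIV. \<Sum>j\<in>UNIV. (Hm1norm (curlM g i j))\<^sup>2)
                  + (\<Sum>i\<in>UNIV. \<Sum>j\<in>UNIV. (Hm1norm (inc g i j))\<^sup>2))"

definition Hhat_cc :: "R3 set \<Rightarrow> (3 \<Rightarrow> 3 \<Rightarrow> distr) \<Rightarrow> bool" where
  "Hhat_cc \<Omega> g \<longleftrightarrow>
     (\<forall>i j \<phi>. test \<phi> \<longrightarrow> g i j \<phi> = g j i \<phi>) \<and>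
     (\<forall>i j. Htm1 \<Omega> (g i j) \<and> Htm1 \<Omega> (curlM g i j) \<and> Htm1 \<Omega> (inc g i j))"

definition Htilde_cc :: "R3 set \<Rightarrow> (3 \<Rightarrow> 3 \<Rightarrow> distr) \<Rightarrow> bool" where
  "Htilde_cc \<Omega> g \<longleftrightarrow> Hhat_cc \<Omega> g \<and>
     (\<forall>e>0. \<exists>\<psi> :: 3 \<Rightarrow> 3 \<Rightarrow> R3 \<Rightarrow> real.
        (\<forall>i j. test_on \<Omega> (\<psi> i j) \<and> \<psi> i j = \<psi> j i) \<and>
        ccnorm (\<lambda>i j \<phi>. g i j \<phi> - fd (\<psi> i j) \<phi>) < e)"

definition lipschitz_boundary :: "R3 set \<Rightarrow> bool" where
  "lipschitz_boundary \<Omega> \<longleftrightarrow> (\<forall>x\<in>frontier \<Omega>. \<exists>Q r h L (\<zeta> :: real \<times> real \<Rightarrow> real).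
     orthogonal_matrix Q \<and> r > 0 \<and> h > 0 \<and> L-lipschitz_on UNIV \<zeta> \<and> \<zeta> (0, 0) = 0 \<and>
     (\<forall>a b. a\<^sup>2 + b\<^sup>2 < r\<^sup>2 \<longrightarrow> \<bar>\<zeta> (a, b)\<bar> < h) \<and>
     (\<forall>y. let z = Q *v (y - x) in
        (z$1)\<^sup>2 + (z$2)\<^sup>2 < r\<^sup>2 \<and> \<bar>z$3\<bar> < h \<longrightarrow> (y \<in> \<Omega> \<longleftrightarrow> z$3 < \<zeta> (z$1, z$2))))"

end

theory Submission
  imports Defs
begin

text \<open>Multiplying \<open>g\<close> by a cutoff function preserves the hypotheses, because commutators with \<open>curl\<close> and
  \<open>inc\<close> only involve \<open>g\<close> and \<open>curl g\<close>; so one may assume that \<open>supp g\<close> lies in a small part of the closure of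
  \<open>\<Omega>\<close> from which a fixed truncated cone points into \<open>\<Omega>\<close>. Let \<open>E\<close> be a vector field supported in that
  cone with \<open>div E = \<delta> - \<rho>\<close>, \<open>\<rho>\<close> smooth, and with the singularity of \<open>x / |x|\<^sup>3\<close>. Convolution with
  \<open>E\<^sub>k\<close> gains one derivative and moves supports into \<open>\<Omega>\<close>, and for a one-form \<open>v\<close>
  \<open>v\<^sub>j = \<rho> * v\<^sub>j + \<partial>\<^sub>j (E\<^sub>k * v\<^sub>k) + E\<^sub>k * (\<partial>\<^sub>k v\<^sub>j - \<partial>\<^sub>j v\<^sub>k)\<close>. Applying this identity to the rows of \<open>g\<close>,
  then to \<open>E\<^sub>k * g\<^sub>i\<^sub>k\<close> and to \<open>curl g\<close> in the remaining index, and symmetrising, writes \<open>g\<close> as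
  \<open>S\<^sub>0 + def S\<^sub>1 + hess S\<^sub>2\<close> with \<open>S\<^sub>2 = E\<^sub>l * E\<^sub>k * g\<^sub>l\<^sub>k\<close>,
  \<open>S\<^sub>1\<close> built from \<open>\<rho> * E * g\<close> and \<open>E * E * curl g\<close>, and \<open>S\<^sub>0\<close> from \<open>\<rho> * g\<close>, \<open>\<rho> * E * curl g\<close> and
  \<open>E * E * inc g\<close>. All smooth remainders are absorbed in \<open>S\<^sub>0\<close>.
  The field \<open>E\<close> is a sum of dilates of test functions; its partial sums give
  approximations of the \<open>S\<^sub>i\<close> by test functions in \<open>\<Omega>\<close>, which are uniformly bounded and convergent because the
  derivatives of the dilates are almost orthogonal, and the same approximations yield density.\<close>

subsection \<open>Smooth functions\<close>

text \<open>The critical estimate is the bound on square integrable functions for convolution with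
  \<open>pd m (E N k)\<close>, uniform in \<open>N\<close>. Young's inequality controls each dilate,
  but their sum only by a multiple of \<open>N\<close>, so cancellation between scales is
  indispensable: each summand is a derivative of a dilated test function, and products of two of
  them decay geometrically in the distance of their scales, which is the setting of the Cotlar-Stein
  argument. Only finite partial sums of the singular kernel ever occur. Every convolution is then
  smooth, the decomposition is an exact algebraic identity for each \<open>N\<close> with
  \<open>RN N\<close> in the place of the delta distribution, and the limit is taken at the very
  end. The gain of two derivatives is split in halves: one comes from pairing \<open>u * k\<close>
  with itself, the other from differentiating the kernel, so that in a double convolution each
  factor has to absorb a single derivative. Identities for functionals \<open>u\<close> are
  inherited from functions, because functionals given by test functions are dense and both sides are
  continuous in \<open>u\<close>.\<close>

fun ck :: "nat \<Rightarrow> (R3 \<Rightarrow> real) \<Rightarrow> bool" where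
  "ck 0 f \<longleftrightarrow> (\<forall>x. f differentiable (at x))"
| "ck (Suc n) f \<longleftrightarrow> (\<forall>x. f differentiable (at x)) \<and> (\<forall>j. ck n (pd j f))"

lemma iter_pd_snoc: "iter_pd (js @ [j]) f = iter_pd js (pd j f)"
  by (induction js) auto

lemma ck_differentiable: "ck n f \<Longrightarrow> f differentiable (at x)"
  by (cases n) auto

text \<open>\<open>ck\<close> strips the innermost derivative, whereas \<open>iter_pd\<close> adds
  derivatives on the outside, so the list has to be split at its last element. Regularity of finite
  order is the form that permits induction for products and compositions.\<close>

lemma ck_iff: "ck n f \<longleftrightarrow> (\<forall>js x. length js \<le> n \<longrightarrow> iter_pd js f differentiable (at x))"
proof (induction n arbitrary: f)
  case 0
  then show ?case by auto
next
  case (Suc n)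
  have "(\<forall>js x. length js \<le> Suc n \<longrightarrow> iter_pd js f differentiable (at x)) \<longleftrightarrow>
     (\<forall>x. f differentiable (at x)) \<and> (\<forall>j js x. length js \<le> n \<longrightarrow> iter_pd js (pd j f) differentiable (at x))"
    (is "?L \<longleftrightarrow> ?R")
  proof
    assume L: ?L
    have "iter_pd [] f differentiable (at x)" for x using L by (metis le0 list.size(3))
    moreover have "iter_pd js (pd j f) differentiable (at x)" if "length js \<le> n" for js j x
      using L[rule_format, of "js @ [j]" x] that by (simp add: iter_pd_snoc)
    ultimately show ?R by simp
  next
    assume R: ?R
    show ?L
    proof (intro allI impI)
      fix js :: "3 list" and x assume l: "length js \<le> Suc n"
      show "iter_pd js f differentiable (at x)"
      proof (cases js rule: rev_cases)
        case Nil then show ?thesis using R by auto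
      next
        case (snoc ys j) then show ?thesis using R l by (auto simp: iter_pd_snoc)
      qed
    qed
  qed
  then show ?case using Suc by auto
qed

lemma smooth_fun_ck: "smooth_fun f \<longleftrightarrow> (\<forall>n. ck n f)"
  unfolding smooth_fun_def ck_iff by auto

lemma smooth_fun_differentiable: "smooth_fun f \<Longrightarrow> f differentiable (at x)"
  using ck_differentiable smooth_fun_ck by blast

lemma smooth_fun_pd: "smooth_fun f \<Longrightarrow> smooth_fun (pd j f)"
  unfolding smooth_fun_ck using ck.simps(2) by blast

lemma smooth_fun_continuous: "smooth_fun f \<Longrightarrow> continuous_on S f"
  by (meson continuous_at_imp_continuous_on differentiable_imp_continuous_within smooth_fun_differentiable)

lemma pd_eqI: "(f has_derivative D) (at x) \<Longrightarrow> pd j f x = D (axis j 1)"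
  unfolding pd_def by (metis frechet_derivative_at)

lemma differentiable_has_derivative:
  "f differentiable (at x) \<Longrightarrow> (f has_derivative frechet_derivative f (at x)) (at x)"
  by (simp add: frechet_derivative_works)

lemma has_derivative_pd:
  assumes "f differentiable (at x)"
  shows "(f has_derivative (\<lambda>h. \<Sum>j\<in>UNIV. (h $ j) * pd j f x)) (at x)"
proof -
  let ?D = "frechet_derivative f (at x)"
  have D: "(f has_derivative ?D) (at x)" using assms by (rule differentiable_has_derivative)
  have lin: "linear ?D" using D by (rule has_derivative_linear)
  have "?D h = (\<Sum>j\<in>UNIV. (h $ j) * pd j f x)" for h
  proof -
    have "h = (\<Sum>j\<in>UNIV. (h $ j) *\<^sub>R axis j 1)"
      by (simp add: basis_expansion flip: scalar_mult_eq_scaleR)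
    then have "?D h = ?D (\<Sum>j\<in>UNIV. (h $ j) *\<^sub>R axis j 1)" by simp
    also have "\<dots> = (\<Sum>j\<in>UNIV. (h $ j) * pd j f x)"
      by (simp add: linear_sum[OF lin] linear_cmul[OF lin] pd_def)
    finally show ?thesis .
  qed
  then have "?D = (\<lambda>h. \<Sum>j\<in>UNIV. (h $ j) * pd j f x)" by auto
  with D show ?thesis by simp
qed

lemma pd_add: "f differentiable (at x) \<Longrightarrow> g differentiable (at x) \<Longrightarrow>
    pd j (\<lambda>x. f x + g x) x = pd j f x + pd j g x"
  using pd_eqI[OF has_derivative_add[OF differentiable_has_derivative differentiable_has_derivative], of f x g j]
  by (simp add: pd_def)

lemma pd_cmult: "f differentiable (at x) \<Longrightarrow> pd j (\<lambda>x. c * f x) x = c * pd j f x"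
  using pd_eqI[OF has_derivative_mult_right[OF differentiable_has_derivative[of f x]], of j c]
  by (simp add: pd_def)

lemma pd_mult: "f differentiable (at x) \<Longrightarrow> g differentiable (at x) \<Longrightarrow>
    pd j (\<lambda>x. f x * g x) x = pd j f x * g x + f x * pd j g x"
  using pd_eqI[OF has_derivative_mult[OF differentiable_has_derivative differentiable_has_derivative], of f x g j]
  by (simp add: pd_def)

lemma pd_const: "pd j (\<lambda>x. c) = (\<lambda>x. 0)"
  using pd_eqI[OF has_derivative_const] by auto

lemma ck_const: "ck n (\<lambda>x. c)"
  by (induction n arbitrary: c) (auto simp: pd_const)

lemma ck_mono: "ck n f \<Longrightarrow> m \<le> n \<Longrightarrow> ck m f"
  unfolding ck_iff by auto

lemma ck_add: "ck n f \<Longrightarrow> ck n g \<Longrightarrow> ck n (\<lambda>x. f x + g x)"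
proof (induction n arbitrary: f g)
  case 0
  then show ?case by auto
next
  case (Suc n)
  have "pd j (\<lambda>x. f x + g x) = (\<lambda>x. pd j f x + pd j g x)" for j
    using Suc.prems by (auto simp: pd_add)
  with Suc show ?case by auto
qed

lemma ck_mult: "ck n f \<Longrightarrow> ck n g \<Longrightarrow> ck n (\<lambda>x. f x * g x)"
proof (induction n arbitrary: f g)
  case 0
  then show ?case by auto
next
  case (Suc n)
  have "pd j (\<lambda>x. f x * g x) = (\<lambda>x. pd j f x * g x + f x * pd j g x)" for j
    using Suc.prems by (auto simp: pd_mult)
  moreover have "ck n f" "ck n g" using Suc.prems ck_mono[of "Suc n"] by auto
  ultimately show ?case using Suc by (auto intro!: ck_add)
qed

lemma smooth_fun_const: "smooth_fun (\<lambda>x. c)"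
  unfolding smooth_fun_ck by (simp add: ck_const)

lemma smooth_fun_add: "smooth_fun f \<Longrightarrow> smooth_fun g \<Longrightarrow> smooth_fun (\<lambda>x. f x + g x)"
  unfolding smooth_fun_ck by (simp add: ck_add)

lemma smooth_fun_mult: "smooth_fun f \<Longrightarrow> smooth_fun g \<Longrightarrow> smooth_fun (\<lambda>x. f x * g x)"
  unfolding smooth_fun_ck by (simp add: ck_mult)

lemma smooth_fun_cmult: "smooth_fun f \<Longrightarrow> smooth_fun (\<lambda>x. c * f x)"
  using smooth_fun_mult[OF smooth_fun_const] .

lemma smooth_fun_diff: "smooth_fun f \<Longrightarrow> smooth_fun g \<Longrightarrow> smooth_fun (\<lambda>x. f x - g x)"
  using smooth_fun_add[OF _ smooth_fun_cmult, of f g "-1"] by simp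

lemma smooth_fun_sum: "(\<And>i. i \<in> I \<Longrightarrow> smooth_fun (f i)) \<Longrightarrow> smooth_fun (\<lambda>x. \<Sum>i\<in>I. f i x)"
  by (induction I rule: infinite_finite_induct) (auto intro: smooth_fun_const smooth_fun_add)

lemma smooth_fun_prod: "(\<And>i. i \<in> I \<Longrightarrow> smooth_fun (f i)) \<Longrightarrow> smooth_fun (\<lambda>x. \<Prod>i\<in>I. f i x)"
  by (induction I rule: infinite_finite_induct) (auto intro: smooth_fun_const smooth_fun_mult)

lemma differentiable_affine:
  "f differentiable (at (b + c *\<^sub>R x)) \<Longrightarrow> (\<lambda>x. f (b + c *\<^sub>R x)) differentiable (at (x::R3))"
proof -
  assume "f differentiable (at (b + c *\<^sub>R x))"
  then have "(f \<circ> (\<lambda>x. b + c *\<^sub>R x)) differentiable (at x)"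
    by (intro differentiable_chain_at) (auto intro!: derivative_intros)
  then show ?thesis by (simp add: o_def)
qed

lemma pd_affine:
  assumes "f differentiable (at (b + c *\<^sub>R x))"
  shows "pd j (\<lambda>x. f (b + c *\<^sub>R x)) x = c * pd j f (b + c *\<^sub>R x)"
proof -
  let ?D = "frechet_derivative f (at (b + c *\<^sub>R x))"
  have D: "(f has_derivative ?D) (at (b + c *\<^sub>R x))" using assms by (rule differentiable_has_derivative)
  have "((\<lambda>x. b + c *\<^sub>R x) has_derivative (\<lambda>h. c *\<^sub>R h)) (at x)"
    by (auto intro!: derivative_eq_intros)
  from diff_chain_at[OF this D]
  have "((\<lambda>x. f (b + c *\<^sub>R x)) has_derivative (\<lambda>h. ?D (c *\<^sub>R h))) (at x)" by (simp add: o_def)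
  from pd_eqI[OF this, of j] show ?thesis
    by (simp add: pd_def linear_cmul[OF has_derivative_linear[OF D]])
qed

lemma ck_affine: "ck n f \<Longrightarrow> ck n (\<lambda>x. f (b + c *\<^sub>R x))"
proof (induction n arbitrary: f)
  case 0
  then show ?case by (auto intro: differentiable_affine)
next
  case (Suc n)
  have "pd j (\<lambda>x. f (b + c *\<^sub>R x)) = (\<lambda>x. c * pd j f (b + c *\<^sub>R x))" for j
    using Suc.prems by (auto simp: pd_affine)
  with Suc show ?case by (auto intro!: ck_mult ck_const differentiable_affine)
qed

lemma smooth_fun_affine: "smooth_fun f \<Longrightarrow> smooth_fun (\<lambda>x. f (b + c *\<^sub>R x))"
  unfolding smooth_fun_ck by (simp add: ck_affine)

section \<open>Smooth functions of one variable and a smooth step\<close>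

definition smooth1 :: "(real \<Rightarrow> real) \<Rightarrow> bool" where
  "smooth1 f \<longleftrightarrow> (\<exists>D. D 0 = f \<and> (\<forall>n x. (D n has_real_derivative D (Suc n) x) (at x)))"

lemma smooth1_deriv: "smooth1 f \<Longrightarrow> \<exists>f'. smooth1 f' \<and> (\<forall>x. (f has_real_derivative f' x) (at x))"
proof -
  assume "smooth1 f"
  then obtain D where D: "D 0 = f" "\<forall>n x. (D n has_real_derivative D (Suc n) x) (at x)"
    unfolding smooth1_def by blast
  have "smooth1 (D 1)" unfolding smooth1_def
    by (rule exI[of _ "\<lambda>n. D (Suc n)"]) (use D in auto)
  with D show ?thesis by (metis One_nat_def)
qed

lemma smooth1_deriv': "smooth1 f \<Longrightarrow> smooth1 (deriv f) \<and> (\<forall>x. (f has_real_derivative deriv f x) (at x))"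
proof -
  assume "smooth1 f"
  from smooth1_deriv[OF this] obtain f' where f': "smooth1 f'" "\<forall>x. (f has_real_derivative f' x) (at x)" by blast
  then have "deriv f = f'" by (auto intro: DERIV_imp_deriv)
  with f' show ?thesis by auto
qed

lemma has_derivative_compose1:
  assumes "(f has_real_derivative d) (at (u x))" "u differentiable (at (x::R3))"
  shows "((\<lambda>x. f (u x)) has_derivative (\<lambda>h. d * frechet_derivative u (at x) h)) (at x)"
proof -
  have "(f has_derivative (*) d) (at (u x))"
    using assms(1) by (simp add: has_field_derivative_def)
  from diff_chain_at[OF differentiable_has_derivative[OF assms(2)] this]
  show ?thesis by (simp add: o_def)
qed

lemma pd_compose1:
  assumes "(f has_real_derivative d) (at (u x))" "u differentiable (at (x::R3))"
  shows "pd j (\<lambda>x. f (u x)) x = d * pd j u x"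
  using pd_eqI[OF has_derivative_compose1[OF assms]] by (simp add: pd_def)

lemma ck_compose1: "smooth1 f \<Longrightarrow> ck n u \<Longrightarrow> ck n (\<lambda>x. f (u x))"
proof (induction n arbitrary: f)
  case 0
  then show ?case using has_derivative_compose1 smooth1_deriv'
    by (fastforce simp: differentiable_def[of "\<lambda>x. f (u x)"])
next
  case (Suc n)
  note d = smooth1_deriv'[OF Suc.prems(1)]
  have "pd j (\<lambda>x. f (u x)) = (\<lambda>x. deriv f (u x) * pd j u x)" for j
    using Suc.prems d pd_compose1 by fastforce
  moreover have "ck n (\<lambda>x. deriv f (u x))" using Suc d ck_mono[of "Suc n" u n] by auto
  moreover have "(\<lambda>x. f (u x)) differentiable (at x)" for x
    using has_derivative_compose1[of f "deriv f (u x)" u x] d Suc.prems(2) by (auto simp: differentiable_def)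
  ultimately show ?case using Suc.prems by (auto intro!: ck_mult)
qed

lemma smooth_fun_compose1: "smooth1 f \<Longrightarrow> smooth_fun u \<Longrightarrow> smooth_fun (\<lambda>x. f (u x))"
  unfolding smooth_fun_ck by (simp add: ck_compose1)

lemma differentiable_nth: "(\<lambda>x::R3. x $ i) differentiable (at x)"
  using bounded_linear_imp_differentiable bounded_linear_vec_nth by blast

lemma pd_nth: "pd j (\<lambda>x. x $ i) = (\<lambda>x. if i = j then 1 else 0)"
  using pd_eqI[OF bounded_linear.has_derivative[OF bounded_linear_vec_nth[of i] has_derivative_ident]]
  by (auto simp: axis_def)

lemma smooth_fun_nth: "smooth_fun (\<lambda>x. x $ i)"
  unfolding smooth_fun_ck
proof
  fix n show "ck n (\<lambda>x. x $ i)"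
    by (cases n) (auto simp: pd_nth ck_const differentiable_nth)
qed

text \<open>General Leibniz rule: differentiating the n-th binomial sum gives two sums, and shifting
  the index in one of them makes Pascal's rule applicable.\<close>

lemma smooth1_mult_aux:
  fixes F G :: "nat \<Rightarrow> real \<Rightarrow> real"
  assumes F: "\<And>n x. (F n has_real_derivative F (Suc n) x) (at x)"
    and G: "\<And>n x. (G n has_real_derivative G (Suc n) x) (at x)"
  shows "((\<lambda>x. \<Sum>k\<le>n. real (n choose k) * F k x * G (n - k) x) has_real_derivative
      (\<Sum>k\<le>Suc n. real (Suc n choose k) * F k x * G (Suc n - k) x)) (at x)"
proof -
  have "((\<lambda>x. \<Sum>k\<le>n. real (n choose k) * F k x * G (n - k) x) has_real_derivative
     (\<Sum>k\<le>n. real (n choose k) * (F (Suc k) x * G (n-k) x + F k x * G (Suc (n - k)) x))) (at x)"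
    by (rule DERIV_sum) (auto intro!: derivative_eq_intros F G simp: algebra_simps)
  also have "(\<Sum>k\<le>n. real (n choose k) * (F (Suc k) x * G (n-k) x + F k x * G (Suc (n - k)) x))
     = (\<Sum>k\<le>n. real (n choose k) * F (Suc k) x * G (n-k) x) + (\<Sum>k\<le>n. real (n choose k) * F k x * G (Suc n - k) x)"
    by (simp add: sum.distrib algebra_simps Suc_diff_le)
  also have "(\<Sum>k\<le>n. real (n choose k) * F k x * G (Suc n - k) x)
      = G (Suc n) x * F 0 x + (\<Sum>k\<le>n. real (n choose Suc k) * F (Suc k) x * G (n - k) x)"
  proof -
    have "(\<Sum>k\<le>n. real (n choose k) * F k x * G (Suc n - k) x)
       = (\<Sum>k\<le>Suc n. real (n choose k) * F k x * G (Suc n - k) x)" by simp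
    then show ?thesis by (simp only: sum.atMost_Suc_shift) simp
  qed
  also have "(\<Sum>k\<le>n. real (n choose k) * F (Suc k) x * G (n-k) x) +
      (G (Suc n) x * F 0 x + (\<Sum>k\<le>n. real (n choose Suc k) * F (Suc k) x * G (n - k) x))
     = (\<Sum>k\<le>Suc n. real (Suc n choose k) * F k x * G (Suc n - k) x)"
    by (simp only: sum.atMost_Suc_shift) (simp add: sum.distrib algebra_simps)
  finally show ?thesis .
qed

lemma smooth1_mult: "smooth1 f \<Longrightarrow> smooth1 g \<Longrightarrow> smooth1 (\<lambda>x. f x * g x)"
proof -
  assume "smooth1 f" "smooth1 g"
  then obtain F G where F: "F 0 = f" "\<And>n x. (F n has_real_derivative F (Suc n) x) (at x)"
    and G: "G 0 = g" "\<And>n x. (G n has_real_derivative G (Suc n) x) (at x)"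
    unfolding smooth1_def by blast
  show ?thesis unfolding smooth1_def
    by (rule exI[of _ "\<lambda>n x. \<Sum>k\<le>n. real (n choose k) * F k x * G (n - k) x"])
      (use smooth1_mult_aux[of F G] F G in auto)
qed

lemma smooth1_affine: "smooth1 f \<Longrightarrow> smooth1 (\<lambda>x. f (b + c * x))"
proof -
  assume "smooth1 f"
  then obtain F where F: "F 0 = f" "\<And>n x. (F n has_real_derivative F (Suc n) x) (at x)"
    unfolding smooth1_def by blast
  show ?thesis unfolding smooth1_def
    by (rule exI[of _ "\<lambda>n x. c ^ n * F n (b + c * x)"])
      (use F(1) in \<open>auto intro!: derivative_eq_intros DERIV_chain2[OF F(2)]\<close>)
qed

lemma smooth1_cmult: "smooth1 f \<Longrightarrow> smooth1 (\<lambda>x. c * f x)"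
proof -
  assume "smooth1 f"
  then obtain F where F: "F 0 = f" "\<And>n x. (F n has_real_derivative F (Suc n) x) (at x)"
    unfolding smooth1_def by blast
  show ?thesis unfolding smooth1_def
    by (rule exI[of _ "\<lambda>n x. c * F n x"])
      (use F(1) in \<open>auto intro!: derivative_eq_intros F(2)\<close>)
qed

lemma smooth1_antideriv: "smooth1 f \<Longrightarrow> (\<And>x. (F has_real_derivative f x) (at x)) \<Longrightarrow> smooth1 F"
proof -
  assume "smooth1 f" and F: "\<And>x. (F has_real_derivative f x) (at x)"
  then obtain D where D: "D 0 = f" "\<And>n x. (D n has_real_derivative D (Suc n) x) (at x)"
    unfolding smooth1_def by blast
  show ?thesis unfolding smooth1_def
    by (rule exI[of _ "\<lambda>n. case n of 0 \<Rightarrow> F | Suc m \<Rightarrow> D m"])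
      (use D F in \<open>auto split: nat.split\<close>)
qed

text \<open>The flat function exp(-1/x) together with all polynomial multiples in 1/x. The family is
  closed under differentiation, so smoothness of all its members follows from a single derivative
  formula.\<close>

definition pexp :: "real poly \<Rightarrow> real \<Rightarrow> real" where
  "pexp p x = (if x > 0 then poly p (1/x) * exp (- (1/x)) else 0)"

lemma poly_exp_tendsto: "((\<lambda>t. poly p t * exp (- t)) \<longlongrightarrow> (0::real)) at_top"
proof -
  have "((\<lambda>t. \<Sum>i\<le>degree p. coeff p i * (t ^ i / exp t)) \<longlongrightarrow> (\<Sum>i\<le>degree p. coeff p i * 0)) at_top"
    by (intro tendsto_intros tendsto_power_div_exp_0)
  then show ?thesis
    by (simp add: poly_altdef exp_minus divide_inverse sum_distrib_right mult.assoc)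
qed

lemma pexp_tendsto: "(pexp p \<longlongrightarrow> 0) (at_right 0)"
proof -
  have "((\<lambda>x. poly p (inverse x) * exp (- inverse x)) \<longlongrightarrow> 0) (at_right 0)"
    by (rule filterlim_compose[OF poly_exp_tendsto filterlim_inverse_at_top_right])
  moreover have "\<forall>\<^sub>F x in at_right 0. poly p (inverse x) * exp (- inverse x) = pexp p x"
    by (rule eventually_mono[OF eventually_at_right_less]) (auto simp: pexp_def field_simps)
  ultimately show ?thesis by (rule Lim_transform_eventually)
qed

text \<open>With t = 1/x the derivative of p(t) exp(-t) is t^2 (p(t) - p'(t)) exp(-t); the two
  \<open>pCons 0\<close> are the factor t^2.\<close>

lemma pexp_deriv: "(pexp p has_real_derivative pexp (pCons 0 (pCons 0 (p - pderiv p))) x) (at x)"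
proof -
  consider "x > 0" | "x < 0" | "x = 0" by linarith
  then show ?thesis
  proof cases
    case 1
    have "((\<lambda>x. poly p (1/x) * exp (- (1/x))) has_real_derivative pexp (pCons 0 (pCons 0 (p - pderiv p))) x) (at x)"
      using 1 by (auto intro!: derivative_eq_intros DERIV_chain2[OF poly_DERIV]
          simp: pexp_def field_simps power2_eq_square)
    then show ?thesis
      by (rule has_field_derivative_transform_within[of _ _ _ _ x]) (use 1 in \<open>auto simp: pexp_def dist_real_def\<close>)
  next
    case 2
    have "((\<lambda>x. 0) has_real_derivative pexp (pCons 0 (pCons 0 (p - pderiv p))) x) (at x)"
      using 2 by (auto simp: pexp_def)
    then show ?thesis
      by (rule has_field_derivative_transform_within[of _ _ _ _ "-x"]) (use 2 in \<open>auto simp: pexp_def dist_real_def\<close>)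
  next
    case 3
    \<comment> \<open>On the right the difference quotient at 0 is again a member of the family,
      with polynomial t p(t), and therefore tends to 0.\<close>
    have "((\<lambda>y. pexp p y / y) \<longlongrightarrow> 0) (at 0)"
    proof (rule filterlim_split_at_real)
      have "\<forall>\<^sub>F x in at_right 0. pexp (pCons 0 p) x = pexp p x / x"
        by (rule eventually_mono[OF eventually_at_right_less]) (auto simp: pexp_def field_simps)
      from Lim_transform_eventually[OF pexp_tendsto this]
      show "((\<lambda>y. pexp p y / y) \<longlongrightarrow> 0) (at_right 0)" .
      have "\<forall>\<^sub>F x in at_left 0. 0 = pexp p x / x"
        by (rule eventually_mono[OF eventually_at_left_real[of "-1"]]) (auto simp: pexp_def)
      from Lim_transform_eventually[OF tendsto_const this]
      show "((\<lambda>y. pexp p y / y) \<longlongrightarrow> 0) (at_left 0)" .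
    qed
    then show ?thesis using 3
      by (simp add: has_field_derivative_iff pexp_def[of _ 0])
  qed
qed

lemma smooth1_pexp: "smooth1 (pexp p)"
  unfolding smooth1_def
proof (intro exI conjI allI)
  let ?P = "rec_nat p (\<lambda>_ q. pCons 0 (pCons 0 (q - pderiv q)))"
  show "(\<lambda>n. pexp (?P n)) 0 = pexp p" by simp
  show "(pexp (?P n) has_real_derivative pexp (?P (Suc n)) x) (at x)" for n x
    using pexp_deriv[of "?P n" x] by simp
qed

text \<open>The normalised primitive of a bump on the unit interval. The sign of the derivative is
  recorded because \<open>kernel_pieces\<close> uses that derivative as a density which must have
  positive mass.\<close>

lemma smooth_step:
  obtains F where "smooth1 F" "\<And>x. x \<le> 0 \<Longrightarrow> F x = 0" "\<And>x. x \<ge> 1 \<Longrightarrow> F x = 1"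
    "\<And>x. 0 \<le> F x \<and> F x \<le> 1" "\<And>x. deriv F x \<ge> 0" "\<And>x. 0 < x \<Longrightarrow> x < 1 \<Longrightarrow> deriv F x > 0"
proof -
  define b where "b x = pexp 1 x * pexp 1 (1 - x)" for x
  have b: "smooth1 b" unfolding b_def
    using smooth1_mult[OF smooth1_pexp[of 1] smooth1_affine[OF smooth1_pexp[of 1], of 1 "-1"]] by simp
  have b0: "b x \<ge> 0" for x by (auto simp: b_def pexp_def)
  have bpos: "b x > 0" if "0 < x" "x < 1" for x using that by (auto simp: b_def pexp_def)
  have bz: "b x = 0" if "x \<le> 0 \<or> x \<ge> 1" for x using that by (auto simp: b_def pexp_def)
  have cont: "continuous_on S b" for S
    using smooth1_deriv'[OF b] by (meson DERIV_isCont continuous_at_imp_continuous_on)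
  \<comment> \<open>Starting the integral at -1 instead of 0 makes 0 an interior point of the range
    in which the fundamental theorem applies; further left \<open>G\<close> is constant.\<close>
  define G where "G x = integral {-1..x} b" for x
  have der: "(G has_real_derivative b x) (at x)" if "x > -1" for x
  proof -
    have "(G has_real_derivative b x) (at x within {-1..x+1})"
      unfolding G_def by (rule integral_has_real_derivative) (use that cont in auto)
    moreover have "at x within {-1..x+1} = at x" 
      by (rule at_within_interior) (use that in auto)
    ultimately show ?thesis by simp
  qed
  have Gmono: "G x \<le> G y" if "-1 < x" "x \<le> y" for x y
    by (rule DERIV_nonneg_imp_nondecreasing[OF that(2)]) (use der b0 that(1) in \<open>meson less_le_trans\<close>)
  have G0: "G x = 0" if "x \<le> 0" for x
  proof -
    have "G x = integral {-1..x} (\<lambda>_. 0)" unfolding G_def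
      by (rule integral_cong) (use that bz in auto)
    then show ?thesis by simp
  qed
  have der': "(G has_real_derivative b x) (at x)" for x
  proof (cases "x > -1")
    case False
    have "((\<lambda>x. 0) has_real_derivative b x) (at x)" using False bz by simp
    then show ?thesis
      by (rule has_field_derivative_transform_within[of _ _ _ _ 1]) (use False G0 in \<open>auto simp: dist_real_def\<close>)
  qed (rule der)
  have G1: "G x = G 1" if "x \<ge> 1" for x
  proof (rule ccontr)
    assume n: "G x \<noteq> G 1"
    then have "1 < x" using that by (cases "x = 1") auto
    from MVT2[OF this, of G b] der' obtain z where "z > 1" "G x - G 1 = (x - 1) * b z" by blast
    with bz[of z] n show False by simp
  qed
  have Gp: "G 1 > 0"
  proof -
    from MVT2[of 0 1 G b] der' obtain z where z: "0 < z" "z < 1" "G 1 - G 0 = (1 - 0) * b z" by auto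
    then show ?thesis using bpos[of z] G0[of 0] by simp
  qed
  define F where "F x = (1 / G 1) * G x" for x
  have sF: "smooth1 F" unfolding F_def by (rule smooth1_cmult[OF smooth1_antideriv[OF b der']])
  have dF: "(F has_real_derivative (1 / G 1) * b x) (at x)" for x
    unfolding F_def by (rule DERIV_cmult[OF der'])
  have "deriv F x = (1 / G 1) * b x" for x using dF by (rule DERIV_imp_deriv)
  moreover have "0 \<le> G x \<and> G x \<le> G 1" for x
    using G0[of x] G1[of x] Gmono[of 0 x] Gmono[of x 1] G0[of 0] Gp by (cases "x \<le> 0"; cases "x \<ge> 1") auto
  moreover have "F x = 1" if "x \<ge> 1" for x using G1[OF that] Gp by (simp add: F_def)
  ultimately show thesis
    by (intro that[of F]) (use sF G0 Gp b0 bpos in \<open>auto simp: F_def\<close>)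
qed

section \<open>Test functions and their supports\<close>

lemma tsupp_subset: "closed S \<Longrightarrow> (\<And>x. x \<notin> S \<Longrightarrow> f x = 0) \<Longrightarrow> tsupp f \<subseteq> S"
  unfolding tsupp_def by (rule closure_minimal) auto

lemma not_in_tsupp: "x \<notin> tsupp f \<Longrightarrow> f x = 0"
  unfolding tsupp_def by (metis (mono_tags) closure_subset mem_Collect_eq subsetD)

lemma closed_tsupp: "closed (tsupp f)"
  unfolding tsupp_def by simp

lemma test_smooth: "test_on U f \<Longrightarrow> smooth_fun f"
  and test_compact: "test_on U f \<Longrightarrow> compact (tsupp f)"
  and test_on_test: "test_on U f \<Longrightarrow> test f"
  unfolding test_on_def by auto

text \<open>Any compact set outside of which the function vanishes may serve as a certificate, so
  supports never have to be computed exactly.\<close>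

lemma test_onI:
  assumes "smooth_fun f" "compact S" "S \<subseteq> U" "\<And>x. x \<notin> S \<Longrightarrow> f x = 0"
  shows "test_on U f"
proof -
  have "tsupp f \<subseteq> S" using assms by (intro tsupp_subset) (auto intro: compact_imp_closed)
  then show ?thesis unfolding test_on_def
    using assms by (metis closed_tsupp compact_Int_closed inf.absorb_iff2 order_trans)
qed

lemma test_on_mono: "test_on U f \<Longrightarrow> U \<subseteq> V \<Longrightarrow> test_on V f"
  unfolding test_on_def by auto

lemma test_on_0: "test_on U (\<lambda>x. 0)"
  by (rule test_onI[of _ "{}"]) (auto intro: smooth_fun_const)

lemma test_on_add: "test_on U f \<Longrightarrow> test_on U g \<Longrightarrow> test_on U (\<lambda>x. f x + g x)"
  by (rule test_onI[of _ "tsupp f \<union> tsupp g"])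
    (auto intro: smooth_fun_add simp: test_on_def not_in_tsupp)

lemma test_on_mult_smooth: "test_on U f \<Longrightarrow> smooth_fun g \<Longrightarrow> test_on U (\<lambda>x. g x * f x)"
  by (rule test_onI[of _ "tsupp f"])
    (auto intro: smooth_fun_mult simp: test_on_def not_in_tsupp)

lemma test_on_cmult: "test_on U f \<Longrightarrow> test_on U (\<lambda>x. c * f x)"
  using test_on_mult_smooth[OF _ smooth_fun_const] .

lemma test_on_uminus: "test_on U f \<Longrightarrow> test_on U (\<lambda>x. - f x)"
  using test_on_cmult[of U f "-1"] by simp

lemma test_on_diff: "test_on U f \<Longrightarrow> test_on U g \<Longrightarrow> test_on U (\<lambda>x. f x - g x)"
  using test_on_add[OF _ test_on_uminus, of U f g] by simp

lemma test_on_sum: "(\<And>i. i \<in> I \<Longrightarrow> test_on U (f i)) \<Longrightarrow> test_on U (\<lambda>x. \<Sum>i\<in>I. f i x)"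
  by (induction I rule: infinite_finite_induct) (auto intro: test_on_0 test_on_add)

text \<open>The complement of the closed support is open, so the function vanishes near such a point
  and not merely at it.\<close>

lemma pd_0_outside: "x \<notin> tsupp f \<Longrightarrow> pd j f x = 0"
proof -
  assume x: "x \<notin> tsupp f"
  have "(f has_derivative (\<lambda>h. 0)) (at x)"
  proof (rule has_derivative_transform_within_open[of "\<lambda>x. 0"])
    show "open (- tsupp f)" using closed_tsupp by auto
  qed (use x not_in_tsupp[of _ f] in auto)
  from pd_eqI[OF this] show ?thesis by simp
qed

lemma test_on_pd: "test_on U f \<Longrightarrow> test_on U (pd j f)"
  by (rule test_onI[of _ "tsupp f"]) (auto intro: smooth_fun_pd simp: test_on_def pd_0_outside)

lemma test_affine:
  assumes "test f" "c \<noteq> 0" shows "test (\<lambda>x. f (b + c *\<^sub>R x))"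
proof (rule test_onI[of _ "(\<lambda>y. (1/c) *\<^sub>R (y - b)) ` tsupp f"])
  show "smooth_fun (\<lambda>x. f (b + c *\<^sub>R x))" using assms by (intro smooth_fun_affine test_smooth)
  show "compact ((\<lambda>y. (1/c) *\<^sub>R (y - b)) ` tsupp f)"
    by (intro compact_continuous_image continuous_intros test_compact[OF assms(1)])
  fix x assume "x \<notin> (\<lambda>y. (1/c) *\<^sub>R (y - b)) ` tsupp f"
  then have "b + c *\<^sub>R x \<notin> tsupp f" using assms(2)
    by (auto simp: image_iff dest!: bspec[of _ _ "b + c *\<^sub>R x"])
  then show "f (b + c *\<^sub>R x) = 0" by (rule not_in_tsupp)
qed simp

lemma test_shift_refl: "test k \<Longrightarrow> test (\<lambda>y. k (x - y))"
  using test_affine[of k "-1" x] by simp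

lemma pd_affine_test: "test f \<Longrightarrow> pd j (\<lambda>x. f (b + c *\<^sub>R x)) = (\<lambda>x. c * pd j f (b + c *\<^sub>R x))"
  by (auto intro!: pd_affine smooth_fun_differentiable test_smooth)

lemma pd_shift_refl: "test f \<Longrightarrow> pd j (\<lambda>y. f (x - y)) = (\<lambda>y. - pd j f (x - y))"
  using pd_affine_test[of f j x "-1"] by simp

lemma test_differentiable: "test f \<Longrightarrow> f differentiable (at x)"
  by (intro smooth_fun_differentiable test_smooth)

lemma test_continuous: "test f \<Longrightarrow> continuous_on S f"
  by (intro smooth_fun_continuous test_smooth)

lemma pd_add': "test f \<Longrightarrow> test g \<Longrightarrow> pd j (\<lambda>x. f x + g x) = (\<lambda>x. pd j f x + pd j g x)"
  by (auto simp: pd_add test_differentiable)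

lemma pd_cmult': "test f \<Longrightarrow> pd j (\<lambda>x. c * f x) = (\<lambda>x. c * pd j f x)"
  by (auto simp: pd_cmult test_differentiable)

lemma pd_diff': "test f \<Longrightarrow> test g \<Longrightarrow> pd j (\<lambda>x. f x - g x) = (\<lambda>x. pd j f x - pd j g x)"
  using pd_add'[of f "\<lambda>x. - g x" j] pd_cmult'[of g j "-1"] test_on_uminus[of UNIV g] by simp

lemma pd_sum': "(\<And>i. i \<in> I \<Longrightarrow> test (f i)) \<Longrightarrow> pd j (\<lambda>x. \<Sum>i\<in>I. f i x) = (\<lambda>x. \<Sum>i\<in>I. pd j (f i) x)"
  by (induction I rule: infinite_finite_induct) (auto simp: pd_const pd_add' test_on_sum)

lemma pd_mult': "smooth_fun f \<Longrightarrow> smooth_fun g \<Longrightarrow> pd j (\<lambda>x. f x * g x) = (\<lambda>x. pd j f x * g x + f x * pd j g x)"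
  by (auto simp: pd_mult smooth_fun_differentiable)

lemma compact_support_bounded:
  assumes "continuous_on UNIV f" "compact (tsupp f)"
  obtains M where "M \<ge> 0" "\<And>x. \<bar>f x\<bar> \<le> M"
proof -
  have "compact (f ` tsupp f)" using assms continuous_on_subset by (intro compact_continuous_image) auto
  then obtain B where B: "\<And>x. x \<in> tsupp f \<Longrightarrow> \<bar>f x\<bar> \<le> B"
    using compact_imp_bounded[of "f ` tsupp f"] unfolding bounded_iff by auto
  show thesis
    by (rule that[of "max B 0"]) (use B not_in_tsupp in \<open>fastforce simp: le_max_iff_disj\<close>)+
qed

lemma test_bounded: assumes "test f" obtains M where "M \<ge> 0" "\<And>x. \<bar>f x\<bar> \<le> M"
  using compact_support_bounded[OF test_continuous[OF assms] test_compact[OF assms]] by blast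

section \<open>Integrals of compactly supported functions and changes of variable\<close>

lemma integrable_cc:
  fixes f :: "'a::euclidean_space \<Rightarrow> real"
  assumes "continuous_on UNIV f" "compact S" "\<And>x. x \<notin> S \<Longrightarrow> f x = 0"
  shows "integrable lborel f"
proof -
  have "integrable lborel (\<lambda>x. indicator S x *\<^sub>R f x)"
    using assms by (intro borel_integrable_compact) (auto intro: continuous_on_subset)
  moreover have "(\<lambda>x. indicator S x *\<^sub>R f x) = f" using assms(3) by (intro ext) (auto simp: indicator_def)
  ultimately show ?thesis by simp
qed

lemma borel_measurable_test: "test f \<Longrightarrow> f \<in> borel_measurable borel"
  by (intro borel_measurable_continuous_onI test_continuous)

lemma integrable_test_mult:
  "test f \<Longrightarrow> continuous_on UNIV g \<Longrightarrow> integrable lborel (\<lambda>x. f x * g x)"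
  by (rule integrable_cc[of _ "tsupp f"])
    (auto intro: continuous_on_mult test_continuous simp: test_compact not_in_tsupp)

lemma integrable_test: "test f \<Longrightarrow> integrable lborel f"
  using integrable_test_mult[of f "\<lambda>_. 1"] by simp

lemma integral_affine:
  fixes f :: "'a::euclidean_space \<Rightarrow> real"
  assumes "f \<in> borel_measurable borel" "c \<noteq> 0"
  shows "(\<integral>x. f (b + c *\<^sub>R x) \<partial>lborel) = (\<integral>x. f x \<partial>lborel) / \<bar>c\<bar> ^ DIM('a)"
proof -
  have "(\<integral>x. f x \<partial>lborel) = \<bar>c\<bar> ^ DIM('a) * (\<integral>x. f (b + c *\<^sub>R x) \<partial>lborel)"
    using assms by (subst lborel_affine[of c b])
      (simp_all add: integral_density integral_distr)
  then show ?thesis using assms(2) by simp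
qed

lemma integral_shift_refl:
  fixes f :: "'a::euclidean_space \<Rightarrow> real"
  assumes "f \<in> borel_measurable borel"
  shows "(\<integral>x. f (b - x) \<partial>lborel) = (\<integral>x. f x \<partial>lborel)"
  using integral_affine[OF assms, of "-1" b] by simp

lemma integral_shift:
  fixes f :: "'a::euclidean_space \<Rightarrow> real"
  assumes "f \<in> borel_measurable borel"
  shows "(\<integral>x. f (x + b) \<partial>lborel) = (\<integral>x. f x \<partial>lborel)"
  using integral_affine[OF assms, of 1 b] by (simp add: add.commute)

subsection \<open>Square integrable functions\<close>

lemma L2_test: "test f \<Longrightarrow> L2 f"
  unfolding L2_def using integrable_test_mult[of f f]
  by (auto simp: power2_eq_square borel_measurable_test test_continuous)

lemma L2_mult_integrable:
  assumes "L2 f" "L2 g" shows "integrable lborel (\<lambda>x. f x * g x)"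
proof (rule Bochner_Integration.integrable_bound)
  show "integrable lborel (\<lambda>x. (f x)\<^sup>2 + (g x)\<^sup>2)" using assms by (simp add: L2_def)
  show "(\<lambda>x. f x * g x) \<in> borel_measurable lborel" using assms by (auto simp: L2_def intro!: borel_measurable_times)
  have "\<bar>a * b\<bar> \<le> a\<^sup>2 + b\<^sup>2" for a b :: real
  proof -
    have "2 * (\<bar>a\<bar> * \<bar>b\<bar>) \<le> a\<^sup>2 + b\<^sup>2" using sum_squares_bound[of "\<bar>a\<bar>" "\<bar>b\<bar>"] by (simp add: mult.assoc)
    moreover have "0 \<le> \<bar>a\<bar> * \<bar>b\<bar>" by simp
    ultimately show ?thesis unfolding abs_mult by linarith
  qed
  then show "AE x in lborel. norm (f x * g x) \<le> norm ((f x)\<^sup>2 + (g x)\<^sup>2)"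
    by simp
qed

lemma L2_add: assumes "L2 f" "L2 g" shows "L2 (\<lambda>x. f x + g x)"
proof -
  have "integrable lborel (\<lambda>x. (f x)\<^sup>2 + 2 * (f x * g x) + (g x)\<^sup>2)"
    using assms L2_mult_integrable[OF assms] by (simp add: L2_def)
  then show ?thesis using assms by (auto simp: L2_def power2_sum algebra_simps intro!: borel_measurable_add)
qed

lemma L2_cmult: "L2 f \<Longrightarrow> L2 (\<lambda>x. c * f x)"
  by (auto simp: L2_def power_mult_distrib)

lemma L2_uminus: "L2 f \<Longrightarrow> L2 (\<lambda>x. - f x)"
  using L2_cmult[of f "-1"] by simp

lemma L2_diff: "L2 f \<Longrightarrow> L2 g \<Longrightarrow> L2 (\<lambda>x. f x - g x)"
  using L2_add[OF _ L2_uminus, of f g] by simp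

lemma L2_0: "L2 (\<lambda>x. 0)" by (simp add: L2_def)

lemma L2_sum: "(\<And>i. i \<in> I \<Longrightarrow> L2 (f i)) \<Longrightarrow> L2 (\<lambda>x. \<Sum>i\<in>I. f i x)"
  by (induction I rule: infinite_finite_induct) (auto intro: L2_0 L2_add)

lemma L2n_nonneg: "L2n f \<ge> 0"
  by (simp add: L2n_def)

lemma L2n_sq: "(L2n f)\<^sup>2 = (\<integral>x. (f x)\<^sup>2 \<partial>lborel)"
  by (simp add: L2n_def)

lemma L2n_sq_mult: "(L2n f)\<^sup>2 = (\<integral>x. f x * f x \<partial>lborel)"
  using L2n_sq[of f] by (simp add: power2_eq_square[of "f _"])

text \<open>Discriminant criterion. It yields the Cauchy-Schwarz inequality both for square
  integrable functions and for the Sobolev inner product \<open>ip1\<close>.\<close>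

lemma quadratic_nonneg_imp:
  fixes a b c :: real
  assumes "\<And>t. 0 \<le> a * t\<^sup>2 + 2 * b * t + c" "a \<ge> 0"
  shows "b\<^sup>2 \<le> a * c"
proof (cases "a = 0")
  case True
  have "b = 0"
  proof (rule ccontr)
    assume "b \<noteq> 0"
    \<comment> \<open>At this value of t the linear function 2 b t + c equals -1.\<close>
    with assms(1)[of "- (c + 1) / (2 * b)"] True show False by (simp add: field_simps)
  qed
  with True show ?thesis by simp
next
  case False
  with assms have "a > 0" by simp
  with assms(1)[of "- b / a"] show ?thesis
    by (simp add: field_simps power2_eq_square)
qed

lemma L2_expand:
  assumes "L2 f" "L2 g"
  shows "(\<integral>x. (t * f x + g x)\<^sup>2 \<partial>lborel) = (L2n f)\<^sup>2 * t\<^sup>2 + 2 * (\<integral>x. f x * g x \<partial>lborel) * t + (L2n g)\<^sup>2"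
proof -
  have "(t * f x + g x)\<^sup>2 = t\<^sup>2 * (f x)\<^sup>2 + 2 * t * (f x * g x) + (g x)\<^sup>2" for x
    by (simp add: power2_eq_square algebra_simps)
  then show ?thesis using assms L2_mult_integrable[OF assms]
    by (simp add: L2n_sq L2_def)
qed

lemma L2_CS:
  assumes "L2 f" "L2 g"
  shows "\<bar>\<integral>x. f x * g x \<partial>lborel\<bar> \<le> L2n f * L2n g"
proof -
  have "(\<integral>x. f x * g x \<partial>lborel)\<^sup>2 \<le> (L2n f)\<^sup>2 * (L2n g)\<^sup>2"
  proof (rule quadratic_nonneg_imp)
    fix t
    have "0 \<le> (\<integral>x. (t * f x + g x)\<^sup>2 \<partial>lborel)" by simp
    then show "0 \<le> (L2n f)\<^sup>2 * t\<^sup>2 + 2 * (\<integral>x. f x * g x \<partial>lborel) * t + (L2n g)\<^sup>2"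
      using L2_expand[OF assms] by simp
  qed simp
  then have "\<bar>\<integral>x. f x * g x \<partial>lborel\<bar>\<^sup>2 \<le> (L2n f * L2n g)\<^sup>2" by (simp add: power_mult_distrib)
  then show ?thesis by (rule power2_le_imp_le) (simp add: L2n_nonneg)
qed

lemma L2n_triangle:
  assumes "L2 f" "L2 g" shows "L2n (\<lambda>x. f x + g x) \<le> L2n f + L2n g"
proof (rule power2_le_imp_le)
  have "(L2n (\<lambda>x. f x + g x))\<^sup>2 = (L2n f)\<^sup>2 + 2 * (\<integral>x. f x * g x \<partial>lborel) + (L2n g)\<^sup>2"
    using L2_expand[OF assms, of 1] by (simp add: L2n_sq)
  also have "\<dots> \<le> (L2n f + L2n g)\<^sup>2"
    using L2_CS[OF assms] by (simp add: power2_sum)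
  finally show "(L2n (\<lambda>x. f x + g x))\<^sup>2 \<le> (L2n f + L2n g)\<^sup>2" .
qed (simp add: L2n_nonneg)

lemma L2n_cmult: "L2n (\<lambda>x. c * f x) = \<bar>c\<bar> * L2n f"
  by (simp add: L2n_def power_mult_distrib real_sqrt_mult)

lemma L2n_uminus: "L2n (\<lambda>x. - f x) = L2n f"
  using L2n_cmult[of "-1" f] by simp

lemma L2n_diff_commute: "L2n (\<lambda>x. f x - g x) = L2n (\<lambda>x. g x - f x)"
  using L2n_uminus[of "\<lambda>x. f x - g x"] by simp

lemma L2n_triangle_diff:
  assumes "L2 f" "L2 g" "L2 h" shows "L2n (\<lambda>x. f x - h x) \<le> L2n (\<lambda>x. f x - g x) + L2n (\<lambda>x. g x - h x)"
  using L2n_triangle[OF L2_diff[OF assms(1,2)] L2_diff[OF assms(2,3)]] by simp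

lemma L2n_le_add_diff: "L2 f \<Longrightarrow> L2 g \<Longrightarrow> L2n f \<le> L2n g + L2n (\<lambda>x. f x - g x)"
  using L2n_triangle[of g "\<lambda>x. f x - g x"] by (simp add: L2_diff)

lemma L2n_0: "L2n (\<lambda>x. 0) = 0" by (simp add: L2n_def)

lemma L2n_sum:
  "(\<And>i. i \<in> I \<Longrightarrow> L2 (f i)) \<Longrightarrow> L2n (\<lambda>x. \<Sum>i\<in>I. f i x) \<le> (\<Sum>i\<in>I. L2n (f i))"
proof (induction I rule: infinite_finite_induct)
  case (insert i I)
  have "L2n (\<lambda>x. \<Sum>i\<in>insert i I. f i x) = L2n (\<lambda>x. f i x + (\<Sum>i\<in>I. f i x))"
    using insert by simp
  also have "\<dots> \<le> L2n (f i) + L2n (\<lambda>x. \<Sum>i\<in>I. f i x)"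
    using insert by (intro L2n_triangle L2_sum) auto
  also have "\<dots> \<le> (\<Sum>i\<in>insert i I. L2n (f i))" using insert by auto
  finally show ?case .
qed (auto simp: L2n_0)

lemma L2n_bound:
  assumes "L2 f" "S \<in> fmeasurable lborel" "\<And>x. x \<notin> S \<Longrightarrow> f x = 0" "\<And>x. \<bar>f x\<bar> \<le> M" "M \<ge> 0"
  shows "L2n f \<le> M * sqrt (measure lborel S)"
proof -
  have "(\<integral>x. (f x)\<^sup>2 \<partial>lborel) \<le> (\<integral>x. M\<^sup>2 * indicator S x \<partial>lborel)"
  proof (rule integral_mono)
    show "integrable lborel (\<lambda>x. (f x)\<^sup>2)" using assms by (simp add: L2_def)
    show "integrable lborel (\<lambda>x. M\<^sup>2 * indicator S x)"
      using assms(2) by (auto simp: fmeasurable_def)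
    fix x show "(f x)\<^sup>2 \<le> M\<^sup>2 * indicator S x"
      using assms(3)[of x] power_mono[OF assms(4)[of x], of 2] by (cases "x \<in> S") auto
  qed
  also have "\<dots> = M\<^sup>2 * measure lborel S" using assms(2) by simp
  finally have "(L2n f)\<^sup>2 \<le> (M * sqrt (measure lborel S))\<^sup>2"
    by (simp add: L2n_sq power_mult_distrib)
  then show ?thesis by (rule power2_le_imp_le) (use assms in simp)
qed

lemma integral_pos_of_pos:
  fixes f :: "R3 \<Rightarrow> real"
  assumes "integrable lborel f" "\<And>x. f x \<ge> 0" "continuous_on UNIV f" "f x0 > 0"
  shows "(\<integral>x. f x \<partial>lborel) > 0"
proof -
  have "isCont f x0" using assms(3) by (simp add: continuous_on_eq_continuous_at)
  then have "\<forall>\<^sub>F x in nhds x0. f x > f x0 / 2"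
    using assms(4) by (intro order_tendstoD(1)[of f "f x0"]) (auto simp: isCont_def tendsto_at_iff_tendsto_nhds)
  then obtain d where d: "d > 0" "\<And>x. dist x x0 < d \<Longrightarrow> f x > f x0 / 2"
    unfolding eventually_nhds_metric by auto
  have "(\<integral>x. f x0 / 2 * indicator (ball x0 d) x \<partial>lborel) \<le> (\<integral>x. f x \<partial>lborel)"
  proof (rule integral_mono)
    show "integrable lborel (\<lambda>x. f x0 / 2 * indicator (ball x0 d) x)"
      by (intro integrable_mult_right integrable_real_indicator) (simp_all only: sets_lborel borel_open open_ball emeasure_lborel_ball_finite)
    fix x show "f x0 / 2 * indicator (ball x0 d) x \<le> f x"
      using d(2)[of x] assms(2)[of x] by (auto simp: indicator_def dist_commute)
  qed (rule assms)
  moreover have "f x0 / 2 * measure lborel (ball x0 d) > 0"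
    using assms(4) content_ball_pos[OF d(1), of x0] by (intro mult_pos_pos) auto
  moreover have "(\<integral>x. f x0 / 2 * indicator (ball x0 d) x \<partial>lborel) = f x0 / 2 * measure lborel (ball x0 d)"
    by simp
  ultimately show ?thesis by linarith
qed

lemma L2n_pos: assumes "test f" "f \<noteq> (\<lambda>_. 0)" shows "L2n f > 0"
proof -
  obtain x0 where "f x0 \<noteq> 0" using assms by auto
  then have "(\<integral>x. (f x)\<^sup>2 \<partial>lborel) > 0"
    using L2_test[OF assms(1)] assms(1)
    by (intro integral_pos_of_pos[of _ x0]) (auto simp: L2_def intro: continuous_on_power test_continuous)
  then show ?thesis by (simp add: L2n_def)
qed

lemma h1n_nonneg: "h1n f \<ge> 0"
  unfolding h1n_def by (simp add: sum_nonneg)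

lemma h1n_sq: "(h1n f)\<^sup>2 = (L2n f)\<^sup>2 + (\<Sum>j\<in>UNIV. (L2n (pd j f))\<^sup>2)"
  unfolding h1n_def by (simp add: sum_nonneg)

lemma L2n_le_h1n: "L2n f \<le> h1n f"
  by (rule power2_le_imp_le) (simp_all add: h1n_sq sum_nonneg h1n_nonneg)

lemma L2n_pd_le_h1n: "L2n (pd j f) \<le> h1n f"
proof (rule power2_le_imp_le)
  have "(L2n (pd j f))\<^sup>2 \<le> (\<Sum>j\<in>UNIV. (L2n (pd j f))\<^sup>2)"
    by (rule member_le_sum) auto
  then show "(L2n (pd j f))\<^sup>2 \<le> (h1n f)\<^sup>2" by (simp add: h1n_sq add_increasing)
qed (rule h1n_nonneg)

lemma h1n_pos: "test f \<Longrightarrow> f \<noteq> (\<lambda>_. 0) \<Longrightarrow> h1n f > 0"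
  using L2n_pos[of f] L2n_le_h1n[of f] by linarith

text \<open>The function and its three derivatives contribute four squares of \<open>M\<close>, and
  4 M^2 = (2 M)^2; this is the origin of the factors 2 in the later Sobolev bounds.\<close>

lemma h1n_le:
  assumes "L2n f \<le> M" "\<And>j. L2n (pd j f) \<le> M"
  shows "h1n f \<le> 2 * M"
proof (rule power2_le_imp_le)
  have M: "M \<ge> 0" using assms(1) L2n_nonneg[of f] by linarith
  have "(h1n f)\<^sup>2 \<le> M\<^sup>2 + (\<Sum>j\<in>(UNIV::3 set). M\<^sup>2)"
    unfolding h1n_sq using assms by (intro add_mono sum_mono power_mono) (auto simp: L2n_nonneg)
  also have "\<dots> = (2 * M)\<^sup>2" by (simp add: power_mult_distrib)
  finally show "(h1n f)\<^sup>2 \<le> (2 * M)\<^sup>2" .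
  show "0 \<le> 2 * M" using M by simp
qed

subsection \<open>Completeness\<close>

lemma LIMSEQ_squeeze_0:
  fixes f g :: "nat \<Rightarrow> real"
  assumes "\<And>n. \<bar>f n\<bar> \<le> g n" "g \<longlonglongrightarrow> 0"
  shows "f \<longlonglongrightarrow> 0"
  by (rule Lim_null_comparison[OF always_eventually assms(2)]) (simp add: assms(1))

definition L2_lim :: "(nat \<Rightarrow> R3 \<Rightarrow> real) \<Rightarrow> (R3 \<Rightarrow> real) \<Rightarrow> bool" where
  "L2_lim f w \<longleftrightarrow> L2 w \<and> (\<lambda>n. L2n (\<lambda>x. f n x - w x)) \<longlonglongrightarrow> 0"

definition L2_Cauchy :: "(nat \<Rightarrow> R3 \<Rightarrow> real) \<Rightarrow> bool" where
  "L2_Cauchy f \<longleftrightarrow> (\<forall>n. L2 (f n)) \<and> (\<forall>e>0. \<exists>N. \<forall>m\<ge>N. \<forall>n\<ge>N. L2n (\<lambda>x. f m x - f n x) \<le> e)"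

lemma nn_integral_L2n: "L2 f \<Longrightarrow> (\<integral>\<^sup>+x. ennreal ((f x)\<^sup>2) \<partial>lborel) = ennreal ((L2n f)\<^sup>2)"
  unfolding L2n_sq by (rule nn_integral_eq_integral) (auto simp: L2_def)

text \<open>Fatou's lemma for the squares. Membership of the limit and the bound come out together,
  so only almost everywhere convergence has to be supplied.\<close>

lemma L2_limI_Fatou:
  assumes "\<And>n. L2 (f n)" "\<And>n. L2n (f n) \<le> B" "AE x in lborel. (\<lambda>n. f n x) \<longlonglongrightarrow> w x"
    "w \<in> borel_measurable lborel" "B \<ge> 0"
  shows "L2 w" "L2n w \<le> B"
proof -
  have [measurable]: "f n \<in> borel_measurable lborel" for n using assms(1) by (simp add: L2_def)
  note [measurable] = assms(4)
  have "(\<integral>\<^sup>+x. ennreal ((w x)\<^sup>2) \<partial>lborel) = (\<integral>\<^sup>+x. liminf (\<lambda>n. ennreal ((f n x)\<^sup>2)) \<partial>lborel)"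
  proof (rule nn_integral_cong_AE)
    show "AE x in lborel. ennreal ((w x)\<^sup>2) = liminf (\<lambda>n. ennreal ((f n x)\<^sup>2))"
      using assms(3)
    proof eventually_elim
      case (elim x)
      then have "(\<lambda>n. ennreal ((f n x)\<^sup>2)) \<longlonglongrightarrow> ennreal ((w x)\<^sup>2)"
        by (intro tendsto_ennrealI tendsto_intros)
      then show ?case using lim_imp_Liminf[OF sequentially_bot] by metis
    qed
  qed
  also have "\<dots> \<le> liminf (\<lambda>n. (\<integral>\<^sup>+x. ennreal ((f n x)\<^sup>2) \<partial>lborel))"
    by (rule nn_integral_liminf) simp
  also have "\<dots> \<le> liminf (\<lambda>n. ennreal (B\<^sup>2))"
    by (intro Liminf_mono always_eventually allI)
      (use assms in \<open>auto simp: nn_integral_L2n intro!: ennreal_leI power_mono L2n_nonneg\<close>)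
  also have "\<dots> = ennreal (B\<^sup>2)" by (simp add: Liminf_const)
  finally have le: "(\<integral>\<^sup>+x. ennreal ((w x)\<^sup>2) \<partial>lborel) \<le> ennreal (B\<^sup>2)" .
  have "integrable lborel (\<lambda>x. (w x)\<^sup>2)"
    by (rule integrableI_bounded) (use le in \<open>auto simp: order_le_less_trans\<close>)
  then show "L2 w" by (simp add: L2_def)
  then have "ennreal ((L2n w)\<^sup>2) \<le> ennreal (B\<^sup>2)" using le by (simp add: nn_integral_L2n)
  then have "(L2n w)\<^sup>2 \<le> B\<^sup>2" by (simp add: ennreal_le_iff)
  then show "L2n w \<le> B" using assms(5) by (rule power2_le_imp_le)
qed

text \<open>Monotone convergence for the squares. The intended \<open>f n\<close> are the partial
  sums of absolute increments of a Cauchy sequence.\<close>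

lemma AE_finite_of_L2_bound:
  assumes "\<And>n. L2 (f n)" "\<And>n. L2n (f n) \<le> B" "\<And>n x. 0 \<le> f n x" "\<And>n x. f n x \<le> f (Suc n) x"
  shows "AE x in lborel. bdd_above (range (\<lambda>n. f n x))"
proof -
  have [measurable]: "f n \<in> borel_measurable lborel" for n using assms(1) by (simp add: L2_def)
  have mono: "incseq (\<lambda>n. ennreal ((f n x)\<^sup>2))" for x
    by (rule incseq_SucI) (auto intro!: ennreal_leI power_mono assms)
  have "(\<integral>\<^sup>+x. (SUP n. ennreal ((f n x)\<^sup>2)) \<partial>lborel) = (SUP n. (\<integral>\<^sup>+x. ennreal ((f n x)\<^sup>2) \<partial>lborel))"
    using mono by (intro nn_integral_monotone_convergence_SUP) (auto simp: incseq_def le_fun_def)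
  also have "\<dots> \<le> ennreal (B\<^sup>2)"
    by (rule SUP_least) (use assms in \<open>auto simp: nn_integral_L2n intro!: ennreal_leI power_mono L2n_nonneg\<close>)
  finally have "(\<integral>\<^sup>+x. (SUP n. ennreal ((f n x)\<^sup>2)) \<partial>lborel) \<noteq> \<infinity>"
    using ennreal_less_top[of "B\<^sup>2"] by (auto simp: top_unique)
  then have "AE x in lborel. (SUP n. ennreal ((f n x)\<^sup>2)) \<noteq> \<infinity>"
    by (intro nn_integral_noteq_infinite) auto
  then show ?thesis
  proof eventually_elim
    case (elim x)
    then obtain r where r: "(SUP n. ennreal ((f n x)\<^sup>2)) = ennreal r" "r \<ge> 0"
      by (cases "SUP n. ennreal ((f n x)\<^sup>2)" rule: ennreal_cases) auto
    have "f n x \<le> sqrt r" for n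
    proof -
      have "ennreal ((f n x)\<^sup>2) \<le> ennreal r" unfolding r(1)[symmetric] by (rule SUP_upper) simp
      then show ?thesis using r(2) by (intro real_le_rsqrt) (simp add: ennreal_le_iff)
    qed
    then show ?case by (auto simp: bdd_above_def)
  qed
qed

lemma L2n_abs: "L2n (\<lambda>x. \<bar>f x\<bar>) = L2n f"
  by (simp add: L2n_def)

lemma L2_abs: "L2 f \<Longrightarrow> L2 (\<lambda>x. \<bar>f x\<bar>)"
  by (auto simp: L2_def intro!: borel_measurable_abs)

text \<open>The Riesz-Fischer argument: along a subsequence with increments at most 2^-k the
  telescoping series converges absolutely almost everywhere, and Fatou's lemma upgrades this to
  convergence in norm of the whole sequence.\<close>

lemma L2_complete:
  assumes "L2_Cauchy f" obtains w where "L2_lim f w"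
proof -
  have L: "L2 (f n)" for n using assms by (simp add: L2_Cauchy_def)
  have "\<exists>N. \<forall>m\<ge>N. \<forall>n\<ge>N. L2n (\<lambda>x. f m x - f n x) \<le> (1/2)^k" for k :: nat
    using assms unfolding L2_Cauchy_def by (auto intro: zero_less_power)
  then obtain N where N: "\<And>k m n. m \<ge> N k \<Longrightarrow> n \<ge> N k \<Longrightarrow> L2n (\<lambda>x. f m x - f n x) \<le> (1/2)^k"
    by metis
  \<comment> \<open>Summing the thresholds produces an index sequence that is monotone and still
    dominates each of them.\<close>
  define s where "s k = (\<Sum>i\<le>k. N i)" for k
  have sN: "s k \<ge> N k" for k unfolding s_def by (rule member_le_sum) auto
  have smono: "mono s" by (rule incseq_SucI[unfolded]) (auto simp: s_def)
  define d where "d k x = f (s (Suc k)) x - f (s k) x" for k x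
  have dL: "L2 (d k)" for k unfolding d_def[abs_def] by (intro L2_diff L)
  have dn: "L2n (d k) \<le> (1/2)^k" for k unfolding d_def[abs_def]
    by (rule N) (use sN[of k] monoD[OF smono, of k "Suc k"] in auto)
  have gn: "L2n (\<lambda>x. \<Sum>k<n. \<bar>d k x\<bar>) \<le> 2" for n
  proof -
    have "L2n (\<lambda>x. \<Sum>k<n. \<bar>d k x\<bar>) \<le> (\<Sum>k<n. L2n (\<lambda>x. \<bar>d k x\<bar>))"
      by (intro L2n_sum L2_abs dL)
    also have "\<dots> \<le> (\<Sum>k<n. (1/2)^k)" by (intro sum_mono) (simp add: L2n_abs dn)
    also have "\<dots> = 2 - 2 * (1/2)^n" by (induction n) simp_all
    also have "\<dots> \<le> 2" by simp
    finally show ?thesis .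
  qed
  have "AE x in lborel. bdd_above (range (\<lambda>n. \<Sum>k<n. \<bar>d k x\<bar>))"
    by (rule AE_finite_of_L2_bound[where B=2]) (auto intro!: L2_sum L2_abs dL gn sum_nonneg)
  then have conv: "AE x in lborel. convergent (\<lambda>k. f (s k) x)"
  proof eventually_elim
    case (elim x)
    then have "(\<Sum>k\<le>n. \<bar>d k x\<bar>) \<le> (SUP n. \<Sum>k<n. \<bar>d k x\<bar>)" for n
      using cSUP_upper[of "Suc n" UNIV "\<lambda>n. \<Sum>k<n. \<bar>d k x\<bar>"] unfolding lessThan_Suc_atMost by simp
    then have "summable (\<lambda>k. \<bar>d k x\<bar>)"
      by (intro bounded_imp_summable[where B="SUP n. \<Sum>k<n. \<bar>d k x\<bar>"]) simp_all
    then have "summable (\<lambda>k. d k x)" by (rule summable_rabs_cancel)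
    then have "convergent (\<lambda>n. \<Sum>k<n. d k x)" by (simp add: summable_iff_convergent)
    moreover have "(\<Sum>k<n. d k x) = f (s n) x - f (s 0) x" for n
      unfolding d_def by (rule sum_lessThan_telescope)
    ultimately have "convergent (\<lambda>n. f (s n) x - f (s 0) x)" by simp
    then show ?case using convergent_diff_const_right_iff by blast
  qed
  define w where "w x = lim (\<lambda>k. f (s k) x)" for x
  have [measurable]: "f n \<in> borel_measurable lborel" for n using L by (simp add: L2_def)
  have wm: "w \<in> borel_measurable lborel" unfolding w_def[abs_def] by measurable
  \<comment> \<open>The index \<open>m\<close> stays fixed while the subsequence runs off to its
    limit, so the Cauchy estimate itself becomes the rate of convergence.\<close>
  have bnd: "L2 (\<lambda>x. w x - f m x) \<and> L2n (\<lambda>x. w x - f m x) \<le> (1/2)^k" if "m \<ge> N k" for k m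
  proof -
    have "L2n (\<lambda>x. f (s (n + k)) x - f m x) \<le> (1/2)^k" for n
      using sN[of k] monoD[OF smono, of k "n + k"] that by (intro N) auto
    moreover have "AE x in lborel. (\<lambda>n. f (s (n + k)) x - f m x) \<longlonglongrightarrow> w x - f m x"
      using conv by eventually_elim
        (auto simp: w_def convergent_LIMSEQ_iff intro!: tendsto_intros LIMSEQ_ignore_initial_segment)
    ultimately show ?thesis
      using L2_limI_Fatou[of "\<lambda>n x. f (s (n + k)) x - f m x" "(1/2)^k" "\<lambda>x. w x - f m x"] wm L2_diff[OF L L, of _ m] by auto
  qed
  have "L2 w" using L2_add[OF conjunct1[OF bnd[OF order_refl, of 0]] L[of "N 0"]] by simp
  moreover have "(\<lambda>n. L2n (\<lambda>x. f n x - w x)) \<longlonglongrightarrow> 0"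
  proof (rule LIMSEQ_I)
    fix r :: real assume "r > 0"
    then obtain k where k: "(1/2::real)^k < r" using real_arch_pow_inv[of r "1/2"] by auto
    show "\<exists>no. \<forall>n\<ge>no. norm (L2n (\<lambda>x. f n x - w x) - 0) < r"
      by (rule exI[of _ "N k"]) (use bnd[of k] k in \<open>auto simp: L2n_nonneg L2n_diff_commute[of w] intro: le_less_trans\<close>)
  qed
  ultimately show thesis using that by (simp add: L2_lim_def)
qed

lemma L2n_zero_AE: "L2 f \<Longrightarrow> L2n f = 0 \<Longrightarrow> AE x in lborel. f x = 0"
proof -
  assume f: "L2 f" "L2n f = 0"
  then have "(\<integral>x. (f x)\<^sup>2 \<partial>lborel) = 0" by (simp add: L2n_def)
  then have "AE x in lborel. (f x)\<^sup>2 = 0"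
    using f by (subst (asm) integral_nonneg_eq_0_iff_AE) (auto simp: L2_def)
  then show ?thesis by simp
qed

text \<open>Functions are not identified almost everywhere, so limits are unique only up to null
  sets. For this reason linearity of the solution operators is an almost everywhere
  statement.\<close>

lemma L2_lim_unique:
  assumes "\<And>n. L2 (f n)" "L2_lim f v" "L2_lim f w" shows "AE x in lborel. v x = w x"
proof -
  have vw: "L2 v" "L2 w" using assms by (auto simp: L2_lim_def)
  have "(\<lambda>n. L2n (\<lambda>x. f n x - v x) + L2n (\<lambda>x. f n x - w x)) \<longlonglongrightarrow> 0 + 0"
    using assms by (intro tendsto_add) (auto simp: L2_lim_def)
  moreover have "L2n (\<lambda>x. v x - w x) \<le> L2n (\<lambda>x. f n x - v x) + L2n (\<lambda>x. f n x - w x)" for n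
    using L2n_triangle_diff[OF vw(1) assms(1) vw(2), of n] by (simp add: L2n_diff_commute)
  ultimately have "L2n (\<lambda>x. v x - w x) \<le> 0"
    by (intro LIMSEQ_le_const[of _ 0]) auto
  then have "L2n (\<lambda>x. v x - w x) = 0" using L2n_nonneg by (simp add: order.antisym)
  from L2n_zero_AE[OF L2_diff[OF vw] this] show ?thesis by simp
qed

lemma L2_lim_lincomb:
  assumes "\<And>n. L2 (f n)" "\<And>n. L2 (g n)" "L2_lim f v" "L2_lim g w"
  shows "L2_lim (\<lambda>n x. a * f n x + b * g n x) (\<lambda>x. a * v x + b * w x)"
proof -
  have vw: "L2 v" "L2 w" using assms by (auto simp: L2_lim_def)
  have "(\<lambda>n. \<bar>a\<bar> * L2n (\<lambda>x. f n x - v x) + \<bar>b\<bar> * L2n (\<lambda>x. g n x - w x)) \<longlonglongrightarrow> \<bar>a\<bar> * 0 + \<bar>b\<bar> * 0"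
    using assms by (intro tendsto_intros) (auto simp: L2_lim_def)
  moreover have "L2n (\<lambda>x. a * f n x + b * g n x - (a * v x + b * w x))
     \<le> \<bar>a\<bar> * L2n (\<lambda>x. f n x - v x) + \<bar>b\<bar> * L2n (\<lambda>x. g n x - w x)" for n
  proof -
    have "L2n (\<lambda>x. a * (f n x - v x) + b * (g n x - w x)) \<le> \<bar>a\<bar> * L2n (\<lambda>x. f n x - v x) + \<bar>b\<bar> * L2n (\<lambda>x. g n x - w x)"
      using L2n_triangle[of "\<lambda>x. a * (f n x - v x)" "\<lambda>x. b * (g n x - w x)"] assms vw
      by (simp add: L2n_cmult L2_cmult L2_diff)
    moreover have "a * (f n x - v x) + b * (g n x - w x) = a * f n x + b * g n x - (a * v x + b * w x)" for x
      by (simp add: algebra_simps)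
    ultimately show ?thesis by simp
  qed
  ultimately have "(\<lambda>n. L2n (\<lambda>x. a * f n x + b * g n x - (a * v x + b * w x))) \<longlonglongrightarrow> 0"
    by (elim LIMSEQ_squeeze_0[rotated, OF tendsto_eq_rhs]) (simp_all add: L2n_nonneg)
  then show ?thesis unfolding L2_lim_def using vw by (auto intro!: L2_add L2_cmult)
qed

lemma L2_lim_integral:
  assumes "\<And>n. L2 (f n)" "L2_lim f w" "L2 g"
  shows "(\<lambda>n. \<integral>x. f n x * g x \<partial>lborel) \<longlonglongrightarrow> (\<integral>x. w x * g x \<partial>lborel)"
proof -
  have w: "L2 w" using assms by (auto simp: L2_lim_def)
  have "(\<integral>x. f n x * g x \<partial>lborel) - (\<integral>x. w x * g x \<partial>lborel) = (\<integral>x. (f n x - w x) * g x \<partial>lborel)" for n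
    using L2_mult_integrable[OF assms(1,3)] L2_mult_integrable[OF w assms(3)]
    by (simp add: left_diff_distrib)
  then have le: "norm ((\<integral>x. f n x * g x \<partial>lborel) - (\<integral>x. w x * g x \<partial>lborel)) \<le> L2n (\<lambda>x. f n x - w x) * L2n g" for n
    using L2_CS[OF L2_diff[OF assms(1) w] assms(3)] by simp
  have "(\<lambda>n. L2n (\<lambda>x. f n x - w x) * L2n g) \<longlonglongrightarrow> 0 * L2n g"
    using assms(2) by (intro tendsto_intros) (simp add: L2_lim_def)
  then have "(\<lambda>n. L2n (\<lambda>x. f n x - w x) * L2n g) \<longlonglongrightarrow> 0" by simp
  from LIMSEQ_squeeze_0[OF le[unfolded real_norm_def] this]
  have "(\<lambda>n. (\<integral>x. f n x * g x \<partial>lborel) - (\<integral>x. w x * g x \<partial>lborel)) \<longlonglongrightarrow> 0" .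
  then show ?thesis by (rule LIM_zero_cancel)
qed

lemma L2_lim_norm_le:
  assumes "\<And>n. L2 (f n)" "L2_lim f w" "\<And>n. L2n (f n) \<le> M" shows "L2n w \<le> M"
proof -
  have w: "L2 w" using assms by (auto simp: L2_lim_def)
  have "(\<lambda>n. M + L2n (\<lambda>x. f n x - w x)) \<longlonglongrightarrow> M + 0"
    using assms by (intro tendsto_intros) (auto simp: L2_lim_def)
  moreover have "L2n w \<le> M + L2n (\<lambda>x. f n x - w x)" for n
    using L2n_le_add_diff[OF w assms(1)[of n]] assms(3)[of n] by (simp add: L2n_diff_commute)
  ultimately show ?thesis using LIMSEQ_le_const[of _ "M + 0" "L2n w"] by auto
qed

section \<open>Taylor estimates, symmetry of second derivatives, integration by parts\<close>

lemma test_Lipschitz: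
  assumes "test f" obtains L where "L \<ge> 0" "\<And>x y. \<bar>f x - f y\<bar> \<le> L * norm (x - y)"
proof -
  have "\<exists>M\<ge>0. \<forall>x. \<bar>pd j f x\<bar> \<le> M" for j using test_bounded[OF test_on_pd[OF assms]] by metis
  then obtain M where M: "\<And>j. M j \<ge> 0" "\<And>j x. \<bar>pd j f x\<bar> \<le> M j" by metis
  show thesis
  proof (rule that[of "\<Sum>j\<in>UNIV. M j"])
    fix x y
    have "norm (f x - f y) \<le> (\<Sum>j\<in>UNIV. M j) * norm (x - y)"
    proof (rule differentiable_bound[of UNIV])
      show "onorm (\<lambda>h. \<Sum>j\<in>UNIV. (h $ j) * pd j f z) \<le> (\<Sum>j\<in>UNIV. M j)" for z
      proof (rule onorm_le)
        fix h :: R3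
        have "norm (\<Sum>j\<in>UNIV. (h $ j) * pd j f z) \<le> (\<Sum>j\<in>UNIV. norm h * M j)"
          by (intro sum_norm_le) (auto simp: abs_mult intro!: mult_mono component_le_norm_cart M)
        then show "norm (\<Sum>j\<in>UNIV. (h $ j) * pd j f z) \<le> (\<Sum>j\<in>UNIV. M j) * norm h"
          by (simp add: sum_distrib_left sum_distrib_right mult.commute)
      qed
    qed (auto intro: has_derivative_pd test_differentiable assms)
    then show "\<bar>f x - f y\<bar> \<le> (\<Sum>j\<in>UNIV. M j) * norm (x - y)" by simp
  qed (simp add: M sum_nonneg)
qed

text \<open>The derivative of \<open>f\<close> is Lipschitz, so along the segment from x to x + h it
  differs from its value at x by a multiple of the length of h; the mean value inequality for the
  linearised function supplies the second factor.\<close>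

lemma test_Taylor2:
  assumes "test f"
  obtains C where "C \<ge> 0" "\<And>x h. \<bar>f (x + h) - f x - (\<Sum>j\<in>UNIV. (h $ j) * pd j f x)\<bar> \<le> C * (norm h)\<^sup>2"
proof -
  have "\<exists>L\<ge>0. \<forall>x y. \<bar>pd j f x - pd j f y\<bar> \<le> L * norm (x - y)" for j
    using test_Lipschitz[OF test_on_pd[OF assms]] by metis
  then obtain L where L: "\<And>j. L j \<ge> 0" "\<And>j x y. \<bar>pd j f x - pd j f y\<bar> \<le> L j * norm (x - y)" by metis
  show thesis
  proof (rule that[of "\<Sum>j\<in>UNIV. L j"])
    fix x h :: R3
    define f' where "f' = (\<lambda>(x::R3) (h::R3). \<Sum>j\<in>UNIV. (h $ j) * pd j f x)"
    let ?S = "(\<lambda>t. x + t *\<^sub>R h) ` {0..1}"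
    have "norm (f (x + h) - f x - f' x ((x + h) - x)) \<le> norm ((x + h) - x) * ((\<Sum>j\<in>UNIV. L j) * norm h)"
    proof (rule differentiable_bound_linearization[where S = ?S])
      show "(f has_derivative f' z) (at z within ?S)" for z unfolding f'_def
        by (rule has_derivative_at_withinI[OF has_derivative_pd[OF test_differentiable[OF assms]]])
      fix z assume "z \<in> ?S"
      then have zx: "norm (z - x) \<le> norm h" by (auto simp: mult_left_le_one_le)
      show "onorm (f' z - f' x) \<le> (\<Sum>j\<in>UNIV. L j) * norm h"
      proof (rule onorm_le)
        fix k :: R3
        have "(f' z - f' x) k = (\<Sum>j\<in>UNIV. (k $ j) * (pd j f z - pd j f x))"
          by (simp add: f'_def sum_subtractf algebra_simps)
        also have "norm \<dots> \<le> (\<Sum>j\<in>UNIV. norm k * (L j * norm h))"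
          by (intro sum_norm_le)
            (auto simp: abs_mult intro!: mult_mono component_le_norm_cart order_trans[OF L(2)] mult_left_mono zx L(1))
        finally show "norm ((f' z - f' x) k) \<le> (\<Sum>j\<in>UNIV. L j) * norm h * norm k"
          by (simp add: sum_distrib_right sum_distrib_left mult_ac)
      qed
    next
      show "x \<in> ?S" by (rule image_eqI[of _ _ 0]) auto
    qed auto
    then show "\<bar>f (x + h) - f x - (\<Sum>j\<in>UNIV. (h $ j) * pd j f x)\<bar> \<le> (\<Sum>j\<in>UNIV. L j) * (norm h)\<^sup>2"
      by (simp add: f'_def power2_eq_square mult_ac)
  qed (simp add: L sum_nonneg)
qed

lemma axis_sum: "(\<Sum>j\<in>UNIV. (c *\<^sub>R axis i 1 :: R3) $ j * g j) = c * g i"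
  by (simp add: axis_def if_distrib[of "\<lambda>x. x * _"] if_distrib[of "\<lambda>x. c * x"] cong: if_cong)

lemma test_difference_quotient:
  assumes "test f"
  obtains C where "C \<ge> 0" "\<And>x t. t > 0 \<Longrightarrow> \<bar>(f (x + t *\<^sub>R axis i 1) - f x) / t - pd i f x\<bar> \<le> C * t"
proof -
  from test_Taylor2[OF assms] obtain C where C: "C \<ge> 0"
    "\<And>x h. \<bar>f (x + h) - f x - (\<Sum>j\<in>UNIV. (h $ j) * pd j f x)\<bar> \<le> C * (norm h)\<^sup>2" by blast
  have "\<bar>(f (x + t *\<^sub>R axis i 1) - f x) / t - pd i f x\<bar> \<le> C * t" if t: "t > 0" for x t
  proof -
    have "\<bar>f (x + t *\<^sub>R axis i 1) - f x - t * pd i f x\<bar> \<le> C * t\<^sup>2"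
      using C(2)[of x "t *\<^sub>R axis i 1"] unfolding axis_sum by (simp add: norm_axis_1)
    moreover have "\<bar>f (x + t *\<^sub>R axis i 1) - f x - t * pd i f x\<bar> = t * \<bar>(f (x + t *\<^sub>R axis i 1) - f x) / t - pd i f x\<bar>"
    proof -
      have "f (x + t *\<^sub>R axis i 1) - f x - t * pd i f x = t * ((f (x + t *\<^sub>R axis i 1) - f x) / t - pd i f x)"
        using t by (simp add: field_simps)
      then show ?thesis using t by (simp add: abs_mult)
    qed
    ultimately show ?thesis using t by (simp add: power2_eq_square mult.left_commute[of C])
  qed
  with C(1) that show thesis by blast
qed

text \<open>The difference quotients in direction \<open>i\<close> converge uniformly together with all their first
  derivatives, so the limit may be differentiated term by term.\<close>
lemma pd_commute:
  assumes "test f" shows "pd i (pd j f) = pd j (pd i f)"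
proof
  fix x0
  define t where "t n = 1 / real (Suc n)" for n
  have t0: "t n > 0" for n by (simp add: t_def)
  have tlim: "t \<longlonglongrightarrow> 0" unfolding t_def using LIMSEQ_inverse_real_of_nat by (simp add: inverse_eq_divide)
  define Q where "Q g n x = (g (x + t n *\<^sub>R axis i 1) - g x) / t n" for g :: "R3 \<Rightarrow> real" and n x
  have Qlim: "(\<lambda>n. Q g n x) \<longlonglongrightarrow> pd i g x" if g: "test g" for g x
  proof -
    obtain C where C: "C \<ge> 0" "\<And>x t. t > 0 \<Longrightarrow> \<bar>(g (x + t *\<^sub>R axis i 1) - g x) / t - pd i g x\<bar> \<le> C * t"
      using test_difference_quotient[OF g] by blast
    have "(\<lambda>n. Q g n x - pd i g x) \<longlonglongrightarrow> 0"
      by (rule LIMSEQ_squeeze_0[of _ "\<lambda>n. C * t n"])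
        (use C t0 tendsto_mult_right_zero[OF tlim] in \<open>auto simp: Q_def\<close>)
    then show ?thesis by (rule LIM_zero_cancel)
  qed
  have der: "(Q f n has_derivative (\<lambda>h. \<Sum>m\<in>UNIV. h $ m * Q (pd m f) n x)) (at x)" for n x
  proof -
    have sm: "smooth_fun (\<lambda>x. (1 / t n) * (f (t n *\<^sub>R axis i 1 + 1 *\<^sub>R x) - f x))"
      by (intro smooth_fun_cmult smooth_fun_diff smooth_fun_affine test_smooth[OF assms])
    have eq: "Q f n = (\<lambda>x. (1 / t n) * (f (t n *\<^sub>R axis i 1 + 1 *\<^sub>R x) - f x))"
      by (auto simp: Q_def add.commute)
    have "pd m (Q f n) x = Q (pd m f) n x" for m
    proof -
      have "pd m (Q f n) x = (1 / t n) * pd m (\<lambda>x. f (t n *\<^sub>R axis i 1 + 1 *\<^sub>R x) - f x) x"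
        unfolding eq by (intro pd_cmult smooth_fun_differentiable smooth_fun_diff smooth_fun_affine test_smooth[OF assms])
      also have "pd m (\<lambda>x. f (t n *\<^sub>R axis i 1 + 1 *\<^sub>R x) - f x) x = 1 * pd m f (t n *\<^sub>R axis i 1 + 1 *\<^sub>R x) - pd m f x"
        using pd_diff'[OF test_affine[OF assms, of 1 "t n *\<^sub>R axis i 1"] assms, of m]
        unfolding pd_affine_test[OF assms] by simp
      finally have "pd m (Q f n) x = (1 / t n) * (1 * pd m f (t n *\<^sub>R axis i 1 + 1 *\<^sub>R x) - pd m f x)" .
      moreover have "Q (pd m f) n x = (1 / t n) * (1 * pd m f (t n *\<^sub>R axis i 1 + 1 *\<^sub>R x) - pd m f x)"
        by (simp add: Q_def add.commute)
      ultimately show ?thesis by (rule trans[OF _ sym])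
    qed
    moreover have "Q f n differentiable (at x)" unfolding eq using sm by (rule smooth_fun_differentiable)
    ultimately show ?thesis using has_derivative_pd[of "Q f n" x] by simp
  qed
  have "\<exists>C\<ge>0. \<forall>x n. \<bar>Q (pd m f) n x - pd i (pd m f) x\<bar> \<le> C * t n" for m
    unfolding Q_def using test_difference_quotient[OF test_on_pd[OF assms], of m i] t0 by metis
  then obtain C where C: "\<And>m. C m \<ge> 0" "\<And>m x n. \<bar>Q (pd m f) n x - pd i (pd m f) x\<bar> \<le> C m * t n" by metis
  have "\<exists>g. \<forall>x\<in>UNIV. (\<lambda>n. Q f n x) \<longlonglongrightarrow> g x \<and>
      (g has_derivative (\<lambda>h. \<Sum>m\<in>UNIV. h $ m * pd i (pd m f) x)) (at x)"
  proof (rule has_derivative_sequence)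
    fix e :: real assume "e > 0"
    have "(\<lambda>n. (\<Sum>m\<in>UNIV. C m) * t n) \<longlonglongrightarrow> 0" by (rule tendsto_mult_right_zero[OF tlim])
    from order_tendstoD(2)[OF this \<open>e > 0\<close>]
    show "\<forall>\<^sub>F n in sequentially. \<forall>x\<in>UNIV. \<forall>h. norm ((\<Sum>m\<in>UNIV. h $ m * Q (pd m f) n x) - (\<Sum>m\<in>UNIV. h $ m * pd i (pd m f) x)) \<le> e * norm h"
    proof eventually_elim
      case (elim n)
      show ?case
      proof (intro ballI allI)
        fix x h :: R3
        have "(\<Sum>m\<in>UNIV. h $ m * Q (pd m f) n x) - (\<Sum>m\<in>UNIV. h $ m * pd i (pd m f) x)
          = (\<Sum>m\<in>UNIV. h $ m * (Q (pd m f) n x - pd i (pd m f) x))"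
          by (simp add: sum_subtractf right_diff_distrib)
        also have "norm \<dots> \<le> (\<Sum>m\<in>UNIV. norm h * (C m * t n))"
          by (intro sum_norm_le) (auto simp: abs_mult intro!: mult_mono component_le_norm_cart C)
        also have "\<dots> = ((\<Sum>m\<in>UNIV. C m) * t n) * norm h"
          by (simp add: sum_distrib_right sum_distrib_left mult_ac)
        also have "\<dots> \<le> e * norm h" by (rule mult_right_mono) (use elim in auto)
        finally show "norm ((\<Sum>m\<in>UNIV. h $ m * Q (pd m f) n x) - (\<Sum>m\<in>UNIV. h $ m * pd i (pd m f) x)) \<le> e * norm h" .
      qed
    qed
  next
    show "(\<lambda>n. Q f n x0) \<longlonglongrightarrow> pd i f x0" by (rule Qlim[OF assms])
  qed (auto intro: der)
  then obtain g where g: "\<And>x. (\<lambda>n. Q f n x) \<longlonglongrightarrow> g x"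
      "\<And>x. (g has_derivative (\<lambda>h. \<Sum>m\<in>UNIV. h $ m * pd i (pd m f) x)) (at x)" by blast
  have "g = pd i f" using LIMSEQ_unique[OF g(1) Qlim[OF assms]] by auto
  with pd_eqI[OF g(2), of j x0] have "pd j (pd i f) x0 = (\<Sum>m\<in>UNIV. (axis j 1 :: R3) $ m * pd i (pd m f) x0)"
    by simp
  then show "pd i (pd j f) x0 = pd j (pd i f) x0" using axis_sum[of 1 j "\<lambda>m. pd i (pd m f) x0"] by simp
qed

lemma integral_bound_on_set:
  fixes f :: "R3 \<Rightarrow> real"
  assumes "integrable lborel f" "S \<in> fmeasurable lborel" "\<And>x. x \<notin> S \<Longrightarrow> f x = 0" "\<And>x. \<bar>f x\<bar> \<le> M"
  shows "\<bar>\<integral>x. f x \<partial>lborel\<bar> \<le> M * measure lborel S"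
proof -
  have "\<bar>\<integral>x. f x \<partial>lborel\<bar> \<le> (\<integral>x. \<bar>f x\<bar> \<partial>lborel)" by (rule integral_abs_bound)
  also have "\<dots> \<le> (\<integral>x. M * indicator S x \<partial>lborel)"
  proof (rule integral_mono)
    show "integrable lborel (\<lambda>x. M * indicator S x)"
      using assms(2) by (intro integrable_mult_right integrable_real_indicator) (auto simp: fmeasurable_def)
    show "\<bar>f x\<bar> \<le> M * indicator S x" for x using assms(3)[of x] assms(4)[of x] by (cases "x \<in> S") auto
  qed (use assms in auto)
  also have "\<dots> = M * measure lborel S" using assms(2) by simp
  finally show ?thesis .
qed

text \<open>A fixed set of finite measure that contains the supports of all difference quotients
  with step at most 1 of a function supported in \<open>S\<close>; uniform estimates on it turn into
  integral estimates.\<close>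

definition nbhd1 :: "R3 set \<Rightarrow> R3 set" where
  "nbhd1 S = {a + b |a b. a \<in> S \<and> b \<in> cball 0 1}"

lemma compact_nbhd1: "compact S \<Longrightarrow> compact (nbhd1 S)"
  unfolding nbhd1_def by (intro compact_sums compact_cball)

lemma nbhd1_fmeasurable: "compact S \<Longrightarrow> nbhd1 S \<in> fmeasurable lborel"
  by (intro fmeasurable_compact compact_nbhd1)

lemma not_in_nbhd1: "x \<notin> nbhd1 S \<Longrightarrow> norm h \<le> 1 \<Longrightarrow> x \<notin> S \<and> x + h \<notin> S"
proof -
  assume x: "x \<notin> nbhd1 S" and h: "norm h \<le> 1"
  have "a + b \<in> nbhd1 S" if "a \<in> S" "norm b \<le> 1" for a b
    using that unfolding nbhd1_def by auto
  from this[of x 0] this[of "x + h" "- h"] show ?thesis using x h by auto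
qed

text \<open>Translation invariance makes the integral of every difference quotient vanish, and these
  quotients converge to the derivative uniformly on a fixed set of finite measure.\<close>

lemma integral_pd_eq_0:
  assumes "test f" shows "(\<integral>x. pd j f x \<partial>lborel) = 0"
proof -
  obtain C where C: "C \<ge> 0" "\<And>x t. t > 0 \<Longrightarrow> \<bar>(f (x + t *\<^sub>R axis j 1) - f x) / t - pd j f x\<bar> \<le> C * t"
    using test_difference_quotient[OF assms] by blast
  let ?S = "nbhd1 (tsupp f)"
  have le: "\<bar>\<integral>x. pd j f x \<partial>lborel\<bar> \<le> C * t * measure lborel ?S" if t: "0 < t" "t \<le> 1" for t
  proof -
    have i1: "integrable lborel (\<lambda>x. f (x + t *\<^sub>R axis j 1))"
      using integrable_test[OF test_affine[OF assms, of 1 "t *\<^sub>R axis j 1"]] by (simp add: add.commute)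
    note i = integrable_test[OF assms] i1 integrable_test[OF test_on_pd[OF assms, of j]]
    have "\<bar>\<integral>x. (f (x + t *\<^sub>R axis j 1) - f x) / t - pd j f x \<partial>lborel\<bar> \<le> C * t * measure lborel ?S"
    proof (rule integral_bound_on_set)
      show "integrable lborel (\<lambda>x. (f (x + t *\<^sub>R axis j 1) - f x) / t - pd j f x)" using i by simp
      show "?S \<in> fmeasurable lborel" by (intro nbhd1_fmeasurable test_compact[OF assms])
      fix x assume "x \<notin> ?S"
      then have "x \<notin> tsupp f" "x + t *\<^sub>R axis j 1 \<notin> tsupp f"
        using not_in_nbhd1[of x "tsupp f" "t *\<^sub>R axis j 1"] t by (auto simp: norm_axis_1)
      then show "(f (x + t *\<^sub>R axis j 1) - f x) / t - pd j f x = 0"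
        by (simp add: not_in_tsupp pd_0_outside)
    qed (rule C(2)[OF t(1)])
    moreover have "(\<integral>x. f (x + t *\<^sub>R axis j 1) \<partial>lborel) = (\<integral>x. f x \<partial>lborel)"
      by (intro integral_shift borel_measurable_test assms)
    ultimately show ?thesis using i by simp
  qed
  have "\<bar>\<integral>x. pd j f x \<partial>lborel\<bar> \<le> 0"
  proof (rule LIMSEQ_le_const)
    show "(\<lambda>n. C * (1 / real (Suc n)) * measure lborel ?S) \<longlonglongrightarrow> 0"
      using LIMSEQ_inverse_real_of_nat
      by (intro tendsto_mult_left_zero tendsto_mult_right_zero) (simp add: inverse_eq_divide)
    show "\<exists>N. \<forall>n\<ge>N. \<bar>\<integral>x. pd j f x \<partial>lborel\<bar> \<le> C * (1 / real (Suc n)) * measure lborel ?S"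
      by (intro exI[of _ 0] allI impI le) auto
  qed
  then show ?thesis by simp
qed

lemma integral_by_parts:
  assumes "test f" "test g"
  shows "(\<integral>x. f x * pd j g x \<partial>lborel) = - (\<integral>x. pd j f x * g x \<partial>lborel)"
proof -
  have fg: "test (\<lambda>x. f x * g x)" using assms by (intro test_on_mult_smooth test_smooth)
  have i: "integrable lborel (\<lambda>x. pd j f x * g x)" "integrable lborel (\<lambda>x. f x * pd j g x)"
    using assms by (auto intro!: integrable_test_mult test_continuous test_on_pd)
  have "0 = (\<integral>x. pd j f x * g x + f x * pd j g x \<partial>lborel)"
    using integral_pd_eq_0[OF fg, of j] assms by (simp add: pd_mult' test_smooth)
  also have "\<dots> = (\<integral>x. pd j f x * g x \<partial>lborel) + (\<integral>x. f x * pd j g x \<partial>lborel)" using i by simp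
  finally show ?thesis by simp
qed

subsection \<open>Functionals bounded in the first Sobolev norm\<close>

text \<open>An admissible constant is carried along instead of the supremum \<open>Hm1norm\<close>.
  Estimates then compose without a separate proof that the supremum is taken over a bounded
  set.\<close>

definition HB :: "distr \<Rightarrow> real \<Rightarrow> bool" where
  "HB u M \<longleftrightarrow> lin_test u \<and> M \<ge> 0 \<and> (\<forall>\<phi>. test \<phi> \<longrightarrow> \<bar>u \<phi>\<bar> \<le> M * h1n \<phi>)"

lemma HB_lin: "HB u M \<Longrightarrow> lin_test u" and HB_nonneg: "HB u M \<Longrightarrow> M \<ge> 0"
  and HB_bound: "HB u M \<Longrightarrow> test \<phi> \<Longrightarrow> \<bar>u \<phi>\<bar> \<le> M * h1n \<phi>"
  by (auto simp: HB_def)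

lemma lin_test_comb: "lin_test u \<Longrightarrow> test \<phi> \<Longrightarrow> test \<psi> \<Longrightarrow> u (\<lambda>x. a * \<phi> x + b * \<psi> x) = a * u \<phi> + b * u \<psi>"
  unfolding lin_test_def by blast

lemma lin_test_add: "lin_test u \<Longrightarrow> test \<phi> \<Longrightarrow> test \<psi> \<Longrightarrow> u (\<lambda>x. \<phi> x + \<psi> x) = u \<phi> + u \<psi>"
  using lin_test_comb[of u \<phi> \<psi> 1 1] by simp

lemma lin_test_diff: "lin_test u \<Longrightarrow> test \<phi> \<Longrightarrow> test \<psi> \<Longrightarrow> u (\<lambda>x. \<phi> x - \<psi> x) = u \<phi> - u \<psi>"
  using lin_test_comb[of u \<phi> \<psi> 1 "-1"] by simp

lemma lin_test_cmult: "lin_test u \<Longrightarrow> test \<phi> \<Longrightarrow> u (\<lambda>x. c * \<phi> x) = c * u \<phi>"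
  using lin_test_comb[of u \<phi> \<phi> c 0] by simp

lemma lin_test_0: "lin_test u \<Longrightarrow> u (\<lambda>x. 0) = 0"
  using lin_test_cmult[of u "\<lambda>x. 0" 0] test_on_0 by simp

lemma lin_test_uminus: "lin_test u \<Longrightarrow> test \<phi> \<Longrightarrow> u (\<lambda>x. - \<phi> x) = - u \<phi>"
  using lin_test_cmult[of u \<phi> "-1"] by simp

lemma lin_test_sum: "lin_test u \<Longrightarrow> (\<And>i. i \<in> I \<Longrightarrow> test (\<phi> i)) \<Longrightarrow> u (\<lambda>x. \<Sum>i\<in>I. \<phi> i x) = (\<Sum>i\<in>I. u (\<phi> i))"
  by (induction I rule: infinite_finite_induct)
    (auto simp: lin_test_0 test_on_sum intro: lin_test_add[THEN trans])

lemma HB_comb: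
  assumes "HB u M" "HB v N" shows "HB (\<lambda>\<phi>. a * u \<phi> + b * v \<phi>) (\<bar>a\<bar> * M + \<bar>b\<bar> * N)"
proof -
  have "\<bar>a * u \<phi> + b * v \<phi>\<bar> \<le> (\<bar>a\<bar> * M + \<bar>b\<bar> * N) * h1n \<phi>" if "test \<phi>" for \<phi>
  proof -
    have "\<bar>a * u \<phi> + b * v \<phi>\<bar> \<le> \<bar>a\<bar> * \<bar>u \<phi>\<bar> + \<bar>b\<bar> * \<bar>v \<phi>\<bar>"
      by (simp add: abs_mult[symmetric])
    also have "\<dots> \<le> \<bar>a\<bar> * (M * h1n \<phi>) + \<bar>b\<bar> * (N * h1n \<phi>)"
      using assms that by (intro add_mono mult_left_mono HB_bound) auto
    finally show ?thesis by (simp add: algebra_simps)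
  qed
  moreover have "lin_test (\<lambda>\<phi>. a * u \<phi> + b * v \<phi>)"
    unfolding lin_test_def using assms[THEN HB_lin] by (simp add: lin_test_comb algebra_simps)
  ultimately show ?thesis using assms by (auto simp: HB_def)
qed

lemma HB_diff: "HB u M \<Longrightarrow> HB v N \<Longrightarrow> HB (\<lambda>\<phi>. u \<phi> - v \<phi>) (M + N)"
  using HB_comb[of u M v N 1 "-1"] by simp

lemma HB_add: "HB u M \<Longrightarrow> HB v N \<Longrightarrow> HB (\<lambda>\<phi>. u \<phi> + v \<phi>) (M + N)"
  using HB_comb[of u M v N 1 1] by simp

lemma HB_cmult: "HB u M \<Longrightarrow> HB (\<lambda>\<phi>. c * u \<phi>) (\<bar>c\<bar> * M)"
  using HB_comb[of u M u M c 0] by simp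

lemma HB_0: "HB (\<lambda>\<phi>. 0) 0"
  by (auto simp: HB_def lin_test_def)

lemma HB_sum: "(\<And>i. i \<in> I \<Longrightarrow> HB (u i) (M i)) \<Longrightarrow> HB (\<lambda>\<phi>. \<Sum>i\<in>I. u i \<phi>) (\<Sum>i\<in>I. M i)"
  by (induction I rule: infinite_finite_induct) (auto simp: HB_0 HB_add)

lemma HB_mono: "HB u M \<Longrightarrow> M \<le> N \<Longrightarrow> HB u N"
  unfolding HB_def by (meson order_trans mult_right_mono h1n_nonneg)

lemma fd_lin: "L2 f \<Longrightarrow> lin_test (fd f)"
  unfolding lin_test_def fd_def
  by (auto simp: algebra_simps L2_mult_integrable L2_test intro!: trans[OF Bochner_Integration.integral_add])

lemma HB_fd: "L2 f \<Longrightarrow> HB (fd f) (L2n f)"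
  unfolding HB_def
proof (intro conjI allI impI)
  fix \<phi> assume f: "L2 f" and \<phi>: "test \<phi>"
  have "\<bar>fd f \<phi>\<bar> \<le> L2n f * L2n \<phi>" unfolding fd_def by (rule L2_CS[OF f L2_test[OF \<phi>]])
  also have "\<dots> \<le> L2n f * h1n \<phi>" by (intro mult_left_mono L2n_le_h1n L2n_nonneg)
  finally show "\<bar>fd f \<phi>\<bar> \<le> L2n f * h1n \<phi>" .
qed (auto simp: fd_lin L2n_nonneg)

text \<open>By the Leibniz rule multiplication by \<eta> is bounded in \<open>h1n\<close>, and the
  bound passes to functionals by duality. The constant is fixed before \<open>u\<close> and
  \<open>M\<close>, which makes the localised estimates uniform in \<open>g\<close>.\<close>

lemma HB_mult_test:
  assumes "test \<eta>"
  obtains C where "C \<ge> 0" "\<And>u M. HB u M \<Longrightarrow> HB (\<lambda>\<phi>. u (\<lambda>x. \<eta> x * \<phi> x)) (C * M)"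
proof -
  have "\<exists>B\<ge>0. \<forall>x. \<bar>pd j \<eta> x\<bar> \<le> B" for j using test_bounded[OF test_on_pd[OF assms]] by metis
  then obtain B where B: "\<And>j. B j \<ge> 0" "\<And>j x. \<bar>pd j \<eta> x\<bar> \<le> B j" by metis
  obtain A where A: "A \<ge> 0" "\<And>x. \<bar>\<eta> x\<bar> \<le> A" using test_bounded[OF assms] by blast
  have mul: "L2n (\<lambda>x. f x * g x) \<le> D * L2n g" if "test f" "test g" "\<And>x. \<bar>f x\<bar> \<le> D" "D \<ge> 0" for f g D
  proof (rule power2_le_imp_le)
    have "(L2n (\<lambda>x. f x * g x))\<^sup>2 \<le> (\<integral>x. D\<^sup>2 * (g x)\<^sup>2 \<partial>lborel)"
      unfolding L2n_sq
    proof (rule integral_mono)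
      show "integrable lborel (\<lambda>x. (f x * g x)\<^sup>2)"
        using L2_test[OF test_on_mult_smooth[OF that(2) test_smooth[OF that(1)]]] by (simp add: L2_def)
      show "integrable lborel (\<lambda>x. D\<^sup>2 * (g x)\<^sup>2)" using L2_test[OF that(2)] by (simp add: L2_def)
      show "(f x * g x)\<^sup>2 \<le> D\<^sup>2 * (g x)\<^sup>2" for x
        unfolding power_mult_distrib using power_mono[OF that(3)[of x], of 2] by (intro mult_right_mono) auto
    qed
    then show "(L2n (\<lambda>x. f x * g x))\<^sup>2 \<le> (D * L2n g)\<^sup>2" by (simp add: power_mult_distrib L2n_sq)
  qed (use that in \<open>simp add: L2n_nonneg\<close>)
  let ?E = "A + (\<Sum>j\<in>UNIV. B j)"
  have Bs: "B j \<le> (\<Sum>j\<in>UNIV. B j)" for j by (rule member_le_sum) (use B in auto)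
  have Bs0: "(\<Sum>j\<in>UNIV. B j) \<ge> 0" by (simp add: sum_nonneg B)
  have h: "h1n (\<lambda>x. \<eta> x * \<phi> x) \<le> 2 * ?E * h1n \<phi>" if \<phi>: "test \<phi>" for \<phi>
  proof -
    have "L2n (\<lambda>x. \<eta> x * \<phi> x) \<le> ?E * h1n \<phi>"
      using A(1) Bs0 by (intro order_trans[OF mul[OF assms \<phi> A(2,1)]] mult_mono L2n_le_h1n L2n_nonneg) auto
    moreover have "L2n (pd j (\<lambda>x. \<eta> x * \<phi> x)) \<le> ?E * h1n \<phi>" for j
    proof -
      have "L2n (pd j (\<lambda>x. \<eta> x * \<phi> x)) = L2n (\<lambda>x. pd j \<eta> x * \<phi> x + \<eta> x * pd j \<phi> x)"
        using assms \<phi> by (simp add: pd_mult' test_smooth)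
      also have "\<dots> \<le> L2n (\<lambda>x. pd j \<eta> x * \<phi> x) + L2n (\<lambda>x. \<eta> x * pd j \<phi> x)"
        using test_on_mult_smooth[OF \<phi> test_smooth[OF test_on_pd[OF assms]], of j]
            test_on_mult_smooth[OF test_on_pd[OF \<phi>] test_smooth[OF assms], of j]
        by (intro L2n_triangle L2_test)
      also have "\<dots> \<le> B j * L2n \<phi> + A * L2n (pd j \<phi>)"
        by (intro add_mono mul test_on_pd assms \<phi> A B)
      also have "\<dots> \<le> (\<Sum>j\<in>UNIV. B j) * h1n \<phi> + A * h1n \<phi>"
        by (intro add_mono mult_mono Bs Bs0 L2n_le_h1n L2n_pd_le_h1n A L2n_nonneg order_refl)
      finally show ?thesis by (simp add: algebra_simps)
    qed
    ultimately show ?thesis using h1n_le by (metis mult.assoc)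
  qed
  show thesis
  proof (rule that[of "2 * ?E"])
    show "2 * ?E \<ge> 0" using A Bs0 by simp
    fix u M assume u: "HB u M"
    have "lin_test (\<lambda>\<phi>. u (\<lambda>x. \<eta> x * \<phi> x))"
      unfolding lin_test_def
    proof (intro allI impI)
      fix \<phi> \<psi> a b assume t: "test \<phi>" "test \<psi>"
      have "(\<lambda>x. \<eta> x * (a * \<phi> x + b * \<psi> x)) = (\<lambda>x. a * (\<eta> x * \<phi> x) + b * (\<eta> x * \<psi> x))"
        by (auto simp: algebra_simps)
      then show "u (\<lambda>x. \<eta> x * (a * \<phi> x + b * \<psi> x)) = a * u (\<lambda>x. \<eta> x * \<phi> x) + b * u (\<lambda>x. \<eta> x * \<psi> x)"
        using t assms by (simp add: lin_test_comb[OF HB_lin[OF u]] test_on_mult_smooth test_smooth)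
    qed
    moreover have "\<bar>u (\<lambda>x. \<eta> x * \<phi> x)\<bar> \<le> 2 * ?E * M * h1n \<phi>" if \<phi>: "test \<phi>" for \<phi>
    proof -
      have "\<bar>u (\<lambda>x. \<eta> x * \<phi> x)\<bar> \<le> M * h1n (\<lambda>x. \<eta> x * \<phi> x)"
        by (intro HB_bound[OF u] test_on_mult_smooth \<phi> test_smooth[OF assms])
      also have "\<dots> \<le> M * (2 * ?E * h1n \<phi>)" by (intro mult_left_mono h \<phi> HB_nonneg[OF u])
      finally show ?thesis by (simp add: mult_ac)
    qed
    ultimately show "HB (\<lambda>\<phi>. u (\<lambda>x. \<eta> x * \<phi> x)) (2 * ?E * M)"
      unfolding HB_def using HB_nonneg[OF u] \<open>2 * ?E \<ge> 0\<close> by auto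
  qed
qed

subsection \<open>Density of test functions in the dual of the first Sobolev space\<close>

definition ip1 :: "(R3 \<Rightarrow> real) \<Rightarrow> (R3 \<Rightarrow> real) \<Rightarrow> real" where
  "ip1 f g = (\<integral>x. f x * g x \<partial>lborel) + (\<Sum>j\<in>UNIV. \<integral>x. pd j f x * pd j g x \<partial>lborel)"

lemma h1n_expand:
  assumes "test f" "test g"
  shows "(h1n (\<lambda>x. t * f x + g x))\<^sup>2 = (h1n f)\<^sup>2 * t\<^sup>2 + 2 * ip1 f g * t + (h1n g)\<^sup>2"
proof -
  have "pd j (\<lambda>x. t * f x + g x) = (\<lambda>x. t * pd j f x + pd j g x)" for j
    using assms by (simp add: pd_add' pd_cmult' test_on_cmult)
  then have "(h1n (\<lambda>x. t * f x + g x))\<^sup>2 = ((L2n f)\<^sup>2 * t\<^sup>2 + 2 * (\<integral>x. f x * g x \<partial>lborel) * t + (L2n g)\<^sup>2) +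
     (\<Sum>j\<in>UNIV. (L2n (pd j f))\<^sup>2 * t\<^sup>2 + 2 * (\<integral>x. pd j f x * pd j g x \<partial>lborel) * t + (L2n (pd j g))\<^sup>2)"
    using assms L2_expand[OF L2_test L2_test, of f g t] L2_expand[OF L2_test L2_test, of "pd _ f" "pd _ g" t]
    unfolding h1n_sq by (simp add: test_on_pd L2n_sq[of "\<lambda>x. t * _ x + _ x"])
  then show ?thesis
    by (simp add: ip1_def h1n_sq sum.distrib sum_distrib_left sum_distrib_right algebra_simps)
qed

lemma ip1_CS: assumes "test f" "test g" shows "\<bar>ip1 f g\<bar> \<le> h1n f * h1n g"
proof -
  have "(ip1 f g)\<^sup>2 \<le> (h1n f)\<^sup>2 * (h1n g)\<^sup>2"
    by (rule quadratic_nonneg_imp) (auto simp flip: h1n_expand[OF assms])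
  then have "\<bar>ip1 f g\<bar>\<^sup>2 \<le> (h1n f * h1n g)\<^sup>2" by (simp add: power_mult_distrib)
  then show ?thesis by (rule power2_le_imp_le) (simp add: h1n_nonneg)
qed

lemma ip1_self: "ip1 f f = (h1n f)\<^sup>2"
  by (simp add: ip1_def h1n_sq L2n_sq_mult)

text \<open>Integration by parts shows that a functional whose Riesz representative is a test
  function is itself given by a test function, namely f minus its Laplacian. This is the source of
  the dense family.\<close>

lemma ip1_fd:
  assumes "test f" "test g"
  shows "ip1 f g = fd (\<lambda>x. f x - (\<Sum>j\<in>UNIV. pd j (pd j f) x)) g"
proof -
  have i: "integrable lborel (\<lambda>x. pd j (pd j f) x * g x)" "integrable lborel (\<lambda>x. f x * g x)" for j
    using assms by (auto intro!: integrable_test_mult test_continuous test_on_pd)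
  have "(\<integral>x. pd j f x * pd j g x \<partial>lborel) = - (\<integral>x. pd j (pd j f) x * g x \<partial>lborel)" for j
    using assms by (intro integral_by_parts test_on_pd)
  then show ?thesis using i
    by (simp add: ip1_def fd_def left_diff_distrib sum_distrib_right sum_negf)
qed

lemma h1n_cmult: "test f \<Longrightarrow> h1n (\<lambda>x. c * f x) = \<bar>c\<bar> * h1n f"
proof -
  assume f: "test f"
  have "(h1n (\<lambda>x. c * f x))\<^sup>2 = (\<bar>c\<bar> * h1n f)\<^sup>2"
    using f by (simp add: h1n_sq L2n_cmult pd_cmult' power_mult_distrib sum_distrib_left algebra_simps)
  then show ?thesis by (simp add: h1n_nonneg)
qed

lemma nonzero_test: obtains \<phi> where "test \<phi>" "\<phi> \<noteq> (\<lambda>_. 0)"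
proof -
  obtain F where F: "smooth1 F" "\<And>x. x \<le> 0 \<Longrightarrow> F x = 0" "\<And>x. x \<ge> 1 \<Longrightarrow> F x = (1::real)"
    using smooth_step by metis
  define \<phi> where "\<phi> x = F (2 + (-1) * (\<Sum>i\<in>UNIV. x $ i * x $ i))" for x :: R3
  have "test \<phi>"
  proof (rule test_onI[of _ "cball 0 2"])
    show "smooth_fun \<phi>" unfolding \<phi>_def
      by (intro smooth_fun_compose1[OF F(1)] smooth_fun_add smooth_fun_const smooth_fun_cmult smooth_fun_sum
          smooth_fun_mult smooth_fun_nth)
    fix x :: R3 assume "x \<notin> cball 0 2"
    then have "norm x > 2" by simp
    then have "(norm x)\<^sup>2 > 2\<^sup>2" by (intro power_strict_mono) auto
    moreover have "(\<Sum>i\<in>UNIV. x $ i * x $ i) = (norm x)\<^sup>2"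
      unfolding power2_norm_eq_inner inner_vec_def by simp
    ultimately show "\<phi> x = 0" unfolding \<phi>_def by (intro F(2)) simp
  qed auto
  moreover have "\<phi> 0 = 1" unfolding \<phi>_def by (rule F(3)) simp
  ultimately show thesis using that[of \<phi>] by fastforce
qed

text \<open>\<open>N\<close> is the optimal constant. Test functions are not complete in
  \<open>h1n\<close>, so a maximiser cannot be expected and a nearly maximising unit vector takes
  its place.\<close>

lemma almost_norming:
  assumes u: "HB u M"
  obtains N where "HB u N" "\<And>\<delta>. N > 0 \<Longrightarrow> \<delta> > 0 \<Longrightarrow> \<exists>\<phi>. test \<phi> \<and> h1n \<phi> = 1 \<and> u \<phi> \<ge> N - \<delta>"
proof -
  let ?T = "{\<phi>. test \<phi> \<and> \<phi> \<noteq> (\<lambda>_. 0)}"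
  define N where "N = (SUP \<phi>\<in>?T. \<bar>u \<phi>\<bar> / h1n \<phi>)"
  have bdd: "bdd_above ((\<lambda>\<phi>. \<bar>u \<phi>\<bar> / h1n \<phi>) ` ?T)"
    by (rule bdd_aboveI2[of _ _ M]) (use HB_bound[OF u] h1n_pos in \<open>auto simp: divide_le_eq\<close>)
  have ne: "?T \<noteq> {}" using nonzero_test by auto
  have N: "\<bar>u \<phi>\<bar> \<le> N * h1n \<phi>" if "test \<phi>" for \<phi>
  proof (cases "\<phi> = (\<lambda>_. 0)")
    case True then show ?thesis using lin_test_0[OF HB_lin[OF u]] by (simp add: h1n_def L2n_0 pd_const)
  next
    case False
    have "\<bar>u \<phi>\<bar> / h1n \<phi> \<le> N" unfolding N_def by (rule cSUP_upper[OF _ bdd]) (use that False in auto)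
    then show ?thesis using h1n_pos[OF that False] by (simp add: divide_le_eq)
  qed
  have N0: "N \<ge> 0"
  proof -
    obtain \<phi> where \<phi>: "test \<phi>" "\<phi> \<noteq> (\<lambda>_. 0)" using nonzero_test by blast
    with N[OF \<phi>(1)] h1n_pos[OF \<phi>] show ?thesis by (metis abs_ge_zero order_trans zero_le_mult_iff less_le_not_le)
  qed
  show thesis
  proof (rule that)
    show "HB u N" using u N N0 by (auto simp: HB_def)
    fix \<delta> :: real assume "\<delta> > 0"
    then have "N - \<delta> < N" by simp
    then obtain \<phi> where \<phi>: "test \<phi>" "\<phi> \<noteq> (\<lambda>_. 0)" "N - \<delta> < \<bar>u \<phi>\<bar> / h1n \<phi>"
      unfolding N_def using less_cSUP_iff[OF ne bdd] by auto
    define c where "c = sgn (u \<phi>) / h1n \<phi>"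
    note p = h1n_pos[OF \<phi>(1,2)]
    \<comment> \<open>The scalar \<open>c\<close> normalises and corrects the sign. If
      \<open>u\<close> vanishes at \<phi> then \<open>sgn\<close> would annihilate the vector, but
      in that case N - \<delta> is negative and plain normalisation is enough.\<close>
    show "\<exists>\<phi>. test \<phi> \<and> h1n \<phi> = 1 \<and> u \<phi> \<ge> N - \<delta>"
    proof (cases "u \<phi> = 0")
      case True
      then have "N - \<delta> < 0" using \<phi> by simp
      then have "N - \<delta> \<le> u (\<lambda>x. 1 / h1n \<phi> * \<phi> x)" using True \<phi> lin_test_cmult[OF HB_lin[OF u] \<phi>(1), of "1 / h1n \<phi>"] by simp
      moreover have "h1n (\<lambda>x. 1 / h1n \<phi> * \<phi> x) = 1" unfolding h1n_cmult[OF \<phi>(1)] using p by simp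
      ultimately show ?thesis using test_on_cmult[OF \<phi>(1)] by blast
    next
      case False
      have "u (\<lambda>x. c * \<phi> x) = c * u \<phi>" by (rule lin_test_cmult[OF HB_lin[OF u] \<phi>(1)])
      also have "\<dots> = \<bar>u \<phi>\<bar> / h1n \<phi>" by (simp add: c_def abs_sgn mult.commute)
      finally have "u (\<lambda>x. c * \<phi> x) \<ge> N - \<delta>" using \<phi>(3) by simp
      moreover have "h1n (\<lambda>x. c * \<phi> x) = 1" using p False unfolding h1n_cmult[OF \<phi>(1)] c_def by (simp add: abs_sgn_eq)
      ultimately show ?thesis using test_on_cmult[OF \<phi>(1)] by blast
    qed
  qed
qed

text \<open>If \<open>\<phi>\<close> is a unit vector at which \<open>u\<close> nearly attains its norm \<open>N\<close>, then \<open>u\<close> is small on the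
  orthogonal complement of \<open>\<phi>\<close>; hence \<open>u\<close> is close to \<open>N\<close> times the functional represented by \<open>\<phi>\<close>, which
  is integration against \<open>\<phi> - \<Delta>\<phi>\<close>.\<close>
lemma HB_dense:
  assumes u: "HB u M" and "e > 0"
  obtains f where "test f" "HB (\<lambda>\<phi>. u \<phi> - fd f \<phi>) e"
proof -
  obtain N where N: "HB u N" and near: "\<And>\<delta>. N > 0 \<Longrightarrow> \<delta> > 0 \<Longrightarrow> \<exists>\<phi>. test \<phi> \<and> h1n \<phi> = 1 \<and> u \<phi> \<ge> N - \<delta>"
    using almost_norming[OF u] by blast
  note lin = HB_lin[OF u]
  show thesis
  proof (cases "N = 0")
    case True
    have "HB (\<lambda>\<phi>. u \<phi> - fd (\<lambda>x. 0) \<phi>) e" 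
      by (rule HB_mono[of _ "N + L2n (\<lambda>x. 0)"], rule HB_diff[OF N HB_fd]) (use True \<open>e > 0\<close> in \<open>auto simp: L2_0 L2n_0\<close>)
    then show thesis using that test_on_0 by blast
  next
    case False
    then have Np: "N > 0" using HB_nonneg[OF N] by simp
    define s where "s = min 1 (e / (2 * N))"
    have s: "s > 0" "s \<le> 1" "N * s \<le> e / 2" using Np \<open>e > 0\<close> by (auto simp: s_def min_def field_simps)
    \<comment> \<open>Adding to \<phi> an orthogonal vector of norm s raises the norm from 1 to at
      most 1 + s^2/2. With a defect of N s^2/2 in the value at \<phi>, the orthogonal vector can
      contribute at most N s^2 to \<open>u\<close>, that is, N s per unit of norm.\<close>
    define \<delta> where "\<delta> = N * s\<^sup>2 / 2"
    have \<delta>: "\<delta> > 0" using Np s by (simp add: \<delta>_def)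
    obtain \<phi> where \<phi>: "test \<phi>" "h1n \<phi> = 1" "u \<phi> \<ge> N - \<delta>" using near[OF Np \<delta>] by blast
    have u\<phi>: "u \<phi> \<le> N" using HB_bound[OF N \<phi>(1)] \<phi>(2) by simp
    have orth: "u \<theta> \<le> N * s * h1n \<theta>" if \<theta>: "test \<theta>" "ip1 \<phi> \<theta> = 0" for \<theta>
    proof (cases "h1n \<theta> = 0")
      case True then show ?thesis using HB_bound[OF N \<theta>(1)] by simp
    next
      case False
      then have hp: "h1n \<theta> > 0" using h1n_nonneg[of \<theta>] by simp
      define t where "t = s / h1n \<theta>"
      have t: "t > 0" using s hp by (simp add: t_def)
      have ip: "ip1 \<theta> \<phi> = 0" using \<theta>(2) by (simp add: ip1_def mult.commute)
      have "(h1n (\<lambda>x. t * \<theta> x + \<phi> x))\<^sup>2 = (h1n \<theta>)\<^sup>2 * t\<^sup>2 + 1"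
        using h1n_expand[OF \<theta>(1) \<phi>(1), of t] ip \<phi>(2) by simp
      also have "\<dots> = s\<^sup>2 + 1" using hp by (simp add: t_def power_divide)
      also have "\<dots> \<le> (1 + s\<^sup>2 / 2)\<^sup>2" by (simp add: power2_sum)
      finally have "h1n (\<lambda>x. t * \<theta> x + \<phi> x) \<le> 1 + s\<^sup>2 / 2" by (rule power2_le_imp_le) simp
      then have "N * h1n (\<lambda>x. t * \<theta> x + \<phi> x) \<le> N * (1 + s\<^sup>2 / 2)" using Np by simp
      moreover have "u (\<lambda>x. t * \<theta> x + \<phi> x) \<le> N * h1n (\<lambda>x. t * \<theta> x + \<phi> x)"
        using HB_bound[OF N test_on_add[OF test_on_cmult[OF \<theta>(1)] \<phi>(1)], of t] by simp
      moreover have "u (\<lambda>x. t * \<theta> x + \<phi> x) = t * u \<theta> + u \<phi>"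
        using lin_test_comb[OF lin \<theta>(1) \<phi>(1), of t 1] by simp
      ultimately have "t * u \<theta> \<le> N * s\<^sup>2" using \<phi>(3) by (simp add: \<delta>_def algebra_simps)
      then have "u \<theta> * s \<le> (N * s * h1n \<theta>) * s" using hp by (simp add: t_def field_simps power2_eq_square)
      then show ?thesis using s(1) mult_le_cancel_right_pos[of s "u \<theta>" "N * s * h1n \<theta>"] by blast
    qed
    define f where "f x = N * (\<phi> x - (\<Sum>j\<in>UNIV. pd j (pd j \<phi>) x))" for x
    have f: "test f" unfolding f_def
      by (intro test_on_cmult test_on_diff test_on_sum test_on_pd \<phi>(1))
    have ff: "fd f \<psi> = N * ip1 \<phi> \<psi>" if "test \<psi>" for \<psi>
      unfolding ip1_fd[OF \<phi>(1) that] by (simp add: f_def fd_def mult.assoc)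
    have bd: "u \<psi> - fd f \<psi> \<le> e * h1n \<psi>" if \<psi>: "test \<psi>" for \<psi>
    proof -
      define c where "c = ip1 \<phi> \<psi>"
      have c: "\<bar>c\<bar> \<le> h1n \<psi>" using ip1_CS[OF \<phi>(1) \<psi>] \<phi>(2) by (simp add: c_def)
      define \<theta> where "\<theta> x = (- c) * \<phi> x + \<psi> x" for x
      have \<theta>: "test \<theta>" unfolding \<theta>_def by (intro test_on_add test_on_cmult \<phi>(1) \<psi>)
      have "(h1n \<theta>)\<^sup>2 = (h1n \<psi>)\<^sup>2 - c\<^sup>2" unfolding \<theta>_def h1n_expand[OF \<phi>(1) \<psi>]
        by (simp add: \<phi>(2) c_def power2_eq_square)
      then have "(h1n \<theta>)\<^sup>2 \<le> (h1n \<psi>)\<^sup>2" by simp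
      then have h\<theta>: "h1n \<theta> \<le> h1n \<psi>" by (rule power2_le_imp_le) (rule h1n_nonneg)
      have "ip1 \<phi> \<theta> = (- c) * ip1 \<phi> \<phi> + ip1 \<phi> \<psi>"
        unfolding ip1_fd[OF \<phi>(1) \<theta>] ip1_fd[OF \<phi>(1) \<phi>(1)] ip1_fd[OF \<phi>(1) \<psi>] \<theta>_def
        using lin_test_comb[OF fd_lin[OF L2_test] \<phi>(1) \<psi>, of "\<lambda>x. \<phi> x - (\<Sum>j\<in>UNIV. pd j (pd j \<phi>) x)" "- c" 1]
        by (simp add: test_on_diff test_on_sum test_on_pd \<phi>(1))
      then have ip: "ip1 \<phi> \<theta> = 0" by (simp add: ip1_self \<phi>(2) c_def)
      have "u \<theta> = (- c) * u \<phi> + u \<psi>" unfolding \<theta>_def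
        using lin_test_comb[OF lin \<phi>(1) \<psi>, of "- c" 1] by simp
      then have "u \<psi> - fd f \<psi> = u \<theta> + c * (u \<phi> - N)" using ff[OF \<psi>] by (simp add: c_def algebra_simps)
      also have "\<dots> \<le> N * s * h1n \<theta> + \<bar>c\<bar> * \<bar>u \<phi> - N\<bar>"
        using orth[OF \<theta> ip] abs_ge_self[of "c * (u \<phi> - N)"] by (simp add: abs_mult)
      also have "\<dots> \<le> N * s * h1n \<psi> + h1n \<psi> * \<delta>"
        by (intro add_mono mult_left_mono mult_mono h\<theta> c) (use Np s \<phi>(3) u\<phi> in \<open>auto simp: h1n_nonneg\<close>)
      also have "\<dots> = (N * s + (N * s) * s / 2) * h1n \<psi>" by (simp add: \<delta>_def power2_eq_square algebra_simps)
      also have "\<dots> \<le> e * h1n \<psi>"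
      proof (intro mult_right_mono h1n_nonneg)
        have "(N * s) * s \<le> N * s" using s Np by (simp add: mult_left_le)
        then show "N * s + (N * s) * s / 2 \<le> e" using s(3) \<open>e > 0\<close> by simp
      qed
      finally show ?thesis .
    qed
    have lin2: "lin_test (\<lambda>\<phi>. u \<phi> - fd f \<phi>)" using HB_lin[OF HB_diff[OF u HB_fd[OF L2_test[OF f]]]] .
    have "\<bar>u \<psi> - fd f \<psi>\<bar> \<le> e * h1n \<psi>" if \<psi>: "test \<psi>" for \<psi>
      using bd[OF \<psi>] bd[OF test_on_uminus[OF \<psi>]] lin_test_uminus[OF lin2 \<psi>] h1n_cmult[OF \<psi>, of "-1"]
      by (simp add: abs_le_iff)
    then have "HB (\<lambda>\<phi>. u \<phi> - fd f \<phi>) e" using lin2 \<open>e > 0\<close> by (simp add: HB_def)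
    with f that show thesis by blast
  qed
qed

section \<open>Convolution of a functional with a test function\<close>

definition conv :: "distr \<Rightarrow> (R3 \<Rightarrow> real) \<Rightarrow> R3 \<Rightarrow> real" where
  "conv u k = (\<lambda>x. u (\<lambda>y. k (x - y)))"

abbreviation cv :: "(R3 \<Rightarrow> real) \<Rightarrow> (R3 \<Rightarrow> real) \<Rightarrow> R3 \<Rightarrow> real" where
  "cv f k \<equiv> conv (fd f) k"

text \<open>Convolution with the reflected kernel is the adjoint of convolution with the
  kernel.\<close>

definition refl_fun :: "(R3 \<Rightarrow> real) \<Rightarrow> R3 \<Rightarrow> real" where
  "refl_fun k = (\<lambda>y. k (- y))"

lemma cv_eq: "cv f k x = (\<integral>y. f y * k (x - y) \<partial>lborel)"
  by (simp add: conv_def fd_def)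

lemma L2n_shift_refl: "test f \<Longrightarrow> L2n (\<lambda>y. f (x - y)) = L2n f"
  unfolding L2n_def by (subst integral_shift_refl[of "\<lambda>y. (f y)\<^sup>2"]) (auto intro: borel_measurable_power borel_measurable_test)

lemma h1n_shift_refl: "test f \<Longrightarrow> h1n (\<lambda>y. f (x - y)) = h1n f"
  unfolding h1n_def by (simp add: L2n_shift_refl pd_shift_refl L2n_uminus test_on_pd)

lemma refl_fun_shift: "refl_fun k = (\<lambda>y. k (0 - y))"
  by (simp add: refl_fun_def)

lemma test_refl_fun: "test k \<Longrightarrow> test (refl_fun k)"
  unfolding refl_fun_shift by (rule test_shift_refl)

lemma refl_fun_refl_fun [simp]: "refl_fun (refl_fun k) = k"
  by (simp add: refl_fun_def)

lemma pd_refl_fun: "test k \<Longrightarrow> pd j (refl_fun k) = (\<lambda>x. - refl_fun (pd j k) x)"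
  using pd_shift_refl[of k j 0] by (simp add: refl_fun_def)

text \<open>The Taylor remainder of the kernel is quadratically small in the first Sobolev norm, which is what
  differentiability of \<open>u * k\<close> for a functional \<open>u\<close> bounded in that norm amounts to.\<close>
lemma Taylor_h1n:
  assumes k: "test k"
  obtains C where "C \<ge> 0"
    "\<And>h. norm h \<le> 1 \<Longrightarrow> test (\<lambda>z. k (z + h) - k z - (\<Sum>m\<in>UNIV. h $ m * pd m k z))"
    "\<And>h. norm h \<le> 1 \<Longrightarrow> h1n (\<lambda>z. k (z + h) - k z - (\<Sum>m\<in>UNIV. h $ m * pd m k z)) \<le> C * (norm h)\<^sup>2"
proof -
  define R where "R g h z = g (z + h) - g z - (\<Sum>m\<in>UNIV. h $ m * pd m g z)" for g h and z :: R3
  have sh: "test (\<lambda>z. g (z + h))" if "test g" for g h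
    using test_affine[OF that, of 1 h] by (simp add: add.commute)
  have tR: "test (R g h)" if "test g" for g h
    unfolding R_def[abs_def] using that by (intro test_on_diff sh test_on_sum test_on_cmult test_on_pd)
  have bd: "\<exists>C\<ge>0. \<forall>h. norm h \<le> 1 \<longrightarrow> L2n (R g h) \<le> C * (norm h)\<^sup>2" if g: "test g" for g
  proof -
    obtain C where C: "C \<ge> 0" "\<And>x h. \<bar>g (x + h) - g x - (\<Sum>j\<in>UNIV. (h $ j) * pd j g x)\<bar> \<le> C * (norm h)\<^sup>2"
      using test_Taylor2[OF g] by blast
    let ?S = "nbhd1 (tsupp g)"
    have "L2n (R g h) \<le> (C * (norm h)\<^sup>2) * sqrt (measure lborel ?S)" if h: "norm h \<le> 1" for h
    proof (rule L2n_bound[OF L2_test[OF tR[OF g]] nbhd1_fmeasurable[OF test_compact[OF g]]])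
      fix x assume "x \<notin> ?S"
      then have "x \<notin> tsupp g" "x + h \<notin> tsupp g" using not_in_nbhd1[of x "tsupp g" h] h by auto
      then show "R g h x = 0" by (simp add: R_def not_in_tsupp pd_0_outside)
    qed (use C in \<open>auto simp: R_def\<close>)
    then show ?thesis
      by (intro exI[of _ "C * sqrt (measure lborel ?S)"]) (use C(1) in \<open>auto simp: mult_ac\<close>)
  qed
  obtain A where A: "A \<ge> 0" "\<And>h. norm h \<le> 1 \<Longrightarrow> L2n (R k h) \<le> A * (norm h)\<^sup>2" using bd[OF k] by blast
  have "\<exists>C\<ge>0. \<forall>h. norm h \<le> 1 \<longrightarrow> L2n (R (pd j k) h) \<le> C * (norm h)\<^sup>2" for j
    using bd[OF test_on_pd[OF k]] by blast
  then obtain B where B: "\<And>j. B j \<ge> 0" "\<And>j h. norm h \<le> 1 \<Longrightarrow> L2n (R (pd j k) h) \<le> B j * (norm h)\<^sup>2" by metis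
  have pdR: "pd j (R k h) = R (pd j k) h" for j h
  proof -
    have "pd j (\<lambda>z. k (z + h)) = (\<lambda>z. pd j k (z + h))"
      using pd_affine_test[OF k, of j h 1] by (simp add: add.commute)
    then show ?thesis unfolding R_def[abs_def]
      by (simp add: pd_diff' pd_sum' pd_cmult' test_on_diff test_on_sum test_on_cmult test_on_pd k sh pd_commute[OF k, of j])
  qed
  let ?D = "A + (\<Sum>j\<in>UNIV. B j)"
  have "h1n (R k h) \<le> 2 * (?D * (norm h)\<^sup>2)" if h: "norm h \<le> 1" for h
  proof (rule h1n_le)
    have S: "(\<Sum>j\<in>UNIV. B j) \<ge> 0" by (simp add: sum_nonneg B)
    show "L2n (R k h) \<le> ?D * (norm h)\<^sup>2"
      by (rule order_trans[OF A(2)[OF h]]) (use S in \<open>simp add: mult_right_mono\<close>)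
    fix j
    have "B j \<le> (\<Sum>j\<in>UNIV. B j)" by (rule member_le_sum) (use B in auto)
    then show "L2n (pd j (R k h)) \<le> ?D * (norm h)\<^sup>2"
      unfolding pdR by (intro order_trans[OF B(2)[OF h]]) (use A(1) in \<open>simp add: mult_right_mono\<close>)
  qed
  then have le: "h1n (R k h) \<le> 2 * ?D * (norm h)\<^sup>2" if "norm h \<le> 1" for h using that by (simp only: mult.assoc)
  have eq: "R k h = (\<lambda>z. k (z + h) - k z - (\<Sum>m\<in>UNIV. h $ m * pd m k z))" for h by (simp add: R_def[abs_def])
  show thesis
    by (rule that[of "2 * ?D"]) (use tR[OF k] le A(1) B(1) in \<open>auto simp only: eq[symmetric] intro: sum_nonneg add_nonneg_nonneg mult_nonneg_nonneg\<close>, simp add: sum_nonneg)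
qed

lemma has_derivative_of_quadratic_bound:
  fixes f :: "R3 \<Rightarrow> real"
  assumes "bounded_linear D" "\<And>h. norm h \<le> 1 \<Longrightarrow> \<bar>f (x + h) - f x - D h\<bar> \<le> C * (norm h)\<^sup>2" "C \<ge> 0"
  shows "(f has_derivative D) (at x)"
  unfolding has_derivative_at
proof
  show "(\<lambda>h. norm (f (x + h) - f x - D h) / norm h) \<midarrow>0\<rightarrow> 0"
  proof (rule Lim_null_comparison)
    show "\<forall>\<^sub>F h in at 0. norm (norm (f (x + h) - f x - D h) / norm h) \<le> C * norm h"
      unfolding eventually_at
      by (rule exI[of _ 1]) (use assms(2) in \<open>auto simp: divide_le_eq power2_eq_square mult.assoc\<close>)
    show "((\<lambda>h. C * norm h) \<longlongrightarrow> 0) (at (0::R3))"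
      by (rule tendsto_mult_right_zero, rule tendsto_norm_zero, rule tendsto_ident_at)
  qed
qed (rule assms)

text \<open>The increment of \<open>conv u k\<close> is \<open>u\<close> applied to the increment of
  the reflected and shifted kernel. Shifts and reflections leave \<open>h1n\<close> unchanged, so
  the Taylor bound for the kernel is the required estimate at every x.\<close>

lemma conv_has_derivative:
  assumes u: "HB u M" and k: "test k"
  shows "(conv u k has_derivative (\<lambda>h. \<Sum>m\<in>UNIV. h $ m * conv u (pd m k) x)) (at x)"
proof -
  obtain C where C: "C \<ge> 0"
    "\<And>h. norm h \<le> 1 \<Longrightarrow> test (\<lambda>z. k (z + h) - k z - (\<Sum>m\<in>UNIV. h $ m * pd m k z))"
    "\<And>h. norm h \<le> 1 \<Longrightarrow> h1n (\<lambda>z. k (z + h) - k z - (\<Sum>m\<in>UNIV. h $ m * pd m k z)) \<le> C * (norm h)\<^sup>2"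
    using Taylor_h1n[OF k] by blast
  note lin = HB_lin[OF u]
  show ?thesis
  proof (rule has_derivative_of_quadratic_bound)
    show "bounded_linear (\<lambda>h::R3. \<Sum>m\<in>UNIV. h $ m * conv u (pd m k) x)"
      by (intro bounded_linear_sum bounded_linear_mult_left[THEN bounded_linear_compose] bounded_linear_vec_nth)
    fix h :: R3 assume h: "norm h \<le> 1"
    define r where "r z = k (z + h) - k z - (\<Sum>m\<in>UNIV. h $ m * pd m k z)" for z
    have r: "test r" using C(2)[OF h] by (simp add: r_def[abs_def])
    have t: "test (\<lambda>y. k (x + h - y))" "test (\<lambda>y. k (x - y))" "\<And>m. test (\<lambda>y. pd m k (x - y))"
      by (intro test_shift_refl k test_on_pd)+
    have "(\<lambda>y. r (x - y)) = (\<lambda>y. k (x + h - y) - k (x - y) - (\<Sum>m\<in>UNIV. h $ m * pd m k (x - y)))"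
      by (simp add: r_def algebra_simps)
    then have "u (\<lambda>y. r (x - y)) = conv u k (x + h) - conv u k x - (\<Sum>m\<in>UNIV. h $ m * conv u (pd m k) x)"
      using t by (simp add: conv_def lin_test_diff[OF lin] lin_test_sum[OF lin] lin_test_cmult[OF lin]
          test_on_diff test_on_sum test_on_cmult)
    moreover have "\<bar>u (\<lambda>y. r (x - y))\<bar> \<le> M * h1n r"
      using HB_bound[OF u test_shift_refl[OF r], of x] by (simp add: h1n_shift_refl[OF r])
    moreover have "M * h1n r \<le> M * (C * (norm h)\<^sup>2)"
      using C(3)[OF h] by (intro mult_left_mono HB_nonneg[OF u]) (simp add: r_def[abs_def])
    ultimately show "\<bar>conv u k (x + h) - conv u k x - (\<Sum>m\<in>UNIV. h $ m * conv u (pd m k) x)\<bar> \<le> M * C * (norm h)\<^sup>2"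
      by (simp add: mult.assoc)
  qed (use C(1) HB_nonneg[OF u] in simp)
qed

lemma pd_conv: "HB u M \<Longrightarrow> test k \<Longrightarrow> pd j (conv u k) = conv u (pd j k)"
proof
  fix x assume "HB u M" "test k"
  from pd_eqI[OF conv_has_derivative[OF this], of j x]
  show "pd j (conv u k) x = conv u (pd j k) x" using axis_sum[of 1 j "\<lambda>m. conv u (pd m k) x"] by simp
qed

lemma smooth_conv: "HB u M \<Longrightarrow> test k \<Longrightarrow> smooth_fun (conv u k)"
proof -
  assume u: "HB u M" and k: "test k"
  have "ck n (conv u k)" if "test k" for n k
    using that
  proof (induction n arbitrary: k)
    case 0 then show ?case using conv_has_derivative[OF u] by (auto simp: differentiable_def)
  next
    case (Suc n) then show ?case
      using conv_has_derivative[OF u] by (auto simp: differentiable_def pd_conv[OF u] test_on_pd)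
  qed
  then show ?thesis using k by (simp add: smooth_fun_ck)
qed

text \<open>Supports add under convolution: if x is no sum of a point of \<open>K\<close> and a
  point of the support of \<open>k\<close>, then y -> k (x - y) is supported off
  \<open>K\<close>.\<close>

lemma conv_eq_0:
  assumes u: "HB u M" and s: "supp_in u K" and k: "test k"
    and x: "x \<notin> {a + b |a b. a \<in> K \<and> b \<in> tsupp k}"
  shows "conv u k x = 0"
proof -
  let ?f = "\<lambda>y. k (x - y)"
  have "tsupp ?f \<subseteq> (\<lambda>y. x - y) ` tsupp k"
  proof (rule tsupp_subset)
    show "closed ((\<lambda>y. x - y) ` tsupp k)"
      by (intro compact_imp_closed compact_continuous_image continuous_intros test_compact[OF k])
    fix y assume "y \<notin> (\<lambda>y. x - y) ` tsupp k"
    then have "x - y \<notin> tsupp k" by (metis image_eqI diff_diff_eq2 add_diff_cancel_left')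
    then show "k (x - y) = 0" by (rule not_in_tsupp)
  qed
  moreover have "(\<lambda>y. x - y) ` tsupp k \<subseteq> - K"
  proof
    fix z assume "z \<in> (\<lambda>y. x - y) ` tsupp k"
    then obtain y where "y \<in> tsupp k" "x = z + y" by force
    with x show "z \<in> - K" by blast
  qed
  ultimately have "test_on (- K) ?f" using test_shift_refl[OF k, of x] by (auto simp: test_on_def)
  then show ?thesis using s by (simp add: supp_in_def conv_def)
qed

lemma test_on_conv:
  assumes "HB u M" "supp_in u K" "compact K" "test k" "{a + b |a b. a \<in> K \<and> b \<in> tsupp k} \<subseteq> U"
  shows "test_on U (conv u k)"
  by (rule test_onI[of _ "{a + b |a b. a \<in> K \<and> b \<in> tsupp k}"])
    (use assms in \<open>auto intro!: smooth_conv compact_sums test_compact conv_eq_0\<close>)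

lemma supp_in_fd: "supp_in (fd f) (tsupp f)"
  unfolding supp_in_def
proof (intro allI impI)
  fix \<phi> assume \<phi>: "test_on (- tsupp f) \<phi>"
  have "(\<lambda>x. f x * \<phi> x) = (\<lambda>x. 0)"
  proof
    fix x show "f x * \<phi> x = 0"
      using \<phi> not_in_tsupp[of x f] not_in_tsupp[of x \<phi>] by (auto simp: test_on_def)
  qed
  then show "fd f \<phi> = 0" by (simp add: fd_def)
qed

lemma supp_in_mono: "supp_in u K \<Longrightarrow> K \<subseteq> L \<Longrightarrow> supp_in u L"
  unfolding supp_in_def by (meson Compl_subset_Compl_iff test_on_mono)

lemma test_cv: "test f \<Longrightarrow> test k \<Longrightarrow> test (cv f k)"
  by (rule test_on_conv[OF HB_fd[OF L2_test] supp_in_fd test_compact]) auto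

lemma tsupp_cv: "test f \<Longrightarrow> test k \<Longrightarrow> tsupp (cv f k) \<subseteq> {a + b |a b. a \<in> tsupp f \<and> b \<in> tsupp k}"
  by (rule tsupp_subset)
    (auto intro!: compact_imp_closed compact_sums test_compact conv_eq_0[OF HB_fd[OF L2_test] supp_in_fd])

lemma pd_cv: "test f \<Longrightarrow> test k \<Longrightarrow> pd j (cv f k) = cv f (pd j k)"
  by (rule pd_conv[OF HB_fd[OF L2_test]])

lemma cv_commute: "test f \<Longrightarrow> test k \<Longrightarrow> cv f k = cv k f"
proof
  fix x assume f: "test f" and k: "test k"
  have "(\<lambda>y. f y * k (x - y)) \<in> borel_measurable borel"
    by (intro borel_measurable_times borel_measurable_test f test_shift_refl k)
  from integral_shift_refl[OF this, of x]
  show "cv f k x = cv k f x" by (simp add: cv_eq mult.commute)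
qed

lemma pd_cv_left: "test f \<Longrightarrow> test k \<Longrightarrow> pd j (cv f k) = cv (pd j f) k"
  by (metis cv_commute pd_cv test_on_pd)

text \<open>Fubini's theorem; the double integrand is continuous and vanishes outside a product of
  two compact sets.\<close>

lemma cv_adjoint:
  assumes f: "test f" and k: "test k" and \<psi>: "test \<psi>"
  shows "(\<integral>x. cv f k x * \<psi> x \<partial>lborel) = (\<integral>y. f y * cv \<psi> (refl_fun k) y \<partial>lborel)"
proof -
  let ?F = "\<lambda>(x, y). f y * k (x - y) * \<psi> x"
  have "integrable (lborel \<Otimes>\<^sub>M lborel) ?F"
    unfolding lborel_prod
  proof (rule integrable_cc)
    show "compact (tsupp \<psi> \<times> tsupp f)" by (rule compact_Times[OF test_compact[OF \<psi>] test_compact[OF f]])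
    have "continuous_on UNIV (\<lambda>p. f (snd p) * k (fst p - snd p) * \<psi> (fst p))"
      by (intro continuous_intros continuous_on_compose2[OF test_continuous[OF f, of UNIV]]
          continuous_on_compose2[OF test_continuous[OF k, of UNIV]]
          continuous_on_compose2[OF test_continuous[OF \<psi>, of UNIV]]) auto
    then show "continuous_on UNIV ?F" by (simp add: case_prod_beta)
    fix p assume "p \<notin> tsupp \<psi> \<times> tsupp f"
    then show "?F p = 0" using not_in_tsupp[of "fst p" \<psi>] not_in_tsupp[of "snd p" f]
      by (cases p) auto
  qed
  from lborel_pair.Fubini_integral[OF this]
  have "(\<integral>y. (\<integral>x. f y * k (x - y) * \<psi> x \<partial>lborel) \<partial>lborel) = (\<integral>x. (\<integral>y. f y * k (x - y) * \<psi> x \<partial>lborel) \<partial>lborel)"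
    by simp
  moreover have "(\<integral>y. f y * k (x - y) * \<psi> x \<partial>lborel) = cv f k x * \<psi> x" for x
    by (simp add: cv_eq)
  moreover have "(\<integral>x. f y * k (x - y) * \<psi> x \<partial>lborel) = f y * cv \<psi> (refl_fun k) y" for y
    unfolding cv_eq refl_fun_def by (subst integral_mult_right_zero[symmetric]) (simp add: mult_ac)
  ultimately show ?thesis by (simp only:)
qed

text \<open>Evaluating at x is pairing with y -> h (x - y), so associativity is the adjoint identity
  with this function as \<psi>.\<close>

lemma cv_assoc:
  assumes f: "test f" and g: "test g" and h: "test h"
  shows "cv (cv f g) h = cv f (cv g h)"
proof
  fix x
  have m: "(\<lambda>y. g y * h (x - z - y)) \<in> borel_measurable borel" for z
    by (intro borel_measurable_times borel_measurable_test g test_shift_refl h)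
  have "cv (\<lambda>y. h (x - y)) (refl_fun g) z = cv g h (x - z)" for z
  proof -
    have "cv (\<lambda>y. h (x - y)) (refl_fun g) z = (\<integral>y. g (y + (- z)) * h (x - z - (y + (- z))) \<partial>lborel)"
      by (simp add: cv_eq refl_fun_def mult.commute)
    also have "\<dots> = cv g h (x - z)" unfolding cv_eq by (rule integral_shift[OF m])
    finally show ?thesis .
  qed
  then show "cv (cv f g) h x = cv f (cv g h) x"
    using cv_adjoint[OF f g test_shift_refl[OF h, of x]] by (simp add: cv_eq[of "cv f g"] cv_eq[of f "cv g h"])
qed

lemma conv_comb_kernel:
  assumes "lin_test u" "test k" "test l"
  shows "conv u (\<lambda>x. a * k x + b * l x) = (\<lambda>x. a * conv u k x + b * conv u l x)"
  unfolding conv_def by (intro ext lin_test_comb assms test_shift_refl)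

lemma conv_diff_kernel:
  assumes "lin_test u" "test k" "test l"
  shows "conv u (\<lambda>x. k x - l x) = (\<lambda>x. conv u k x - conv u l x)"
  unfolding conv_def by (intro ext lin_test_diff assms test_shift_refl)

lemma conv_sum_kernel:
  assumes "lin_test u" "\<And>i. i \<in> I \<Longrightarrow> test (k i)"
  shows "conv u (\<lambda>x. \<Sum>i\<in>I. k i x) = (\<lambda>x. \<Sum>i\<in>I. conv u (k i) x)"
  unfolding conv_def by (intro ext lin_test_sum assms test_shift_refl)

text \<open>For functionals given by test functions this is \<open>cv_adjoint\<close>. An
  \<open>HB\<close> error e in \<open>u\<close> changes each side by at most a fixed multiple of e,
  so density of test functions gives the general case.\<close>

lemma conv_adjoint:
  assumes u: "HB u M" and k: "test k" and \<psi>: "test \<psi>"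
  shows "fd (conv u k) \<psi> = u (cv \<psi> (refl_fun k))"
proof -
  define D where "D = fd (conv u k) \<psi> - u (cv \<psi> (refl_fun k))"
  have rk: "test (cv \<psi> (refl_fun k))" by (intro test_cv \<psi> test_refl_fun k)
  define B where "B = h1n k * (\<integral>x. \<bar>\<psi> x\<bar> \<partial>lborel) + h1n (cv \<psi> (refl_fun k))"
  have le: "\<bar>D\<bar> \<le> e * B" if e: "e > 0" for e
  proof -
    obtain f where f: "test f" and uf: "HB (\<lambda>\<phi>. u \<phi> - fd f \<phi>) e" using HB_dense[OF u e] by blast
    have i: "integrable lborel (\<lambda>x. \<psi> x * conv u k x)" "integrable lborel (\<lambda>x. \<psi> x * cv f k x)"
      by (intro integrable_test_mult \<psi> smooth_fun_continuous smooth_conv[OF u k] smooth_conv[OF HB_fd[OF L2_test[OF f]] k])+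
    have pt: "\<bar>conv u k x - cv f k x\<bar> \<le> e * h1n k" for x
      using HB_bound[OF uf test_shift_refl[OF k, of x]] by (simp add: conv_def h1n_shift_refl[OF k])
    have "fd (conv u k) \<psi> - fd (cv f k) \<psi> = (\<integral>x. \<psi> x * (conv u k x - cv f k x) \<partial>lborel)"
      using i by (simp add: fd_def right_diff_distrib mult.commute)
    also have "\<bar>\<dots>\<bar> \<le> (\<integral>x. \<bar>\<psi> x * (conv u k x - cv f k x)\<bar> \<partial>lborel)" by (rule integral_abs_bound)
    also have "\<dots> \<le> (\<integral>x. \<bar>\<psi> x\<bar> * (e * h1n k) \<partial>lborel)"
    proof (rule integral_mono)
      show "integrable lborel (\<lambda>x. \<bar>\<psi> x * (conv u k x - cv f k x)\<bar>)"
        using i by (intro integrable_abs) (simp add: right_diff_distrib)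
      show "integrable lborel (\<lambda>x. \<bar>\<psi> x\<bar> * (e * h1n k))" using integrable_test[OF \<psi>] by simp
    qed (auto simp: abs_mult intro!: mult_left_mono pt)
    finally have 1: "\<bar>fd (conv u k) \<psi> - fd (cv f k) \<psi>\<bar> \<le> e * (h1n k * (\<integral>x. \<bar>\<psi> x\<bar> \<partial>lborel))"
      by (simp add: mult_ac)
    have 2: "fd (cv f k) \<psi> = fd f (cv \<psi> (refl_fun k))"
      using cv_adjoint[OF f k \<psi>] by (simp add: fd_def)
    have 3: "\<bar>u (cv \<psi> (refl_fun k)) - fd f (cv \<psi> (refl_fun k))\<bar> \<le> e * h1n (cv \<psi> (refl_fun k))"
      by (rule HB_bound[OF uf rk])
    show ?thesis using 1 2 3 unfolding D_def B_def by (simp add: distrib_left)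
  qed
  have "\<bar>D\<bar> \<le> 0"
  proof (rule LIMSEQ_le_const)
    show "(\<lambda>n. (1 / real (Suc n)) * B) \<longlonglongrightarrow> 0"
      using LIMSEQ_inverse_real_of_nat by (intro tendsto_mult_left_zero) (simp add: inverse_eq_divide)
    show "\<exists>N. \<forall>n\<ge>N. \<bar>D\<bar> \<le> (1 / real (Suc n)) * B" by (intro exI[of _ 0] allI impI le) simp
  qed
  then show ?thesis by (simp add: D_def)
qed

subsection \<open>Bounds for convolution operators on square integrable functions\<close>

text \<open>A bound for the norm of the convolution operator on square integrable functions. It is
  tested on test functions only, so that with a test kernel every function that occurs is again a
  test function.\<close>

definition OB :: "(R3 \<Rightarrow> real) \<Rightarrow> real \<Rightarrow> bool" where
  "OB k C \<longleftrightarrow> C \<ge> 0 \<and> (\<forall>v. test v \<longrightarrow> L2n (cv v k) \<le> C * L2n v)"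

lemma OB_D: "OB k C \<Longrightarrow> test v \<Longrightarrow> L2n (cv v k) \<le> C * L2n v" and OB_nonneg: "OB k C \<Longrightarrow> C \<ge> 0"
  by (auto simp: OB_def)

lemma OB_mono: "OB k C \<Longrightarrow> C \<le> D \<Longrightarrow> OB k D"
  unfolding OB_def by (meson order_trans mult_right_mono L2n_nonneg)

lemma L2n_sq_le_imp:
  assumes "(L2n f)\<^sup>2 \<le> C * L2n f" "C \<ge> 0" shows "L2n f \<le> C"
proof (cases "L2n f = 0")
  case False
  then have "L2n f > 0" using L2n_nonneg[of f] by simp
  with assms(1) show ?thesis by (simp add: power2_eq_square)
qed (use assms in simp)

text \<open>With w = k * v, the square of the norm of w is the integral of k against the convolution
  of w with the reflected v, and by Cauchy-Schwarz that convolution is bounded pointwise by the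
  product of the two norms. One factor \<open>L2n w\<close> then cancels.\<close>

lemma OB_Young:
  assumes k: "test k" shows "OB k (\<integral>x. \<bar>k x\<bar> \<partial>lborel)"
  unfolding OB_def
proof (intro conjI allI impI)
  show "0 \<le> (\<integral>x. \<bar>k x\<bar> \<partial>lborel)" by simp
  fix v assume v: "test v"
  define w where "w = cv k v"
  have w: "test w" unfolding w_def by (intro test_cv k v)
  have G: "\<bar>cv w (refl_fun v) y\<bar> \<le> L2n w * L2n v" for y
  proof -
    have rv: "test (refl_fun v)" by (rule test_refl_fun[OF v])
    have "\<bar>cv w (refl_fun v) y\<bar> \<le> L2n w * L2n (\<lambda>z. refl_fun v (y - z))"
      unfolding cv_eq by (rule L2_CS) (intro L2_test w test_shift_refl rv)+
    also have "L2n (\<lambda>z. refl_fun v (y - z)) = L2n v"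
      using L2n_shift_refl[OF rv, of y] L2n_shift_refl[OF v, of 0] by (simp add: refl_fun_def)
    finally show ?thesis .
  qed
  have "(L2n w)\<^sup>2 = (\<integral>y. k y * cv w (refl_fun v) y \<partial>lborel)"
    using cv_adjoint[OF k v w] by (simp add: L2n_sq_mult w_def)
  also have "\<dots> \<le> (\<integral>y. \<bar>k y\<bar> * (L2n w * L2n v) \<partial>lborel)"
  proof (rule integral_mono)
    show "integrable lborel (\<lambda>y. k y * cv w (refl_fun v) y)"
      by (intro integrable_test_mult k test_continuous test_cv w test_refl_fun v)
    show "integrable lborel (\<lambda>y. \<bar>k y\<bar> * (L2n w * L2n v))" using integrable_test[OF k] by simp
    show "k y * cv w (refl_fun v) y \<le> \<bar>k y\<bar> * (L2n w * L2n v)" for y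
      using mult_left_mono[OF G[of y], of "\<bar>k y\<bar>"] abs_ge_self[of "k y * cv w (refl_fun v) y"] by (simp add: abs_mult)
  qed
  finally have "(L2n w)\<^sup>2 \<le> ((\<integral>x. \<bar>k x\<bar> \<partial>lborel) * L2n v) * L2n w" by (simp add: mult_ac)
  from L2n_sq_le_imp[OF this] show "L2n (cv v k) \<le> (\<integral>x. \<bar>k x\<bar> \<partial>lborel) * L2n v"
    unfolding cv_commute[OF v k] w_def[symmetric] by (simp add: L2n_nonneg)
qed

lemma OB_cv:
  assumes "OB k C" "OB l D" "test k" "test l" shows "OB (cv k l) (C * D)"
  unfolding OB_def
proof (intro conjI allI impI)
  fix v assume v: "test v"
  have "L2n (cv v (cv k l)) = L2n (cv (cv v k) l)" by (simp add: cv_assoc v assms)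
  also have "\<dots> \<le> D * L2n (cv v k)" by (intro OB_D assms test_cv v)
  also have "\<dots> \<le> D * (C * L2n v)" by (intro mult_left_mono OB_D assms v OB_nonneg[OF assms(2)])
  finally show "L2n (cv v (cv k l)) \<le> C * D * L2n v" by (simp add: mult_ac)
qed (simp add: OB_nonneg[OF assms(1)] OB_nonneg[OF assms(2)])

lemma OB_comb:
  assumes "OB k C" "OB l D" "test k" "test l" shows "OB (\<lambda>x. a * k x + b * l x) (\<bar>a\<bar> * C + \<bar>b\<bar> * D)"
  unfolding OB_def
proof (intro conjI allI impI)
  fix v assume v: "test v"
  have "L2n (cv v (\<lambda>x. a * k x + b * l x)) = L2n (\<lambda>x. a * cv v k x + b * cv v l x)"
    by (simp add: conv_comb_kernel fd_lin L2_test v assms)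
  also have "\<dots> \<le> L2n (\<lambda>x. a * cv v k x) + L2n (\<lambda>x. b * cv v l x)"
    by (intro L2n_triangle L2_test test_on_cmult test_cv v assms)
  also have "\<dots> \<le> \<bar>a\<bar> * (C * L2n v) + \<bar>b\<bar> * (D * L2n v)"
    unfolding L2n_cmult by (intro add_mono mult_left_mono OB_D assms v) auto
  finally show "L2n (cv v (\<lambda>x. a * k x + b * l x)) \<le> (\<bar>a\<bar> * C + \<bar>b\<bar> * D) * L2n v" by (simp add: algebra_simps)
qed (simp add: OB_nonneg[OF assms(1)] OB_nonneg[OF assms(2)])

lemma OB_diff: "OB k C \<Longrightarrow> OB l D \<Longrightarrow> test k \<Longrightarrow> test l \<Longrightarrow> OB (\<lambda>x. k x - l x) (C + D)"
  using OB_comb[of k C l D 1 "-1"] by simp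

lemma OB_add: "OB k C \<Longrightarrow> OB l D \<Longrightarrow> test k \<Longrightarrow> test l \<Longrightarrow> OB (\<lambda>x. k x + l x) (C + D)"
  using OB_comb[of k C l D 1 1] by simp

lemma OB_uminus: "OB k C \<Longrightarrow> test k \<Longrightarrow> OB (\<lambda>x. - k x) C"
  using OB_comb[of k C k C "-1" 0] by simp

text \<open>An operator T and its adjoint T' have the same norm, since |T' v|^2 = <v, T T'
  v>.\<close>

lemma OB_refl_fun:
  assumes "OB k C" "test k" shows "OB (refl_fun k) C"
  unfolding OB_def
proof (intro conjI allI impI)
  fix v assume v: "test v"
  define w where "w = cv v (refl_fun k)"
  have w: "test w" unfolding w_def by (intro test_cv v test_refl_fun assms)
  have "(L2n w)\<^sup>2 = (\<integral>x. v x * cv w k x \<partial>lborel)"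
    using cv_adjoint[OF v test_refl_fun[OF assms(2)] w] by (simp add: L2n_sq_mult w_def)
  also have "\<dots> \<le> L2n v * L2n (cv w k)"
    using L2_CS[OF L2_test[OF v] L2_test[OF test_cv[OF w assms(2)]]] by linarith
  also have "\<dots> \<le> L2n v * (C * L2n w)" by (intro mult_left_mono OB_D[OF assms(1) w] L2n_nonneg)
  finally have "(L2n w)\<^sup>2 \<le> (C * L2n v) * L2n w" by (simp add: mult_ac)
  from L2n_sq_le_imp[OF this] show "L2n (cv v (refl_fun k)) \<le> C * L2n v"
    unfolding w_def[symmetric] by (simp add: L2n_nonneg OB_nonneg[OF assms(1)])
qed (rule OB_nonneg[OF assms(1)])

subsection \<open>Almost orthogonality for commuting convolutions\<close>

definition ip :: "(R3 \<Rightarrow> real) \<Rightarrow> (R3 \<Rightarrow> real) \<Rightarrow> real" where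
  "ip f g = (\<integral>x. f x * g x \<partial>lborel)"

lemma ip_commute: "ip f g = ip g f"
  by (simp add: ip_def mult.commute)

lemma ip_self: "ip f f = (L2n f)\<^sup>2"
  by (simp add: ip_def L2n_sq_mult)

lemma ip_le: "test f \<Longrightarrow> test g \<Longrightarrow> \<bar>ip f g\<bar> \<le> L2n f * L2n g"
  unfolding ip_def by (intro L2_CS L2_test)

lemma ip_sum_right:
  assumes "test f" "\<And>i. i \<in> I \<Longrightarrow> test (g i)"
  shows "ip f (\<lambda>x. \<Sum>i\<in>I. g i x) = (\<Sum>i\<in>I. ip f (g i))"
  using lin_test_sum[OF fd_lin[OF L2_test[OF assms(1)]] assms(2)] by (simp add: ip_def fd_def)

lemma ip_sum_left:
  assumes "test f" "\<And>i. i \<in> I \<Longrightarrow> test (g i)"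
  shows "ip (\<lambda>x. \<Sum>i\<in>I. g i x) f = (\<Sum>i\<in>I. ip (g i) f)"
  using ip_sum_right[OF assms] by (simp add: ip_commute)

lemma ip_cv: "test f \<Longrightarrow> test k \<Longrightarrow> test g \<Longrightarrow> ip (cv f k) g = ip f (cv g (refl_fun k))"
  unfolding ip_def by (rule cv_adjoint)

lemma ip_cv_refl: "test f \<Longrightarrow> test k \<Longrightarrow> test g \<Longrightarrow> ip (cv f (refl_fun k)) g = ip f (cv g k)"
  using ip_cv[of f "refl_fun k" g] by (simp add: test_refl_fun)

lemma ip_cv_refl': "test f \<Longrightarrow> test k \<Longrightarrow> test g \<Longrightarrow> ip g (cv f (refl_fun k)) = ip (cv g k) f"
  using ip_cv_refl[of f k g] by (simp add: ip_commute)

lemma cv_cv_commute: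
  "test f \<Longrightarrow> test k \<Longrightarrow> test l \<Longrightarrow> cv (cv f k) l = cv (cv f l) k"
  by (simp add: cv_assoc cv_commute[of k l])

lemma cv_zero: "test f \<Longrightarrow> cv f (\<lambda>x. 0) = (\<lambda>x. 0)"
  by (rule ext) (simp add: cv_eq)

text \<open>Subtraction on naturals is truncated, so one of the two terms is zero and the sum is |i
  - j|.\<close>

definition ndist :: "nat \<Rightarrow> nat \<Rightarrow> nat" where
  "ndist i j = (i - j) + (j - i)"

lemma ndist_commute: "ndist i j = ndist j i"
  by (simp add: ndist_def)

lemma sum_geometric_le:
  fixes q :: real assumes "0 \<le> q" "q < 1" shows "(\<Sum>i<N. q ^ i) \<le> 1 / (1 - q)"
  using assms by (simp add: sum_gp_strict divide_right_mono)

lemma sum_ndist_le: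
  fixes q :: real assumes q: "0 \<le> q" "q < 1" shows "(\<Sum>j<N. q ^ ndist i j) \<le> 2 / (1 - q)"
proof -
  \<comment> \<open>Enlarging the range beyond i makes it possible to split at i whether or not i <
    N; either half is then part of a geometric series.\<close>
  have "(\<Sum>j<N. q ^ ndist i j) \<le> (\<Sum>j<i + N + 1. q ^ ndist i j)"
    using q by (intro sum_mono2) auto
  also have "\<dots> = (\<Sum>j<i. q ^ ndist i j) + (\<Sum>j=i..<i + N + 1. q ^ ndist i j)"
    by (subst sum.atLeastLessThan_concat[symmetric, of 0 i, unfolded atLeast0LessThan]) (auto simp: atLeast0LessThan)
  also have "(\<Sum>j<i. q ^ ndist i j) = (\<Sum>j<i. q ^ Suc j)"
    by (subst sum.nat_diff_reindex[symmetric]) (auto simp: ndist_def intro!: sum.cong arg_cong[of _ _ "\<lambda>n. q ^ n"])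
  also have "\<dots> \<le> (\<Sum>j<i. q ^ j)" using q by (intro sum_mono) (auto simp: mult_left_le_one_le)
  also have "(\<Sum>j=i..<i + N + 1. q ^ ndist i j) = (\<Sum>j<N + 1. q ^ j)"
    using sum.shift_bounds_nat_ivl[of "\<lambda>j. q ^ ndist i j" 0 i "N + 1"]
    by (simp add: ndist_def atLeast0LessThan add.commute)
  finally have "(\<Sum>j<N. q ^ ndist i j) \<le> (\<Sum>j<i. q ^ j) + (\<Sum>j<N + 1. q ^ j)" by simp
  also have "\<dots> \<le> 1 / (1 - q) + 1 / (1 - q)" by (intro add_mono sum_geometric_le q)
  finally show ?thesis by simp
qed

text \<open>Two upper bounds for the same quantity are interpolated: it is at most their geometric
  mean, and the geometric mean of x and y is at most their arithmetic mean.\<close>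

lemma geometric_mean_bound:
  fixes L u v x y :: real
  assumes "0 \<le> L" "L \<le> u\<^sup>2 * x" "L \<le> v\<^sup>2 * y" "0 \<le> u" "0 \<le> v" "0 \<le> x" "0 \<le> y"
  shows "L \<le> u * v * ((x + y) / 2)"
proof (rule power2_le_imp_le)
  have "L\<^sup>2 \<le> (u\<^sup>2 * x) * (v\<^sup>2 * y)" unfolding power2_eq_square[of L] using assms by (intro mult_mono) auto
  also have "\<dots> = (u * v)\<^sup>2 * (x * y)" by (simp add: power_mult_distrib)
  also have "\<dots> \<le> (u * v)\<^sup>2 * ((x + y) / 2)\<^sup>2"
  proof (rule mult_left_mono)
    have "0 \<le> (x - y)\<^sup>2" by simp
    then show "x * y \<le> ((x + y) / 2)\<^sup>2" by (simp add: power2_eq_square field_simps)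
  qed simp
  finally show "L\<^sup>2 \<le> (u * v * ((x + y) / 2))\<^sup>2" by (simp only: power_mult_distrib)
qed (use assms in simp)

text \<open>Let T_i be convolution with \<open>k i\<close> and T_i' its adjoint; condition
  \<open>ao\<close> bounds T_i' T_j. Convolutions commute, so it covers T_j T_i' as well. The decay
  is written as the square of a power of r^2 because square roots are taken twice below.\<close>

locale almost_orthogonal =
  fixes k :: "nat \<Rightarrow> R3 \<Rightarrow> real" and A r :: real
  assumes k: "\<And>i. test (k i)" and A: "A \<ge> 0" and r: "0 < r" "r < 1"
    and ao: "\<And>i j. OB (cv (k j) (refl_fun (k i))) ((A * (r\<^sup>2) ^ ndist i j)\<^sup>2)"
begin

definition q :: real where "q = r\<^sup>2"
definition G :: real where "G = 2 / (1 - q)"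
definition b :: "nat \<Rightarrow> real" where "b d = A * q ^ d"

lemma q: "0 \<le> q" "q < 1"
  using r by (auto simp: q_def power_less_one_iff)

lemma b_nonneg: "b d \<ge> 0" by (simp add: b_def A q)

lemma G_nonneg: "G \<ge> 0" using q by (simp add: G_def)

lemma b_sum: "(\<Sum>j<N. b (ndist i j)) \<le> A * G"
  unfolding b_def G_def sum_distrib_left[symmetric] by (intro mult_left_mono sum_ndist_le q A)

lemma b_sum': "(\<Sum>i<N. b (ndist i j)) \<le> A * G"
  using b_sum[of j N] by (simp add: ndist_commute)

lemma b_sq_sum: "(\<Sum>j<N. (b (ndist i j))\<^sup>2) \<le> A\<^sup>2 * G"
proof -
  have "(\<Sum>j<N. (b (ndist i j))\<^sup>2) \<le> (\<Sum>j<N. A\<^sup>2 * q ^ ndist i j)"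
    unfolding b_def power_mult_distrib
  proof (intro sum_mono mult_left_mono)
    fix j show "(q ^ ndist i j)\<^sup>2 \<le> q ^ ndist i j"
      using q by (simp add: power2_eq_square mult_left_le power_le_one)
  qed simp
  also have "\<dots> \<le> A\<^sup>2 * G" unfolding G_def sum_distrib_left[symmetric] by (intro mult_left_mono sum_ndist_le q) simp
  finally show ?thesis .
qed

lemma ao': "test v \<Longrightarrow> L2n (cv (cv v (k j)) (refl_fun (k i))) \<le> (b (ndist i j))\<^sup>2 * L2n v"
  using OB_D[OF ao] k by (simp add: cv_assoc test_refl_fun b_def q_def)

lemma ao'': "test v \<Longrightarrow> L2n (cv (cv v (refl_fun (k i))) (k j)) \<le> (b (ndist i j))\<^sup>2 * L2n v"
  using ao'[of v j i] k by (simp add: cv_cv_commute test_refl_fun)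

definition s :: "(R3 \<Rightarrow> real) \<Rightarrow> nat \<Rightarrow> real" where "s x i = L2n (cv x (k i))"

lemma s_nonneg: "s x i \<ge> 0" by (simp add: s_def L2n_nonneg)

lemma prod_le_sq: "a * c \<le> (a\<^sup>2 + c\<^sup>2) / 2" for a c :: real
  using sum_squares_bound[of a c] by simp

text \<open>A form of Schur's test: bounded row and column sums of the weights control the double
  sum.\<close>

lemma double_sum_le:
  fixes t v :: "nat \<Rightarrow> real"
  assumes w: "\<And>i j. w i j \<ge> 0" "\<And>i. (\<Sum>j<N. w i j) \<le> B" "\<And>j. (\<Sum>i<N. w i j) \<le> B"
    and t: "(\<Sum>i<N. t i) \<le> S" "\<And>i. t i \<ge> 0" and v: "(\<Sum>i<N. v i) \<le> S'" "\<And>i. v i \<ge> 0"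
    and B: "B \<ge> 0"
  shows "(\<Sum>i<N. \<Sum>j<N. w i j * (t i + v j)) \<le> B * (S + S')"
proof -
  have "(\<Sum>i<N. \<Sum>j<N. w i j * (t i + v j)) = (\<Sum>i<N. t i * (\<Sum>j<N. w i j)) + (\<Sum>i<N. \<Sum>j<N. w i j * v j)"
    by (simp add: sum.distrib distrib_left sum_distrib_left mult.commute)
  also have "(\<Sum>i<N. \<Sum>j<N. w i j * v j) = (\<Sum>j<N. v j * (\<Sum>i<N. w i j))"
    by (subst sum.swap) (simp add: sum_distrib_left mult.commute)
  also have "(\<Sum>i<N. t i * (\<Sum>j<N. w i j)) \<le> (\<Sum>i<N. t i * B)" by (intro sum_mono mult_left_mono w t)
  also have "(\<Sum>j<N. v j * (\<Sum>i<N. w i j)) \<le> (\<Sum>j<N. v j * B)" by (intro sum_mono mult_left_mono w v)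
  finally have "(\<Sum>i<N. \<Sum>j<N. w i j * (t i + v j)) \<le> (\<Sum>i<N. t i) * B + (\<Sum>j<N. v j) * B"
    by (simp add: sum_distrib_right)
  also have "\<dots> \<le> S * B + S' * B" by (intro add_mono mult_right_mono t v B)
  finally show ?thesis by (simp add: algebra_simps)
qed

text \<open>With \<open>y = \<Sum> T\<^sub>i' T\<^sub>i x\<close> one has \<open>\<Sum> |T\<^sub>i x|\<^sup>2 = \<langle>y, x\<rangle>\<close>, while almost orthogonality bounds \<open>|y|\<^sup>2\<close>
  by \<open>\<Sum> |T\<^sub>i x|\<^sup>2\<close> again.\<close>
lemma square_function:
  assumes x: "test x" shows "(\<Sum>i<N. (s x i)\<^sup>2) \<le> A\<^sup>2 * G * (L2n x)\<^sup>2"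
proof -
  define S where "S = (\<Sum>i<N. (s x i)\<^sup>2)"
  define y where "y = (\<lambda>z. \<Sum>i<N. cv (cv x (k i)) (refl_fun (k i)) z)"
  have t: "test (cv x (k i))" "test (cv (cv x (k i)) (refl_fun (k j)))" for i j
    by (intro test_cv x k test_refl_fun)+
  have y: "test y" unfolding y_def by (intro test_on_sum t)
  have B: "A\<^sup>2 * G \<ge> 0" using G_nonneg by simp
  have Sy: "S = ip y x"
    unfolding y_def S_def s_def by (simp add: ip_sum_left x t ip_cv_refl k ip_self)
  have "(L2n y)\<^sup>2 = (\<Sum>i<N. \<Sum>j<N. ip (cv (cv x (k i)) (refl_fun (k i))) (cv (cv x (k j)) (refl_fun (k j))))"
    unfolding ip_self[symmetric] using y unfolding y_def by (simp add: ip_sum_left ip_sum_right t)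
  also have "\<dots> \<le> (\<Sum>i<N. \<Sum>j<N. (b (ndist i j))\<^sup>2 / 2 * ((s x i)\<^sup>2 + (s x j)\<^sup>2))"
  proof (intro sum_mono)
    fix i j
    have "ip (cv (cv x (k i)) (refl_fun (k i))) (cv (cv x (k j)) (refl_fun (k j)))
        = ip (cv (cv (cv x (k i)) (refl_fun (k i))) (k j)) (cv x (k j))"
      by (rule ip_cv_refl'[OF t(1) k t(2)])
    also have "\<dots> \<le> L2n (cv (cv (cv x (k i)) (refl_fun (k i))) (k j)) * s x j"
      unfolding s_def using ip_le[OF test_cv[OF t(2) k] t(1)] abs_le_D1 by blast
    also have "\<dots> \<le> (b (ndist i j))\<^sup>2 * s x i * s x j"
      unfolding s_def by (intro mult_right_mono ao'' t L2n_nonneg)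
    also have "\<dots> \<le> (b (ndist i j))\<^sup>2 * (((s x i)\<^sup>2 + (s x j)\<^sup>2) / 2)"
      unfolding mult.assoc by (intro mult_left_mono prod_le_sq) simp
    finally show "ip (cv (cv x (k i)) (refl_fun (k i))) (cv (cv x (k j)) (refl_fun (k j)))
      \<le> (b (ndist i j))\<^sup>2 / 2 * ((s x i)\<^sup>2 + (s x j)\<^sup>2)" by simp
  qed
  also have "\<dots> \<le> A\<^sup>2 * G / 2 * (S + S)"
  proof (rule double_sum_le)
    show "(\<Sum>j<N. (b (ndist i j))\<^sup>2 / 2) \<le> A\<^sup>2 * G / 2" for i
      using b_sq_sum[of i N] by (simp add: sum_divide_distrib[symmetric])
    then show "(\<Sum>i<N. (b (ndist i j))\<^sup>2 / 2) \<le> A\<^sup>2 * G / 2" for j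
      by (simp add: ndist_commute[of _ j])
  qed (use B in \<open>auto simp: S_def\<close>)
  finally have yS: "(L2n y)\<^sup>2 \<le> A\<^sup>2 * G * S" by simp
  have S0: "S \<ge> 0" by (simp add: S_def sum_nonneg)
  have "S\<^sup>2 \<le> (L2n y * L2n x)\<^sup>2"
    using ip_le[OF y x] S0 by (intro power_mono) (auto simp: Sy)
  also have "\<dots> \<le> A\<^sup>2 * G * S * (L2n x)\<^sup>2"
    unfolding power_mult_distrib by (intro mult_right_mono yS) simp
  finally have le: "S * S \<le> (A\<^sup>2 * G * (L2n x)\<^sup>2) * S" by (simp add: power2_eq_square mult_ac)
  show ?thesis
  proof (cases "S = 0")
    case False
    then show ?thesis using le S0 unfolding S_def[symmetric] by simp
  next
    case True then show ?thesis using B unfolding S_def[symmetric] by simp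
  qed
qed

text \<open>Expanding the square norm of the sum of all T_i x gives terms <T_i' T_j x, x>;
  \<open>W n d x\<close> collects those with j = i + d, that is, one diagonal.\<close>

definition W :: "nat \<Rightarrow> nat \<Rightarrow> (R3 \<Rightarrow> real) \<Rightarrow> R3 \<Rightarrow> real" where
  "W n d x = (\<lambda>z. \<Sum>i<n. cv (cv x (k (i + d))) (refl_fun (k i)) z)"

text \<open>Grouping the four operators of a term of \<open>|W\<^sub>d x|\<^sup>2\<close> in two ways gives either decay in \<open>d\<close> or
  decay in the summation indices; the geometric mean of the two bounds has both.\<close>
lemma W_bound:
  assumes x: "test x" shows "L2n (W n d x) \<le> A\<^sup>2 * G * r ^ d * L2n x"
proof -
  define S where "S = A\<^sup>2 * G * (L2n x)\<^sup>2"
  have t: "test (cv x (k i))" "test (cv (cv x (k i)) (refl_fun (k j)))" for i j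
    by (intro test_cv x k test_refl_fun)+
  have W: "test (W n d x)" unfolding W_def by (intro test_on_sum t)
  have sums: "(\<Sum>i<n. (s x i)\<^sup>2) \<le> S" "(\<Sum>i<n. (s x (i + d))\<^sup>2) \<le> S"
  proof -
    show "(\<Sum>i<n. (s x i)\<^sup>2) \<le> S" unfolding S_def by (rule square_function[OF x])
    have "(\<Sum>i<n. (s x (i + d))\<^sup>2) = (\<Sum>i\<in>{d..<n + d}. (s x i)\<^sup>2)"
      using sum.shift_bounds_nat_ivl[of "\<lambda>i. (s x i)\<^sup>2" 0 d n] by (simp add: atLeast0LessThan)
    also have "\<dots> \<le> (\<Sum>i<n + d. (s x i)\<^sup>2)" by (intro sum_mono2) auto
    also have "\<dots> \<le> S" unfolding S_def by (rule square_function[OF x])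
    finally show "(\<Sum>i<n. (s x (i + d))\<^sup>2) \<le> S" .
  qed
  have B: "A * G / 4 \<ge> 0" using G_nonneg A by simp
  have "(L2n (W n d x))\<^sup>2 = (\<Sum>i<n. \<Sum>j<n. ip (cv (cv x (k (i + d))) (refl_fun (k i))) (cv (cv x (k (j + d))) (refl_fun (k j))))"
    unfolding ip_self[symmetric] using W unfolding W_def by (simp add: ip_sum_left ip_sum_right t)
  also have "\<dots> \<le> (\<Sum>i<n. \<Sum>j<n. b d * (b (ndist i j) / 4 * ((s x (i + d))\<^sup>2 + ((s x j)\<^sup>2 + 2 * (s x (j + d))\<^sup>2))))"
  proof (intro sum_mono)
    fix i j
    define L where "L = L2n (cv (cv (cv x (k (i + d))) (refl_fun (k i))) (k j))"
    have L1: "L \<le> (b (ndist i j))\<^sup>2 * s x (i + d)" unfolding L_def s_def by (intro ao'' t)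
    have "cv (cv (cv x (k (i + d))) (refl_fun (k i))) (k j) = cv (cv (cv x (k (i + d))) (k j)) (refl_fun (k i))"
      by (rule cv_cv_commute[OF t(1) test_refl_fun[OF k] k])
    also have "cv (cv x (k (i + d))) (k j) = cv (cv x (k j)) (k (i + d))" by (rule cv_cv_commute[OF x k k])
    finally have "L = L2n (cv (cv (cv x (k j)) (k (i + d))) (refl_fun (k i)))" by (simp add: L_def)
    also have "\<dots> \<le> (b (ndist i (i + d)))\<^sup>2 * s x j" unfolding s_def by (intro ao' t)
    finally have L2: "L \<le> (b d)\<^sup>2 * s x j" by (simp add: ndist_def)
    have "ip (cv (cv x (k (i + d))) (refl_fun (k i))) (cv (cv x (k (j + d))) (refl_fun (k j)))
        = ip (cv (cv (cv x (k (i + d))) (refl_fun (k i))) (k j)) (cv x (k (j + d)))"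
      by (rule ip_cv_refl'[OF t(1) k t(2)])
    also have "\<dots> \<le> L * s x (j + d)"
      unfolding s_def L_def using ip_le[OF test_cv[OF t(2) k] t(1)] abs_le_D1 by blast
    also have "\<dots> \<le> (b (ndist i j) * b d * ((s x (i + d) + s x j) / 2)) * s x (j + d)"
      by (intro mult_right_mono geometric_mean_bound L1 L2 b_nonneg s_nonneg) (simp add: L_def L2n_nonneg)
    also have "\<dots> = b (ndist i j) * b d / 2 * (s x (i + d) * s x (j + d) + s x j * s x (j + d))"
      by (simp add: field_simps)
    also have "\<dots> \<le> b (ndist i j) * b d / 2 * (((s x (i + d))\<^sup>2 + (s x (j + d))\<^sup>2) / 2 + ((s x j)\<^sup>2 + (s x (j + d))\<^sup>2) / 2)"
      by (intro mult_left_mono add_mono prod_le_sq) (simp add: b_nonneg)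
    finally show "ip (cv (cv x (k (i + d))) (refl_fun (k i))) (cv (cv x (k (j + d))) (refl_fun (k j)))
      \<le> b d * (b (ndist i j) / 4 * ((s x (i + d))\<^sup>2 + ((s x j)\<^sup>2 + 2 * (s x (j + d))\<^sup>2)))"
      by (simp add: field_simps)
  qed
  also have "\<dots> = b d * (\<Sum>i<n. \<Sum>j<n. b (ndist i j) / 4 * ((s x (i + d))\<^sup>2 + ((s x j)\<^sup>2 + 2 * (s x (j + d))\<^sup>2)))"
    by (simp only: sum_distrib_left)
  also have "\<dots> \<le> b d * (A * G / 4 * (S + (S + 2 * S)))"
  proof (intro mult_left_mono b_nonneg double_sum_le)
    show "(\<Sum>j<n. b (ndist i j) / 4) \<le> A * G / 4" for i
      using b_sum[of i n] by (simp add: sum_divide_distrib[symmetric])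
    show "(\<Sum>i<n. b (ndist i j) / 4) \<le> A * G / 4" for j
      using b_sum'[of j n] by (simp add: sum_divide_distrib[symmetric])
    show "(\<Sum>j<n. (s x j)\<^sup>2 + 2 * (s x (j + d))\<^sup>2) \<le> S + 2 * S"
      using sums by (simp add: sum.distrib sum_distrib_left[symmetric])
  qed (use B sums b_nonneg in auto)
  \<comment> \<open>The choice q = r^2 makes the bound a perfect square: \<open>b d\<close>
    contributes q^d = (r^d)^2, and the remaining factors are A^4 G^2 times the squared norm of
    x.\<close>
  also have "\<dots> = (A\<^sup>2 * G * r ^ d * L2n x)\<^sup>2"
    by (simp add: S_def b_def q_def power_mult_distrib power_even_eq[symmetric] power2_eq_square mult_ac)
  finally show ?thesis
    by (rule power2_le_imp_le) (simp add: L2n_nonneg G_nonneg r less_imp_le)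
qed

text \<open>By symmetry the part below the diagonal equals the part above. The diagonal itself is
  counted twice on the right, which costs nothing because its entries are nonnegative.\<close>

lemma sum_symmetric_le:
  fixes f :: "nat \<Rightarrow> nat \<Rightarrow> real"
  assumes sym: "\<And>i j. f i j = f j i" and diag: "\<And>i. f i i \<ge> 0"
  shows "(\<Sum>i<N. \<Sum>j<N. f i j) \<le> 2 * (\<Sum>d<N. \<Sum>i<N - d. f i (i + d))"
proof -
  have eq: "(\<Sum>d<N. \<Sum>i<N - d. f i (i + d)) = (\<Sum>j<N. \<Sum>i\<le>j. f i j)"
  proof -
    have "(\<Sum>d<N. \<Sum>i<N - d. f i (i + d)) = (\<Sum>(d, i)\<in>(SIGMA d:{..<N}. {..<N - d}). f i (i + d))"
      by (simp add: sum.Sigma)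
    also have "\<dots> = (\<Sum>(d, i)\<in>{(d, i). d + i < N}. f i (i + d))"
      by (rule sum.cong) auto
    also have "\<dots> = (\<Sum>j<N. \<Sum>d\<le>j. f (j - d) (j - d + d))" by (rule sum.triangle_reindex)
    also have "\<dots> = (\<Sum>j<N. \<Sum>i\<le>j. f i j)"
    proof (rule sum.cong[OF refl])
      fix j
      have "(\<Sum>d\<le>j. f (j - d) (j - d + d)) = (\<Sum>d\<le>j. f (j - d) j)" by (rule sum.cong) auto
      also have "\<dots> = (\<Sum>i\<le>j. f i j)"
        by (rule sum.reindex_bij_witness[of _ "\<lambda>i. j - i" "\<lambda>i. j - i"]) auto
      finally show "(\<Sum>d\<le>j. f (j - d) (j - d + d)) = (\<Sum>i\<le>j. f i j)" .
    qed
    finally show ?thesis .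
  qed
  have "(\<Sum>i<N. \<Sum>j<N. f i j) \<le> 2 * (\<Sum>j<N. \<Sum>i\<le>j. f i j)"
  proof (induction N)
    case (Suc N)
    have "(\<Sum>i<Suc N. \<Sum>j<Suc N. f i j) = (\<Sum>i<N. \<Sum>j<N. f i j) + 2 * (\<Sum>i<N. f i N) + f N N"
    proof -
      have "(\<Sum>j<N. f N j) = (\<Sum>i<N. f i N)" by (intro sum.cong refl sym)
      then show ?thesis by (simp add: sum.distrib)
    qed
    then show ?case using Suc diag[of N] by (simp flip: lessThan_Suc_atMost)
  qed simp
  then show ?thesis by (simp add: eq)
qed

text \<open>After expansion into diagonals, \<open>W_bound\<close> makes the d-th diagonal at most a
  constant times r^d, so the sum over d is bounded by a geometric series whatever the number of
  terms.\<close>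

lemma Cotlar_Stein: "OB (\<lambda>z. \<Sum>i<N. k i z) (sqrt (2 * (A\<^sup>2 * G) / (1 - r)))"
  unfolding OB_def
proof (intro conjI allI impI)
  have B: "A\<^sup>2 * G \<ge> 0" using G_nonneg by simp
  show B': "0 \<le> sqrt (2 * (A\<^sup>2 * G) / (1 - r))" using B r by simp
  fix x assume x: "test x"
  have t: "test (cv x (k i))" "test (cv (cv x (k i)) (refl_fun (k j)))" for i j
    by (intro test_cv x k test_refl_fun)+
  have Wt: "test (W n d x)" for n d unfolding W_def by (intro test_on_sum t)
  have "(L2n (cv x (\<lambda>z. \<Sum>i<N. k i z)))\<^sup>2 = (\<Sum>i<N. \<Sum>j<N. ip (cv x (k i)) (cv x (k j)))"
    unfolding ip_self[symmetric] by (simp add: conv_sum_kernel fd_lin L2_test x k ip_sum_left ip_sum_right t test_on_sum)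
  also have "\<dots> \<le> 2 * (\<Sum>d<N. \<Sum>i<N - d. ip (cv x (k i)) (cv x (k (i + d))))"
    by (rule sum_symmetric_le) (auto simp: ip_commute ip_self)
  also have "\<dots> = 2 * (\<Sum>d<N. ip (W (N - d) d x) x)"
  proof -
    have "ip (W n d x) x = (\<Sum>i<n. ip (cv x (k i)) (cv x (k (i + d))))" for n d
    proof -
      have "ip (W n d x) x = (\<Sum>i<n. ip (cv (cv x (k (i + d))) (refl_fun (k i))) x)"
        unfolding W_def by (rule ip_sum_left[OF x t(2)])
      also have "\<dots> = (\<Sum>i<n. ip (cv x (k (i + d))) (cv x (k i)))"
        by (intro sum.cong refl ip_cv_refl t k x)
      finally show ?thesis by (simp only: ip_commute[of "cv x (k (_ + d))"])
    qed
    then show ?thesis by simp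
  qed
  also have "\<dots> \<le> 2 * (\<Sum>d<N. A\<^sup>2 * G * (L2n x)\<^sup>2 * r ^ d)"
  proof (intro mult_left_mono sum_mono)
    fix d
    have "ip (W (N - d) d x) x \<le> L2n (W (N - d) d x) * L2n x" using ip_le[OF Wt x] abs_le_D1 by blast
    also have "\<dots> \<le> (A\<^sup>2 * G * r ^ d * L2n x) * L2n x" by (intro mult_right_mono W_bound x L2n_nonneg)
    finally show "ip (W (N - d) d x) x \<le> A\<^sup>2 * G * (L2n x)\<^sup>2 * r ^ d" by (simp add: power2_eq_square mult_ac)
  qed simp
  also have "\<dots> \<le> 2 * (A\<^sup>2 * G * (L2n x)\<^sup>2 * (1 / (1 - r)))"
    unfolding sum_distrib_left[symmetric] using r B by (intro mult_left_mono sum_geometric_le) auto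
  also have "\<dots> = (sqrt (2 * (A\<^sup>2 * G) / (1 - r)) * L2n x)\<^sup>2"
    using B r by (simp add: power_mult_distrib)
  finally show "L2n (cv x (\<lambda>z. \<Sum>i<N. k i z)) \<le> sqrt (2 * (A\<^sup>2 * G) / (1 - r)) * L2n x"
    by (rule power2_le_imp_le) (use B' in \<open>simp add: L2n_nonneg\<close>)
qed

end

subsection \<open>Dilations\<close>

text \<open>The normalisation by t^3 preserves integrals in three dimensions, hence also the Young
  bound of the kernel.\<close>

definition dil :: "real \<Rightarrow> (R3 \<Rightarrow> real) \<Rightarrow> R3 \<Rightarrow> real" where
  "dil t f = (\<lambda>x. (1 / t ^ 3) * f ((1 / t) *\<^sub>R x))"

lemma test_dil: "test f \<Longrightarrow> t > 0 \<Longrightarrow> test (dil t f)"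
  unfolding dil_def using test_affine[of f "1 / t" 0] by (intro test_on_cmult) simp

lemma pd_dil: "test f \<Longrightarrow> t > 0 \<Longrightarrow> pd j (dil t f) = (\<lambda>x. (1 / t) * dil t (pd j f) x)"
proof -
  assume f: "test f" and t: "t > 0"
  have a: "test (\<lambda>x. f ((1 / t) *\<^sub>R x))" using test_affine[OF f, of "1 / t" 0] t by simp
  have "pd j (\<lambda>x. f ((1 / t) *\<^sub>R x)) = (\<lambda>x. (1 / t) * pd j f ((1 / t) *\<^sub>R x))"
    using pd_affine_test[OF f, of j 0 "1 / t"] by simp
  then show ?thesis unfolding dil_def pd_cmult'[OF a] by (simp add: mult_ac)
qed

lemma integral_dil: "f \<in> borel_measurable borel \<Longrightarrow> t > 0 \<Longrightarrow> (\<integral>x. dil t f x \<partial>lborel) = (\<integral>x. f x \<partial>lborel)"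
  using integral_affine[of f "1 / t" 0] by (simp add: dil_def power_divide)

lemma integral_abs_dil: "test f \<Longrightarrow> t > 0 \<Longrightarrow> (\<integral>x. \<bar>dil t f x\<bar> \<partial>lborel) = (\<integral>x. \<bar>f x\<bar> \<partial>lborel)"
  using integral_dil[OF borel_measurable_abs[OF borel_measurable_test], of f t] by (simp add: dil_def abs_mult)

lemma dil_dil: "dil s (dil t f) = dil (s * t) f"
  by (simp add: dil_def power_mult_distrib mult_ac)

lemma dil_diff: "dil t (\<lambda>x. f x - g x) = (\<lambda>x. dil t f x - dil t g x)"
  by (simp add: dil_def right_diff_distrib)

lemma dil_sum: "dil t (\<lambda>x. \<Sum>i\<in>I. f i x) = (\<lambda>x. \<Sum>i\<in>I. dil t (f i) x)"
  by (simp add: dil_def sum_distrib_left)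

lemma cv_cmult_right: "test v \<Longrightarrow> test k \<Longrightarrow> cv v (\<lambda>x. c * k x) = (\<lambda>x. c * cv v k x)"
  using conv_comb_kernel[OF fd_lin[OF L2_test], of v k k c 0] by simp

lemma cv_cmult_left: "test v \<Longrightarrow> test k \<Longrightarrow> cv (\<lambda>x. c * v x) k = (\<lambda>x. c * cv v k x)"
  by (metis cv_commute cv_cmult_right test_on_cmult)

lemma OB_cmult: "OB k C \<Longrightarrow> test k \<Longrightarrow> OB (\<lambda>x. c * k x) (\<bar>c\<bar> * C)"
  using OB_comb[of k C k C c 0] by simp

lemma OB_sum:
  "(\<And>i. i \<in> I \<Longrightarrow> OB (k i) (C i)) \<Longrightarrow> (\<And>i. i \<in> I \<Longrightarrow> test (k i)) \<Longrightarrow> OB (\<lambda>x. \<Sum>i\<in>I. k i x) (\<Sum>i\<in>I. C i)"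
proof (induction I rule: infinite_finite_induct)
  case (insert i I)
  then show ?case using OB_add[of "k i" "C i" "\<lambda>x. \<Sum>i\<in>I. k i x"] by (simp add: test_on_sum)
qed (auto simp: OB_def cv_zero L2n_0)

lemma OB_dil: "test f \<Longrightarrow> t > 0 \<Longrightarrow> OB (dil t f) (\<integral>x. \<bar>f x\<bar> \<partial>lborel)"
  using OB_Young[OF test_dil, of f t] by (simp add: integral_abs_dil)

text \<open>A derivative of \<open>\<Psi>\<close> can be moved from the finer to the coarser of the two kernels, at the gain of the
  ratio of their scales.\<close>
lemma OB_dil_pair:
  fixes m :: 3
  assumes \<Psi>: "test \<Psi>" and s: "s > 0" and t: "t > 0"
    and X_def: "X = pd m \<Psi>"
    and B_def: "B = (\<integral>x. \<bar>\<Psi> x\<bar> \<partial>lborel) * (\<integral>x. \<bar>pd m X x\<bar> \<partial>lborel)"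
  shows "OB (cv (dil t X) (refl_fun (dil s X))) (s / t * B)"
    and "OB (cv (dil t X) (refl_fun (dil s X))) (t / s * B)"
proof -
  have X: "test X" "test (pd m X)" unfolding X_def by (intro test_on_pd \<Psi>)+
  note T = \<Psi> X
  have eq: "dil s X = (\<lambda>x. s * pd m (dil s \<Psi>) x)" if "s > 0" for s
    unfolding pd_dil[OF \<Psi> that] X_def using that by simp
  have pdr: "pd m (refl_fun f) = (\<lambda>x. - refl_fun (pd m f) x)" if "test f" for f by (rule pd_refl_fun[OF that])
  have "refl_fun (dil s X) = (\<lambda>x. (- s) * pd m (refl_fun (dil s \<Psi>)) x)"
    unfolding pdr[OF test_dil[OF \<Psi> s]] by (subst eq[OF s]) (simp add: refl_fun_def)
  then have "cv (dil t X) (refl_fun (dil s X)) = (\<lambda>x. (- s) * cv (dil t X) (pd m (refl_fun (dil s \<Psi>))) x)"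
    using T s t by (simp only: cv_cmult_right test_dil test_on_pd test_refl_fun)
  also have "cv (dil t X) (pd m (refl_fun (dil s \<Psi>))) = cv (pd m (dil t X)) (refl_fun (dil s \<Psi>))"
    using T s t by (metis pd_cv pd_cv_left test_dil test_refl_fun)
  also have "\<dots> = (\<lambda>x. (1 / t) * cv (dil t (pd m X)) (refl_fun (dil s \<Psi>)) x)"
    unfolding pd_dil[OF X(1) t] by (rule cv_cmult_left) (intro test_dil test_refl_fun T s t)+
  finally have e1: "cv (dil t X) (refl_fun (dil s X)) = (\<lambda>x. (- s / t) * cv (dil t (pd m X)) (refl_fun (dil s \<Psi>)) x)"
    by simp
  have "OB (\<lambda>x. (- s / t) * cv (dil t (pd m X)) (refl_fun (dil s \<Psi>)) x)
      (\<bar>- s / t\<bar> * ((\<integral>x. \<bar>pd m X x\<bar> \<partial>lborel) * (\<integral>x. \<bar>\<Psi> x\<bar> \<partial>lborel)))"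
    by (intro OB_cmult OB_cv OB_dil OB_refl_fun test_cv test_dil test_refl_fun T s t)
  then show "OB (cv (dil t X) (refl_fun (dil s X))) (s / t * B)"
    unfolding e1 B_def using s t by (simp add: mult_ac)
  have "cv (dil t X) (refl_fun (dil s X)) = (\<lambda>x. t * cv (pd m (dil t \<Psi>)) (refl_fun (dil s X)) x)"
    by (subst eq[OF t], rule cv_cmult_left) (intro test_dil test_refl_fun test_on_pd T s t)+
  also have "cv (pd m (dil t \<Psi>)) (refl_fun (dil s X)) = cv (dil t \<Psi>) (pd m (refl_fun (dil s X)))"
    using T s t by (metis pd_cv pd_cv_left test_dil test_refl_fun)
  also have "pd m (refl_fun (dil s X)) = (\<lambda>x. (- 1 / s) * refl_fun (dil s (pd m X)) x)"
    unfolding pdr[OF test_dil[OF X(1) s]] pd_dil[OF X(1) s] by (simp add: refl_fun_def)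
  also have "cv (dil t \<Psi>) \<dots> = (\<lambda>x. (- 1 / s) * cv (dil t \<Psi>) (refl_fun (dil s (pd m X))) x)"
    by (rule cv_cmult_right) (intro test_dil test_refl_fun T s t)+
  finally have e2: "cv (dil t X) (refl_fun (dil s X)) = (\<lambda>x. (- t / s) * cv (dil t \<Psi>) (refl_fun (dil s (pd m X))) x)"
    by simp
  have "OB (\<lambda>x. (- t / s) * cv (dil t \<Psi>) (refl_fun (dil s (pd m X))) x)
      (\<bar>- t / s\<bar> * ((\<integral>x. \<bar>\<Psi> x\<bar> \<partial>lborel) * (\<integral>x. \<bar>pd m X x\<bar> \<partial>lborel)))"
    by (intro OB_cmult OB_cv OB_dil OB_refl_fun test_cv test_dil test_refl_fun T s t)
  then show "OB (cv (dil t X) (refl_fun (dil s X))) (t / s * B)"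
    unfolding e2 B_def using s t by (simp add: mult_ac)
qed

text \<open>Young's inequality alone gives a bound proportional to \<open>N\<close>. For scales with
  ratio r^4 the gain from \<open>OB_dil_pair\<close> is the |i - j|-th power of r^4, which is
  exactly the decay asked for in \<open>almost_orthogonal\<close>.\<close>

lemma OB_sum_dil_pd:
  assumes \<Psi>: "test \<Psi>" and r: "0 < r" "r < 1"
  obtains C where "C \<ge> 0" "\<And>N. OB (\<lambda>x. \<Sum>j<N. dil ((r ^ 4) ^ j) (pd m \<Psi>) x) C"
proof -
  define X where "X = pd m \<Psi>"
  define B where "B = (\<integral>x. \<bar>\<Psi> x\<bar> \<partial>lborel) * (\<integral>x. \<bar>pd m X x\<bar> \<partial>lborel)"
  have B: "B \<ge> 0" by (simp add: B_def)
  have p: "(r ^ 4) ^ j > 0" for j using r by simp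
  interpret almost_orthogonal "\<lambda>j. dil ((r ^ 4) ^ j) X" "sqrt B" r
  proof
    show "test (dil ((r ^ 4) ^ i) X)" for i unfolding X_def by (intro test_dil test_on_pd \<Psi> p)
    fix i j
    have e: "(sqrt B * (r\<^sup>2) ^ ndist i j)\<^sup>2 = (r ^ 4) ^ ndist i j * B"
      using B by (simp add: power_mult_distrib power_mult[symmetric] mult.commute)
    show "OB (cv (dil ((r ^ 4) ^ j) X) (refl_fun (dil ((r ^ 4) ^ i) X))) ((sqrt B * (r\<^sup>2) ^ ndist i j)\<^sup>2)"
    proof (cases "j \<le> i")
      case True
      then have "(r ^ 4) ^ ndist i j = (r ^ 4) ^ i / (r ^ 4) ^ j" using r by (simp add: ndist_def power_diff)
      then show ?thesis unfolding e using OB_dil_pair(1)[OF \<Psi> p[of i] p[of j] X_def B_def] by simp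
    next
      case False
      then have "(r ^ 4) ^ ndist i j = (r ^ 4) ^ j / (r ^ 4) ^ i" using r by (simp add: ndist_def power_diff)
      then show ?thesis unfolding e using OB_dil_pair(2)[OF \<Psi> p[of i] p[of j] X_def B_def] by simp
    qed
  qed (use r B in auto)
  show thesis
    by (rule that[OF _ Cotlar_Stein[unfolded X_def]]) (use r G_nonneg in simp)
qed

subsection \<open>Kernels supported in a cone\<close>

definition pbox :: "R3 \<Rightarrow> real \<Rightarrow> R3 set" where
  "pbox p d = {b. \<forall>i. \<bar>b $ i - p $ i\<bar> \<le> 2 * d}"

text \<open>A truncated cone over a cube. The condition 0 < s matters: shifts along the cone have to
  carry boundary points into the open set, and s = 0 would admit the unshifted point.\<close>

definition cone_seg :: "R3 \<Rightarrow> real \<Rightarrow> real \<Rightarrow> R3 set" where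
  "cone_seg p d \<sigma> = {s *\<^sub>R b |s b. 0 < s \<and> s \<le> \<sigma> \<and> b \<in> pbox p d}"

lemma pbox_eq_cbox: "pbox p d = cbox (\<chi> i. p $ i - 2 * d) (\<chi> i. p $ i + 2 * d)"
  unfolding pbox_def by (auto simp: mem_box_cart abs_le_iff algebra_simps)

lemma compact_pbox: "compact (pbox p d)" and convex_pbox: "convex (pbox p d)"
  unfolding pbox_eq_cbox by (simp_all add: compact_cbox convex_box)

text \<open>The normalised sum is a convex combination of two points of the cube, while the heights
  add. Convolving two kernels of height 1 therefore leads to height 2, the height used in the
  geometric condition on the domain.\<close>

lemma cone_seg_add: "x \<in> cone_seg p d \<sigma> \<Longrightarrow> y \<in> cone_seg p d \<tau> \<Longrightarrow> x + y \<in> cone_seg p d (\<sigma> + \<tau>)"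
proof -
  assume "x \<in> cone_seg p d \<sigma>" "y \<in> cone_seg p d \<tau>"
  then obtain s b t c where *: "x = s *\<^sub>R b" "0 < s" "s \<le> \<sigma>" "b \<in> pbox p d"
      "y = t *\<^sub>R c" "0 < t" "t \<le> \<tau>" "c \<in> pbox p d"
    unfolding cone_seg_def by auto
  let ?e = "(s / (s + t)) *\<^sub>R b + (t / (s + t)) *\<^sub>R c"
  have "?e \<in> pbox p d"
    by (rule convexD[OF convex_pbox]) (use * in \<open>auto simp: add_divide_distrib[symmetric]\<close>)
  moreover have "x + y = (s + t) *\<^sub>R ?e" using * by (simp add: scaleR_add_right)
  ultimately show ?thesis unfolding cone_seg_def using * by (intro CollectI exI[of _ "s + t"] exI[of _ ?e]) auto
qed

lemma cone_seg_mono: "\<sigma> \<le> \<tau> \<Longrightarrow> cone_seg p d \<sigma> \<subseteq> cone_seg p d \<tau>"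
  unfolding cone_seg_def by force

lemma tsupp_dil_subset:
  assumes f: "test f" and t: "t > 0" and s: "tsupp f \<subseteq> S"
  shows "tsupp (dil t f) \<subseteq> (\<lambda>x. t *\<^sub>R x) ` S"
proof -
  have "tsupp (dil t f) \<subseteq> (\<lambda>x. t *\<^sub>R x) ` tsupp f"
  proof (rule tsupp_subset)
    show "closed ((\<lambda>x. t *\<^sub>R x) ` tsupp f)"
      by (intro compact_imp_closed compact_scaling test_compact[OF f])
    fix x assume x: "x \<notin> (\<lambda>x. t *\<^sub>R x) ` tsupp f"
    have "(1 / t) *\<^sub>R x \<notin> tsupp f"
      using x t image_eqI[of x "\<lambda>x. t *\<^sub>R x" "(1 / t) *\<^sub>R x" "tsupp f"] by auto
    then show "dil t f x = 0" by (simp add: dil_def not_in_tsupp)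
  qed
  with s show ?thesis by blast
qed

text \<open>Take for \<rho> a product of one-dimensional densities h_i, so that its dilate is the
  product of the dilated densities g_i. The difference g_1 g_2 g_3 - h_1 h_2 h_3 is replaced one
  factor at a time, and each g_i - h_i has mean zero, hence a compactly supported primitive. This
  solves the divergence equation explicitly.\<close>

lemma kernel_pieces:
  assumes d: "d > 0" and l: "0 < l" "l < 1" and lp: "\<And>i. (1 / l - 1) * \<bar>p $ i\<bar> \<le> d"
  obtains \<rho> \<Psi> where "test \<rho>" "\<And>k. test (\<Psi> k)" "tsupp \<rho> \<subseteq> pbox p d" "\<And>k. tsupp (\<Psi> k) \<subseteq> pbox p d"
    "(\<integral>x. \<rho> x \<partial>lborel) = 1" "\<And>x. (\<Sum>k\<in>UNIV. pd k (\<Psi> k) x) = dil l \<rho> x - \<rho> x"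
proof -
  obtain F where F: "smooth1 F" "\<And>x. x \<le> 0 \<Longrightarrow> F x = 0" "\<And>x. x \<ge> 1 \<Longrightarrow> F x = (1::real)"
    "\<And>x. deriv F x \<ge> 0" "\<And>x. 0 < x \<Longrightarrow> x < 1 \<Longrightarrow> deriv F x > 0"
    using smooth_step by metis
  \<comment> \<open>A smooth step rising from 0 at p_i - d to 1 at p_i + d; its derivative is the
    density in the i-th variable.\<close>
  define H where "H i x = F ((1 / (2 * d)) * (d - p $ i) + (1 / (2 * d)) * x)" for i x
  have arg: "(1 / (2 * d)) * (d - p $ i) + (1 / (2 * d)) * x = (x - p $ i + d) / (2 * d)" for i x
    using d by (simp add: field_simps)
  have H: "smooth1 (H i)" for i unfolding H_def[abs_def] by (rule smooth1_affine[OF F(1)])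
  have H0: "H i x = 0" if "x \<le> p $ i - d" for i x
    unfolding H_def arg using d that by (intro F(2)) (simp add: divide_le_0_iff)
  have H1: "H i x = 1" if "x \<ge> p $ i + d" for i x
    unfolding H_def arg using d that by (intro F(3)) (simp add: le_divide_eq)
  define h where "h i = deriv (H i)" for i
  have h: "smooth1 (h i)" "(H i has_real_derivative h i x) (at x)" for i x
    using smooth1_deriv'[OF H] by (auto simp: h_def)
  have h_eq: "h i x = (1 / (2 * d)) * deriv F ((x - p $ i + d) / (2 * d))" for i x
  proof -
    have "(F has_real_derivative deriv F y) (at y)" for y using smooth1_deriv'[OF F(1)] by blast
    then have "(H i has_real_derivative (deriv F ((1 / (2 * d)) * (d - p $ i) + (1 / (2 * d)) * x) * (1 / (2 * d)))) (at x)"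
      unfolding H_def[abs_def] by (rule DERIV_chain2) (use d in \<open>auto intro!: derivative_eq_intros\<close>)
    then show ?thesis unfolding arg h_def by (simp add: DERIV_imp_deriv)
  qed
  have h_nonneg: "h i x \<ge> 0" for i x using d F(4) by (simp add: h_eq)
  have h_pos: "h i (p $ i) > 0" for i using d F(5)[of "1/2"] by (simp add: h_eq)
  have dF0: "deriv F y = 0" if "y < 0 \<or> y > 1" for y
  proof -
    have der: "(F has_real_derivative deriv F y) (at y)" using smooth1_deriv'[OF F(1)] by blast
    from that show ?thesis
    proof
      assume "y < 0"
      then have "((\<lambda>_. 0) has_real_derivative deriv F y) (at y)"
        by (intro has_field_derivative_transform_within_open[OF der, of "{..<0}"]) (auto simp: F(2))
      then show ?thesis using DERIV_const DERIV_unique by blast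
    next
      assume "y > 1"
      then have "((\<lambda>_. 1) has_real_derivative deriv F y) (at y)"
        by (intro has_field_derivative_transform_within_open[OF der, of "{1<..}"]) (auto simp: F(3))
      then show ?thesis using DERIV_const DERIV_unique by blast
    qed
  qed
  have h0: "h i x = 0" if "x < p $ i - d \<or> x > p $ i + d" for i x
    unfolding h_eq using that d dF0[of "(x - p $ i + d) / (2 * d)"]
    by (auto simp: divide_less_0_iff less_divide_eq)
  define \<mu> where "\<mu> = 1 / l"
  have mu: "\<mu> > 1" using l by (simp add: \<mu>_def)
  \<comment> \<open>The hypothesis on \<open>l\<close> says that the dilation moves each coordinate
    of the centre by at most d. This is why the dilated density also stays within distance 2 d of
    the centre and the same cube serves for all functions.\<close>
  have pb: "\<bar>(\<mu> - 1) * p $ i\<bar> \<le> d" for i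
    using lp[of i] mu by (simp add: abs_mult \<mu>_def)
  have far: "\<mu> * x > p $ i + d" if "x > p $ i + 2 * d" for i x
  proof -
    have "\<mu> * x > \<mu> * (p $ i + 2 * d)" using that mu by simp
    moreover have "\<mu> * (p $ i + 2 * d) = p $ i + 2 * d + (\<mu> - 1) * p $ i + (\<mu> - 1) * (2 * d)" by (simp add: algebra_simps)
    ultimately show ?thesis using pb[of i] d mult_nonneg_nonneg[of "\<mu> - 1" "2 * d"] mu by linarith
  qed
  have near: "\<mu> * x < p $ i - d" if "x < p $ i - 2 * d" for i x
  proof -
    have "\<mu> * x < \<mu> * (p $ i - 2 * d)" using that mu by simp
    moreover have "\<mu> * (p $ i - 2 * d) = p $ i - 2 * d + (\<mu> - 1) * p $ i - (\<mu> - 1) * (2 * d)" by (simp add: algebra_simps)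
    ultimately show ?thesis using pb[of i] d mult_nonneg_nonneg[of "\<mu> - 1" "2 * d"] mu by linarith
  qed
  \<comment> \<open>Both steps equal 0 far to the left and 1 far to the right, so their difference
    is a primitive of \<open>g i\<close> minus \<open>h i\<close> with compact support.\<close>
  define R where "R i x = H i (0 + \<mu> * x) - H i x" for i x
  define g where "g i x = \<mu> * h i (0 + \<mu> * x)" for i x
  have g: "smooth1 (g i)" for i unfolding g_def[abs_def] by (intro smooth1_cmult smooth1_affine h)
  have dR: "(R i has_real_derivative (g i x - h i x)) (at x)" for i x
    unfolding R_def[abs_def] g_def
  proof (rule DERIV_diff[OF _ h(2)])
    have "((\<lambda>x. H i (0 + \<mu> * x)) has_real_derivative h i (0 + \<mu> * x) * \<mu>) (at x)"
      by (rule DERIV_chain2[OF h(2)]) (auto intro!: derivative_eq_intros)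
    then show "((\<lambda>x. H i (0 + \<mu> * x)) has_real_derivative \<mu> * h i (0 + \<mu> * x)) (at x)" by (simp add: mult.commute)
  qed
  have R: "smooth1 (R i)" for i
  proof -
    obtain D where D: "D 0 = g i" "\<And>n x. (D n has_real_derivative D (Suc n) x) (at x)"
      using g[of i] unfolding smooth1_def by blast
    obtain E where E: "E 0 = h i" "\<And>n x. (E n has_real_derivative E (Suc n) x) (at x)"
      using h(1)[of i] unfolding smooth1_def by blast
    have "smooth1 (\<lambda>x. g i x - h i x)" unfolding smooth1_def
      by (rule exI[of _ "\<lambda>n x. D n x - E n x"]) (use D E in \<open>auto intro!: DERIV_diff\<close>)
    then show ?thesis by (rule smooth1_antideriv) (rule dR)
  qed
  have out: "h i x = 0" "g i x = 0" "R i x = 0" if "\<bar>x - p $ i\<bar> > 2 * d" for i x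
  proof -
    from that consider "x > p $ i + 2 * d" | "x < p $ i - 2 * d" by linarith
    then have "h i x = 0 \<and> g i x = 0 \<and> R i x = 0"
    proof cases
      case 1 then show ?thesis using far[OF 1] d by (auto simp: g_def R_def h0 H1)
    next
      case 2 then show ?thesis using near[OF 2] d by (auto simp: g_def R_def h0 H0)
    qed
    then show "h i x = 0" "g i x = 0" "R i x = 0" by auto
  qed
  define P where "P u v w x = u (x $ 1) * (v (x $ 2) * w (x $ 3))" for u v w :: "real \<Rightarrow> real" and x :: R3
  have sP: "smooth_fun (P u v w)" if "smooth1 u" "smooth1 v" "smooth1 w" for u v w
    unfolding P_def[abs_def] using that by (intro smooth_fun_mult smooth_fun_compose1[OF _ smooth_fun_nth])
  have tP: "test_on (pbox p d) (P u v w)" if "smooth1 u" "smooth1 v" "smooth1 w"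
    "\<And>x. \<bar>x - p $ 1\<bar> > 2 * d \<Longrightarrow> u x = 0" "\<And>x. \<bar>x - p $ 2\<bar> > 2 * d \<Longrightarrow> v x = 0" "\<And>x. \<bar>x - p $ 3\<bar> > 2 * d \<Longrightarrow> w x = 0" for u v w
  proof (rule test_onI[OF sP compact_pbox])
    fix x assume "x \<notin> pbox p d"
    then obtain i where i: "\<bar>x $ i - p $ i\<bar> > 2 * d" unfolding pbox_def by (auto simp: not_le)
    consider "i = 1" | "i = 2" | "i = 3" using exhaust_3[of i] by auto
    then show "P u v w x = 0" using i that(4-6) by cases (auto simp: P_def)
  qed (use that in auto)
  have pd1: "pd j (\<lambda>x. u (x $ i)) = (\<lambda>x. deriv u (x $ i) * (if i = j then 1 else 0))" if "smooth1 u" for u i j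
  proof
    fix x show "pd j (\<lambda>x. u (x $ i)) x = deriv u (x $ i) * (if i = j then 1 else 0)"
      using pd_compose1[of u "deriv u (x $ i)" "\<lambda>x. x $ i" x j] smooth1_deriv'[OF that] by (simp add: pd_nth differentiable_nth)
  qed
  have pdP: "pd 1 (P u v w) = P (deriv u) v w" "pd 2 (P u v w) = P u (deriv v) w" "pd 3 (P u v w) = P u v (deriv w)"
    if "smooth1 u" "smooth1 v" "smooth1 w" for u v w
    unfolding P_def[abs_def]
    by (simp_all add: pd_mult' pd1 that smooth_fun_mult smooth_fun_compose1[OF _ smooth_fun_nth])
  define c where "c = (\<integral>x. P (h 1) (h 2) (h 3) x \<partial>lborel)"
  have th: "test_on (pbox p d) (P (h 1) (h 2) (h 3))" by (intro tP h out)
  have c: "c > 0"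
    unfolding c_def
  proof (rule integral_pos_of_pos[of _ p])
    show "integrable lborel (P (h 1) (h 2) (h 3))" by (rule integrable_test[OF test_on_test[OF th]])
    show "continuous_on UNIV (P (h 1) (h 2) (h 3))" by (rule test_continuous[OF test_on_test[OF th]])
  qed (auto simp: P_def h_nonneg h_pos)
  define \<rho> where "\<rho> x = (1 / c) * P (h 1) (h 2) (h 3) x" for x
  \<comment> \<open>In the k-th component the earlier factors are still undilated, the later ones
    already dilated, and the k-th is the primitive: the order in which the product difference
    telescopes.\<close>
  define \<Psi> where "\<Psi> k = (\<lambda>x. (1 / c) * (if k = 1 then P (R 1) (g 2) (g 3) else if k = 2 then P (h 1) (R 2) (g 3) else P (h 1) (h 2) (R 3)) x)" for k :: 3
  have t\<rho>: "test_on (pbox p d) \<rho>" unfolding \<rho>_def[abs_def] by (intro test_on_cmult th)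
  have t\<Psi>: "test_on (pbox p d) (\<Psi> k)" for k
    unfolding \<Psi>_def by (intro test_on_cmult) (auto intro!: tP h g R out)
  have dR': "deriv (R i) = (\<lambda>x. g i x - h i x)" for i using dR by (auto intro: DERIV_imp_deriv)
  have tt: "test (P (R 1) (g 2) (g 3))" "test (P (h 1) (R 2) (g 3))" "test (P (h 1) (h 2) (R 3))"
    by (rule test_on_test[OF tP], (rule R g h(1) out, assumption?)+)+
  have "\<Psi> 1 = (\<lambda>x. (1 / c) * P (R 1) (g 2) (g 3) x)" "\<Psi> 2 = (\<lambda>x. (1 / c) * P (h 1) (R 2) (g 3) x)"
    "\<Psi> 3 = (\<lambda>x. (1 / c) * P (h 1) (h 2) (R 3) x)"
    by (simp_all add: \<Psi>_def)
  then have pds: "pd 1 (\<Psi> 1) = (\<lambda>x. (1 / c) * P (\<lambda>x. g 1 x - h 1 x) (g 2) (g 3) x)"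
    "pd 2 (\<Psi> 2) = (\<lambda>x. (1 / c) * P (h 1) (\<lambda>x. g 2 x - h 2 x) (g 3) x)"
    "pd 3 (\<Psi> 3) = (\<lambda>x. (1 / c) * P (h 1) (h 2) (\<lambda>x. g 3 x - h 3 x) x)"
    by (simp_all only: pd_cmult'[OF tt(1)] pd_cmult'[OF tt(2)] pd_cmult'[OF tt(3)] pdP R g h dR')
  show thesis
  proof (rule that)
    show "test \<rho>" "test (\<Psi> k)" for k using t\<rho> t\<Psi> test_on_test by blast+
    show "tsupp \<rho> \<subseteq> pbox p d" "tsupp (\<Psi> k) \<subseteq> pbox p d" for k using t\<rho> t\<Psi> by (auto simp: test_on_def)
    show "(\<integral>x. \<rho> x \<partial>lborel) = 1" using c by (simp add: \<rho>_def c_def)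
    fix x
    have "dil l \<rho> x = (1 / c) * P (g 1) (g 2) (g 3) x"
      using l by (simp add: dil_def \<rho>_def P_def g_def \<mu>_def power3_eq_cube)
    then show "(\<Sum>k\<in>UNIV. pd k (\<Psi> k) x) = dil l \<rho> x - \<rho> x"
      unfolding sum_3 pds \<rho>_def by (simp add: P_def algebra_simps)
  qed
qed

text \<open>As \<rho> has integral 1, the error at x is an average of \<psi>(x + y) - \<psi>(x) over
  |y| at most t r, and the Lipschitz bound yields a factor t. The restriction t r \<le> 1 keeps the
  error inside a fixed neighbourhood of the support.\<close>

lemma approximate_identity_bound:
  assumes \<rho>: "test \<rho>" and \<rho>1: "(\<integral>x. \<rho> x \<partial>lborel) = 1" and \<psi>: "test \<psi>" and r: "\<And>x. \<rho> x \<noteq> 0 \<Longrightarrow> norm x \<le> r" "r > 0"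
  obtains C where "C \<ge> 0" "\<And>t. 0 < t \<Longrightarrow> t * r \<le> 1 \<Longrightarrow> L2n (\<lambda>x. cv \<psi> (refl_fun (dil t \<rho>)) x - \<psi> x) \<le> C * t"
proof -
  obtain L where L: "L \<ge> 0" "\<And>x y. \<bar>\<psi> x - \<psi> y\<bar> \<le> L * norm (x - y)" using test_Lipschitz[OF \<psi>] by blast
  let ?S = "nbhd1 (tsupp \<psi>)"
  define I where "I = (\<integral>x. \<bar>\<rho> x\<bar> \<partial>lborel)"
  have "L2n (\<lambda>x. cv \<psi> (refl_fun (dil t \<rho>)) x - \<psi> x) \<le> (L * r * I * t) * sqrt (measure lborel ?S)"
    if t: "0 < t" "t * r \<le> 1" for t
  proof -
    define k where "k = dil t \<rho>"
    have k: "test k" unfolding k_def by (rule test_dil[OF \<rho> t(1)])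
    have ksup: "norm y \<le> t * r" if "k y \<noteq> 0" for y
    proof -
      have "\<rho> ((1 / t) *\<^sub>R y) \<noteq> 0" using that by (auto simp: k_def dil_def)
      from r(1)[OF this] show ?thesis using t(1) by (simp add: divide_le_eq mult.commute)
    qed
    have k1: "(\<integral>x. k x \<partial>lborel) = 1" unfolding k_def by (simp add: integral_dil borel_measurable_test \<rho> t \<rho>1)
    have sh: "test (\<lambda>y. \<psi> (x + y))" for x using test_affine[OF \<psi>, of 1 x] by simp
    have int: "integrable lborel (\<lambda>y. k y * \<psi> (x + y))" "integrable lborel (\<lambda>y. k y * \<psi> x)" for x
      using integrable_test_mult[OF k test_continuous[OF sh, of _ x]] integrable_test[OF k] by auto
    have eq: "cv \<psi> (refl_fun k) x - \<psi> x = (\<integral>y. k y * (\<psi> (x + y) - \<psi> x) \<partial>lborel)" for x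
    proof -
      have "cv \<psi> (refl_fun k) x = (\<integral>y. k (0 - y) * \<psi> (x + (0 - y)) \<partial>lborel)"
        unfolding cv_commute[OF \<psi> test_refl_fun[OF k]] cv_eq by (simp add: refl_fun_def)
      also have "\<dots> = (\<integral>y. k y * \<psi> (x + y) \<partial>lborel)"
        by (rule integral_shift_refl[of "\<lambda>y. k y * \<psi> (x + y)"]) (intro borel_measurable_times borel_measurable_test k sh)
      finally show ?thesis using int[of x] k1 by (simp add: right_diff_distrib)
    qed
    show ?thesis unfolding k_def[symmetric]
    proof (rule L2n_bound[OF L2_test nbhd1_fmeasurable[OF test_compact[OF \<psi>]]])
      show "test (\<lambda>x. cv \<psi> (refl_fun k) x - \<psi> x)" by (intro test_on_diff test_cv \<psi> test_refl_fun k)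
      show "0 \<le> L * r * I * t" using L(1) r(2) t(1) by (simp add: I_def)
    next
      fix x assume x: "x \<notin> ?S"
      have "k y * (\<psi> (x + y) - \<psi> x) = 0" for y
      proof (cases "k y = 0")
        case False
        then have "norm y \<le> 1" using ksup[OF False] t(2) by simp
        then show ?thesis using not_in_nbhd1[OF x, of y] not_in_tsupp[of x \<psi>] not_in_tsupp[of "x + y" \<psi>] by auto
      qed simp
      then show "cv \<psi> (refl_fun k) x - \<psi> x = 0" unfolding eq by (simp only: integral_zero)
    next
      fix x
      have "\<bar>cv \<psi> (refl_fun k) x - \<psi> x\<bar> \<le> (\<integral>y. \<bar>k y * (\<psi> (x + y) - \<psi> x)\<bar> \<partial>lborel)"
        unfolding eq by (rule integral_abs_bound)
      also have "\<dots> \<le> (\<integral>y. \<bar>k y\<bar> * (L * (t * r)) \<partial>lborel)"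
      proof (rule integral_mono)
        show "integrable lborel (\<lambda>y. \<bar>k y * (\<psi> (x + y) - \<psi> x)\<bar>)"
          using int[of x] by (intro integrable_abs) (simp add: right_diff_distrib)
        show "integrable lborel (\<lambda>y. \<bar>k y\<bar> * (L * (t * r)))" using integrable_test[OF k] by simp
        fix y show "\<bar>k y * (\<psi> (x + y) - \<psi> x)\<bar> \<le> \<bar>k y\<bar> * (L * (t * r))"
        proof (cases "k y = 0")
          case False
          have "\<bar>\<psi> (x + y) - \<psi> x\<bar> \<le> L * norm y" using L(2)[of "x + y" x] by simp
          also have "\<dots> \<le> L * (t * r)" by (intro mult_left_mono ksup[OF False] L)
          finally show ?thesis by (simp add: abs_mult mult_left_mono)
        qed simp
      qed
      also have "\<dots> = L * r * I * t" by (simp add: I_def k_def integral_abs_dil[OF \<rho> t(1)])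
      finally show "\<bar>cv \<psi> (refl_fun k) x - \<psi> x\<bar> \<le> L * r * I * t" .
    qed
  qed
  then show thesis
    using L(1) r(2) by (intro that[of "L * r * I * sqrt (measure lborel ?S)"]) (auto simp: I_def mult_ac)
qed

text \<open>Differentiation commutes with convolution, so the rate for \<psi> also holds for its
  partial derivatives.\<close>

lemma approximate_identity:
  assumes \<rho>: "test \<rho>" and \<rho>1: "(\<integral>x. \<rho> x \<partial>lborel) = 1" and \<psi>: "test \<psi>" and l: "0 < l" "l < 1"
  shows "(\<lambda>N. h1n (\<lambda>x. cv \<psi> (refl_fun (dil (l ^ N) \<rho>)) x - \<psi> x)) \<longlonglongrightarrow> 0"
proof -
  obtain r where r: "r > 0" "\<And>x. x \<in> tsupp \<rho> \<Longrightarrow> norm x \<le> r"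
    using compact_imp_bounded[OF test_compact[OF \<rho>]] unfolding bounded_pos by blast
  have r': "\<rho> x \<noteq> 0 \<Longrightarrow> norm x \<le> r" for x using r(2)[of x] not_in_tsupp by blast
  let ?D = "\<lambda>f t. L2n (\<lambda>x. cv f (refl_fun (dil t \<rho>)) x - f x)"
  have ex: "\<exists>C\<ge>0. \<forall>t. 0 < t \<longrightarrow> t * r \<le> 1 \<longrightarrow> ?D f t \<le> C * t" if "test f" for f
    using approximate_identity_bound[OF \<rho> \<rho>1 that r' r(1)] by metis
  obtain A where A: "A \<ge> 0" "\<And>t. 0 < t \<Longrightarrow> t * r \<le> 1 \<Longrightarrow> ?D \<psi> t \<le> A * t" using ex[OF \<psi>] by blast
  obtain B where B: "\<And>j. B j \<ge> 0" "\<And>j t. 0 < t \<Longrightarrow> t * r \<le> 1 \<Longrightarrow> ?D (pd j \<psi>) t \<le> B j * t"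
    using ex[OF test_on_pd[OF \<psi>]] by metis
  define C where "C = A + (\<Sum>j\<in>UNIV. B j)"
  have bd: "h1n (\<lambda>x. cv \<psi> (refl_fun (dil t \<rho>)) x - \<psi> x) \<le> 2 * (C * t)" if t: "0 < t" "t * r \<le> 1" for t
  proof (rule h1n_le)
    have k: "test (refl_fun (dil t \<rho>))" by (intro test_refl_fun test_dil \<rho> t)
    have "A \<le> C" "B j \<le> C" for j
      using A(1) B(1) member_le_sum[of j UNIV B] by (auto simp: C_def sum_nonneg add_increasing)
    then have m: "A * t \<le> C * t" "B j * t \<le> C * t" for j using t(1) by (auto intro: mult_right_mono)
    show "?D \<psi> t \<le> C * t" using A(2)[OF t] m(1) by linarith
    show "L2n (pd j (\<lambda>x. cv \<psi> (refl_fun (dil t \<rho>)) x - \<psi> x)) \<le> C * t" for j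
      using B(2)[OF t, of j] m(2)[of j] by (simp add: pd_diff' test_cv \<psi> k pd_cv_left)
  qed
  have lim: "(\<lambda>N. l ^ N) \<longlonglongrightarrow> 0" using l by (intro LIMSEQ_power_zero) simp
  show ?thesis
  proof (rule Lim_null_comparison)
    have "(\<lambda>N. l ^ N * r) \<longlonglongrightarrow> 0" by (rule tendsto_mult_left_zero[OF lim])
    from order_tendstoD(2)[OF this, of 1]
    show "\<forall>\<^sub>F N in sequentially. norm (h1n (\<lambda>x. cv \<psi> (refl_fun (dil (l ^ N) \<rho>)) x - \<psi> x)) \<le> 2 * (C * l ^ N)"
      using l by (auto elim!: eventually_mono intro!: bd simp: h1n_nonneg)
    show "(\<lambda>N. 2 * (C * l ^ N)) \<longlonglongrightarrow> 0" by (intro tendsto_mult_right_zero lim)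
  qed
qed

text \<open>Any ratio close enough to 1 works, by continuity. The fourth power appears because the
  scales of the kernel are powers of r^4, as required by \<open>OB_sum_dil_pd\<close>.\<close>

lemma exists_ratio:
  fixes p :: R3
  assumes d: "d > 0"
  obtains r :: real where "0 < r" "r < 1" "\<And>i. (1 / r ^ 4 - 1) * \<bar>p $ i\<bar> \<le> d"
proof -
  have "((\<lambda>r. (1 / r ^ 4 - 1) * norm p) \<longlongrightarrow> (1 / 1 ^ 4 - 1) * norm p) (at_left (1::real))"
    by (intro tendsto_intros) auto
  then have "\<forall>\<^sub>F r in at_left 1. (1 / r ^ 4 - 1) * norm p < d"
    using d by (intro order_tendstoD(2)) auto
  moreover have "\<forall>\<^sub>F r in at_left (1::real). r \<in> {0<..<1}" by (rule eventually_at_left_real) simp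
  ultimately have "\<forall>\<^sub>F r in at_left 1. (1 / r ^ 4 - 1) * norm p < d \<and> r \<in> {0<..<1}" by (rule eventually_conj)
  then obtain r :: real where r: "(1 / r ^ 4 - 1) * norm p < d" "0 < r" "r < 1"
    using eventually_happens'[of "at_left (1::real)"] by (auto simp: trivial_limit_at_left_real)
  have "1 / r ^ 4 - 1 \<ge> 0" using r(2,3) by (simp add: power_le_one)
  then have "(1 / r ^ 4 - 1) * \<bar>p $ i\<bar> \<le> d" for i
    using r(1) mult_left_mono[OF component_le_norm_cart[of p i]] by (meson less_imp_le order_trans)
  with r that show thesis by blast
qed

text \<open>\<open>E\<close> is a regularised vector field with divergence \<open>\<delta> - \<rho>\<close> and singularity of order \<open>-2\<close> at the origin;
  \<open>RN N\<close> approximates \<open>\<delta>\<close>.\<close>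
lemma kernel_family:
  assumes d: "d > 0"
  obtains \<rho> :: "R3 \<Rightarrow> real" and E :: "nat \<Rightarrow> 3 \<Rightarrow> R3 \<Rightarrow> real" and RN :: "nat \<Rightarrow> R3 \<Rightarrow> real" where
    "test \<rho>" "\<And>N k. test (E N k)" "\<And>N. test (RN N)"
    "tsupp \<rho> \<subseteq> cone_seg p d 1" "\<And>N k. tsupp (E N k) \<subseteq> cone_seg p d 1"
    "\<And>N x. (\<Sum>k\<in>UNIV. pd k (E N k) x) = RN N x - \<rho> x"
    "\<exists>C. \<forall>N k. OB (E N k) C" "\<exists>C. \<forall>N k m. OB (pd m (E N k)) C"
    "\<And>e. e > 0 \<Longrightarrow> \<exists>N0. \<forall>N\<ge>N0. \<forall>M\<ge>N0. \<forall>k. OB (\<lambda>x. E N k x - E M k x) e"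
    "\<And>\<psi>. test \<psi> \<Longrightarrow> (\<lambda>N. h1n (\<lambda>x. cv \<psi> (refl_fun (RN N)) x - \<psi> x)) \<longlonglongrightarrow> 0"
proof -
  obtain r where r: "0 < r" "r < 1" "\<And>i. (1 / r ^ 4 - 1) * \<bar>p $ i\<bar> \<le> d" using exists_ratio[OF d] by blast
  define l where "l = r ^ 4"
  have l: "0 < l" "l < 1" using r by (auto simp: l_def power_less_one_iff)
  have lp: "(1 / l - 1) * \<bar>p $ i\<bar> \<le> d" for i using r(3) by (simp add: l_def)
  have lj: "l ^ j > 0" "l ^ j \<le> 1" for j using l by (auto intro: power_le_one)
  have "\<exists>\<rho> \<Psi>. test \<rho> \<and> (\<forall>k. test (\<Psi> k)) \<and> tsupp \<rho> \<subseteq> pbox p d \<and> (\<forall>k. tsupp (\<Psi> k) \<subseteq> pbox p d) \<and>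
      (\<integral>x. \<rho> x \<partial>lborel) = 1 \<and> (\<forall>x. (\<Sum>k\<in>UNIV. pd k (\<Psi> k) x) = dil l \<rho> x - \<rho> x)"
  proof (rule kernel_pieces[OF d l lp])
    fix \<rho> \<Psi>
    assume "test \<rho>" "\<And>k. test (\<Psi> k)" "tsupp \<rho> \<subseteq> pbox p d" "\<And>k. tsupp (\<Psi> k) \<subseteq> pbox p d"
      "(\<integral>x. \<rho> x \<partial>lborel) = 1" "\<And>x. (\<Sum>k\<in>UNIV. pd k (\<Psi> k) x) = dil l \<rho> x - \<rho> x"
    then show ?thesis by (intro exI[of _ \<rho>] exI[of _ \<Psi>]) simp
  qed
  then obtain \<rho> \<Psi> where K: "test \<rho> \<and> (\<forall>k. test (\<Psi> k)) \<and> tsupp \<rho> \<subseteq> pbox p d \<and> (\<forall>k. tsupp (\<Psi> k) \<subseteq> pbox p d) \<and>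
      (\<integral>x. \<rho> x \<partial>lborel) = 1 \<and> (\<forall>x. (\<Sum>k\<in>UNIV. pd k (\<Psi> k) x) = dil l \<rho> x - \<rho> x)"
    by (elim exE) (rule that)
  then have \<rho>: "test \<rho>" and \<Psi>: "\<And>k. test (\<Psi> k)" and supp: "tsupp \<rho> \<subseteq> pbox p d" "\<And>k. tsupp (\<Psi> k) \<subseteq> pbox p d"
    and \<rho>1: "(\<integral>x. \<rho> x \<partial>lborel) = 1" and div: "\<And>x. (\<Sum>k\<in>UNIV. pd k (\<Psi> k) x) = dil l \<rho> x - \<rho> x"
    by simp_all
  \<comment> \<open>The weight l^j cancels the factor produced by differentiating the dilate, so
    first derivatives of the pieces are plain dilates of a derivative, as almost orthogonality
    needs. Undifferentiated pieces become geometrically small, which gives convergence in operator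
    norm.\<close>
  define e where "e k j = (\<lambda>x. l ^ j * dil (l ^ j) (\<Psi> k) x)" for k j
  have e: "test (e k j)" for k j unfolding e_def by (intro test_on_cmult test_dil \<Psi> lj)
  have pde: "pd m (e k j) = dil (l ^ j) (pd m (\<Psi> k))" for m k j
    unfolding e_def pd_cmult'[OF test_dil[OF \<Psi> lj(1)]] pd_dil[OF \<Psi> lj(1)] using l by simp
  define E where "E N k = (\<lambda>x. \<Sum>j<N. e k j x)" for N k
  define RN where "RN N = dil (l ^ N) \<rho>" for N
  define J where "J k = (\<integral>x. \<bar>\<Psi> k x\<bar> \<partial>lborel)" for k
  define JJ where "JJ = (\<Sum>k\<in>UNIV. J k)"
  have J0: "J k \<ge> 0" for k by (simp add: J_def)
  have J: "J k \<ge> 0" "J k \<le> JJ" for k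
    unfolding JJ_def using J0 member_le_sum[of k UNIV J] by auto
  have JJ: "JJ \<ge> 0" using J[of 1] by linarith
  have OBe: "OB (e k j) (l ^ j * JJ)" for k j
  proof (rule OB_mono)
    show "OB (e k j) (\<bar>l ^ j\<bar> * J k)" unfolding e_def J_def by (intro OB_cmult OB_dil test_dil \<Psi> lj)
    show "\<bar>l ^ j\<bar> * J k \<le> l ^ j * JJ" using J[of k] l by (simp add: mult_left_mono)
  qed
  have pdE: "pd m (E N k) = (\<lambda>x. \<Sum>j<N. dil (l ^ j) (pd m (\<Psi> k)) x)" for m N k
    unfolding E_def by (simp add: pd_sum' e pde)
  have OBdiff: "OB (\<lambda>x. E N k x - E M k x) (JJ / (1 - l) * l ^ M)" if "M \<le> N" for N M k
  proof -
    have "(\<lambda>x. E N k x - E M k x) = (\<lambda>x. \<Sum>j\<in>{M..<N}. e k j x)"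
    proof
      fix x
      have "(\<Sum>j<N. e k j x) = (\<Sum>j<M. e k j x) + (\<Sum>j\<in>{M..<N}. e k j x)"
        using sum.atLeastLessThan_concat[of 0 M N "\<lambda>j. e k j x"] that by (simp add: atLeast0LessThan)
      then show "E N k x - E M k x = (\<Sum>j\<in>{M..<N}. e k j x)" by (simp add: E_def)
    qed
    moreover have "OB (\<lambda>x. \<Sum>j\<in>{M..<N}. e k j x) (\<Sum>j\<in>{M..<N}. l ^ j * JJ)" by (intro OB_sum OBe e)
    moreover have "(\<Sum>j\<in>{M..<N}. l ^ j * JJ) \<le> JJ / (1 - l) * l ^ M"
    proof -
      have "(\<Sum>j\<in>{M..<N}. l ^ j * JJ) = l ^ M * JJ * (\<Sum>j<N - M. l ^ j)"
        using sum.shift_bounds_nat_ivl[of "\<lambda>j. l ^ j * JJ" 0 M "N - M"] that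
        by (simp add: atLeast0LessThan sum_distrib_left power_add mult_ac)
      also have "\<dots> \<le> l ^ M * JJ * (1 / (1 - l))"
        using l JJ by (intro mult_left_mono sum_geometric_le) auto
      finally show ?thesis by (simp add: mult_ac)
    qed
    ultimately show ?thesis using OB_mono by simp
  qed
  show thesis
  proof (rule that[of \<rho> E RN])
    show "test \<rho>" by fact
    show tE: "test (E N k)" for N k unfolding E_def by (intro test_on_sum e)
    show "test (RN N)" for N unfolding RN_def by (intro test_dil \<rho> lj)
    show "tsupp \<rho> \<subseteq> cone_seg p d 1"
    proof
      fix x assume "x \<in> tsupp \<rho>"
      then show "x \<in> cone_seg p d 1" unfolding cone_seg_def using supp(1)
        by (intro CollectI exI[of _ 1] exI[of _ x]) auto
    qed
    show "tsupp (E N k) \<subseteq> cone_seg p d 1" for N k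
    proof -
      have "tsupp (E N k) \<subseteq> (\<Union>j<N. tsupp (e k j))"
      proof (rule tsupp_subset)
        show "closed (\<Union>j<N. tsupp (e k j))" by (intro closed_UN) (auto simp: closed_tsupp)
        fix x assume "x \<notin> (\<Union>j<N. tsupp (e k j))"
        then show "E N k x = 0" unfolding E_def by (intro sum.neutral) (auto intro: not_in_tsupp)
      qed
      also have "\<dots> \<subseteq> cone_seg p d 1"
      proof (rule UN_least)
        fix j
        have "tsupp (e k j) \<subseteq> tsupp (dil (l ^ j) (\<Psi> k))"
          by (rule tsupp_subset[OF closed_tsupp]) (simp add: e_def not_in_tsupp)
        also have "\<dots> \<subseteq> (\<lambda>x. l ^ j *\<^sub>R x) ` pbox p d" by (intro tsupp_dil_subset \<Psi> lj supp)
        also have "\<dots> \<subseteq> cone_seg p d 1" unfolding cone_seg_def using lj[of j] by auto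
        finally show "tsupp (e k j) \<subseteq> cone_seg p d 1" .
      qed
      finally show ?thesis .
    qed
    show "(\<Sum>k\<in>UNIV. pd k (E N k) x) = RN N x - \<rho> x" for N x
    proof -
      have "(\<Sum>k\<in>UNIV. pd k (E N k) x) = (\<Sum>j<N. \<Sum>k\<in>UNIV. dil (l ^ j) (pd k (\<Psi> k)) x)"
        unfolding pdE by (rule sum.swap)
      also have "\<dots> = (\<Sum>j<N. dil (l ^ j) (\<lambda>x. dil l \<rho> x - \<rho> x) x)"
      proof (rule sum.cong[OF refl])
        fix j show "(\<Sum>k\<in>UNIV. dil (l ^ j) (pd k (\<Psi> k)) x) = dil (l ^ j) (\<lambda>x. dil l \<rho> x - \<rho> x) x"
          using fun_cong[OF dil_sum[of "l ^ j" "\<lambda>k. pd k (\<Psi> k)" UNIV], of x] by (simp only: div)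
      qed
      also have "\<dots> = (\<Sum>j<N. dil (l ^ Suc j) \<rho> x - dil (l ^ j) \<rho> x)"
        unfolding dil_diff dil_dil by (simp add: mult.commute)
      also have "\<dots> = RN N x - dil (l ^ 0) \<rho> x" unfolding RN_def by (rule sum_lessThan_telescope)
      finally show ?thesis by (simp add: dil_def)
    qed
    show "\<exists>C. \<forall>N k. OB (E N k) C"
    proof (intro exI allI)
      fix N k show "OB (E N k) (JJ / (1 - l))"
        using OBdiff[of 0 N k] by (simp add: E_def[of 0])
    qed
    show "\<exists>C. \<forall>N k m. OB (pd m (E N k)) C"
    proof -
      have "\<exists>C\<ge>0. \<forall>N. OB (pd m (E N k)) C" for k m
        unfolding pdE l_def using OB_sum_dil_pd[OF \<Psi> r(1,2), of m k] by metis
      then have ex: "\<exists>C. C \<ge> 0 \<and> (\<forall>N. OB (pd m (E N k)) C)" for k m by blast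
      define C where "C k m = (SOME C. C \<ge> 0 \<and> (\<forall>N. OB (pd m (E N k)) C))" for k m
      have C: "C k m \<ge> 0" "OB (pd m (E N k)) (C k m)" for k m N
        using someI_ex[OF ex, of m k] by (auto simp: C_def)
      have "C k m \<le> (\<Sum>k\<in>UNIV. \<Sum>m\<in>UNIV. C k m)" for k m
      proof -
        have "C k m \<le> (\<Sum>m\<in>UNIV. C k m)" by (rule member_le_sum) (use C in auto)
        also have "\<dots> \<le> (\<Sum>k\<in>UNIV. \<Sum>m\<in>UNIV. C k m)" by (rule member_le_sum) (use C in \<open>auto simp: sum_nonneg\<close>)
        finally show ?thesis .
      qed
      then show ?thesis using C(2) OB_mono by blast
    qed
    show "\<exists>N0. \<forall>N\<ge>N0. \<forall>M\<ge>N0. \<forall>k. OB (\<lambda>x. E N k x - E M k x) \<epsilon>" if "\<epsilon> > 0" for \<epsilon>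
    proof -
      have "(\<lambda>M. JJ / (1 - l) * l ^ M) \<longlonglongrightarrow> 0"
        using l by (intro tendsto_mult_right_zero LIMSEQ_power_zero) simp
      from order_tendstoD(2)[OF this \<open>\<epsilon> > 0\<close>]
      obtain N0 where N0: "\<And>M. M \<ge> N0 \<Longrightarrow> JJ / (1 - l) * l ^ M < \<epsilon>" unfolding eventually_sequentially by blast
      have le: "OB (\<lambda>x. E N k x - E M k x) \<epsilon>" if "M \<le> N" "M \<ge> N0" for N M k
        using OB_mono[OF OBdiff[OF that(1)]] N0[OF that(2)] by (simp add: less_imp_le)
      have "OB (\<lambda>x. E N k x - E M k x) \<epsilon>" if "N \<ge> N0" "M \<ge> N0" for N M k
      proof (cases "M \<le> N")
        case False
        then have "OB (\<lambda>x. - (E M k x - E N k x)) \<epsilon>"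
          by (intro OB_uminus le test_on_diff tE that) auto
        then show ?thesis by simp
      qed (use le that in blast)
      then show ?thesis by blast
    qed
    show "(\<lambda>N. h1n (\<lambda>x. cv \<psi> (refl_fun (RN N)) x - \<psi> x)) \<longlonglongrightarrow> 0" if "test \<psi>" for \<psi>
      unfolding RN_def by (rule approximate_identity[OF \<rho> \<rho>1 that l])
  qed
qed

subsection \<open>Inward cones of a Lipschitz domain\<close>

lemma orthogonal_matrix_norm: "orthogonal_matrix Q \<Longrightarrow> norm (Q *v v) = norm (v :: real^'n)"
proof -
  assume "orthogonal_matrix Q"
  then have "orthogonal_transformation ((*v) Q)"
    by (simp add: orthogonal_transformation_matrix matrix_vector_mul_linear)
  then show ?thesis by (rule orthogonal_transformation_norm)
qed

lemma norm_R3_sq: "(norm z)\<^sup>2 = (z $ 1)\<^sup>2 + (z $ 2)\<^sup>2 + (z $ 3)\<^sup>2" for z :: R3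
  unfolding power2_norm_eq_inner inner_vec_def by (simp add: sum_3 power2_eq_square)

lemma norm_diff_pbox: "b \<in> pbox p d \<Longrightarrow> norm (b - p) \<le> 6 * d"
proof -
  assume "b \<in> pbox p d"
  then have "\<bar>(b - p) $ i\<bar> \<le> 2 * d" for i by (auto simp: pbox_def)
  then have "(\<Sum>i\<in>UNIV. \<bar>(b - p) $ i\<bar>) \<le> (\<Sum>i\<in>(UNIV::3 set). 2 * d)" by (rule sum_mono)
  with norm_le_l1_cart[of "b - p"] show ?thesis by simp
qed

text \<open>In the chart the domain lies below the graph of \<zeta>, and its closure weakly below. A
  step whose downward part outweighs L times its horizontal part descends faster than the graph can,
  so it ends strictly below.\<close>

lemma inward_cone_boundary:
  assumes lip: "lipschitz_boundary \<Omega>" and x: "x \<in> frontier \<Omega>"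
  obtains R p d where "R > 0" "d > 0"
    "\<And>y c. y \<in> closure \<Omega> \<Longrightarrow> dist y x \<le> R \<Longrightarrow> c \<in> cone_seg p d 2 \<Longrightarrow> y + c \<in> \<Omega>"
proof -
  from lip x obtain Q r h L and \<zeta> :: "real \<times> real \<Rightarrow> real" where
    Q: "orthogonal_matrix Q" and r: "r > 0" and h: "h > 0" and L: "L-lipschitz_on UNIV \<zeta>"
    and chart: "\<And>y. ((Q *v (y - x)) $ 1)\<^sup>2 + ((Q *v (y - x)) $ 2)\<^sup>2 < r\<^sup>2 \<and> \<bar>(Q *v (y - x)) $ 3\<bar> < h \<Longrightarrow>
       (y \<in> \<Omega> \<longleftrightarrow> (Q *v (y - x)) $ 3 < \<zeta> ((Q *v (y - x)) $ 1, (Q *v (y - x)) $ 2))"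
    unfolding lipschitz_boundary_def Let_def by metis
  define T where "T y = Q *v (y - x)" for y
  define m where "m = min r h"
  have m: "m > 0" "m \<le> r" "m \<le> h" using r h by (auto simp: m_def)
  have L0: "L \<ge> 0" using L by (rule lipschitz_on_nonneg)
  have nT: "norm (T y) = dist y x" for y unfolding T_def by (simp add: orthogonal_matrix_norm[OF Q] dist_norm)
  have cyl: "y \<in> \<Omega> \<longleftrightarrow> T y $ 3 < \<zeta> (T y $ 1, T y $ 2)" if "norm (T y) < m" for y
  proof (rule chart[folded T_def])
    have "(norm (T y))\<^sup>2 < r\<^sup>2" using that m by (intro power_strict_mono) auto
    then have "(T y $ 1)\<^sup>2 + (T y $ 2)\<^sup>2 < r\<^sup>2" unfolding norm_R3_sq by (smt (verit) zero_le_power2)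
    moreover have "\<bar>T y $ 3\<bar> < h" using component_le_norm_cart[of "T y" 3] that m by linarith
    ultimately show "(T y $ 1)\<^sup>2 + (T y $ 2)\<^sup>2 < r\<^sup>2 \<and> \<bar>T y $ 3\<bar> < h" ..
  qed
  have cT: "continuous_on UNIV T" unfolding T_def
    by (intro continuous_on_compose2[OF linear_continuous_on[OF matrix_vector_mul_bounded_linear[of Q], of UNIV]] continuous_intros) auto
  have cT': "continuous_on UNIV (\<lambda>y. T y $ i)" for i
    by (intro continuous_on_component cT)
  have c\<zeta>: "continuous_on UNIV (\<lambda>y. \<zeta> (T y $ 1, T y $ 2))"
    by (rule continuous_on_compose2[OF lipschitz_on_continuous_on[OF L]]) (auto intro!: continuous_on_Pair cT')
  \<comment> \<open>The points of the chart strictly above the graph form an open set disjoint from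
    the domain, and such a set contains no point of the closure.\<close>
  have below: "T y $ 3 \<le> \<zeta> (T y $ 1, T y $ 2)" if y: "y \<in> closure \<Omega>" "norm (T y) < m" for y
  proof (rule ccontr)
    assume n: "\<not> T y $ 3 \<le> \<zeta> (T y $ 1, T y $ 2)"
    define S where "S = {y. \<zeta> (T y $ 1, T y $ 2) < T y $ 3} \<inter> {y. norm (T y) < m}"
    have "open S" unfolding S_def
      by (intro open_Int open_Collect_less c\<zeta> cT' continuous_on_norm cT continuous_on_const)
    moreover have "y \<in> S" using n y by (auto simp: S_def)
    ultimately have "S \<inter> \<Omega> \<noteq> {}" using y(1) open_Int_closure_eq_empty by blast
    then obtain z where "z \<in> S" "z \<in> \<Omega>" by blast
    then show False using cyl[of z] by (auto simp: S_def)
  qed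
  \<comment> \<open>The size of \<tau> keeps m/4 + 2 (\<tau> + \<epsilon>) below m, so shifted
    points remain in the chart. The width d is such that \<epsilon> = 6 d, the bound of
    \<open>norm_diff_pbox\<close>, satisfies \<epsilon> (1 + L) = \<tau>/2: half of the descent
    survives all errors.\<close>
  define \<tau> where "\<tau> = m / 16"
  define d where "d = \<tau> / (12 * (1 + L))"
  define \<epsilon> where "\<epsilon> = 6 * d"
  \<comment> \<open>The downward vertical of the chart, of length \<tau>, transported back by the
    inverse rotation.\<close>
  define p where "p = transpose Q *v (axis 3 (- \<tau>))"
  have \<tau>: "\<tau> > 0" using m by (simp add: \<tau>_def)
  have d: "d > 0" using \<tau> L0 by (simp add: d_def)
  have \<epsilon>: "\<epsilon> > 0" "\<epsilon> * (1 + L) = \<tau> / 2" using d L0 by (auto simp: \<epsilon>_def d_def field_simps)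
  have "\<epsilon> * 1 \<le> \<epsilon> * (1 + L)" using \<epsilon>(1) L0 by (intro mult_left_mono) auto
  then have \<epsilon>\<tau>: "\<epsilon> \<le> \<tau> / 2" unfolding \<epsilon>(2) by simp
  have Qp: "Q *v p = axis 3 (- \<tau>)"
  proof -
    have "Q *v p = (Q ** transpose Q) *v (axis 3 (- \<tau>))" by (simp only: p_def matrix_vector_mul_assoc)
    moreover have "Q ** transpose Q = mat 1" using Q by (simp add: orthogonal_matrix_def)
    ultimately show ?thesis by (simp only: matrix_vector_mul_lid)
  qed
  show thesis
  proof (rule that[of "m / 4" d p])
    show "m / 4 > 0" "d > 0" using m d by auto
    fix y c assume y: "y \<in> closure \<Omega>" "dist y x \<le> m / 4" and c: "c \<in> cone_seg p d 2"
    from c obtain s b where sb: "c = s *\<^sub>R b" "0 < s" "s \<le> 2" "b \<in> pbox p d" by (auto simp: cone_seg_def)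
    define q where "q = Q *v (b - p)"
    have q: "norm q \<le> \<epsilon>" unfolding q_def orthogonal_matrix_norm[OF Q] \<epsilon>_def by (rule norm_diff_pbox[OF sb(4)])
    have Qb: "Q *v b = axis 3 (- \<tau>) + q"
      unfolding q_def Qp[symmetric] by (simp add: matrix_vector_right_distrib[symmetric])
    have Tyc: "T (y + c) = T y + s *\<^sub>R (axis 3 (- \<tau>) + q)"
    proof -
      have "T (y + c) = Q *v ((y - x) + s *\<^sub>R b)" by (simp add: T_def sb(1) algebra_simps)
      also have "\<dots> = T y + s *\<^sub>R (Q *v b)"
        by (simp add: matrix_vector_right_distrib T_def matrix_vector_mult_scaleR)
      finally show ?thesis by (simp add: Qb)
    qed
    have "norm (T (y + c)) \<le> norm (T y) + s * (\<tau> + \<epsilon>)"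
    proof -
      have "norm (axis 3 (- \<tau>) + q) \<le> \<tau> + \<epsilon>"
      proof -
        have "axis 3 (- \<tau>) = (- \<tau>) *\<^sub>R (axis 3 1 :: R3)" by (simp add: axis_def vec_eq_iff)
        then have "norm (axis 3 (- \<tau>) :: R3) = \<tau>" using \<tau> by (simp add: norm_axis_1)
        then show ?thesis using norm_triangle_ineq[of "axis 3 (- \<tau>)" q] q by linarith
      qed
      then have "norm (s *\<^sub>R (axis 3 (- \<tau>) + q)) \<le> s * (\<tau> + \<epsilon>)" using sb(2) by (simp add: mult_left_mono)
      then show ?thesis unfolding Tyc using norm_triangle_ineq[of "T y" "s *\<^sub>R (axis 3 (- \<tau>) + q)"] by linarith
    qed
    also have "\<dots> \<le> m / 4 + 2 * (\<tau> + \<epsilon>)"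
      using y(2) sb \<tau> \<epsilon> by (intro add_mono mult_right_mono) (auto simp: nT)
    also have "\<dots> < m" using m \<epsilon>\<tau> by (simp add: \<tau>_def)
    finally have inside: "norm (T (y + c)) < m" .
    have z: "T y $ 3 \<le> \<zeta> (T y $ 1, T y $ 2)" by (rule below[OF y(1)]) (use y(2) m in \<open>simp add: nT\<close>)
    have q3: "\<bar>q $ 3\<bar> \<le> \<epsilon>" using component_le_norm_cart[of q 3] q by linarith
    have c1: "T (y + c) $ 1 = T y $ 1 + s * q $ 1" "T (y + c) $ 2 = T y $ 2 + s * q $ 2"
      "T (y + c) $ 3 = T y $ 3 - s * \<tau> + s * q $ 3"
      unfolding Tyc by (simp_all add: axis_def algebra_simps)
    have "dist (\<zeta> (T (y + c) $ 1, T (y + c) $ 2)) (\<zeta> (T y $ 1, T y $ 2)) \<le> L * dist (T (y + c) $ 1, T (y + c) $ 2) (T y $ 1, T y $ 2)"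
      by (rule lipschitz_onD[OF L]) auto
    also have "dist (T (y + c) $ 1, T (y + c) $ 2) (T y $ 1, T y $ 2) \<le> s * \<epsilon>"
    proof -
      have "dist (T (y + c) $ 1, T (y + c) $ 2) (T y $ 1, T y $ 2) = sqrt ((s * q $ 1)\<^sup>2 + (s * q $ 2)\<^sup>2)"
        by (simp add: dist_prod_def c1 dist_real_def)
      also have "\<dots> \<le> sqrt ((s * norm q)\<^sup>2)"
        unfolding power_mult_distrib norm_R3_sq by (simp add: algebra_simps)
      also have "\<dots> \<le> s * \<epsilon>" using sb(2) q by (simp add: mult_left_mono)
      finally show ?thesis .
    qed
    finally have "\<zeta> (T (y + c) $ 1, T (y + c) $ 2) \<ge> \<zeta> (T y $ 1, T y $ 2) - L * (s * \<epsilon>)"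
      using L0 by (simp add: dist_real_def mult_left_mono abs_le_iff)
    moreover have "s * q $ 3 \<le> s * \<epsilon>" using q3 sb(2) by (intro mult_left_mono) auto
    moreover have "s * \<epsilon> + L * (s * \<epsilon>) = s * (\<tau> / 2)" unfolding \<epsilon>(2)[symmetric] by (simp add: algebra_simps)
    moreover have "s * (\<tau> / 2) < s * \<tau>" using sb(2) \<tau> by simp
    ultimately have "T (y + c) $ 3 < \<zeta> (T (y + c) $ 1, T (y + c) $ 2)" using z c1(3) by linarith
    then show "y + c \<in> \<Omega>" using cyl[OF inside] by simp
  qed
qed

lemma inward_cone:
  assumes op: "open \<Omega>" and lip: "lipschitz_boundary \<Omega>" and x: "x \<in> closure \<Omega>"
  obtains R p d where "R > 0" "d > 0"
    "\<And>y c. y \<in> closure \<Omega> \<Longrightarrow> dist y x \<le> R \<Longrightarrow> c \<in> cone_seg p d 2 \<Longrightarrow> y + c \<in> \<Omega>"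
proof (cases "x \<in> \<Omega>")
  case True
  then obtain e where e: "e > 0" "ball x e \<subseteq> \<Omega>" using op open_contains_ball by blast
  \<comment> \<open>A cone vector has length at most 2 * 6 * e/48 = e/4, so the shifted point is
    within e/2 + e/4 < e of x; at an interior point no direction is preferred and the cube is
    centred at 0.\<close>
  show thesis
  proof (rule that[of "e / 2" "e / 48" 0])
    fix y c assume y: "dist y x \<le> e / 2" and c: "c \<in> cone_seg 0 (e / 48) 2"
    from c obtain s b where sb: "c = s *\<^sub>R b" "0 < s" "s \<le> 2" "b \<in> pbox 0 (e / 48)" by (auto simp: cone_seg_def)
    have "norm c \<le> 2 * (6 * (e / 48))"
      unfolding sb(1) norm_scaleR using norm_diff_pbox[OF sb(4)] sb(2,3) by (intro mult_mono) auto
    then have "dist (y + c) x \<le> e / 2 + e / 4"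
      using y norm_triangle_ineq[of "y - x" c] by (simp add: dist_norm algebra_simps)
    then show "y + c \<in> \<Omega>" using e by (auto simp: dist_commute)
  qed (use e in auto)
next
  case False
  then have "x \<in> frontier \<Omega>" using x op by (simp add: frontier_def interior_open)
  then show thesis
  proof (rule inward_cone_boundary[OF lip])
    fix R p d assume A: "R > 0" "d > 0"
      "\<And>y c. y \<in> closure \<Omega> \<Longrightarrow> dist y x \<le> R \<Longrightarrow> c \<in> cone_seg p d 2 \<Longrightarrow> y + c \<in> \<Omega>"
    show thesis by (rule that[OF A])
  qed
qed

lemma bump_function:
  fixes x :: R3
  assumes R: "R > 0"
  obtains \<beta> where "test \<beta>" "tsupp \<beta> \<subseteq> cball x R" "\<And>y. dist y x < R / 2 \<Longrightarrow> \<beta> y = 1"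
proof -
  obtain F where F: "smooth1 F" "\<And>x. x \<le> 0 \<Longrightarrow> F x = 0" "\<And>x. x \<ge> 1 \<Longrightarrow> F x = (1::real)"
    using smooth_step by metis
  \<comment> \<open>The argument of the step is affine in the squared distance, with value 1 at
    distance R/2 and 0 at distance R.\<close>
  define \<beta> where "\<beta> y = F (4/3 + (- 4 / (3 * R\<^sup>2)) * (\<Sum>i\<in>UNIV. (y $ i - x $ i) * (y $ i - x $ i)))" for y :: R3
  have eq: "(\<Sum>i\<in>UNIV. (y $ i - x $ i) * (y $ i - x $ i)) = (dist y x)\<^sup>2" for y
    unfolding dist_norm power2_norm_eq_inner inner_vec_def by simp
  have "test_on (cball x R) \<beta>"
  proof (rule test_onI[of _ "cball x R"])
    show "smooth_fun \<beta>" unfolding \<beta>_def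
      by (intro smooth_fun_compose1[OF F(1)] smooth_fun_add smooth_fun_const smooth_fun_cmult smooth_fun_sum
          smooth_fun_mult smooth_fun_nth smooth_fun_diff)
    fix y assume "y \<notin> cball x R"
    then have "(dist y x)\<^sup>2 \<ge> R\<^sup>2" using R by (intro power_mono) (auto simp: dist_commute)
    then show "\<beta> y = 0" unfolding \<beta>_def eq using R by (intro F(2)) (simp add: field_simps)
  qed auto
  moreover have "\<beta> y = 1" if "dist y x < R / 2" for y
  proof -
    have "(dist y x)\<^sup>2 \<le> (R / 2)\<^sup>2" using that by (intro power_mono) auto
    then show ?thesis unfolding \<beta>_def eq using R by (intro F(3)) (simp add: field_simps)
  qed
  ultimately show thesis using that test_on_test by (metis test_on_def)
qed

lemma sum_prod_telescope:
  fixes b :: "nat \<Rightarrow> real"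
  shows "1 - (\<Sum>i<n. b i * (\<Prod>j<i. 1 - b j)) = (\<Prod>i<n. 1 - b i)"
  by (induction n) (simp_all add: algebra_simps)

text \<open>From bumps \<beta>_i the functions \<beta>_i times the product of 1 - \<beta>_j over j <
  i sum to 1 minus the product of all 1 - \<beta>_j, hence to 1 wherever some bump equals 1. An open
  neighbourhood \<open>U\<close> is needed because a distribution supported in the closure may still
  see derivatives of a function that vanishes only on the closure.\<close>

lemma cone_partition:
  assumes op: "open \<Omega>" and bd: "bounded \<Omega>" and lip: "lipschitz_boundary \<Omega>"
  obtains n :: nat and \<eta> :: "nat \<Rightarrow> R3 \<Rightarrow> real" and p d U where
    "\<And>i. test (\<eta> i)" "\<And>i. d i > 0"
    "\<And>i y c. y \<in> closure \<Omega> \<Longrightarrow> y \<in> tsupp (\<eta> i) \<Longrightarrow> c \<in> cone_seg (p i) (d i) 2 \<Longrightarrow> y + c \<in> \<Omega>"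
    "open U" "closure \<Omega> \<subseteq> U" "\<And>x. x \<in> U \<Longrightarrow> (\<Sum>i<n. \<eta> i x) = 1"
proof (cases "\<Omega> = {}")
  case True
  show thesis
    by (rule that[of "\<lambda>_ _. 0" "\<lambda>_. 1" "\<lambda>_. 0" "{}" 0]) (auto simp: True test_on_0)
next
  case False
  have "\<exists>R p d. R > 0 \<and> d > 0 \<and> (\<forall>y c. y \<in> closure \<Omega> \<longrightarrow> dist y x \<le> R \<longrightarrow> c \<in> cone_seg p d 2 \<longrightarrow> y + c \<in> \<Omega>)"
    if xO: "x \<in> closure \<Omega>" for x
  proof (rule inward_cone[OF op lip xO])
    fix R p d assume A: "R > 0" "d > 0"
      "\<And>y c. y \<in> closure \<Omega> \<Longrightarrow> dist y x \<le> R \<Longrightarrow> c \<in> cone_seg p d 2 \<Longrightarrow> y + c \<in> \<Omega>"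
    show ?thesis by (intro exI[of _ R] exI[of _ p] exI[of _ d] conjI allI impI) (fact A(1), fact A(2), rule A(3))
  qed
  then have "\<forall>x. \<exists>T. x \<in> closure \<Omega> \<longrightarrow> (case T of (R, p, d) \<Rightarrow> R > 0 \<and> d > 0 \<and>
      (\<forall>y c. y \<in> closure \<Omega> \<longrightarrow> dist y x \<le> R \<longrightarrow> c \<in> cone_seg p d 2 \<longrightarrow> y + c \<in> \<Omega>))" by fast
  from choice[OF this] obtain T where T: "\<And>x. x \<in> closure \<Omega> \<Longrightarrow> (case T x of (R, p, d) \<Rightarrow> R > 0 \<and> d > 0 \<and>
      (\<forall>y c. y \<in> closure \<Omega> \<longrightarrow> dist y x \<le> R \<longrightarrow> c \<in> cone_seg p d 2 \<longrightarrow> y + c \<in> \<Omega>))" by blast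
  define R where "R x = fst (T x)" for x
  define p where "p x = fst (snd (T x))" for x
  define d where "d x = snd (snd (T x))" for x
  have Rpd: "R x > 0 \<and> d x > 0 \<and>
      (\<forall>y c. y \<in> closure \<Omega> \<longrightarrow> dist y x \<le> R x \<longrightarrow> c \<in> cone_seg (p x) (d x) 2 \<longrightarrow> y + c \<in> \<Omega>)" if "x \<in> closure \<Omega>" for x
    using T[OF that] by (simp add: R_def p_def d_def case_prod_beta)
  have R0: "R x > 0" if "x \<in> closure \<Omega>" for x using Rpd[OF that] by (rule conjunct1)
  have cpt: "compact (closure \<Omega>)" using bd by (simp add: compact_closure)
  have cov: "closure \<Omega> \<subseteq> (\<Union>x\<in>closure \<Omega>. ball x (R x / 2))"
  proof
    fix x assume x: "x \<in> closure \<Omega>"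
    show "x \<in> (\<Union>x\<in>closure \<Omega>. ball x (R x / 2))" by (rule UN_I[OF x]) (simp add: R0[OF x])
  qed
  obtain S where S: "S \<subseteq> closure \<Omega>" "finite S" "closure \<Omega> \<subseteq> (\<Union>x\<in>S. ball x (R x / 2))"
    by (rule compactE_image[OF cpt open_ball cov])
  obtain xs where xs: "set xs = S" using finite_list[OF S(2)] by blast
  have "closure \<Omega> \<noteq> {}" using False by simp
  then have "S \<noteq> {}" using S(3) by auto
  then have xs0: "xs \<noteq> []" using xs by auto
  \<comment> \<open>Indices beyond the list repeat its first point, so that the local assertions
    hold for every natural index and not only for those in the sum.\<close>
  define x where "x i = (if i < length xs then xs ! i else hd xs)" for i
  have xS: "x i \<in> S" for i using xs xs0 by (auto simp: x_def)
  then have x: "x i \<in> closure \<Omega>" for i using S(1) by blast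
  have "\<exists>\<beta>. test \<beta> \<and> tsupp \<beta> \<subseteq> cball (x i) (R (x i)) \<and> (\<forall>y. dist y (x i) < R (x i) / 2 \<longrightarrow> \<beta> y = 1)" for i
    using bump_function[OF R0[OF x[of i]], of "x i"] by metis
  then obtain \<beta> where \<beta>: "\<And>i. test (\<beta> i)" "\<And>i. tsupp (\<beta> i) \<subseteq> cball (x i) (R (x i))"
    "\<And>i y. dist y (x i) < R (x i) / 2 \<Longrightarrow> \<beta> i y = (1::real)" by metis
  define \<eta> where "\<eta> i = (\<lambda>y. (\<Prod>j<i. 1 - \<beta> j y) * \<beta> i y)" for i
  show thesis
  proof (rule that[of \<eta> "\<lambda>i. d (x i)" "\<lambda>i. p (x i)" "\<Union>x\<in>S. ball x (R x / 2)" "length xs"])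
    show "test (\<eta> i)" for i unfolding \<eta>_def
      by (intro test_on_mult_smooth \<beta> smooth_fun_prod smooth_fun_diff smooth_fun_const test_smooth[OF \<beta>(1)])
    show "d (x i) > 0" for i using Rpd[OF x] by blast
    fix i y c assume y: "y \<in> closure \<Omega>" "y \<in> tsupp (\<eta> i)" and c: "c \<in> cone_seg (p (x i)) (d (x i)) 2"
    have "tsupp (\<eta> i) \<subseteq> tsupp (\<beta> i)"
      by (rule tsupp_subset[OF closed_tsupp]) (simp add: \<eta>_def not_in_tsupp)
    then have "dist y (x i) \<le> R (x i)" using y(2) \<beta>(2)[of i] by (auto simp: dist_commute)
    then show "y + c \<in> \<Omega>" using Rpd[OF x[of i]] y(1) c by blast
  next
    fix y assume "y \<in> (\<Union>x\<in>S. ball x (R x / 2))"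
    then obtain z where z: "z \<in> set xs" "dist z y < R z / 2" using xs by auto
    then obtain i where i: "i < length xs" "xs ! i = z" by (auto simp: in_set_conv_nth)
    then have "\<beta> i y = 1" using z(2) by (intro \<beta>(3)) (auto simp: x_def dist_commute)
    then have "(\<Prod>i<length xs. 1 - \<beta> i y) = 0" using i(1) by (intro prod_zero) auto
    then show "(\<Sum>i<length xs. \<eta> i y) = 1"
    proof -
      assume "(\<Prod>i<length xs. 1 - \<beta> i y) = 0"
      with sum_prod_telescope[of "\<lambda>i. \<beta> i y" "length xs"]
      have "(\<Sum>i<length xs. \<beta> i y * (\<Prod>j<i. 1 - \<beta> j y)) = 1" by linarith
      then show ?thesis by (simp only: \<eta>_def mult.commute)
    qed
  qed (use S in auto)
qed

subsection \<open>Approximating sequences\<close>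

text \<open>The proof carries approximating sequences rather than their limits: they are linear in
  the data pointwise, not just almost everywhere, and the density statement uses the same sequences
  again.\<close>

definition h10_seq :: "R3 set \<Rightarrow> real \<Rightarrow> (nat \<Rightarrow> R3 \<Rightarrow> real) \<Rightarrow> bool" where
  "h10_seq \<Omega> M \<Phi> \<longleftrightarrow> (\<forall>N. test_on \<Omega> (\<Phi> N)) \<and> L2_Cauchy \<Phi> \<and> (\<forall>j. L2_Cauchy (\<lambda>N. pd j (\<Phi> N))) \<and>
     (\<forall>N. L2n (\<Phi> N) \<le> M) \<and> (\<forall>N j. L2n (pd j (\<Phi> N)) \<le> M)"

lemma L2_Cauchy_comb:
  assumes "L2_Cauchy f" "L2_Cauchy g" shows "L2_Cauchy (\<lambda>n x. a * f n x + b * g n x)"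
proof -
  obtain v where v: "L2_lim f v" using L2_complete[OF assms(1)] by blast
  obtain w where w: "L2_lim g w" using L2_complete[OF assms(2)] by blast
  have L: "L2 (f n)" "L2 (g n)" for n using assms by (auto simp: L2_Cauchy_def)
  let ?f = "\<lambda>n x. a * f n x + b * g n x" and ?w = "\<lambda>x. a * v x + b * w x"
  have lim: "L2_lim ?f ?w" by (rule L2_lim_lincomb[OF L v w])
  have Lf: "L2 (?f n)" for n by (intro L2_add L2_cmult L)
  show ?thesis unfolding L2_Cauchy_def
  proof (intro conjI allI impI Lf)
    fix e :: real assume "e > 0"
    then have "\<forall>\<^sub>F n in sequentially. L2n (\<lambda>x. ?f n x - ?w x) < e / 2"
      using lim unfolding L2_lim_def by (intro order_tendstoD(2)) auto
    then obtain N where N: "\<And>n. n \<ge> N \<Longrightarrow> L2n (\<lambda>x. ?f n x - ?w x) < e / 2" unfolding eventually_sequentially by blast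
    show "\<exists>N. \<forall>m\<ge>N. \<forall>n\<ge>N. L2n (\<lambda>x. ?f m x - ?f n x) \<le> e"
    proof (intro exI allI impI)
      fix m n assume mn: "m \<ge> N" "n \<ge> N"
      have "L2n (\<lambda>x. ?f m x - ?f n x) \<le> L2n (\<lambda>x. ?f m x - ?w x) + L2n (\<lambda>x. ?w x - ?f n x)"
        using lim by (intro L2n_triangle_diff Lf) (simp add: L2_lim_def)
      then show "L2n (\<lambda>x. ?f m x - ?f n x) \<le> e"
        using N[OF mn(1)] N[OF mn(2)] L2n_diff_commute[of ?w "?f n"] by linarith
    qed
  qed
qed

lemma h10_seq_comb:
  assumes "h10_seq \<Omega> M \<Phi>" "h10_seq \<Omega> M' \<Phi>'"
  shows "h10_seq \<Omega> (\<bar>a\<bar> * M + \<bar>b\<bar> * M') (\<lambda>N x. a * \<Phi> N x + b * \<Phi>' N x)"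
proof -
  have t: "test (\<Phi> N)" "test (\<Phi>' N)" for N using assms test_on_test by (auto simp: h10_seq_def)
  have pd: "pd j (\<lambda>x. a * \<Phi> N x + b * \<Phi>' N x) = (\<lambda>x. a * pd j (\<Phi> N) x + b * pd j (\<Phi>' N) x)" for j N
    using t by (simp add: pd_add' pd_cmult' test_on_cmult)
  have le: "L2n (\<lambda>x. a * f x + b * g x) \<le> \<bar>a\<bar> * M + \<bar>b\<bar> * M'" if "L2 f" "L2 g" "L2n f \<le> M" "L2n g \<le> M'" for f g
  proof -
    have "L2n (\<lambda>x. a * f x + b * g x) \<le> \<bar>a\<bar> * L2n f + \<bar>b\<bar> * L2n g"
      using L2n_triangle[of "\<lambda>x. a * f x" "\<lambda>x. b * g x"] that by (simp add: L2n_cmult L2_cmult)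
    also have "\<dots> \<le> \<bar>a\<bar> * M + \<bar>b\<bar> * M'" by (intro add_mono mult_left_mono that) auto
    finally show ?thesis .
  qed
  show ?thesis
    using assms t unfolding h10_seq_def pd
    by (auto intro!: L2_Cauchy_comb test_on_add test_on_cmult le L2_test test_on_pd)
qed

lemma h10_seq_0: "h10_seq \<Omega> 0 (\<lambda>N x. 0)"
  by (auto simp: h10_seq_def L2_Cauchy_def L2_0 L2n_0 pd_const test_on_0)

lemma h10_seq_mono: "h10_seq \<Omega> M \<Phi> \<Longrightarrow> M \<le> M' \<Longrightarrow> h10_seq \<Omega> M' \<Phi>"
  unfolding h10_seq_def by (meson order_trans)

lemma h10_seq_add: "h10_seq \<Omega> M \<Phi> \<Longrightarrow> h10_seq \<Omega> M' \<Phi>' \<Longrightarrow> h10_seq \<Omega> (M + M') (\<lambda>N x. \<Phi> N x + \<Phi>' N x)"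
  using h10_seq_comb[of \<Omega> M \<Phi> M' \<Phi>' 1 1] by simp

lemma h10_seq_sum:
  "(\<And>i. i \<in> I \<Longrightarrow> h10_seq \<Omega> (M i) (\<Phi> i)) \<Longrightarrow> h10_seq \<Omega> (\<Sum>i\<in>I. M i) (\<lambda>N x. \<Sum>i\<in>I. \<Phi> i N x)"
  by (induction I rule: infinite_finite_induct) (auto simp: h10_seq_0 h10_seq_add)

text \<open>Bounds on two derivatives make u -> u * \<kappa> uniformly bounded from order -1 to
  order 1. Convergence in operator norm is asked of the kernels only, since their highest
  derivatives need not converge in that sense.\<close>

definition kernel_seq :: "(nat \<Rightarrow> R3 \<Rightarrow> real) \<Rightarrow> real \<Rightarrow> bool" where
  "kernel_seq \<kappa> C \<longleftrightarrow> (\<forall>N. test (\<kappa> N) \<and> OB (\<kappa> N) C \<and> (\<forall>m. OB (pd m (\<kappa> N)) C) \<and> (\<forall>m p. OB (pd m (pd p (\<kappa> N))) C)) \<and>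
     (\<forall>e>0. \<exists>N0. \<forall>N\<ge>N0. \<forall>M\<ge>N0. OB (\<lambda>x. \<kappa> N x - \<kappa> M x) e)"

text \<open>Pairing \<open>w = u * k\<close> with itself and moving the kernel to the other factor: \<open>|w|\<^sup>2 = u(k' * w)\<close>.\<close>
lemma L2n_conv_le_aux:
  assumes u: "HB u M" and k: "test k" "OB k C" "\<And>j. OB (pd j k) C" and w: "test (conv u k)"
  shows "L2n (conv u k) \<le> 2 * C * M"
proof -
  let ?w = "conv u k" and ?k = "refl_fun k"
  have C: "C \<ge> 0" by (rule OB_nonneg[OF k(2)])
  have "(L2n ?w)\<^sup>2 = u (cv ?w ?k)"
    using conv_adjoint[OF u k(1) w] by (simp add: L2n_sq_mult fd_def)
  also have "\<dots> \<le> M * h1n (cv ?w ?k)"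
    using HB_bound[OF u test_cv[OF w test_refl_fun[OF k(1)]]] by linarith
  also have "\<dots> \<le> M * (2 * (C * L2n ?w))"
  proof (intro mult_left_mono h1n_le HB_nonneg[OF u])
    show "L2n (cv ?w ?k) \<le> C * L2n ?w" by (intro OB_D[OF _ w] OB_refl_fun k)
    fix j
    have "pd j (cv ?w ?k) = cv ?w (\<lambda>x. - refl_fun (pd j k) x)"
      by (simp add: pd_cv[OF w test_refl_fun[OF k(1)]] pd_refl_fun[OF k(1)])
    moreover have "OB (\<lambda>x. - refl_fun (pd j k) x) C" by (intro OB_uminus OB_refl_fun k test_refl_fun test_on_pd)
    ultimately show "L2n (pd j (cv ?w ?k)) \<le> C * L2n ?w" using OB_D[OF _ w] by metis
  qed
  finally have "(L2n ?w)\<^sup>2 \<le> (2 * C * M) * L2n ?w" by (simp add: mult_ac)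
  then show ?thesis by (rule L2n_sq_le_imp) (use C HB_nonneg[OF u] in simp)
qed

lemma L2n_conv_le:
  assumes u: "HB u M" "supp_in u K" "compact K"
    and k: "test k" "OB k C" "\<And>j. OB (pd j k) C" "\<And>i j. OB (pd i (pd j k)) C"
  shows "L2n (conv u k) \<le> 2 * C * M" "L2n (pd j (conv u k)) \<le> 2 * C * M"
proof -
  have t: "test (conv u k)" if "test k" for k by (rule test_on_conv[OF u that]) simp
  show "L2n (conv u k) \<le> 2 * C * M" by (rule L2n_conv_le_aux[OF u(1) k(1-3) t[OF k(1)]])
  show "L2n (pd j (conv u k)) \<le> 2 * C * M" unfolding pd_conv[OF u(1) k(1)]
    by (rule L2n_conv_le_aux[OF u(1)]) (intro test_on_pd k t)+
qed

lemma supp_in_diff_fd: "supp_in u K \<Longrightarrow> supp_in (\<lambda>\<phi>. u \<phi> - fd f \<phi>) (K \<union> tsupp f)"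
  using supp_in_mono[of u K "K \<union> tsupp f"] supp_in_mono[OF supp_in_fd[of f], of "K \<union> tsupp f"]
  by (auto simp: supp_in_def)

text \<open>Uniform boundedness plus convergence on a dense set: write \<open>u\<close> as a test
  function f plus a functional small in \<open>HB\<close>. The small part is controlled by the
  kernel bounds; for f all derivatives are moved onto f, and the kernel differences tend to zero in
  operator norm.\<close>

lemma h10_seq_conv:
  assumes u: "HB u M" "supp_in u K" "compact K" and \<kappa>: "kernel_seq \<kappa> C"
    and sub: "\<And>N. {a + b |a b. a \<in> K \<and> b \<in> tsupp (\<kappa> N)} \<subseteq> \<Omega>"
  shows "h10_seq \<Omega> (2 * C * M) (\<lambda>N. conv u (\<kappa> N))"
proof -
  have k: "test (\<kappa> N)" "OB (\<kappa> N) C" "OB (pd m (\<kappa> N)) C" "OB (pd m (pd p (\<kappa> N))) C" for N m p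
    using \<kappa> by (auto simp: kernel_seq_def)
  have C: "C \<ge> 0" by (rule OB_nonneg[OF k(2)])
  have t: "test_on \<Omega> (conv u (\<kappa> N))" for N by (rule test_on_conv[OF u k(1) sub])
  have small: "\<exists>N0. \<forall>m\<ge>N0. \<forall>n\<ge>N0. L2n (\<lambda>x. conv u (\<kappa> m) x - conv u (\<kappa> n) x) \<le> e \<and>
     (\<forall>j. L2n (\<lambda>x. pd j (conv u (\<kappa> m)) x - pd j (conv u (\<kappa> n)) x) \<le> e)" if e: "e > 0" for e
  proof -
    define e' where "e' = e / (2 * (4 * C + 1))"
    have e': "e' > 0" "4 * C * e' \<le> e / 2" using e C by (auto simp: e'_def field_simps)
    obtain f where f: "test f" and uf: "HB (\<lambda>\<phi>. u \<phi> - fd f \<phi>) e'" using HB_dense[OF u(1) e'(1)] by blast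
    define v where "v = (\<lambda>\<phi>. u \<phi> - fd f \<phi>)"
    have v: "HB v e'" "supp_in v (K \<union> tsupp f)" "compact (K \<union> tsupp f)"
      using uf supp_in_diff_fd[OF u(2)] u(3) test_compact[OF f] by (auto simp: v_def)
    define e2 where "e2 = e / (2 * (h1n f + 1))"
    have e2: "e2 > 0" "e2 * h1n f \<le> e / 2" using e h1n_nonneg[of f] by (auto simp: e2_def field_simps)
    obtain N0 where N0: "\<And>N M. N \<ge> N0 \<Longrightarrow> M \<ge> N0 \<Longrightarrow> OB (\<lambda>x. \<kappa> N x - \<kappa> M x) e2"
      using \<kappa> e2(1) unfolding kernel_seq_def by blast
    show ?thesis
    proof (intro exI[of _ N0] allI impI conjI)
      fix m n assume mn: "m \<ge> N0" "n \<ge> N0"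
      define \<delta> where "\<delta> = (\<lambda>x. \<kappa> m x - \<kappa> n x)"
      have \<delta>: "test \<delta>" unfolding \<delta>_def by (intro test_on_diff k)
      have OB\<delta>: "OB \<delta> e2" unfolding \<delta>_def by (rule N0[OF mn])
      have O: "OB \<delta> (2 * C)" "OB (pd j \<delta>) (2 * C)" "OB (pd i (pd j \<delta>)) (2 * C)" for i j
        unfolding \<delta>_def using OB_diff[OF k(2) k(2) k(1) k(1), of m n]
          OB_diff[OF k(3) k(3) test_on_pd[OF k(1)] test_on_pd[OF k(1)], of j m j n]
          OB_diff[OF k(4) k(4) test_on_pd[OF test_on_pd[OF k(1)]] test_on_pd[OF test_on_pd[OF k(1)]], of i j m i j n]
        by (simp_all add: pd_diff' k(1) test_on_pd)
      have eq: "(\<lambda>x. conv u (\<kappa> m) x - conv u (\<kappa> n) x) = conv u \<delta>"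
        unfolding \<delta>_def by (simp add: conv_diff_kernel[OF HB_lin[OF u(1)] k(1) k(1)])
      have split: "conv u \<delta> = (\<lambda>x. cv f \<delta> x + conv v \<delta> x)" by (simp add: conv_def v_def)
      have tv: "test (conv v \<delta>)" by (rule test_on_conv[OF v \<delta>]) simp
      have tf: "test (cv f \<delta>)" by (rule test_cv[OF f \<delta>])
      have "L2n (conv u \<delta>) \<le> L2n (cv f \<delta>) + L2n (conv v \<delta>)"
        unfolding split by (intro L2n_triangle L2_test tf tv)
      also have "L2n (cv f \<delta>) \<le> e2 * h1n f"
        using OB_D[OF OB\<delta> f] mult_left_mono[OF L2n_le_h1n[of f], of e2] e2(1) by linarith
      also have "L2n (conv v \<delta>) \<le> 4 * C * e'" using L2n_conv_le(1)[OF v \<delta> O] by (simp add: mult_ac)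
      finally show "L2n (\<lambda>x. conv u (\<kappa> m) x - conv u (\<kappa> n) x) \<le> e" unfolding eq using e' e2 by linarith
      fix j
      have "(\<lambda>x. pd j (conv u (\<kappa> m)) x - pd j (conv u (\<kappa> n)) x) = pd j (conv u \<delta>)"
        unfolding eq[symmetric] by (rule pd_diff'[OF test_on_test[OF t] test_on_test[OF t], symmetric])
      also have "\<dots> = (\<lambda>x. cv (pd j f) \<delta> x + pd j (conv v \<delta>) x)"
        unfolding split by (simp add: pd_add' tf tv pd_cv_left f \<delta>)
      finally have "L2n (\<lambda>x. pd j (conv u (\<kappa> m)) x - pd j (conv u (\<kappa> n)) x) \<le> L2n (cv (pd j f) \<delta>) + L2n (pd j (conv v \<delta>))"
        by (simp add: L2n_triangle L2_test test_on_pd tv test_cv f \<delta>)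
      also have "L2n (cv (pd j f) \<delta>) \<le> e2 * h1n f"
        using OB_D[OF OB\<delta> test_on_pd[OF f, of j]] mult_left_mono[OF L2n_pd_le_h1n[of j f], of e2] e2(1) by linarith
      also have "L2n (pd j (conv v \<delta>)) \<le> 4 * C * e'" using L2n_conv_le(2)[OF v \<delta> O] by (simp add: mult_ac)
      finally show "L2n (\<lambda>x. pd j (conv u (\<kappa> m)) x - pd j (conv u (\<kappa> n)) x) \<le> e" using e' e2 by linarith
    qed
  qed
  show ?thesis unfolding h10_seq_def
  proof (intro conjI allI)
    show "test_on \<Omega> (conv u (\<kappa> N))" for N by (rule t)
    show "L2_Cauchy (\<lambda>N. conv u (\<kappa> N))" "L2_Cauchy (\<lambda>N. pd j (conv u (\<kappa> N)))" for j
      unfolding L2_Cauchy_def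
      by (intro conjI allI impI L2_test test_on_pd test_on_test[OF t]; drule small; blast)+
    show "L2n (conv u (\<kappa> N)) \<le> 2 * C * M" "L2n (pd j (conv u (\<kappa> N))) \<le> 2 * C * M" for N j
      by (rule L2n_conv_le[OF u k])+
  qed
qed

definition kernel_seq1 :: "(nat \<Rightarrow> R3 \<Rightarrow> real) \<Rightarrow> real \<Rightarrow> bool" where
  "kernel_seq1 \<kappa> C \<longleftrightarrow> (\<forall>N. test (\<kappa> N) \<and> OB (\<kappa> N) C \<and> (\<forall>m. OB (pd m (\<kappa> N)) C)) \<and>
     (\<forall>e>0. \<exists>N0. \<forall>N\<ge>N0. \<forall>M\<ge>N0. OB (\<lambda>x. \<kappa> N x - \<kappa> M x) e)"

text \<open>Of two derivatives of a convolution, one goes to each factor, so two kernels gaining one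
  derivative make a kernel gaining two.\<close>

lemma kernel_seq_cv:
  assumes a: "kernel_seq1 a C" and b: "kernel_seq1 b D"
  shows "kernel_seq (\<lambda>N. cv (a N) (b N)) (C * D)"
proof -
  have A: "test (a N)" "OB (a N) C" "OB (pd m (a N)) C" for N m using a by (auto simp: kernel_seq1_def)
  have B: "test (b N)" "OB (b N) D" "OB (pd m (b N)) D" for N m using b by (auto simp: kernel_seq1_def)
  have C: "C \<ge> 0" "D \<ge> 0" using OB_nonneg[OF A(2)] OB_nonneg[OF B(2)] by auto
  have Cauchy: "\<exists>N0. \<forall>N\<ge>N0. \<forall>M\<ge>N0. OB (\<lambda>x. cv (a N) (b N) x - cv (a M) (b M) x) e" if e: "e > 0" for e
  proof -
    define e1 where "e1 = e / (2 * (D + 1))"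
    define e2 where "e2 = e / (2 * (C + 1))"
    have e12: "e1 > 0" "e1 * D \<le> e / 2" "e2 > 0" "C * e2 \<le> e / 2" using e C by (auto simp: e1_def e2_def field_simps)
    obtain N1 where N1: "\<And>N M. N \<ge> N1 \<Longrightarrow> M \<ge> N1 \<Longrightarrow> OB (\<lambda>x. a N x - a M x) e1"
      using a e12 unfolding kernel_seq1_def by blast
    obtain N2 where N2: "\<And>N M. N \<ge> N2 \<Longrightarrow> M \<ge> N2 \<Longrightarrow> OB (\<lambda>x. b N x - b M x) e2"
      using b e12 unfolding kernel_seq1_def by blast
    show ?thesis
    proof (intro exI[of _ "max N1 N2"] allI impI)
      fix N M assume N: "N \<ge> max N1 N2" "M \<ge> max N1 N2"
      have ta: "test (\<lambda>x. a N x - a M x)" and tb: "test (\<lambda>x. b N x - b M x)" by (intro test_on_diff A B)+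
      have "cv (a N) (b N) x - cv (a M) (b M) x = cv (\<lambda>x. a N x - a M x) (b N) x + cv (a M) (\<lambda>x. b N x - b M x) x" for x
      proof -
        have "cv (\<lambda>x. a N x - a M x) (b N) = (\<lambda>x. cv (a N) (b N) x - cv (a M) (b N) x)"
          by (simp add: cv_commute[OF ta B(1)] cv_commute[OF A(1) B(1)] conv_diff_kernel[OF fd_lin[OF L2_test[OF B(1)]] A(1) A(1)])
        moreover have "cv (a M) (\<lambda>x. b N x - b M x) = (\<lambda>x. cv (a M) (b N) x - cv (a M) (b M) x)"
          by (rule conv_diff_kernel[OF fd_lin[OF L2_test[OF A(1)]] B(1) B(1)])
        ultimately show ?thesis by simp
      qed
      then have eq: "(\<lambda>x. cv (a N) (b N) x - cv (a M) (b M) x) = (\<lambda>x. cv (\<lambda>x. a N x - a M x) (b N) x + cv (a M) (\<lambda>x. b N x - b M x) x)"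
        by (rule ext)
      have "OB (\<lambda>x. cv (\<lambda>x. a N x - a M x) (b N) x + cv (a M) (\<lambda>x. b N x - b M x) x) (e1 * D + C * e2)"
        using N by (intro OB_add OB_cv test_cv N1 N2 A B ta tb) auto
      then show "OB (\<lambda>x. cv (a N) (b N) x - cv (a M) (b M) x) e"
        unfolding eq using e12 by (elim OB_mono) linarith
    qed
  qed
  show ?thesis unfolding kernel_seq_def
  proof (intro conjI allI)
    fix N m p
    show "test (cv (a N) (b N))" "OB (cv (a N) (b N)) (C * D)" by (intro test_cv OB_cv A B)+
    show "OB (pd m (cv (a N) (b N))) (C * D)" unfolding pd_cv[OF A(1) B(1)] by (intro OB_cv A B test_on_pd)
    have "pd m (pd p (cv (a N) (b N))) = cv (pd m (a N)) (pd p (b N))"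
      by (simp add: pd_cv[OF A(1) B(1)] pd_cv_left A B test_on_pd)
    then show "OB (pd m (pd p (cv (a N) (b N)))) (C * D)" by (simp add: OB_cv A B test_on_pd)
  qed (use Cauchy in blast)
qed

lemma OB_test_ex: assumes "test k" obtains C where "C \<ge> 0" "OB k C" "\<And>m. OB (pd m k) C" "\<And>m p. OB (pd m (pd p k)) C"
proof -
  define J where "J f = (\<integral>x. \<bar>f x\<bar> \<partial>lborel)" for f :: "R3 \<Rightarrow> real"
  define C where "C = J k + (\<Sum>m\<in>UNIV. J (pd m k)) + (\<Sum>m\<in>UNIV. \<Sum>p\<in>UNIV. J (pd m (pd p k)))"
  have J: "J f \<ge> 0" for f by (simp add: J_def)
  have O: "OB f C" if "test f" "J f \<le> C" for f using OB_Young[OF that(1)] that(2) by (auto intro: OB_mono simp: J_def)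
  have s: "(\<Sum>m\<in>UNIV. J (pd m k)) \<ge> 0" "(\<Sum>m\<in>UNIV. \<Sum>p\<in>UNIV. J (pd m (pd p k))) \<ge> 0" by (simp_all add: sum_nonneg J)
  have 1: "J (pd m k) \<le> (\<Sum>m\<in>UNIV. J (pd m k))" for m by (rule member_le_sum) (auto simp: J)
  have 2: "J (pd m (pd p k)) \<le> (\<Sum>m\<in>UNIV. \<Sum>p\<in>UNIV. J (pd m (pd p k)))" for m p
  proof -
    have "J (pd m (pd p k)) \<le> (\<Sum>p\<in>UNIV. J (pd m (pd p k)))" by (rule member_le_sum) (auto simp: J)
    also have "\<dots> \<le> (\<Sum>m\<in>UNIV. \<Sum>p\<in>UNIV. J (pd m (pd p k)))" by (rule member_le_sum) (auto simp: J sum_nonneg)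
    finally show ?thesis .
  qed
  show thesis
  proof (rule that)
    show "C \<ge> 0" using J s by (simp add: C_def)
    show "OB k C" using s by (intro O assms) (simp add: C_def)
    show "OB (pd m k) C" for m using s 1[of m] J[of k] by (intro O test_on_pd assms) (simp add: C_def)
    show "OB (pd m (pd p k)) C" for m p using s 2[of m p] J[of k] by (intro O test_on_pd assms) (simp add: C_def)
  qed
qed

lemma OB_zero: "OB (\<lambda>x. 0) e" if "e > 0"
  using that by (auto simp: OB_def cv_zero L2n_0 L2n_nonneg)

lemma kernel_seq_const: assumes "test k" obtains C where "kernel_seq (\<lambda>_. k) C" "kernel_seq1 (\<lambda>_. k) C"
proof -
  obtain C where C: "C \<ge> 0" "OB k C" "\<And>m. OB (pd m k) C" "\<And>m p. OB (pd m (pd p k)) C" using OB_test_ex[OF assms] by blast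
  show thesis by (rule that[of C]) (use assms C OB_zero in \<open>auto simp: kernel_seq_def kernel_seq1_def\<close>)
qed

subsection \<open>Localisation\<close>

definition loc :: "(R3 \<Rightarrow> real) \<Rightarrow> (3 \<Rightarrow> 3 \<Rightarrow> distr) \<Rightarrow> 3 \<Rightarrow> 3 \<Rightarrow> distr" where
  "loc \<eta> g i j = (\<lambda>\<phi>. g i j (\<lambda>x. \<eta> x * \<phi> x))"

text \<open>\<open>rcurl g i k j\<close> is \<open>\<partial>\<^sub>k g\<^sub>i\<^sub>j - \<partial>\<^sub>j g\<^sub>i\<^sub>k\<close>, the curl of row \<open>i\<close> as a two-form, and \<open>riem g l i k j\<close> is
  \<open>\<partial>\<^sub>l (rcurl g i k j) - \<partial>\<^sub>i (rcurl g l k j)\<close>, the linearised curvature encoded by \<open>inc g\<close>.\<close>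
definition rcurl :: "(3 \<Rightarrow> 3 \<Rightarrow> distr) \<Rightarrow> 3 \<Rightarrow> 3 \<Rightarrow> 3 \<Rightarrow> distr" where
  "rcurl g i k j = (\<lambda>\<phi>. - g i j (pd k \<phi>) + g i k (pd j \<phi>))"

definition riem :: "(3 \<Rightarrow> 3 \<Rightarrow> distr) \<Rightarrow> 3 \<Rightarrow> 3 \<Rightarrow> 3 \<Rightarrow> 3 \<Rightarrow> distr" where
  "riem g l i k j = (\<lambda>\<phi>. - rcurl g i k j (pd l \<phi>) + rcurl g l k j (pd i \<phi>))"

text \<open>The contraction identity for two alternating symbols, checked for the nine index pairs;
  it recovers the antisymmetric derivative from the curl vector.\<close>

lemma eps_curlV: "(\<Sum>m\<in>UNIV. eps m k j * curlV v m \<phi>) = dd k (v j) \<phi> - dd j (v k) \<phi>"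
proof -
  have "k = 1 \<or> k = 2 \<or> k = 3" "j = 1 \<or> j = 2 \<or> j = 3" using exhaust_3 by auto
  then show ?thesis by (elim disjE) (simp_all add: curlV_def sum_3 eps_def)
qed

lemma rcurl_eq: "rcurl g i k j \<phi> = (\<Sum>m\<in>UNIV. eps m k j * curlM g i m \<phi>)"
  unfolding curlM_def eps_curlV by (simp add: rcurl_def dd_def)

text \<open>The same contraction is made in both index pairs, so bounds on \<open>inc g\<close>
  become bounds on the curvature form that occurs in the decomposition.\<close>

lemma riem_eq: "riem g l i k j \<phi> = (\<Sum>a\<in>UNIV. eps a k j * (\<Sum>m\<in>UNIV. eps m l i * inc g a m \<phi>))"
proof -
  have "(\<Sum>m\<in>UNIV. eps m l i * inc g a m \<phi>) = - curlM g i a (pd l \<phi>) + curlM g l a (pd i \<phi>)" for a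
  proof -
    have "inc g a = curlV (\<lambda>q. curlM g q a)" by (simp add: inc_def curlM_def[of "\<lambda>i j. curlM g j i"])
    then show ?thesis by (simp add: eps_curlV dd_def)
  qed
  then show ?thesis
    by (simp add: riem_def rcurl_eq right_diff_distrib sum_subtractf)
qed

lemma abs_eps_le: "\<bar>eps i j k\<bar> \<le> 1"
  by (simp add: eps_def)

lemma Hm1norm_nonneg: "in_Hm1 u \<Longrightarrow> Hm1norm u \<ge> 0"
proof -
  assume u: "in_Hm1 u"
  obtain \<phi> where \<phi>: "test \<phi>" "\<phi> \<noteq> (\<lambda>_. 0)" using nonzero_test by blast
  have "0 \<le> \<bar>u \<phi>\<bar> / h1n \<phi>" by (simp add: h1n_nonneg)
  also have "\<dots> \<le> Hm1norm u" unfolding Hm1norm_def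
    using u \<phi> by (intro cSUP_upper) (auto simp: in_Hm1_def)
  finally show ?thesis .
qed

lemma h1n_zero: "h1n (\<lambda>x. 0) = 0"
  by (simp add: h1n_def L2n_0 pd_const)

lemma HB_Hm1norm: "in_Hm1 u \<Longrightarrow> HB u (Hm1norm u)"
  unfolding HB_def
proof (intro conjI allI impI)
  assume u: "in_Hm1 u"
  then show lin: "lin_test u" by (simp add: in_Hm1_def)
  show "0 \<le> Hm1norm u" by (rule Hm1norm_nonneg[OF u])
  fix \<phi> assume \<phi>: "test \<phi>"
  show "\<bar>u \<phi>\<bar> \<le> Hm1norm u * h1n \<phi>"
  proof (cases "\<phi> = (\<lambda>_. 0)")
    case True then show ?thesis using lin_test_0[OF lin] by (simp add: h1n_zero)
  next
    case False
    have "\<bar>u \<phi>\<bar> / h1n \<phi> \<le> Hm1norm u" unfolding Hm1norm_def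
      using u \<phi> False by (intro cSUP_upper) (auto simp: in_Hm1_def)
    then show ?thesis using h1n_pos[OF \<phi> False] by (simp add: divide_le_eq)
  qed
qed

lemma Hm1norm_le:
  assumes "HB u M" shows "Hm1norm u \<le> M"
  unfolding Hm1norm_def
proof (rule cSUP_least)
  show "{\<phi>. test \<phi> \<and> \<phi> \<noteq> (\<lambda>_. 0)} \<noteq> {}" using nonzero_test by auto
  fix \<phi> assume "\<phi> \<in> {\<phi>. test \<phi> \<and> \<phi> \<noteq> (\<lambda>_. 0)}"
  then show "\<bar>u \<phi>\<bar> / h1n \<phi> \<le> M" using HB_bound[OF assms, of \<phi>] h1n_pos[of \<phi>] by (simp add: divide_le_eq)
qed

lemma sum_sq_upper: "(f i j)\<^sup>2 \<le> (\<Sum>i\<in>UNIV. \<Sum>j\<in>UNIV. (f i j)\<^sup>2)" for f :: "3 \<Rightarrow> 3 \<Rightarrow> real"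
proof -
  have "(f i j)\<^sup>2 \<le> (\<Sum>j\<in>UNIV. (f i j)\<^sup>2)" by (rule member_le_sum) auto
  also have "\<dots> \<le> (\<Sum>i\<in>UNIV. \<Sum>j\<in>UNIV. (f i j)\<^sup>2)" by (rule member_le_sum) (auto simp: sum_nonneg)
  finally show ?thesis .
qed

lemma sum_sq_nonneg: "0 \<le> (\<Sum>i\<in>UNIV. \<Sum>j\<in>UNIV. (f i j)\<^sup>2)" for f :: "3 \<Rightarrow> 3 \<Rightarrow> real"
  by (simp add: sum_nonneg)

lemma Hhat_sym: "Hhat_cc \<Omega> g \<Longrightarrow> test \<phi> \<Longrightarrow> g i j \<phi> = g j i \<phi>"
  by (simp add: Hhat_cc_def)

lemma ccnorm_nonneg: "ccnorm g \<ge> 0"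
  unfolding ccnorm_def by (simp add: sum_nonneg)

lemma Hhat_HB:
  assumes "Hhat_cc \<Omega> g"
  shows "HB (g i j) (ccnorm g)" "HB (curlM g i j) (ccnorm g)" "HB (inc g i j) (ccnorm g)"
proof -
  have in': "in_Hm1 (g i j)" "in_Hm1 (curlM g i j)" "in_Hm1 (inc g i j)"
    using assms by (auto simp: Hhat_cc_def Htm1_def)
  note s = sum_sq_nonneg[of "\<lambda>i j. Hm1norm (g i j)"] sum_sq_nonneg[of "\<lambda>i j. Hm1norm (curlM g i j)"]
    sum_sq_nonneg[of "\<lambda>i j. Hm1norm (inc g i j)"]
  note u = sum_sq_upper[of "\<lambda>i j. Hm1norm (g i j)" i j] sum_sq_upper[of "\<lambda>i j. Hm1norm (curlM g i j)" i j]
    sum_sq_upper[of "\<lambda>i j. Hm1norm (inc g i j)" i j]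
  have "Hm1norm (g i j) \<le> ccnorm g" "Hm1norm (curlM g i j) \<le> ccnorm g" "Hm1norm (inc g i j) \<le> ccnorm g"
    unfolding ccnorm_def by (rule real_le_rsqrt; use s u in linarith)+
  then show "HB (g i j) (ccnorm g)" "HB (curlM g i j) (ccnorm g)" "HB (inc g i j) (ccnorm g)"
    using in' HB_Hm1norm HB_mono by blast+
qed

lemma HB_cong: "HB u M \<Longrightarrow> (\<And>\<phi>. test \<phi> \<Longrightarrow> v \<phi> = u \<phi>) \<Longrightarrow> HB v M"
  unfolding HB_def lin_test_def by (simp add: test_on_add test_on_cmult)

lemma HB_eps_sum:
  assumes "\<And>m. HB (u m) M" shows "HB (\<lambda>\<phi>. \<Sum>m\<in>UNIV. eps (m::3) k j * u m \<phi>) (3 * M)"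
proof (rule HB_mono)
  have M: "M \<ge> 0" using HB_nonneg[OF assms[of 1]] .
  show "HB (\<lambda>\<phi>. \<Sum>m\<in>UNIV. eps m k j * u m \<phi>) (\<Sum>m\<in>UNIV. \<bar>eps m k j\<bar> * M)"
    by (intro HB_sum HB_cmult assms)
  have "(\<Sum>m\<in>UNIV. \<bar>eps m k j\<bar> * M) \<le> (\<Sum>m\<in>(UNIV::3 set). 1 * M)"
    by (intro sum_mono mult_right_mono abs_eps_le M)
  then show "(\<Sum>m\<in>UNIV. \<bar>eps m k j\<bar> * M) \<le> 3 * M" by simp
qed

lemma HB_rcurl: "Hhat_cc \<Omega> g \<Longrightarrow> HB (rcurl g i k j) (3 * ccnorm g)"
  by (rule HB_cong[OF HB_eps_sum[OF Hhat_HB(2)]]) (simp_all add: rcurl_eq)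

lemma HB_riem: "Hhat_cc \<Omega> g \<Longrightarrow> HB (riem g l i k j) (3 * (3 * ccnorm g))"
  by (rule HB_cong[OF HB_eps_sum[OF HB_eps_sum[OF Hhat_HB(3)]]]) (simp_all add: riem_eq)

lemma pd_mult_test:
  assumes "test \<eta>" "test \<phi>"
  shows "(\<lambda>x. \<eta> x * pd k \<phi> x) = (\<lambda>x. pd k (\<lambda>x. \<eta> x * \<phi> x) x - pd k \<eta> x * \<phi> x)"
  using assms by (simp add: pd_mult' test_smooth)

lemma test_mult: "test \<eta> \<Longrightarrow> test \<phi> \<Longrightarrow> test (\<lambda>x. \<eta> x * \<phi> x)"
  by (intro test_on_mult_smooth test_smooth)

text \<open>Leibniz rule in dual form: the commutator of the curl with multiplication by \<eta>
  contains \<open>g\<close> without derivatives.\<close>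

lemma rcurl_loc:
  assumes g: "\<And>i j. lin_test (g i j)" and \<eta>: "test \<eta>" and \<phi>: "test \<phi>"
  shows "rcurl (loc \<eta> g) i k j \<phi> =
    rcurl g i k j (\<lambda>x. \<eta> x * \<phi> x) + (loc (pd k \<eta>) g i j \<phi> - loc (pd j \<eta>) g i k \<phi>)"
proof -
  have "g i j (\<lambda>x. \<eta> x * pd k \<phi> x) = g i j (pd k (\<lambda>x. \<eta> x * \<phi> x)) - g i j (\<lambda>x. pd k \<eta> x * \<phi> x)" for i j k
    unfolding pd_mult_test[OF \<eta> \<phi>] by (intro lin_test_diff g test_on_pd test_mult \<eta> \<phi>)
  then show ?thesis by (simp add: rcurl_def loc_def)
qed

text \<open>The second-order commutator contains single first derivatives of \<open>g\<close>, for
  which there is no bound individually. By the symmetry of \<open>g\<close> they combine to curls of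
  the rows of \<open>loc (pd k \<eta>) g\<close>, and those are controlled.\<close>

lemma riem_loc:
  assumes g: "\<And>i j. lin_test (g i j)" and c: "\<And>i k j. lin_test (rcurl g i k j)" and sym: "\<And>i j \<phi>. test \<phi> \<Longrightarrow> g i j \<phi> = g j i \<phi>"
    and \<eta>: "test \<eta>" and \<phi>: "test \<phi>"
  shows "riem (loc \<eta> g) l i k j \<phi> =
    (riem g l i k j (\<lambda>x. \<eta> x * \<phi> x) + (rcurl g i k j (\<lambda>x. pd l \<eta> x * \<phi> x) - rcurl g l k j (\<lambda>x. pd i \<eta> x * \<phi> x)))
    + (rcurl (loc (pd k \<eta>) g) j l i \<phi> - rcurl (loc (pd j \<eta>) g) k l i \<phi>)"
proof -
  have e: "rcurl (loc \<eta> g) i k j (pd l \<phi>) =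
     (rcurl g i k j (pd l (\<lambda>x. \<eta> x * \<phi> x)) - rcurl g i k j (\<lambda>x. pd l \<eta> x * \<phi> x)) + (loc (pd k \<eta>) g i j (pd l \<phi>) - loc (pd j \<eta>) g i k (pd l \<phi>))"
    for i l
  proof -
    have "rcurl g i k j (\<lambda>x. \<eta> x * pd l \<phi> x) = rcurl g i k j (pd l (\<lambda>x. \<eta> x * \<phi> x)) - rcurl g i k j (\<lambda>x. pd l \<eta> x * \<phi> x)"
      unfolding pd_mult_test[OF \<eta> \<phi>] by (intro lin_test_diff c test_on_pd test_mult \<eta> \<phi>)
    then show ?thesis unfolding rcurl_loc[OF g \<eta> test_on_pd[OF \<phi>]] by simp
  qed
  have s: "loc (pd m \<eta>) g a b (pd n \<phi>) = loc (pd m \<eta>) g b a (pd n \<phi>)" for m n a b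
    unfolding loc_def by (intro sym test_mult test_on_pd \<eta> \<phi>)
  have "riem (loc \<eta> g) l i k j \<phi> = - rcurl (loc \<eta> g) i k j (pd l \<phi>) + rcurl (loc \<eta> g) l k j (pd i \<phi>)"
    by (simp add: riem_def)
  then show ?thesis unfolding e
    using s[of k i j l] s[of k l j i] s[of j i k l] s[of j l k i]
    by (simp add: riem_def rcurl_def[of "loc _ g"])
qed

lemma HB_loc_ex:
  assumes \<eta>: "test \<eta>" shows "\<exists>C\<ge>0. \<forall>g i j. Hhat_cc \<Omega> g \<longrightarrow> HB (loc \<eta> g i j) (C * ccnorm g)"
proof -
  obtain C where "C \<ge> 0" "\<And>u M. HB u M \<Longrightarrow> HB (\<lambda>\<phi>. u (\<lambda>x. \<eta> x * \<phi> x)) (C * M)"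
    using HB_mult_test[OF \<eta>] by blast
  then show ?thesis unfolding loc_def using Hhat_HB(1) by metis
qed

text \<open>The sum of three chosen constants dominates each of them.\<close>

lemma uniform_bound_3:
  assumes "\<And>k::3. \<exists>C\<ge>(0::real). P k C" and mono: "\<And>k C D. P k C \<Longrightarrow> C \<le> D \<Longrightarrow> P k D"
  shows "\<exists>C\<ge>0. \<forall>k. P k C"
proof -
  define c where "c k = (SOME C. C \<ge> 0 \<and> P k C)" for k
  have c: "c k \<ge> 0" "P k (c k)" for k using someI_ex[of "\<lambda>C. C \<ge> 0 \<and> P k C"] assms(1) by (auto simp: c_def)
  have "c k \<le> (\<Sum>k\<in>UNIV. c k)" for k by (rule member_le_sum) (auto simp: c)
  then show ?thesis using c mono by (intro exI[of _ "\<Sum>k\<in>UNIV. c k"] conjI allI sum_nonneg) blast+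
qed

lemma HB_loc_mono:
  "HB u (C * ccnorm g) \<Longrightarrow> C \<le> D \<Longrightarrow> HB u (D * ccnorm g)"
  by (erule HB_mono) (intro mult_right_mono ccnorm_nonneg)

lemma HB_loc_pd_ex:
  assumes \<eta>: "test \<eta>" shows "\<exists>C\<ge>0. \<forall>k g i j. Hhat_cc \<Omega> g \<longrightarrow> HB (loc (pd k \<eta>) g i j) (C * ccnorm g)"
  by (rule uniform_bound_3[where P="\<lambda>k C. \<forall>g i j. Hhat_cc \<Omega> g \<longrightarrow> HB (loc (pd k \<eta>) g i j) (C * ccnorm g)"])
    (use HB_loc_ex[OF test_on_pd[OF \<eta>]] HB_loc_mono in blast)+

lemma HB_rcurl_loc_ex:
  assumes \<eta>: "test \<eta>"
  shows "\<exists>C\<ge>0. \<forall>g i k j. Hhat_cc \<Omega> g \<longrightarrow> HB (rcurl (loc \<eta> g) i k j) (C * ccnorm g)"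
proof -
  obtain C where C: "C \<ge> 0" "\<And>u M. HB u M \<Longrightarrow> HB (\<lambda>\<phi>. u (\<lambda>x. \<eta> x * \<phi> x)) (C * M)"
    using HB_mult_test[OF \<eta>] by blast
  obtain D where D: "D \<ge> 0" "\<And>k g i j. Hhat_cc \<Omega> g \<Longrightarrow> HB (loc (pd k \<eta>) g i j) (D * ccnorm g)"
    using HB_loc_pd_ex[OF \<eta>] by blast
  show ?thesis
  proof (intro exI[of _ "C * 3 + (D + D)"] conjI allI impI)
    show "0 \<le> C * 3 + (D + D)" using C(1) D(1) by simp
    fix g i k j assume g: "Hhat_cc \<Omega> g"
    have "HB (\<lambda>\<phi>. rcurl g i k j (\<lambda>x. \<eta> x * \<phi> x) + (loc (pd k \<eta>) g i j \<phi> - loc (pd j \<eta>) g i k \<phi>))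
      (C * (3 * ccnorm g) + (D * ccnorm g + D * ccnorm g))"
      by (intro HB_add HB_diff C(2) D(2) HB_rcurl[OF g] g)
    then have "HB (rcurl (loc \<eta> g) i k j) (C * (3 * ccnorm g) + (D * ccnorm g + D * ccnorm g))"
      by (rule HB_cong) (rule rcurl_loc[OF HB_lin[OF Hhat_HB(1)[OF g]] \<eta>])
    then show "HB (rcurl (loc \<eta> g) i k j) ((C * 3 + (D + D)) * ccnorm g)" by (simp add: algebra_simps)
  qed
qed

lemma HB_riem_loc_ex:
  assumes \<eta>: "test \<eta>"
  shows "\<exists>C\<ge>0. \<forall>g l i k j. Hhat_cc \<Omega> g \<longrightarrow> HB (riem (loc \<eta> g) l i k j) (C * ccnorm g)"
proof -
  obtain C where C: "C \<ge> 0" "\<And>u M. HB u M \<Longrightarrow> HB (\<lambda>\<phi>. u (\<lambda>x. \<eta> x * \<phi> x)) (C * M)"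
    using HB_mult_test[OF \<eta>] by blast
  have "\<exists>C\<ge>0. \<forall>k u M. HB u M \<longrightarrow> HB (\<lambda>\<phi>. u (\<lambda>x. pd k \<eta> x * \<phi> x)) (C * M)"
  proof (rule uniform_bound_3[where P="\<lambda>k C. \<forall>u M. HB u M \<longrightarrow> HB (\<lambda>\<phi>. u (\<lambda>x. pd k \<eta> x * \<phi> x)) (C * M)"])
    show "\<exists>C\<ge>0. \<forall>u M. HB u M \<longrightarrow> HB (\<lambda>\<phi>. u (\<lambda>x. pd k \<eta> x * \<phi> x)) (C * M)" for k
      using HB_mult_test[OF test_on_pd[OF \<eta>, of k]] by metis
    fix k C D assume *: "\<forall>u M. HB u M \<longrightarrow> HB (\<lambda>\<phi>. u (\<lambda>x. pd k \<eta> x * \<phi> x)) (C * M)" "C \<le> D"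
    show "\<forall>u M. HB u M \<longrightarrow> HB (\<lambda>\<phi>. u (\<lambda>x. pd k \<eta> x * \<phi> x)) (D * M)"
    proof (intro allI impI)
      fix u M assume u: "HB u M"
      from *(1) u have "HB (\<lambda>\<phi>. u (\<lambda>x. pd k \<eta> x * \<phi> x)) (C * M)" by blast
      then show "HB (\<lambda>\<phi>. u (\<lambda>x. pd k \<eta> x * \<phi> x)) (D * M)"
        by (rule HB_mono) (intro mult_right_mono *(2) HB_nonneg[OF u])
    qed
  qed
  then obtain D where D: "D \<ge> 0" "\<And>k u M. HB u M \<Longrightarrow> HB (\<lambda>\<phi>. u (\<lambda>x. pd k \<eta> x * \<phi> x)) (D * M)" by blast
  have "\<exists>C\<ge>0. \<forall>m g i k j. Hhat_cc \<Omega> g \<longrightarrow> HB (rcurl (loc (pd m \<eta>) g) i k j) (C * ccnorm g)"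
    by (rule uniform_bound_3[where P="\<lambda>m C. \<forall>g i k j. Hhat_cc \<Omega> g \<longrightarrow> HB (rcurl (loc (pd m \<eta>) g) i k j) (C * ccnorm g)"])
      (use HB_rcurl_loc_ex[OF test_on_pd[OF \<eta>]] HB_loc_mono in blast)+
  then obtain F where F: "F \<ge> 0" "\<And>m g i k j. Hhat_cc \<Omega> g \<Longrightarrow> HB (rcurl (loc (pd m \<eta>) g) i k j) (F * ccnorm g)" by blast
  show ?thesis
  proof (intro exI[of _ "C * 9 + (D * 3 + D * 3) + (F + F)"] conjI allI impI)
    show "0 \<le> C * 9 + (D * 3 + D * 3) + (F + F)" using C(1) D(1) F(1) by simp
    fix g l i k j assume g: "Hhat_cc \<Omega> g"
    have "HB (\<lambda>\<phi>. (riem g l i k j (\<lambda>x. \<eta> x * \<phi> x) + (rcurl g i k j (\<lambda>x. pd l \<eta> x * \<phi> x) - rcurl g l k j (\<lambda>x. pd i \<eta> x * \<phi> x)))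
        + (rcurl (loc (pd k \<eta>) g) j l i \<phi> - rcurl (loc (pd j \<eta>) g) k l i \<phi>))
      ((C * (3 * (3 * ccnorm g)) + (D * (3 * ccnorm g) + D * (3 * ccnorm g))) + (F * ccnorm g + F * ccnorm g))"
      by (intro HB_add HB_diff C(2) D(2) F(2) HB_rcurl[OF g] HB_riem[OF g] g)
    then have "HB (riem (loc \<eta> g) l i k j)
      ((C * (3 * (3 * ccnorm g)) + (D * (3 * ccnorm g) + D * (3 * ccnorm g))) + (F * ccnorm g + F * ccnorm g))"
      by (rule HB_cong)
        (rule riem_loc[OF HB_lin[OF Hhat_HB(1)[OF g]] HB_lin[OF HB_rcurl[OF g]] Hhat_sym[OF g] \<eta>])
    then show "HB (riem (loc \<eta> g) l i k j) ((C * 9 + (D * 3 + D * 3) + (F + F)) * ccnorm g)" by (simp add: algebra_simps)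
  qed
qed

text \<open>The product \<eta> \<phi> lives on the intersection of two supports, and this misses the
  closure of the domain as soon as \<phi> avoids the part of it met by \<eta>.\<close>

lemma supp_in_loc:
  assumes g: "Hhat_cc \<Omega> g" and \<eta>: "test \<eta>"
  shows "supp_in (loc \<eta> g i j) (closure \<Omega> \<inter> tsupp \<eta>)"
  unfolding supp_in_def loc_def
proof (intro allI impI)
  fix \<phi> assume \<phi>: "test_on (- (closure \<Omega> \<inter> tsupp \<eta>)) \<phi>"
  have "test_on (- closure \<Omega>) (\<lambda>x. \<eta> x * \<phi> x)"
  proof (rule test_onI[of _ "tsupp \<eta> \<inter> tsupp \<phi>"])
    show "smooth_fun (\<lambda>x. \<eta> x * \<phi> x)" by (intro smooth_fun_mult test_smooth[OF \<eta>] test_smooth[OF \<phi>])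
    show "compact (tsupp \<eta> \<inter> tsupp \<phi>)" by (intro compact_Int test_compact[OF \<eta>] test_compact[OF \<phi>])
    show "tsupp \<eta> \<inter> tsupp \<phi> \<subseteq> - closure \<Omega>" using \<phi> by (auto simp: test_on_def)
    show "\<eta> x * \<phi> x = 0" if "x \<notin> tsupp \<eta> \<inter> tsupp \<phi>" for x using that not_in_tsupp by auto
  qed
  then show "g i j (\<lambda>x. \<eta> x * \<phi> x) = 0" using g by (auto simp: Hhat_cc_def Htm1_def supp_in_def)
qed

lemma supp_in_rcurl: "(\<And>i j. supp_in (h i j) K) \<Longrightarrow> supp_in (rcurl h i k j) K"
  unfolding supp_in_def rcurl_def by (simp add: test_on_pd)

lemma supp_in_riem: "(\<And>i j. supp_in (h i j) K) \<Longrightarrow> supp_in (riem h l i k j) K"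
  using supp_in_rcurl[of h K] unfolding supp_in_def riem_def by (simp add: test_on_pd)

subsection \<open>The local decomposition\<close>

lemma fd_commute: "fd f g = fd g f"
  by (simp add: fd_def mult.commute)

lemma fd_sum: "test \<psi> \<Longrightarrow> (\<And>i. i \<in> I \<Longrightarrow> test (w i)) \<Longrightarrow> fd (\<lambda>x. \<Sum>i\<in>I. w i x) \<psi> = (\<Sum>i\<in>I. fd (w i) \<psi>)"
  using lin_test_sum[OF fd_lin[OF L2_test], of \<psi> I w] by (simp add: fd_commute[of _ \<psi>])

lemma fd_comb: "test \<psi> \<Longrightarrow> test f \<Longrightarrow> test g \<Longrightarrow> fd (\<lambda>x. a * f x + b * g x) \<psi> = a * fd f \<psi> + b * fd g \<psi>"
  using lin_test_comb[OF fd_lin[OF L2_test], of \<psi> f g a b] by (simp add: fd_commute[of _ \<psi>])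

lemma refl_fun_cv: "test a \<Longrightarrow> test b \<Longrightarrow> refl_fun (cv a b) = cv (refl_fun a) (refl_fun b)"
proof
  fix x assume a: "test a" and b: "test b"
  have "(\<lambda>y. a y * b (- x - y)) \<in> borel_measurable borel"
    by (intro borel_measurable_times borel_measurable_test a test_shift_refl b)
  from integral_shift_refl[OF this, of 0]
  show "refl_fun (cv a b) x = cv (refl_fun a) (refl_fun b) x"
    unfolding refl_fun_def cv_eq by (simp add: algebra_simps)
qed

lemma h1n_cv_le:
  assumes k: "OB k C" "test k" and f: "test f" shows "h1n (cv f k) \<le> C * h1n f"
proof (rule power2_le_imp_le)
  have C: "C \<ge> 0" by (rule OB_nonneg[OF k(1)])
  have "(L2n (cv f k))\<^sup>2 \<le> (C * L2n f)\<^sup>2" by (intro power_mono OB_D k f L2n_nonneg)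
  moreover have "(L2n (pd j (cv f k)))\<^sup>2 \<le> (C * L2n (pd j f))\<^sup>2" for j
    unfolding pd_cv_left[OF f k(2)] by (intro power_mono OB_D k test_on_pd f L2n_nonneg)
  ultimately have "(h1n (cv f k))\<^sup>2 \<le> (C * L2n f)\<^sup>2 + (\<Sum>j\<in>UNIV. (C * L2n (pd j f))\<^sup>2)"
    unfolding h1n_sq by (intro add_mono sum_mono)
  also have "\<dots> = (C * h1n f)\<^sup>2" by (simp add: power_mult_distrib h1n_sq sum_distrib_left distrib_left)
  finally show "(h1n (cv f k))\<^sup>2 \<le> (C * h1n f)\<^sup>2" .
  show "0 \<le> C * h1n f" using C h1n_nonneg[of f] by simp
qed

text \<open>One package for a cutoff \<eta>: bounds uniform in \<open>g\<close>, symmetry, pointwise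
  linearity, and recovery of \<eta> g in the limit. Patches can be added, and \<eta> = 1 is the
  global statement.\<close>

definition decomposes :: "R3 set \<Rightarrow> (R3 \<Rightarrow> real) \<Rightarrow> ((3 \<Rightarrow> 3 \<Rightarrow> distr) \<Rightarrow> nat \<Rightarrow> 3 \<Rightarrow> 3 \<Rightarrow> R3 \<Rightarrow> real)
    \<Rightarrow> ((3 \<Rightarrow> 3 \<Rightarrow> distr) \<Rightarrow> nat \<Rightarrow> 3 \<Rightarrow> R3 \<Rightarrow> real) \<Rightarrow> ((3 \<Rightarrow> 3 \<Rightarrow> distr) \<Rightarrow> nat \<Rightarrow> R3 \<Rightarrow> real) \<Rightarrow> real \<Rightarrow> bool" where
  "decomposes \<Omega> \<eta> X Y Z C \<longleftrightarrow> C \<ge> 0 \<and>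
    (\<forall>g. Hhat_cc \<Omega> g \<longrightarrow> (\<forall>i j. h10_seq \<Omega> (C * ccnorm g) (\<lambda>N. X g N i j)) \<and>
       (\<forall>k. h10_seq \<Omega> (C * ccnorm g) (\<lambda>N. Y g N k)) \<and> h10_seq \<Omega> (C * ccnorm g) (Z g)) \<and>
    (\<forall>g N i j. X g N i j = X g N j i) \<and>
    (\<forall>g h a b N. (\<forall>i j x. X (\<lambda>i j \<phi>. a * g i j \<phi> + b * h i j \<phi>) N i j x = a * X g N i j x + b * X h N i j x) \<and>
       (\<forall>k x. Y (\<lambda>i j \<phi>. a * g i j \<phi> + b * h i j \<phi>) N k x = a * Y g N k x + b * Y h N k x) \<and>
       (\<forall>x. Z (\<lambda>i j \<phi>. a * g i j \<phi> + b * h i j \<phi>) N x = a * Z g N x + b * Z h N x)) \<and>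
    (\<forall>g i j \<psi>. Hhat_cc \<Omega> g \<longrightarrow> test \<psi> \<longrightarrow>
       (\<lambda>N. fd (X g N i j) \<psi> + defV (\<lambda>k. fd (Y g N k)) i j \<psi> + hess (fd (Z g N)) i j \<psi>) \<longlonglongrightarrow> g i j (\<lambda>x. \<eta> x * \<psi> x))"

text \<open>The kernels have supports of height 1, but the condition on the domain is for height 2,
  because at most two of them are convolved with each other.\<close>

locale patch =
  fixes \<Omega> :: "R3 set" and \<eta> :: "R3 \<Rightarrow> real" and p :: R3 and d :: real
    and \<rho> :: "R3 \<Rightarrow> real" and E :: "nat \<Rightarrow> 3 \<Rightarrow> R3 \<Rightarrow> real" and RN :: "nat \<Rightarrow> R3 \<Rightarrow> real"
  assumes bd: "bounded \<Omega>" and \<eta>: "test \<eta>"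
    and cone: "\<And>y c. y \<in> closure \<Omega> \<Longrightarrow> y \<in> tsupp \<eta> \<Longrightarrow> c \<in> cone_seg p d 2 \<Longrightarrow> y + c \<in> \<Omega>"
    and \<rho>: "test \<rho>" and E: "\<And>N k. test (E N k)" and RN: "\<And>N. test (RN N)"
    and supp\<rho>: "tsupp \<rho> \<subseteq> cone_seg p d 1" and suppE: "\<And>N k. tsupp (E N k) \<subseteq> cone_seg p d 1"
    and div: "\<And>N x. (\<Sum>k\<in>UNIV. pd k (E N k) x) = RN N x - \<rho> x"
    and OBE: "\<exists>C. \<forall>N k. OB (E N k) C" and OBpdE: "\<exists>C. \<forall>N k m. OB (pd m (E N k)) C"
    and CauchyE: "\<And>e. e > 0 \<Longrightarrow> \<exists>N0. \<forall>N\<ge>N0. \<forall>M\<ge>N0. \<forall>k. OB (\<lambda>x. E N k x - E M k x) e"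
    and approx: "\<And>\<psi>. test \<psi> \<Longrightarrow> (\<lambda>N. h1n (\<lambda>x. cv \<psi> (refl_fun (RN N)) x - \<psi> x)) \<longlonglongrightarrow> 0"
begin

definition EE :: "nat \<Rightarrow> 3 \<Rightarrow> 3 \<Rightarrow> R3 \<Rightarrow> real" where "EE N l k = cv (E N l) (E N k)"
definition RE :: "nat \<Rightarrow> 3 \<Rightarrow> R3 \<Rightarrow> real" where "RE N k = cv \<rho> (E N k)"

definition X0 :: "(3 \<Rightarrow> 3 \<Rightarrow> distr) \<Rightarrow> nat \<Rightarrow> 3 \<Rightarrow> 3 \<Rightarrow> R3 \<Rightarrow> real" where
  "X0 h N i j x = conv (h i j) \<rho> x + ((\<Sum>k\<in>UNIV. conv (rcurl h i k j) (RE N k) x)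
     + (\<Sum>k\<in>UNIV. \<Sum>l\<in>UNIV. conv (riem h l i k j) (EE N l k) x))"

definition X :: "(3 \<Rightarrow> 3 \<Rightarrow> distr) \<Rightarrow> nat \<Rightarrow> 3 \<Rightarrow> 3 \<Rightarrow> R3 \<Rightarrow> real" where
  "X g N i j = (\<lambda>x. (1/2) * X0 (loc \<eta> g) N i j x + (1/2) * X0 (loc \<eta> g) N j i x)"

text \<open>Before symmetrisation the curl term occurs under both derivatives, once from each of the
  two index positions, while the term with \<rho> occurs under one. Averaging over i and j and
  comparing with the factor 1/2 in \<open>defV\<close> gives the coefficients 2 and 1.\<close>

definition Y0 :: "(3 \<Rightarrow> 3 \<Rightarrow> distr) \<Rightarrow> nat \<Rightarrow> 3 \<Rightarrow> R3 \<Rightarrow> real" where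
  "Y0 h N i x = 1 * (\<Sum>k\<in>UNIV. conv (h k i) (RE N k) x) + 2 * (\<Sum>k\<in>UNIV. \<Sum>l\<in>UNIV. conv (rcurl h k l i) (EE N l k) x)"

definition Y :: "(3 \<Rightarrow> 3 \<Rightarrow> distr) \<Rightarrow> nat \<Rightarrow> 3 \<Rightarrow> R3 \<Rightarrow> real" where
  "Y g = Y0 (loc \<eta> g)"

definition Z :: "(3 \<Rightarrow> 3 \<Rightarrow> distr) \<Rightarrow> nat \<Rightarrow> R3 \<Rightarrow> real" where
  "Z g N x = (\<Sum>k\<in>UNIV. \<Sum>l\<in>UNIV. conv (loc \<eta> g k l) (EE N l k) x)"

definition K :: "R3 set" where "K = closure \<Omega> \<inter> tsupp \<eta>"

lemma compact_K: "compact K"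
  unfolding K_def using bd test_compact[OF \<eta>] by (intro compact_Int) (simp_all add: compact_closure)

lemma tEE: "test (EE N l k)" and tRE: "test (RE N k)"
  unfolding EE_def RE_def by (intro test_cv \<rho> E)+

lemma subset_of_cone:
  assumes "tsupp k \<subseteq> cone_seg p d 2" shows "{a + b |a b. a \<in> K \<and> b \<in> tsupp k} \<subseteq> \<Omega>"
  using assms cone unfolding K_def by blast

lemma tsupp_cv_cone:
  assumes "test a" "test b" "tsupp a \<subseteq> cone_seg p d 1" "tsupp b \<subseteq> cone_seg p d 1"
  shows "tsupp (cv a b) \<subseteq> cone_seg p d 2"
proof
  fix x assume "x \<in> tsupp (cv a b)"
  then obtain y z where yz: "x = y + z" "y \<in> tsupp a" "z \<in> tsupp b" using tsupp_cv[OF assms(1,2)] by auto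
  then have "y \<in> cone_seg p d 1" "z \<in> cone_seg p d 1" using assms(3,4) by auto
  from cone_seg_add[OF this] show "x \<in> cone_seg p d 2" using yz(1) by simp
qed

lemma sub_\<rho>: "{a + b |a b. a \<in> K \<and> b \<in> tsupp \<rho>} \<subseteq> \<Omega>"
  by (rule subset_of_cone) (use supp\<rho> cone_seg_mono[of 1 2 p d] in auto)

lemma sub_EE: "{a + b |a b. a \<in> K \<and> b \<in> tsupp (EE N l k)} \<subseteq> \<Omega>"
  unfolding EE_def by (intro subset_of_cone tsupp_cv_cone E suppE)

lemma sub_RE: "{a + b |a b. a \<in> K \<and> b \<in> tsupp (RE N k)} \<subseteq> \<Omega>"
  unfolding RE_def by (intro subset_of_cone tsupp_cv_cone E suppE \<rho> supp\<rho>)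

lemma kernel_seqs:
  obtains C where "C \<ge> 0" "kernel_seq (\<lambda>_. \<rho>) C" "\<And>k. kernel_seq (\<lambda>N. RE N k) C" "\<And>l k. kernel_seq (\<lambda>N. EE N l k) C"
proof -
  obtain A where A: "\<And>N k. OB (E N k) A" using OBE by blast
  obtain B where B: "\<And>N k m. OB (pd m (E N k)) B" using OBpdE by blast
  have E1: "kernel_seq1 (\<lambda>N. E N k) (max A B)" for k
    unfolding kernel_seq1_def
  proof (intro conjI allI impI)
    fix N m
    show "test (E N k)" by (rule E)
    show "OB (E N k) (max A B)" by (rule OB_mono[OF A]) simp
    show "OB (pd m (E N k)) (max A B)" by (rule OB_mono[OF B]) simp
  next
    fix e :: real assume "e > 0"
    from CauchyE[OF this] show "\<exists>N0. \<forall>N\<ge>N0. \<forall>M\<ge>N0. OB (\<lambda>x. E N k x - E M k x) e" by blast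
  qed
  obtain R where R: "kernel_seq (\<lambda>_. \<rho>) R" "kernel_seq1 (\<lambda>_. \<rho>) R" using kernel_seq_const[OF \<rho>] by blast
  have RE: "kernel_seq (\<lambda>N. RE N k) (R * max A B)" for k unfolding RE_def by (rule kernel_seq_cv[OF R(2) E1])
  have EE: "kernel_seq (\<lambda>N. EE N l k) (max A B * max A B)" for l k unfolding EE_def by (rule kernel_seq_cv[OF E1 E1])
  have mono: "kernel_seq \<kappa> C \<Longrightarrow> C \<le> D \<Longrightarrow> kernel_seq \<kappa> D" for \<kappa> C D
    unfolding kernel_seq_def by (meson OB_mono)
  have R0: "R \<ge> 0" using R(1) OB_nonneg unfolding kernel_seq_def by blast
  define S where "S = R * max A B"
  define T where "T = max A B * max A B"
  show thesis
    by (rule that[of "max R (max S T)"])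
      (use R0 in \<open>auto intro: mono[OF R(1)] mono[OF RE[folded S_def]] mono[OF EE[folded T_def]]\<close>)
qed

lemma HB_h_ex:
  "\<exists>D\<ge>0. \<forall>g. Hhat_cc \<Omega> g \<longrightarrow> (\<forall>i j. HB (loc \<eta> g i j) (D * ccnorm g)) \<and>
     (\<forall>i k j. HB (rcurl (loc \<eta> g) i k j) (D * ccnorm g)) \<and> (\<forall>l i k j. HB (riem (loc \<eta> g) l i k j) (D * ccnorm g))"
proof -
  obtain D1 where D1: "D1 \<ge> 0" "\<And>g i j. Hhat_cc \<Omega> g \<Longrightarrow> HB (loc \<eta> g i j) (D1 * ccnorm g)"
    using HB_loc_ex[OF \<eta>] by blast
  obtain D2 where D2: "D2 \<ge> 0" "\<And>g i k j. Hhat_cc \<Omega> g \<Longrightarrow> HB (rcurl (loc \<eta> g) i k j) (D2 * ccnorm g)"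
    using HB_rcurl_loc_ex[OF \<eta>] by blast
  obtain D3 where D3: "D3 \<ge> 0" "\<And>g l i k j. Hhat_cc \<Omega> g \<Longrightarrow> HB (riem (loc \<eta> g) l i k j) (D3 * ccnorm g)"
    using HB_riem_loc_ex[OF \<eta>] by blast
  show ?thesis
    by (rule exI[of _ "max D1 (max D2 D3)"])
      (use D1(1) in \<open>auto intro: HB_loc_mono[OF D1(2)] HB_loc_mono[OF D2(2)] HB_loc_mono[OF D3(2)]\<close>)
qed

lemma h10_seqs:
  obtains C where "C \<ge> 0" "\<And>g i j. Hhat_cc \<Omega> g \<Longrightarrow> h10_seq \<Omega> (C * ccnorm g) (\<lambda>N. X g N i j)"
    "\<And>g k. Hhat_cc \<Omega> g \<Longrightarrow> h10_seq \<Omega> (C * ccnorm g) (\<lambda>N. Y g N k)"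
    "\<And>g. Hhat_cc \<Omega> g \<Longrightarrow> h10_seq \<Omega> (C * ccnorm g) (Z g)"
proof -
  obtain A where A: "A \<ge> 0" "kernel_seq (\<lambda>_. \<rho>) A" "\<And>k. kernel_seq (\<lambda>N. RE N k) A" "\<And>l k. kernel_seq (\<lambda>N. EE N l k) A"
    using kernel_seqs by blast
  obtain D where D': "D \<ge> 0 \<and> (\<forall>g. Hhat_cc \<Omega> g \<longrightarrow> (\<forall>i j. HB (loc \<eta> g i j) (D * ccnorm g)) \<and>
     (\<forall>i k j. HB (rcurl (loc \<eta> g) i k j) (D * ccnorm g)) \<and> (\<forall>l i k j. HB (riem (loc \<eta> g) l i k j) (D * ccnorm g)))"
    using HB_h_ex by (elim exE) (rule that)
  then have D: "D \<ge> 0" "\<And>g i j. Hhat_cc \<Omega> g \<Longrightarrow> HB (loc \<eta> g i j) (D * ccnorm g)"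
    "\<And>g i k j. Hhat_cc \<Omega> g \<Longrightarrow> HB (rcurl (loc \<eta> g) i k j) (D * ccnorm g)"
    "\<And>g l i k j. Hhat_cc \<Omega> g \<Longrightarrow> HB (riem (loc \<eta> g) l i k j) (D * ccnorm g)"
    by simp_all
  define B where "B = 2 * A * D"
  have B: "B \<ge> 0" using A(1) D(1) by (simp add: B_def)
  \<comment> \<open>The constant 21 is the largest count of elementary convolutions: 1 + 3 + 9 for
    \<open>X\<close>, 3 + 2 * 9 for \<open>Y\<close>, 9 for \<open>Z\<close>.\<close>
  show thesis
  proof (rule that[of "21 * B"])
    show "21 * B \<ge> 0" using B by simp
  next
    fix g assume g: "Hhat_cc \<Omega> g"
    define M where "M = 2 * A * (D * ccnorm g)"
    have M: "M \<ge> 0" "21 * B * ccnorm g = 21 * M" using A D ccnorm_nonneg[of g] by (auto simp: M_def B_def)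
    have s: "supp_in (loc \<eta> g i j) K" for i j unfolding K_def by (rule supp_in_loc[OF g \<eta>])
    note s' = s supp_in_rcurl[OF s] supp_in_riem[OF s]
    have c: "h10_seq \<Omega> M (\<lambda>N. conv (loc \<eta> g i j) \<rho>)" "h10_seq \<Omega> M (\<lambda>N. conv (loc \<eta> g i j) (RE N k))"
      "h10_seq \<Omega> M (\<lambda>N. conv (loc \<eta> g i j) (EE N l k))"
      "h10_seq \<Omega> M (\<lambda>N. conv (rcurl (loc \<eta> g) i m j) (RE N k))"
      "h10_seq \<Omega> M (\<lambda>N. conv (rcurl (loc \<eta> g) i m j) (EE N l k))"
      "h10_seq \<Omega> M (\<lambda>N. conv (riem (loc \<eta> g) n i m j) (EE N l k))" for i j k l m n
      unfolding M_def
      by (rule h10_seq_conv[OF D(2)[OF g] s'(1) compact_K A(2) sub_\<rho>] h10_seq_conv[OF D(2)[OF g] s'(1) compact_K A(3) sub_RE]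
          h10_seq_conv[OF D(2)[OF g] s'(1) compact_K A(4) sub_EE] h10_seq_conv[OF D(3)[OF g] s'(2) compact_K A(3) sub_RE]
          h10_seq_conv[OF D(3)[OF g] s'(2) compact_K A(4) sub_EE] h10_seq_conv[OF D(4)[OF g] s'(3) compact_K A(4) sub_EE])+
    have X0: "h10_seq \<Omega> (M + ((\<Sum>k\<in>(UNIV::3 set). M) + (\<Sum>k\<in>(UNIV::3 set). \<Sum>l\<in>(UNIV::3 set). M))) (\<lambda>N x. X0 (loc \<eta> g) N i j x)" for i j
      unfolding X0_def by (intro h10_seq_add h10_seq_sum c)
    have "h10_seq \<Omega> (\<bar>1/2\<bar> * (M + ((\<Sum>k\<in>(UNIV::3 set). M) + (\<Sum>k\<in>(UNIV::3 set). \<Sum>l\<in>(UNIV::3 set). M)))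
       + \<bar>1/2\<bar> * (M + ((\<Sum>k\<in>(UNIV::3 set). M) + (\<Sum>k\<in>(UNIV::3 set). \<Sum>l\<in>(UNIV::3 set). M)))) (\<lambda>N. X g N i j)" for i j
      unfolding X_def by (intro h10_seq_comb X0)
    then show "h10_seq \<Omega> (21 * B * ccnorm g) (\<lambda>N. X g N i j)" for i j
      unfolding M(2) by (rule h10_seq_mono) (use M(1) in simp)
    have "h10_seq \<Omega> (\<bar>1\<bar> * (\<Sum>k\<in>(UNIV::3 set). M) + \<bar>2\<bar> * (\<Sum>k\<in>(UNIV::3 set). \<Sum>l\<in>(UNIV::3 set). M)) (\<lambda>N x. Y0 (loc \<eta> g) N i x)" for i
      unfolding Y0_def by (intro h10_seq_comb h10_seq_sum c)
    then have "h10_seq \<Omega> (\<bar>1\<bar> * (\<Sum>k\<in>(UNIV::3 set). M) + \<bar>2\<bar> * (\<Sum>k\<in>(UNIV::3 set). \<Sum>l\<in>(UNIV::3 set). M)) (\<lambda>N. Y g N i)" for i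
      by (simp add: Y_def)
    then show "h10_seq \<Omega> (21 * B * ccnorm g) (\<lambda>N. Y g N i)" for i
      unfolding M(2) by (rule h10_seq_mono) (use M(1) in simp)
    have "h10_seq \<Omega> (\<Sum>k\<in>(UNIV::3 set). \<Sum>l\<in>(UNIV::3 set). M) (\<lambda>N x. Z g N x)"
      unfolding Z_def by (intro h10_seq_sum c)
    then have "h10_seq \<Omega> (\<Sum>k\<in>(UNIV::3 set). \<Sum>l\<in>(UNIV::3 set). M) (Z g)" by simp
    then show "h10_seq \<Omega> (21 * B * ccnorm g) (Z g)"
      unfolding M(2) by (rule h10_seq_mono) (use M(1) in simp)
  qed
qed

lemma linear_ops:
  defines "G g h a b \<equiv> (\<lambda>i j \<phi>. a * g i j \<phi> + b * h i j \<phi>)"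
  shows "X (G g h a b) N i j x = a * X g N i j x + b * X h N i j x"
    "Y (G g h a b) N k x = a * Y g N k x + b * Y h N k x"
    "Z (G g h a b) N x = a * Z g N x + b * Z h N x"
proof -
  have l: "loc \<eta> (G g h a b) i j \<phi> = a * loc \<eta> g i j \<phi> + b * loc \<eta> h i j \<phi>" for i j \<phi> by (simp add: loc_def G_def)
  have r: "rcurl (loc \<eta> (G g h a b)) i k j \<phi> = a * rcurl (loc \<eta> g) i k j \<phi> + b * rcurl (loc \<eta> h) i k j \<phi>" for i k j \<phi>
    by (simp add: rcurl_def l algebra_simps)
  have m: "riem (loc \<eta> (G g h a b)) l i k j \<phi> = a * riem (loc \<eta> g) l i k j \<phi> + b * riem (loc \<eta> h) l i k j \<phi>" for l i k j \<phi>
    by (simp add: riem_def r algebra_simps)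
  have X0: "X0 (loc \<eta> (G g h a b)) N i j x = a * X0 (loc \<eta> g) N i j x + b * X0 (loc \<eta> h) N i j x" for i j
    unfolding X0_def conv_def l r m by (simp add: sum.distrib sum_distrib_left distrib_left)
  show "X (G g h a b) N i j x = a * X g N i j x + b * X h N i j x"
    unfolding X_def X0 by (simp add: algebra_simps)
  show "Y (G g h a b) N k x = a * Y g N k x + b * Y h N k x"
    unfolding Y_def Y0_def conv_def l r by (simp add: sum.distrib sum_distrib_left distrib_left mult.left_commute)
  show "Z (G g h a b) N x = a * Z g N x + b * Z h N x"
    unfolding Z_def conv_def l by (simp add: sum.distrib sum_distrib_left)
qed

text \<open>The transposed operators, acting on test functions: every identity between convolved
  distributions is verified after pairing with a test function, where the kernels appear
  reflected.\<close>

definition A :: "nat \<Rightarrow> 3 \<Rightarrow> (R3 \<Rightarrow> real) \<Rightarrow> R3 \<Rightarrow> real" where "A N k \<phi> = cv \<phi> (refl_fun (E N k))"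
definition B :: "(R3 \<Rightarrow> real) \<Rightarrow> R3 \<Rightarrow> real" where "B \<phi> = cv \<phi> (refl_fun \<rho>)"
definition P :: "nat \<Rightarrow> (R3 \<Rightarrow> real) \<Rightarrow> R3 \<Rightarrow> real" where "P N \<phi> = cv \<phi> (refl_fun (RN N))"

lemma tA: "test \<phi> \<Longrightarrow> test (A N k \<phi>)" and tB: "test \<phi> \<Longrightarrow> test (B \<phi>)" and tP: "test \<phi> \<Longrightarrow> test (P N \<phi>)"
  unfolding A_def B_def P_def by (intro test_cv test_refl_fun E \<rho> RN; assumption)+

lemma pdA: "test \<phi> \<Longrightarrow> pd j (A N k \<phi>) = A N k (pd j \<phi>)"
  and pdP: "test \<phi> \<Longrightarrow> pd j (P N \<phi>) = P N (pd j \<phi>)"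
  unfolding A_def B_def P_def by (intro pd_cv_left test_refl_fun E \<rho> RN; assumption)+

lemma AP: "test \<phi> \<Longrightarrow> A N k (P N \<phi>) = P N (A N k \<phi>)" and AB: "test \<phi> \<Longrightarrow> A N k (B \<phi>) = B (A N k \<phi>)"
  and AA: "test \<phi> \<Longrightarrow> A N k (A N l \<phi>) = A N l (A N k \<phi>)"
  unfolding A_def B_def P_def by (intro cv_cv_commute test_refl_fun E \<rho> RN; assumption)+

text \<open>The divergence equation transposed. Reflection reverses the sign of a derivative, which
  is why the divergence is subtracted.\<close>

lemma P_eq:
  assumes \<phi>: "test \<phi>"
  shows "P N \<phi> = (\<lambda>x. B \<phi> x - (\<Sum>k\<in>UNIV. pd k (A N k \<phi>) x))"
proof -
  have "RN N = (\<lambda>x. \<rho> x + (\<Sum>k\<in>UNIV. pd k (E N k) x))" unfolding div by simp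
  then have "refl_fun (RN N) = (\<lambda>x. refl_fun \<rho> x - (\<Sum>k\<in>UNIV. pd k (refl_fun (E N k)) x))"
    unfolding pd_refl_fun[OF E] by (simp add: refl_fun_def sum_negf)
  then have "P N \<phi> = cv \<phi> (\<lambda>x. refl_fun \<rho> x - (\<Sum>k\<in>UNIV. pd k (refl_fun (E N k)) x))" by (simp add: P_def)
  also have "\<dots> = (\<lambda>x. cv \<phi> (refl_fun \<rho>) x - cv \<phi> (\<lambda>x. \<Sum>k\<in>UNIV. pd k (refl_fun (E N k)) x) x)"
    by (intro conv_diff_kernel fd_lin L2_test \<phi> test_refl_fun \<rho> test_on_sum test_on_pd E)
  also have "cv \<phi> (\<lambda>x. \<Sum>k\<in>UNIV. pd k (refl_fun (E N k)) x) = (\<lambda>x. \<Sum>k\<in>UNIV. cv \<phi> (pd k (refl_fun (E N k))) x)"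
    by (intro conv_sum_kernel fd_lin L2_test \<phi> test_refl_fun test_on_pd E)
  also have "(\<lambda>x. \<Sum>k\<in>UNIV. cv \<phi> (pd k (refl_fun (E N k))) x) = (\<lambda>x. \<Sum>k\<in>UNIV. pd k (A N k \<phi>) x)"
    unfolding A_def by (simp add: pd_cv[OF \<phi> test_refl_fun[OF E]])
  finally show ?thesis by (simp add: B_def)
qed

lemma lin_P:
  assumes u: "lin_test u" and \<phi>: "test \<phi>"
  shows "u (P N \<phi>) = u (B \<phi>) - (\<Sum>k\<in>UNIV. u (pd k (A N k \<phi>)))"
  unfolding P_eq[OF \<phi>]
  using \<phi> by (simp add: lin_test_diff[OF u] lin_test_sum[OF u] tB tA test_on_pd test_on_sum)

lemma fd_conv_RE: "HB u M \<Longrightarrow> test \<psi> \<Longrightarrow> fd (conv u (RE N k)) \<psi> = u (A N k (B \<psi>))"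
proof -
  assume u: "HB u M" and \<psi>: "test \<psi>"
  have "cv \<psi> (refl_fun (RE N k)) = A N k (B \<psi>)"
    unfolding RE_def A_def B_def refl_fun_cv[OF \<rho> E]
    by (rule cv_assoc[symmetric]) (intro \<psi> test_refl_fun \<rho> E)+
  then show ?thesis by (simp add: conv_adjoint[OF u tRE \<psi>])
qed

lemma fd_conv_EE: "HB u M \<Longrightarrow> test \<psi> \<Longrightarrow> fd (conv u (EE N l k)) \<psi> = u (A N k (A N l \<psi>))"
proof -
  assume u: "HB u M" and \<psi>: "test \<psi>"
  have "cv \<psi> (refl_fun (EE N l k)) = A N k (A N l \<psi>)"
    unfolding EE_def A_def refl_fun_cv[OF E E]
    by (rule cv_assoc[symmetric]) (intro \<psi> test_refl_fun E)+
  then show ?thesis by (simp add: conv_adjoint[OF u tEE \<psi>])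
qed

text \<open>With \<open>RN N\<close> in place of delta the identity is exact for each
  \<open>N\<close>. Two applications of the one-form identity start from P P \<psi>, and the term
  with B P \<psi> is the smooth remainder of the outer one; \<open>X\<close> contains B \<psi>
  instead. If \<open>P N\<close> were the identity, the right side would be
  \<open>h i j \<psi>\<close>.\<close>

lemma local_identity:
  assumes g: "Hhat_cc \<Omega> g" and \<psi>: "test \<psi>"
  defines "h \<equiv> loc \<eta> g"
  shows "fd (X g N i j) \<psi> + defV (\<lambda>k. fd (Y g N k)) i j \<psi> + hess (fd (Z g N)) i j \<psi>
    = h i j (P N (P N \<psi>)) - h i j (B (P N \<psi>)) + h i j (B \<psi>)"
proof -
  obtain D where D': "D \<ge> 0 \<and> (\<forall>g. Hhat_cc \<Omega> g \<longrightarrow> (\<forall>i j. HB (loc \<eta> g i j) (D * ccnorm g)) \<and>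
     (\<forall>i k j. HB (rcurl (loc \<eta> g) i k j) (D * ccnorm g)) \<and> (\<forall>l i k j. HB (riem (loc \<eta> g) l i k j) (D * ccnorm g)))"
    using HB_h_ex by (elim exE) (rule that)
  then have D: "D \<ge> 0" "\<And>i j. HB (h i j) (D * ccnorm g)"
    "\<And>i k j. HB (rcurl h i k j) (D * ccnorm g)"
    "\<And>l i k j. HB (riem h l i k j) (D * ccnorm g)"
    using g unfolding h_def by simp_all
  note lin = HB_lin[OF D(2)] HB_lin[OF D(3)]
  have sym: "h i j \<phi> = h j i \<phi>" if "test \<phi>" for i j \<phi>
    unfolding h_def loc_def by (intro Hhat_sym[OF g] test_mult \<eta> that)
  have s: "supp_in (h i j) K" for i j unfolding K_def h_def by (rule supp_in_loc[OF g \<eta>])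
  note s' = s supp_in_rcurl[OF s] supp_in_riem[OF s]
  note tc = test_on_conv[OF D(2) s'(1) compact_K _ subset_UNIV] test_on_conv[OF D(3) s'(2) compact_K _ subset_UNIV]
    test_on_conv[OF D(4) s'(3) compact_K _ subset_UNIV]
  have tconv: "test (conv (h i j) k)" "test (conv (rcurl h i a j) k)" "test (conv (riem h l i a j) k)"
    if "test k" for i j a l k using tc that by blast+
  have hP: "h i j (P N \<phi>) = h i j (B \<phi>) + (\<Sum>k\<in>UNIV. rcurl h i k j (A N k \<phi>)) - (\<Sum>k\<in>UNIV. h i k (pd j (A N k \<phi>)))"
    if "test \<phi>" for i j \<phi>
    unfolding lin_P[OF lin(1) that] by (simp add: rcurl_def sum_subtractf)
  have cP: "rcurl h i k j (P N \<phi>) = rcurl h i k j (B \<phi>) + (\<Sum>l\<in>UNIV. riem h l i k j (A N l \<phi>)) - (\<Sum>l\<in>UNIV. rcurl h l k j (pd i (A N l \<phi>)))"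
    if "test \<phi>" for i k j \<phi>
    unfolding lin_P[OF lin(2) that] by (simp add: riem_def sum_subtractf)
  define Q where "Q i \<phi> = (\<Sum>k\<in>UNIV. h k i (A N k (B \<phi>)))" for i \<phi>
  define W where "W i \<phi> = (\<Sum>k\<in>UNIV. \<Sum>l\<in>UNIV. rcurl h k l i (A N k (A N l \<phi>)))" for i \<phi>
  define V where "V \<phi> = (\<Sum>k\<in>UNIV. \<Sum>l\<in>UNIV. h k l (A N k (A N l \<phi>)))" for \<phi>
  define U where "U i j = h i j (B \<psi>) + ((\<Sum>k\<in>UNIV. rcurl h i k j (A N k (B \<psi>)))
     + (\<Sum>k\<in>UNIV. \<Sum>l\<in>UNIV. riem h l i k j (A N k (A N l \<psi>))))" for i j
  have fdX0: "fd (X0 h N i j) \<psi> = U i j" for i j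
  proof -
    have "fd (X0 h N i j) \<psi> = fd (\<lambda>x. 1 * conv (h i j) \<rho> x + 1 * ((\<lambda>x. 1 * (\<Sum>k\<in>UNIV. conv (rcurl h i k j) (RE N k) x)
        + 1 * (\<Sum>k\<in>UNIV. \<Sum>l\<in>UNIV. conv (riem h l i k j) (EE N l k) x)) x)) \<psi>"
      by (simp add: X0_def[abs_def])
    also have "\<dots> = 1 * fd (conv (h i j) \<rho>) \<psi> + 1 * (1 * fd (\<lambda>x. \<Sum>k\<in>UNIV. conv (rcurl h i k j) (RE N k) x) \<psi>
        + 1 * fd (\<lambda>x. \<Sum>k\<in>UNIV. \<Sum>l\<in>UNIV. conv (riem h l i k j) (EE N l k) x) \<psi>)"
      by (subst fd_comb, (intro \<psi> test_on_add test_on_cmult test_on_sum tconv \<rho> tRE tEE)+)+ (rule refl)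
    also have "\<dots> = U i j"
      by (simp add: U_def fd_sum[OF \<psi>] test_on_sum tconv tRE tEE fd_conv_RE[OF D(3) \<psi>] fd_conv_EE[OF D(4) \<psi>]
          conv_adjoint[OF D(2) \<rho> \<psi>] flip: B_def)
    finally show ?thesis .
  qed
  have tX0: "test (X0 h N i j)" for i j
    unfolding X0_def[abs_def] by (intro test_on_add test_on_sum tconv \<rho> tRE tEE)
  have fdX: "fd (X g N i j) \<psi> = (U i j + U j i) / 2"
    unfolding X_def h_def[symmetric] fd_comb[OF \<psi> tX0 tX0] fdX0 by simp
  have fdY: "fd (Y g N i) \<phi> = Q i \<phi> + 2 * W i \<phi>" if \<phi>: "test \<phi>" for i \<phi>
  proof -
    have "fd (Y g N i) \<phi> = 1 * fd (\<lambda>x. \<Sum>k\<in>UNIV. conv (h k i) (RE N k) x) \<phi>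
        + 2 * fd (\<lambda>x. \<Sum>k\<in>UNIV. \<Sum>l\<in>UNIV. conv (rcurl h k l i) (EE N l k) x) \<phi>"
      unfolding Y_def h_def[symmetric] Y0_def[abs_def]
      by (rule fd_comb) (intro \<phi> test_on_sum tconv tRE tEE)+
    also have "\<dots> = Q i \<phi> + 2 * W i \<phi>"
      by (simp add: Q_def W_def fd_sum[OF \<phi>] test_on_sum tconv tRE tEE fd_conv_RE[OF D(2) \<phi>] fd_conv_EE[OF D(3) \<phi>])
    finally show ?thesis .
  qed
  have fdZ: "fd (Z g N) \<phi> = V \<phi>" if \<phi>: "test \<phi>" for \<phi>
    unfolding Z_def[abs_def] h_def[symmetric]
    by (simp add: V_def fd_sum[OF \<phi>] test_on_sum tconv tEE fd_conv_EE[OF D(2) \<phi>])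
  \<comment> \<open>The identity before symmetrisation: \<open>Q\<close> stands only under the
    derivative with index j, whereas \<open>W\<close> stands under both.\<close>
  have T: "h i j (P N (P N \<psi>)) - h i j (B (P N \<psi>)) + h i j (B \<psi>)
      = U i j - Q i (pd j \<psi>) - W i (pd j \<psi>) - W j (pd i \<psi>) + V (pd i (pd j \<psi>))" for i j
  proof -
    have t: "test (A N k \<psi>)" "test (pd j (A N k \<psi>))" for k using \<psi> by (auto intro: tA test_on_pd)
    have "h i j (P N (P N \<psi>)) - h i j (B (P N \<psi>)) = (\<Sum>k\<in>UNIV. rcurl h i k j (P N (A N k \<psi>))) - (\<Sum>k\<in>UNIV. h i k (P N (pd j (A N k \<psi>))))"
      unfolding hP[OF tP[OF \<psi>]] by (simp add: AP \<psi> pdP t)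
    \<comment> \<open>Symmetry of \<open>h\<close> turns the contracted index into the row index, so
      that the one-form identity can be applied once more in the index i.\<close>
    also have "(\<Sum>k\<in>UNIV. h i k (P N (pd j (A N k \<psi>)))) = (\<Sum>k\<in>UNIV. h k i (P N (pd j (A N k \<psi>))))"
      by (intro sum.cong refl sym tP t)
    also have "\<dots> = (\<Sum>k\<in>UNIV. h k i (B (pd j (A N k \<psi>)))) + (\<Sum>k\<in>UNIV. \<Sum>l\<in>UNIV. rcurl h k l i (A N l (pd j (A N k \<psi>))))
        - (\<Sum>k\<in>UNIV. \<Sum>l\<in>UNIV. h k l (pd i (A N l (pd j (A N k \<psi>)))))"
      unfolding hP[OF t(2)] by (simp add: sum.distrib sum_subtractf)
    also have "(\<Sum>k\<in>UNIV. h k i (B (pd j (A N k \<psi>)))) = Q i (pd j \<psi>)"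
      unfolding Q_def by (simp add: pdA \<psi> AB test_on_pd)
    also have "(\<Sum>k\<in>UNIV. \<Sum>l\<in>UNIV. rcurl h k l i (A N l (pd j (A N k \<psi>)))) = W i (pd j \<psi>)"
      unfolding W_def by (intro sum.cong refl) (simp add: pdA \<psi> AA test_on_pd)
    also have "(\<Sum>k\<in>UNIV. \<Sum>l\<in>UNIV. h k l (pd i (A N l (pd j (A N k \<psi>))))) = V (pd i (pd j \<psi>))"
      unfolding V_def by (intro sum.cong refl) (simp add: pdA \<psi> tA AA test_on_pd)
    also have "(\<Sum>k\<in>UNIV. rcurl h i k j (P N (A N k \<psi>))) = (\<Sum>k\<in>UNIV. rcurl h i k j (B (A N k \<psi>)))
        + (\<Sum>k\<in>UNIV. \<Sum>l\<in>UNIV. riem h l i k j (A N l (A N k \<psi>))) - (\<Sum>k\<in>UNIV. \<Sum>l\<in>UNIV. rcurl h l k j (pd i (A N l (A N k \<psi>))))"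
      unfolding cP[OF t(1)] by (simp add: sum.distrib sum_subtractf)
    also have "(\<Sum>k\<in>UNIV. \<Sum>l\<in>UNIV. rcurl h l k j (pd i (A N l (A N k \<psi>)))) = W j (pd i \<psi>)"
      unfolding W_def by (subst sum.swap) (simp add: pdA \<psi> tA)
    also have "(\<Sum>k\<in>UNIV. rcurl h i k j (B (A N k \<psi>))) = (\<Sum>k\<in>UNIV. rcurl h i k j (A N k (B \<psi>)))"
      by (simp add: AB \<psi>)
    also have "(\<Sum>k\<in>UNIV. \<Sum>l\<in>UNIV. riem h l i k j (A N l (A N k \<psi>))) = (\<Sum>k\<in>UNIV. \<Sum>l\<in>UNIV. riem h l i k j (A N k (A N l \<psi>)))"
      by (intro sum.cong refl arg_cong[of _ _ "riem h _ _ _ _"] AA \<psi>)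
    finally show ?thesis by (simp add: U_def)
  qed
  have t2: "test (pd i \<psi>)" "test (pd i (pd j \<psi>))" for i j by (intro test_on_pd \<psi>)+
  have "defV (\<lambda>k. fd (Y g N k)) i j \<psi> = - ((Q i (pd j \<psi>) + 2 * W i (pd j \<psi>)) + (Q j (pd i \<psi>) + 2 * W j (pd i \<psi>))) / 2"
    unfolding defV_def dd_def fdY[OF t2(1)] by simp
  moreover have "hess (fd (Z g N)) i j \<psi> = V (pd j (pd i \<psi>))"
    unfolding hess_def dd_def by (simp add: fdZ[OF t2(2)])
  moreover have "h i j (P N (P N \<psi>)) - h i j (B (P N \<psi>)) + h i j (B \<psi>) = h j i (P N (P N \<psi>)) - h j i (B (P N \<psi>)) + h j i (B \<psi>)"
    using sym[of "P N (P N \<psi>)" i j] sym[of "B (P N \<psi>)" i j] sym[of "B \<psi>" i j] by (simp add: tP tB \<psi>)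
  ultimately show ?thesis
    using T[of i j] T[of j i] pd_commute[OF \<psi>, of i j] unfolding fdX by (simp add: field_simps)
qed

text \<open>The error is \<open>h\<close> applied to P \<delta> + \<delta> - B \<delta> with
  \<delta> = P \<psi> - \<psi>. The approximate identity sends \<delta> to zero in
  \<open>h1n\<close>, and \<open>P\<close> and \<open>B\<close> are bounded in that norm uniformly
  in \<open>N\<close>.\<close>

lemma local_limit:
  assumes g: "Hhat_cc \<Omega> g" and \<psi>: "test \<psi>"
  shows "(\<lambda>N. fd (X g N i j) \<psi> + defV (\<lambda>k. fd (Y g N k)) i j \<psi> + hess (fd (Z g N)) i j \<psi>) \<longlonglongrightarrow> g i j (\<lambda>x. \<eta> x * \<psi> x)"
proof -
  define h where "h = loc \<eta> g"
  obtain D where D: "HB (h i j) D" using HB_h_ex g unfolding h_def by blast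
  note lin = HB_lin[OF D]
  \<comment> \<open>By the divergence equation \<open>RN N\<close> is \<rho> plus first derivatives
    of the kernels, so its operator bound is inherited from theirs.\<close>
  obtain CP where CP: "\<And>N. OB (RN N) CP"
  proof -
    obtain C1 where C1: "\<And>N k m. OB (pd m (E N k)) C1" using OBpdE by blast
    have "OB (\<lambda>x. \<rho> x + (\<Sum>k\<in>UNIV. pd k (E N k) x)) ((\<integral>x. \<bar>\<rho> x\<bar> \<partial>lborel) + (\<Sum>k\<in>(UNIV::3 set). C1))" for N
      by (intro OB_add OB_Young OB_sum C1 \<rho> test_on_sum test_on_pd E)
    then have "OB (RN N) ((\<integral>x. \<bar>\<rho> x\<bar> \<partial>lborel) + (\<Sum>k\<in>(UNIV::3 set). C1))" for N
      unfolding div by simp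
    then show thesis by (rule that)
  qed
  have CP0: "CP \<ge> 0" by (rule OB_nonneg[OF CP])
  define CB where "CB = (\<integral>x. \<bar>\<rho> x\<bar> \<partial>lborel)"
  have CB: "OB \<rho> CB" unfolding CB_def by (rule OB_Young[OF \<rho>])
  define \<delta> where "\<delta> N = (\<lambda>x. P N \<psi> x - \<psi> x)" for N
  have \<delta>: "test (\<delta> N)" for N unfolding \<delta>_def by (intro test_on_diff tP \<psi>)
  have dif: "h i j (P N (P N \<psi>)) - h i j (B (P N \<psi>)) + h i j (B \<psi>) - h i j \<psi> = h i j (P N (\<delta> N)) + h i j (\<delta> N) - h i j (B (\<delta> N))" for N
  proof -
    have c: "cv (\<delta> N) k = (\<lambda>x. cv (P N \<psi>) k x - cv \<psi> k x)" if "test k" for k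
      unfolding \<delta>_def using conv_diff_kernel[OF fd_lin[OF L2_test[OF that]] tP[OF \<psi>] \<psi>, of N]
      by (simp add: cv_commute[of _ k] that test_on_diff tP \<psi>)
    have "P N (\<delta> N) = (\<lambda>x. P N (P N \<psi>) x - P N \<psi> x)" "B (\<delta> N) = (\<lambda>x. B (P N \<psi>) x - B \<psi> x)"
      using c[OF test_refl_fun[OF RN[of N]]] c[OF test_refl_fun[OF \<rho>]] by (simp_all add: P_def B_def)
    then show ?thesis unfolding \<delta>_def[of N]
      by (simp add: lin_test_diff[OF lin] tP tB \<psi>)
  qed
  have h\<delta>: "h1n (P N (\<delta> N)) \<le> CP * h1n (\<delta> N)" "h1n (B (\<delta> N)) \<le> CB * h1n (\<delta> N)" for N
    unfolding P_def[of N "\<delta> N"] B_def by (intro h1n_cv_le OB_refl_fun CP CB RN \<rho> test_refl_fun \<delta>)+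
  have le: "\<bar>h i j (P N (P N \<psi>)) - h i j (B (P N \<psi>)) + h i j (B \<psi>) - h i j \<psi>\<bar> \<le> (D * (CP + 1 + CB)) * h1n (\<delta> N)" for N
  proof -
    have D0: "D \<ge> 0" by (rule HB_nonneg[OF D])
    have "\<bar>h i j (P N (\<delta> N))\<bar> \<le> D * (CP * h1n (\<delta> N))"
      by (rule order_trans[OF HB_bound[OF D tP[OF \<delta>]]]) (intro mult_left_mono h\<delta> D0)
    moreover have "\<bar>h i j (B (\<delta> N))\<bar> \<le> D * (CB * h1n (\<delta> N))"
      by (rule order_trans[OF HB_bound[OF D tB[OF \<delta>]]]) (intro mult_left_mono h\<delta> D0)
    moreover have "\<bar>h i j (\<delta> N)\<bar> \<le> D * h1n (\<delta> N)" by (rule HB_bound[OF D \<delta>])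
    moreover have "(D * (CP + 1 + CB)) * h1n (\<delta> N) = D * (CP * h1n (\<delta> N)) + D * h1n (\<delta> N) + D * (CB * h1n (\<delta> N))"
      by (simp add: algebra_simps)
    ultimately show ?thesis unfolding dif by linarith
  qed
  have "(\<lambda>N. (D * (CP + 1 + CB)) * h1n (\<delta> N)) \<longlonglongrightarrow> 0"
    unfolding \<delta>_def P_def by (rule tendsto_mult_right_zero[OF approx[OF \<psi>]])
  from LIMSEQ_squeeze_0[OF le this]
  have "(\<lambda>N. h i j (P N (P N \<psi>)) - h i j (B (P N \<psi>)) + h i j (B \<psi>)) \<longlonglongrightarrow> h i j \<psi>" by (rule LIM_zero_cancel)
  then show ?thesis unfolding local_identity[OF g \<psi>] h_def[symmetric] by (simp add: h_def loc_def)
qed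

lemma decomposes_patch: "\<exists>X Y Z C. decomposes \<Omega> \<eta> X Y Z C"
proof -
  obtain C where C: "C \<ge> 0" "\<And>g i j. Hhat_cc \<Omega> g \<Longrightarrow> h10_seq \<Omega> (C * ccnorm g) (\<lambda>N. X g N i j)"
    "\<And>g k. Hhat_cc \<Omega> g \<Longrightarrow> h10_seq \<Omega> (C * ccnorm g) (\<lambda>N. Y g N k)"
    "\<And>g. Hhat_cc \<Omega> g \<Longrightarrow> h10_seq \<Omega> (C * ccnorm g) (Z g)"
    using h10_seqs by blast
  have "X g N i j = X g N j i" for g N i j by (simp add: X_def add.commute)
  then have "decomposes \<Omega> \<eta> X Y Z C"
    unfolding decomposes_def using C by (intro conjI allI impI linear_ops local_limit)
  then show ?thesis by blast
qed

end

subsection \<open>The global decomposition\<close>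

lemma decomposes_ex:
  assumes bd: "bounded \<Omega>" and \<eta>: "test \<eta>" and d: "d > 0"
    and cone: "\<And>y c. y \<in> closure \<Omega> \<Longrightarrow> y \<in> tsupp \<eta> \<Longrightarrow> c \<in> cone_seg p d 2 \<Longrightarrow> y + c \<in> \<Omega>"
  shows "\<exists>X Y Z C. decomposes \<Omega> \<eta> X Y Z C"
proof (rule kernel_family[OF d, of p])
  fix \<rho> :: "R3 \<Rightarrow> real" and E :: "nat \<Rightarrow> 3 \<Rightarrow> R3 \<Rightarrow> real" and RN :: "nat \<Rightarrow> R3 \<Rightarrow> real"
  assume k: "test \<rho>" "\<And>N k. test (E N k)" "\<And>N. test (RN N)"
    "tsupp \<rho> \<subseteq> cone_seg p d 1" "\<And>N k. tsupp (E N k) \<subseteq> cone_seg p d 1"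
    "\<And>N x. (\<Sum>k\<in>UNIV. pd k (E N k) x) = RN N x - \<rho> x"
    "\<exists>C. \<forall>N k. OB (E N k) C" "\<exists>C. \<forall>N k m. OB (pd m (E N k)) C"
    "\<And>e. e > 0 \<Longrightarrow> \<exists>N0. \<forall>N\<ge>N0. \<forall>M\<ge>N0. \<forall>k. OB (\<lambda>x. E N k x - E M k x) e"
    "\<And>\<psi>. test \<psi> \<Longrightarrow> (\<lambda>N. h1n (\<lambda>x. cv \<psi> (refl_fun (RN N)) x - \<psi> x)) \<longlonglongrightarrow> 0"
  interpret patch \<Omega> \<eta> p d \<rho> E RN by unfold_locales (fact bd \<eta> cone k)+
  show ?thesis by (rule decomposes_patch)
qed

lemma decomposes_h10_seq:
  assumes "decomposes \<Omega> \<eta> X Y Z C" "Hhat_cc \<Omega> g"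
  shows "h10_seq \<Omega> (C * ccnorm g) (\<lambda>N. X g N i j)" "h10_seq \<Omega> (C * ccnorm g) (\<lambda>N. Y g N k)"
    "h10_seq \<Omega> (C * ccnorm g) (Z g)"
  using assms unfolding decomposes_def by simp_all

lemma decomposes_linear:
  assumes "decomposes \<Omega> \<eta> X Y Z C"
  shows "X (\<lambda>i j \<phi>. a * g i j \<phi> + b * h i j \<phi>) N i j x = a * X g N i j x + b * X h N i j x"
    "Y (\<lambda>i j \<phi>. a * g i j \<phi> + b * h i j \<phi>) N k x = a * Y g N k x + b * Y h N k x"
    "Z (\<lambda>i j \<phi>. a * g i j \<phi> + b * h i j \<phi>) N x = a * Z g N x + b * Z h N x"
  using assms unfolding decomposes_def by simp_all

lemma decomposes_sym: "decomposes \<Omega> \<eta> X Y Z C \<Longrightarrow> X g N i j = X g N j i"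
proof -
  assume "decomposes \<Omega> \<eta> X Y Z C"
  then have "\<forall>g N i j. X g N i j = X g N j i" unfolding decomposes_def by (elim conjE)
  then show ?thesis by (elim allE)
qed

lemma decomposes_limit:
  "decomposes \<Omega> \<eta> X Y Z C \<Longrightarrow> Hhat_cc \<Omega> g \<Longrightarrow> test \<psi> \<Longrightarrow>
    (\<lambda>N. fd (X g N i j) \<psi> + defV (\<lambda>k. fd (Y g N k)) i j \<psi> + hess (fd (Z g N)) i j \<psi>) \<longlonglongrightarrow> g i j (\<lambda>x. \<eta> x * \<psi> x)"
  unfolding decomposes_def by simp

lemma h10_seq_test: "h10_seq \<Omega> M \<Phi> \<Longrightarrow> test (\<Phi> N)"
  unfolding h10_seq_def using test_on_test by blast

lemma decomposes_sum:
  fixes n :: nat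
  assumes D: "\<And>a. decomposes \<Omega> (\<eta> a) (X a) (Y a) (Z a) (C a)" and \<eta>: "\<And>a. test (\<eta> a)"
    and one: "\<And>x. x \<in> U \<Longrightarrow> (\<Sum>a<n. \<eta> a x) = 1" and U: "open U" "closure \<Omega> \<subseteq> U"
  shows "decomposes \<Omega> (\<lambda>_. 1) (\<lambda>g N i j x. \<Sum>a<n. X a g N i j x) (\<lambda>g N k x. \<Sum>a<n. Y a g N k x)
    (\<lambda>g N x. \<Sum>a<n. Z a g N x) (\<Sum>a<n. C a)"
  unfolding decomposes_def
proof (intro conjI allI impI)
  show "0 \<le> (\<Sum>a<n. C a)" using D by (intro sum_nonneg) (simp add: decomposes_def)
  fix g assume g: "Hhat_cc \<Omega> g"
  show "h10_seq \<Omega> ((\<Sum>a<n. C a) * ccnorm g) (\<lambda>N x. \<Sum>a<n. X a g N i j x)" for i j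
    unfolding sum_distrib_right by (intro h10_seq_sum decomposes_h10_seq[OF D g])
  show "h10_seq \<Omega> ((\<Sum>a<n. C a) * ccnorm g) (\<lambda>N x. \<Sum>a<n. Y a g N k x)" for k
    unfolding sum_distrib_right by (intro h10_seq_sum decomposes_h10_seq[OF D g])
  show "h10_seq \<Omega> ((\<Sum>a<n. C a) * ccnorm g) (\<lambda>N x. \<Sum>a<n. Z a g N x)"
    unfolding sum_distrib_right by (intro h10_seq_sum decomposes_h10_seq[OF D g])
next
  show "(\<lambda>x. \<Sum>a<n. X a g N i j x) = (\<lambda>x. \<Sum>a<n. X a g N j i x)" for g N i j
    by (simp add: decomposes_sym[OF D, of _ g N i j])
next
  fix g h a b N
  show "(\<Sum>c<n. X c (\<lambda>i j \<phi>. a * g i j \<phi> + b * h i j \<phi>) N i j x) = a * (\<Sum>c<n. X c g N i j x) + b * (\<Sum>c<n. X c h N i j x)" for i j x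
    by (simp add: decomposes_linear(1)[OF D] sum.distrib sum_distrib_left)
  show "(\<Sum>c<n. Y c (\<lambda>i j \<phi>. a * g i j \<phi> + b * h i j \<phi>) N k x) = a * (\<Sum>c<n. Y c g N k x) + b * (\<Sum>c<n. Y c h N k x)" for k x
    by (simp add: decomposes_linear(2)[OF D] sum.distrib sum_distrib_left)
  show "(\<Sum>c<n. Z c (\<lambda>i j \<phi>. a * g i j \<phi> + b * h i j \<phi>) N x) = a * (\<Sum>c<n. Z c g N x) + b * (\<Sum>c<n. Z c h N x)" for x
    by (simp add: decomposes_linear(3)[OF D] sum.distrib sum_distrib_left)
next
  fix g i j \<psi> assume g: "Hhat_cc \<Omega> g" and \<psi>: "test \<psi>"
  note lin = HB_lin[OF Hhat_HB(1)[OF g]]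
  have t: "test (X a g N i j)" "test (Y a g N k)" "test (Z a g N)" for a N i j k
    using decomposes_h10_seq[OF D g] h10_seq_test by blast+
  have t2: "test (pd i \<psi>)" "test (pd i (pd j \<psi>))" for i j by (intro test_on_pd \<psi>)+
  have eq: "fd (\<lambda>x. \<Sum>a<n. X a g N i j x) \<psi> + defV (\<lambda>k. fd (\<lambda>x. \<Sum>a<n. Y a g N k x)) i j \<psi> + hess (fd (\<lambda>x. \<Sum>a<n. Z a g N x)) i j \<psi>
     = (\<Sum>a<n. fd (X a g N i j) \<psi> + defV (\<lambda>k. fd (Y a g N k)) i j \<psi> + hess (fd (Z a g N)) i j \<psi>)" for N
    unfolding defV_def hess_def dd_def
    by (simp add: fd_sum t \<psi> t2 sum.distrib sum_negf sum_subtractf flip: sum_divide_distrib)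
  have lim: "(\<lambda>N. \<Sum>a<n. fd (X a g N i j) \<psi> + defV (\<lambda>k. fd (Y a g N k)) i j \<psi> + hess (fd (Z a g N)) i j \<psi>)
      \<longlonglongrightarrow> (\<Sum>a<n. g i j (\<lambda>x. \<eta> a x * \<psi> x))"
    by (intro tendsto_sum decomposes_limit[OF D g \<psi>])
  have te: "test (\<lambda>x. \<eta> a x * \<psi> x)" for a by (rule test_mult[OF \<eta> \<psi>])
  have "(\<Sum>a<n. g i j (\<lambda>x. \<eta> a x * \<psi> x)) = g i j (\<lambda>x. \<Sum>a<n. \<eta> a x * \<psi> x)"
    by (rule lin_test_sum[OF lin te, symmetric])
  also have "\<dots> = g i j \<psi> - g i j (\<lambda>x. \<psi> x - (\<Sum>a<n. \<eta> a x * \<psi> x))"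
    by (subst lin_test_diff[OF lin \<psi> test_on_sum[OF te]]) simp
  \<comment> \<open>The cutoffs sum to 1 on \<open>U\<close>, so what is missing from \<psi> is
    supported off the closure of the domain and is invisible to \<open>g\<close>.\<close>
  also have "g i j (\<lambda>x. \<psi> x - (\<Sum>a<n. \<eta> a x * \<psi> x)) = 0"
  proof -
    have "test_on (- closure \<Omega>) (\<lambda>x. \<psi> x - (\<Sum>a<n. \<eta> a x * \<psi> x))"
    proof (rule test_onI[of _ "tsupp \<psi> - U"])
      show "smooth_fun (\<lambda>x. \<psi> x - (\<Sum>a<n. \<eta> a x * \<psi> x))"
        by (intro test_smooth[of UNIV] test_on_diff test_on_sum te \<psi>)
      show "compact (tsupp \<psi> - U)" by (intro compact_diff test_compact[OF \<psi>] U)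
      show "tsupp \<psi> - U \<subseteq> - closure \<Omega>" using U by blast
      fix x assume "x \<notin> tsupp \<psi> - U"
      then consider "x \<notin> tsupp \<psi>" | "x \<in> U" by blast
      then show "\<psi> x - (\<Sum>a<n. \<eta> a x * \<psi> x) = 0"
      proof cases
        case 1 then show ?thesis by (simp add: not_in_tsupp)
      next
        case 2 then show ?thesis using one[OF 2] by (simp flip: sum_distrib_right)
      qed
    qed
    then show ?thesis using g by (auto simp: Hhat_cc_def Htm1_def supp_in_def)
  qed
  finally show "(\<lambda>N. fd (\<lambda>x. \<Sum>a<n. X a g N i j x) \<psi> + defV (\<lambda>k. fd (\<lambda>x. \<Sum>a<n. Y a g N k x)) i j \<psi> + hess (fd (\<lambda>x. \<Sum>a<n. Z a g N x)) i j \<psi>)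
    \<longlonglongrightarrow> g i j (\<lambda>x. 1 * \<psi> x)"
    using lim unfolding eq by simp
qed

lemma decomposes_global:
  assumes op: "open \<Omega>" and bd: "bounded \<Omega>" and lip: "lipschitz_boundary \<Omega>"
  shows "\<exists>X Y Z C. decomposes \<Omega> (\<lambda>_. 1) X Y Z C"
proof (rule cone_partition[OF op bd lip])
  fix n :: nat and \<eta> :: "nat \<Rightarrow> R3 \<Rightarrow> real" and p d U
  assume part: "\<And>i. test (\<eta> i)" "\<And>i. d i > 0"
    "\<And>i y c. y \<in> closure \<Omega> \<Longrightarrow> y \<in> tsupp (\<eta> i) \<Longrightarrow> c \<in> cone_seg (p i) (d i) 2 \<Longrightarrow> y + c \<in> \<Omega>"
    "open U" "closure \<Omega> \<subseteq> U" "\<And>x. x \<in> U \<Longrightarrow> (\<Sum>i<n. \<eta> i x) = 1"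
  have "\<forall>a. \<exists>T. case T of (X, Y, Z, C) \<Rightarrow> decomposes \<Omega> (\<eta> a) X Y Z C"
  proof
    fix a
    obtain X Y Z C where "decomposes \<Omega> (\<eta> a) X Y Z C"
      using decomposes_ex[OF bd part(1)[of a] part(2)[of a] part(3)[of _ a]] by blast
    then show "\<exists>T. case T of (X, Y, Z, C) \<Rightarrow> decomposes \<Omega> (\<eta> a) X Y Z C" by (intro exI[of _ "(X, Y, Z, C)"]) simp
  qed
  from choice[OF this] obtain T where T: "\<And>a. case T a of (X, Y, Z, C) \<Rightarrow> decomposes \<Omega> (\<eta> a) X Y Z C" by blast
  define X where "X a = fst (T a)" for a
  define Y where "Y a = fst (snd (T a))" for a
  define Z where "Z a = fst (snd (snd (T a)))" for a
  define C where "C a = snd (snd (snd (T a)))" for a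
  have "decomposes \<Omega> (\<eta> a) (X a) (Y a) (Z a) (C a)" for a
    using T[of a] by (simp add: X_def Y_def Z_def C_def case_prod_beta)
  from decomposes_sum[OF this part(1) part(6) part(4,5)] show ?thesis by blast
qed

lemma h10_seq_L2: "h10_seq \<Omega> M \<Phi> \<Longrightarrow> L2 (\<Phi> N)"
  by (rule L2_test[OF h10_seq_test])

lemma H10_of_h10_seq:
  assumes "h10_seq \<Omega> M \<Phi>" "L2_lim \<Phi> w" shows "H10 \<Omega> w"
  unfolding H10_def
proof (intro conjI exI[of _ \<Phi>] allI)
  show "L2 w" "(\<lambda>n. L2n (\<lambda>x. \<Phi> n x - w x)) \<longlonglongrightarrow> 0" using assms(2) by (auto simp: L2_lim_def)
  show "test_on \<Omega> (\<Phi> n)" for n using assms(1) by (simp add: h10_seq_def)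
  fix j
  have "L2_Cauchy (\<lambda>n. pd j (\<Phi> n))" using assms(1) by (simp add: h10_seq_def)
  then obtain G where "L2_lim (\<lambda>n. pd j (\<Phi> n)) G" using L2_complete by blast
  then show "\<exists>G. L2 G \<and> (\<lambda>n. L2n (\<lambda>x. pd j (\<Phi> n) x - G x)) \<longlonglongrightarrow> 0" by (auto simp: L2_lim_def)
qed

lemma fd_pd: "test f \<Longrightarrow> test \<psi> \<Longrightarrow> fd f (pd j \<psi>) = - fd (pd j f) \<psi>"
  unfolding fd_def by (rule integral_by_parts)

text \<open>No weak derivative of \<open>w\<close> is constructed: the pairings that define its norm
  are limits of pairings of the approximants, where integration by parts is available.\<close>

lemma h1norm_le_of_h10_seq:
  assumes s: "h10_seq \<Omega> M \<Phi>" and lim: "L2_lim \<Phi> w" shows "h1norm w \<le> 2 * M"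
proof -
  let ?T = "{\<psi>. test \<psi> \<and> \<psi> \<noteq> (\<lambda>_. 0)}"
  have M: "L2n (\<Phi> N) \<le> M" "L2n (pd j (\<Phi> N)) \<le> M" for N j using s by (auto simp: h10_seq_def)
  have M0: "M \<ge> 0" using M(1)[of 0] L2n_nonneg[of "\<Phi> 0"] by linarith
  have w: "L2n w \<le> M" by (rule L2_lim_norm_le[OF h10_seq_L2[OF s] lim M(1)])
  have bd: "\<bar>fd w (pd j \<psi>)\<bar> / L2n \<psi> \<le> M" if "\<psi> \<in> ?T" for \<psi> j
  proof -
    have \<psi>: "test \<psi>" "L2n \<psi> > 0" using that L2n_pos by auto
    have "(\<lambda>N. fd (\<Phi> N) (pd j \<psi>)) \<longlonglongrightarrow> fd w (pd j \<psi>)"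
      unfolding fd_def by (rule L2_lim_integral[OF h10_seq_L2[OF s] lim L2_test[OF test_on_pd[OF \<psi>(1)]]])
    then have "(\<lambda>N. \<bar>fd (\<Phi> N) (pd j \<psi>)\<bar>) \<longlonglongrightarrow> \<bar>fd w (pd j \<psi>)\<bar>" by (rule tendsto_rabs)
    moreover have "\<bar>fd (\<Phi> N) (pd j \<psi>)\<bar> \<le> M * L2n \<psi>" for N
    proof -
      have "\<bar>fd (\<Phi> N) (pd j \<psi>)\<bar> = \<bar>fd (pd j (\<Phi> N)) \<psi>\<bar>" by (simp add: fd_pd[OF h10_seq_test[OF s] \<psi>(1)])
      also have "\<dots> \<le> L2n (pd j (\<Phi> N)) * L2n \<psi>" unfolding fd_def
        by (intro L2_CS L2_test test_on_pd h10_seq_test[OF s] \<psi>)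
      also have "\<dots> \<le> M * L2n \<psi>" by (intro mult_right_mono M L2n_nonneg)
      finally show ?thesis .
    qed
    ultimately have "\<bar>fd w (pd j \<psi>)\<bar> \<le> M * L2n \<psi>" by (intro LIMSEQ_le_const2) auto
    then show ?thesis using \<psi>(2) by (simp add: divide_le_eq)
  qed
  have sup: "(SUP \<psi>\<in>?T. \<bar>\<integral>x. w x * pd j \<psi> x \<partial>lborel\<bar> / L2n \<psi>)\<^sup>2 \<le> M\<^sup>2" for j
  proof (rule power_mono)
    have ne: "?T \<noteq> {}" using nonzero_test by auto
    show "(SUP \<psi>\<in>?T. \<bar>\<integral>x. w x * pd j \<psi> x \<partial>lborel\<bar> / L2n \<psi>) \<le> M"
      by (rule cSUP_least[OF ne]) (rule bd[unfolded fd_def])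
    obtain \<psi> where \<psi>: "\<psi> \<in> ?T" using ne by blast
    have "0 \<le> \<bar>\<integral>x. w x * pd j \<psi> x \<partial>lborel\<bar> / L2n \<psi>" by (simp add: L2n_nonneg)
    also have "\<dots> \<le> (SUP \<psi>\<in>?T. \<bar>\<integral>x. w x * pd j \<psi> x \<partial>lborel\<bar> / L2n \<psi>)"
      by (rule cSUP_upper[OF \<psi>]) (rule bdd_aboveI2[of _ _ M], rule bd[unfolded fd_def])
    finally show "0 \<le> (SUP \<psi>\<in>?T. \<bar>\<integral>x. w x * pd j \<psi> x \<partial>lborel\<bar> / L2n \<psi>)" .
  qed
  have "h1norm w \<le> sqrt (M\<^sup>2 + (\<Sum>j\<in>(UNIV::3 set). M\<^sup>2))"
    unfolding h1norm_def by (intro real_sqrt_le_mono add_mono sum_mono sup power_mono w L2n_nonneg)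
  also have "\<dots> = sqrt ((2 * M)\<^sup>2)" by (simp add: power_mult_distrib)
  also have "\<dots> = 2 * M" by (rule real_sqrt_unique) (use M0 in simp_all)
  finally show ?thesis .
qed

subsection \<open>Density\<close>

text \<open>What a function small in the first Sobolev norm provides as a functional: it and its
  derivatives up to second order are small in the dual norm.\<close>

definition small2 :: "distr \<Rightarrow> real \<Rightarrow> bool" where
  "small2 u e \<longleftrightarrow> HB u e \<and> (\<forall>m. HB (dd m u) e) \<and> (\<forall>m n. HB (dd m (dd n u)) e)"

lemma lin_test_dd: "lin_test u \<Longrightarrow> lin_test (dd m u)"
  unfolding lin_test_def[of "dd m u"]
proof (intro allI impI)
  fix \<phi> \<psi> a b assume u: "lin_test u" and t: "test \<phi>" "test \<psi>"
  have "pd m (\<lambda>x. a * \<phi> x + b * \<psi> x) = (\<lambda>x. a * pd m \<phi> x + b * pd m \<psi> x)"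
    using t by (simp add: pd_add' pd_cmult' test_on_cmult)
  then show "dd m u (\<lambda>x. a * \<phi> x + b * \<psi> x) = a * dd m u \<phi> + b * dd m u \<psi>"
    using t by (simp add: dd_def lin_test_comb[OF u] test_on_pd)
qed

text \<open>One derivative is absorbed by hypothesis \<open>d\<close>, the second falls on the test
  function and is paid for by \<open>h1n\<close>.\<close>

lemma small2_fd:
  assumes w: "L2 w" "L2n w \<le> e" and d: "\<And>m \<phi>. test \<phi> \<Longrightarrow> \<bar>fd w (pd m \<phi>)\<bar> \<le> e * L2n \<phi>"
  shows "small2 (fd w) e"
proof -
  have e: "e \<ge> 0" using w(2) L2n_nonneg[of w] by linarith
  note lin = fd_lin[OF w(1)]
  have 1: "HB (dd m (fd w)) e" for m
    unfolding HB_def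
  proof (intro conjI allI impI)
    fix \<phi> assume \<phi>: "test \<phi>"
    show "\<bar>dd m (fd w) \<phi>\<bar> \<le> e * h1n \<phi>"
      using d[OF \<phi>, of m] mult_left_mono[OF L2n_le_h1n[of \<phi>] e] by (simp add: dd_def)
  qed (use e lin_test_dd[OF lin] in auto)
  have 2: "HB (dd m (dd n (fd w))) e" for m n
    unfolding HB_def
  proof (intro conjI allI impI)
    fix \<phi> assume \<phi>: "test \<phi>"
    show "\<bar>dd m (dd n (fd w)) \<phi>\<bar> \<le> e * h1n \<phi>"
      using d[OF test_on_pd[OF \<phi>], of n m] mult_left_mono[OF L2n_pd_le_h1n[of m \<phi>] e] by (simp add: dd_def)
  qed (use e lin_test_dd[OF lin_test_dd[OF lin]] in auto)
  show ?thesis unfolding small2_def using 1 2 HB_mono[OF HB_fd[OF w(1)] w(2)] by blast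
qed

text \<open>The derivative of w - \<Phi>_N is tested as the limit over k of that of \<Phi>_k -
  \<Phi>_N, so the Cauchy property of the derivatives suffices.\<close>

lemma small2_h10_seq:
  assumes s: "h10_seq \<Omega> M \<Phi>" and lim: "L2_lim \<Phi> w" and e: "e > 0"
  shows "\<exists>N0. \<forall>N\<ge>N0. small2 (fd (\<lambda>x. w x - \<Phi> N x)) e"
proof -
  have w: "L2 w" using lim by (simp add: L2_lim_def)
  note L = h10_seq_L2[OF s] and t = h10_seq_test[OF s]
  have "\<forall>\<^sub>F N in sequentially. L2n (\<lambda>x. \<Phi> N x - w x) < e"
    using lim e unfolding L2_lim_def by (intro order_tendstoD(2)) auto
  then obtain N1 where N1: "\<And>N. N \<ge> N1 \<Longrightarrow> L2n (\<lambda>x. \<Phi> N x - w x) < e" unfolding eventually_sequentially by blast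
  have "\<exists>N. \<forall>k\<ge>N. \<forall>n\<ge>N. L2n (\<lambda>x. pd m (\<Phi> k) x - pd m (\<Phi> n) x) \<le> e" for m
    using s e unfolding h10_seq_def L2_Cauchy_def by blast
  then obtain N2 where N2: "\<And>m k n. k \<ge> N2 m \<Longrightarrow> n \<ge> N2 m \<Longrightarrow> L2n (\<lambda>x. pd m (\<Phi> k) x - pd m (\<Phi> n) x) \<le> e" by metis
  have le: "N2 m \<le> (\<Sum>m\<in>UNIV. N2 m)" for m by (rule member_le_sum) auto
  show ?thesis
  proof (intro exI[of _ "max N1 (\<Sum>m\<in>UNIV. N2 m)"] allI impI)
    fix N assume N: "N \<ge> max N1 (\<Sum>m\<in>UNIV. N2 m)"
    show "small2 (fd (\<lambda>x. w x - \<Phi> N x)) e"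
    proof (rule small2_fd)
      show "L2 (\<lambda>x. w x - \<Phi> N x)" by (intro L2_diff w L)
      show "L2n (\<lambda>x. w x - \<Phi> N x) \<le> e" using N1[of N] N by (simp add: L2n_diff_commute[of w])
      fix m \<phi> assume \<phi>: "test \<phi>"
      have lin: "fd (\<lambda>x. v x - \<Phi> N x) (pd m \<phi>) = fd v (pd m \<phi>) - fd (\<Phi> N) (pd m \<phi>)" if "L2 v" for v
        unfolding fd_def using L2_mult_integrable[OF that L2_test[OF test_on_pd[OF \<phi>]]] L2_mult_integrable[OF L[of N] L2_test[OF test_on_pd[OF \<phi>]]]
        by (simp add: left_diff_distrib)
      have "(\<lambda>k. fd (\<Phi> k) (pd m \<phi>)) \<longlonglongrightarrow> fd w (pd m \<phi>)"
        unfolding fd_def by (rule L2_lim_integral[OF L lim L2_test[OF test_on_pd[OF \<phi>]]])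
      then have "(\<lambda>k. fd (\<lambda>x. \<Phi> k x - \<Phi> N x) (pd m \<phi>)) \<longlonglongrightarrow> fd (\<lambda>x. w x - \<Phi> N x) (pd m \<phi>)"
        unfolding lin[OF w] lin[OF L] by (intro tendsto_diff tendsto_const)
      then have "(\<lambda>k. \<bar>fd (\<lambda>x. \<Phi> k x - \<Phi> N x) (pd m \<phi>)\<bar>) \<longlonglongrightarrow> \<bar>fd (\<lambda>x. w x - \<Phi> N x) (pd m \<phi>)\<bar>" by (rule tendsto_rabs)
      moreover have "\<bar>fd (\<lambda>x. \<Phi> k x - \<Phi> N x) (pd m \<phi>)\<bar> \<le> e * L2n \<phi>" if k: "k \<ge> N" for k
      proof -
        have "\<bar>fd (\<lambda>x. \<Phi> k x - \<Phi> N x) (pd m \<phi>)\<bar> = \<bar>fd (\<lambda>x. pd m (\<Phi> k) x - pd m (\<Phi> N) x) \<phi>\<bar>"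
          by (simp add: fd_pd[OF test_on_diff[OF t t] \<phi>] pd_diff'[OF t t])
        also have "\<dots> \<le> L2n (\<lambda>x. pd m (\<Phi> k) x - pd m (\<Phi> N) x) * L2n \<phi>"
          unfolding fd_def by (intro L2_CS L2_test test_on_diff test_on_pd t \<phi>)
        also have "\<dots> \<le> e * L2n \<phi>"
          using N k le[of m] by (intro mult_right_mono N2 L2n_nonneg) auto
        finally show ?thesis .
      qed
      ultimately show "\<bar>fd (\<lambda>x. w x - \<Phi> N x) (pd m \<phi>)\<bar> \<le> e * L2n \<phi>"
        by (intro LIMSEQ_le_const2) auto
    qed
  qed
qed

lemma eps_symmetric_sum:
  assumes "\<And>k l. f k l = f l k" shows "(\<Sum>k\<in>UNIV. \<Sum>l\<in>UNIV. eps j k l * f k l) = 0"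
proof -
  have "j = 1 \<or> j = 2 \<or> j = 3" using exhaust_3 by auto
  then show ?thesis
    using assms[of 1 2] assms[of 1 3] assms[of 2 3] by (elim disjE) (simp_all add: sum_3 eps_def)
qed

lemma HB_eps_sum2:
  assumes "\<And>k l. HB (u k l) M" shows "HB (\<lambda>\<phi>. \<Sum>k\<in>UNIV. \<Sum>l\<in>UNIV. eps j (k::3) (l::3) * u k l \<phi>) (9 * M)"
proof (rule HB_mono)
  have M: "M \<ge> 0" using HB_nonneg[OF assms[of 1 1]] .
  show "HB (\<lambda>\<phi>. \<Sum>k\<in>UNIV. \<Sum>l\<in>UNIV. eps j k l * u k l \<phi>) (\<Sum>k\<in>UNIV. \<Sum>l\<in>UNIV. \<bar>eps j k l\<bar> * M)"
    by (intro HB_sum HB_cmult assms)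
  have "(\<Sum>k\<in>UNIV. \<Sum>l\<in>UNIV. \<bar>eps j k l\<bar> * M) \<le> (\<Sum>k\<in>(UNIV::3 set). \<Sum>l\<in>(UNIV::3 set). 1 * M)"
    by (intro sum_mono mult_right_mono abs_eps_le M)
  then show "(\<Sum>k\<in>UNIV. \<Sum>l\<in>UNIV. \<bar>eps j k l\<bar> * M) \<le> 9 * M" by simp
qed

lemma pd_commute3: "test \<phi> \<Longrightarrow> pd a (pd b (pd c \<phi>)) = pd c (pd b (pd a \<phi>))"
  by (metis pd_commute test_on_pd)

text \<open>In \<open>curl\<close> and \<open>inc\<close> of \<open>w\<^sub>0 + def w\<^sub>1 + hess w\<^sub>2\<close> all terms with three or more derivatives of a component
  cancel, so two derivatives suffice to control the norm.\<close>
lemma HB_curl_inc: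
  assumes \<delta>: "\<And>i j \<phi>. test \<phi> \<Longrightarrow> \<delta> i j \<phi> = w0 i j \<phi> + defV w1 i j \<phi> + hess w2 i j \<phi>"
    and s: "\<And>i j. small2 (w0 i j) e" "\<And>k. small2 (w1 k) e" "small2 w2 e"
  shows "HB (\<delta> i j) (3 * e)" "HB (curlM \<delta> i j) (18 * e)" "HB (inc \<delta> i j) (81 * e)"
proof -
  have h: "HB (w0 i j) e" "HB (dd m (w0 i j)) e" "HB (dd m (dd n (w0 i j))) e" "HB (dd m (w1 k)) e" "HB (dd m (dd n (w1 k))) e"
     "HB (dd m (dd n w2)) e" for i j k m n
    using s unfolding small2_def by blast+
  have e: "e \<ge> 0" by (rule HB_nonneg[OF h(1)])
  have "HB (\<lambda>\<phi>. w0 i j \<phi> + ((1/2) * dd j (w1 i) \<phi> + (1/2) * dd i (w1 j) \<phi>) + dd i (dd j w2) \<phi>) (e + (\<bar>1/2\<bar> * e + \<bar>1/2\<bar> * e) + e)"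
    by (intro HB_add HB_comb h)
  then have "HB (\<lambda>\<phi>. w0 i j \<phi> + ((1/2) * dd j (w1 i) \<phi> + (1/2) * dd i (w1 j) \<phi>) + dd i (dd j w2) \<phi>) (3 * e)" by simp
  then show "HB (\<delta> i j) (3 * e)"
    by (rule HB_cong) (simp add: \<delta> defV_def hess_def add_divide_distrib)
  have d3: "\<delta> i j \<phi> = w0 i j \<phi> + (- w1 i (pd j \<phi>) - w1 j (pd i \<phi>)) / 2 + w2 (pd j (pd i \<phi>))" if "test \<phi>" for i j \<phi>
    using \<delta>[OF that] by (simp add: defV_def hess_def dd_def)
  have "HB (\<lambda>\<phi>. \<Sum>a\<in>UNIV. \<Sum>b\<in>UNIV. eps j a b * (1 * dd a (w0 i b) \<phi> + (1/2) * dd a (dd i (w1 b)) \<phi>)) (9 * (\<bar>1\<bar> * e + \<bar>1/2\<bar> * e))"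
    by (intro HB_eps_sum2 HB_comb h)
  then have "HB (curlM \<delta> i j) (9 * (\<bar>1\<bar> * e + \<bar>1/2\<bar> * e))"
  proof (rule HB_cong)
    fix \<phi> assume \<phi>: "test \<phi>"
    \<comment> \<open>The terms symmetric in the two indices that are contracted with the
      alternating symbol.\<close>
    define S where "S a b = w1 i (pd b (pd a \<phi>)) / 2 - w2 (pd b (pd i (pd a \<phi>)))" for a b
    have Ssym: "S a b = S b a" for a b
      unfolding S_def using pd_commute[OF \<phi>, of b a] pd_commute3[OF \<phi>, of b i a] by simp
    have "curlM \<delta> i j \<phi> = (\<Sum>a\<in>UNIV. \<Sum>b\<in>UNIV. eps j a b * (1 * dd a (w0 i b) \<phi> + (1/2) * dd a (dd i (w1 b)) \<phi>) + eps j a b * S a b)"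
      unfolding curlM_def curlV_def
    proof (intro sum.cong refl)
      fix a b
      show "eps j a b * dd a (\<delta> i b) \<phi> = eps j a b * (1 * dd a (w0 i b) \<phi> + (1/2) * dd a (dd i (w1 b)) \<phi>) + eps j a b * S a b"
        unfolding S_def dd_def d3[OF test_on_pd[OF \<phi>]] by (simp add: field_simps)
    qed
    also have "\<dots> = (\<Sum>a\<in>UNIV. \<Sum>b\<in>UNIV. eps j a b * (1 * dd a (w0 i b) \<phi> + (1/2) * dd a (dd i (w1 b)) \<phi>)) + (\<Sum>a\<in>UNIV. \<Sum>b\<in>UNIV. eps j a b * S a b)"
      by (simp only: sum.distrib)
    finally show "curlM \<delta> i j \<phi> = (\<Sum>a\<in>UNIV. \<Sum>b\<in>UNIV. eps j a b * (1 * dd a (w0 i b) \<phi> + (1/2) * dd a (dd i (w1 b)) \<phi>))"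
      by (simp only: eps_symmetric_sum[OF Ssym] add_0_right)
  qed
  then show "HB (curlM \<delta> i j) (18 * e)" by (rule HB_mono) (use e in simp)
  have "HB (\<lambda>\<phi>. \<Sum>a\<in>UNIV. \<Sum>b\<in>UNIV. eps j a b * (\<Sum>c\<in>UNIV. \<Sum>k\<in>UNIV. eps i c k * dd a (dd c (w0 b k)) \<phi>)) (9 * (9 * e))"
    by (intro HB_eps_sum2 h)
  then have "HB (inc \<delta> i j) (9 * (9 * e))"
  proof (rule HB_cong)
    fix \<phi> assume \<phi>: "test \<phi>"
    have inc_eq: "inc \<delta> i j \<phi> = (\<Sum>a\<in>UNIV. \<Sum>b\<in>UNIV. eps j a b * (\<Sum>c\<in>UNIV. \<Sum>k\<in>UNIV. eps i c k * \<delta> b k (pd c (pd a \<phi>))))"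
      unfolding inc_def curlM_def curlV_def dd_def by (simp add: sum_negf)
    \<comment> \<open>These terms are symmetric in c and k and disappear under the inner alternating
      symbol.\<close>
    define T where "T b k a c = w2 (pd k (pd b (pd c (pd a \<phi>)))) - w1 b (pd k (pd c (pd a \<phi>))) / 2" for a b c k
    have Tsym: "T b k a c = T b c a k" for a b c k
      unfolding T_def using pd_commute[OF test_on_pd[OF \<phi>], of k c a] pd_commute3[OF test_on_pd[OF \<phi>], of k b c a] by simp
    \<comment> \<open>The remaining \<open>w1\<close> terms survive the inner contraction, but are
      symmetric in a and b and disappear under the outer one.\<close>
    define V where "V a b = (\<Sum>c\<in>UNIV. \<Sum>k\<in>UNIV. eps i c k * (- w1 k (pd b (pd c (pd a \<phi>))) / 2))" for a b
    have Vsym: "V a b = V b a" for a b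
      unfolding V_def using pd_commute3[OF \<phi>, of b _ a] by simp
    have inner: "(\<Sum>c\<in>UNIV. \<Sum>k\<in>UNIV. eps i c k * \<delta> b k (pd c (pd a \<phi>)))
       = (\<Sum>c\<in>UNIV. \<Sum>k\<in>UNIV. eps i c k * dd a (dd c (w0 b k)) \<phi>) + V a b" for a b
    proof -
      have "(\<Sum>c\<in>UNIV. \<Sum>k\<in>UNIV. eps i c k * \<delta> b k (pd c (pd a \<phi>)))
        = (\<Sum>c\<in>UNIV. \<Sum>k\<in>UNIV. eps i c k * dd a (dd c (w0 b k)) \<phi> + eps i c k * (- w1 k (pd b (pd c (pd a \<phi>))) / 2) + eps i c k * T b k a c)"
      proof (intro sum.cong refl)
        fix c k
        show "eps i c k * \<delta> b k (pd c (pd a \<phi>)) = eps i c k * dd a (dd c (w0 b k)) \<phi> + eps i c k * (- w1 k (pd b (pd c (pd a \<phi>))) / 2) + eps i c k * T b k a c"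
          unfolding T_def dd_def d3[OF test_on_pd[OF test_on_pd[OF \<phi>]]] by (simp add: field_simps)
      qed
      also have "\<dots> = (\<Sum>c\<in>UNIV. \<Sum>k\<in>UNIV. eps i c k * dd a (dd c (w0 b k)) \<phi>) + V a b + (\<Sum>c\<in>UNIV. \<Sum>k\<in>UNIV. eps i c k * T b k a c)"
        by (simp only: sum.distrib V_def)
      also have "(\<Sum>c\<in>UNIV. \<Sum>k\<in>UNIV. eps i c k * T b k a c) = 0" by (rule eps_symmetric_sum) (rule Tsym)
      finally show ?thesis by simp
    qed
    show "inc \<delta> i j \<phi> = (\<Sum>a\<in>UNIV. \<Sum>b\<in>UNIV. eps j a b * (\<Sum>c\<in>UNIV. \<Sum>k\<in>UNIV. eps i c k * dd a (dd c (w0 b k)) \<phi>))"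
      unfolding inc_eq inner distrib_left sum.distrib eps_symmetric_sum[OF Vsym] by simp
  qed
  then show "HB (inc \<delta> i j) (81 * e)" by simp
qed

lemma HB_in_Hm1: "HB u M \<Longrightarrow> in_Hm1 u"
  unfolding in_Hm1_def
proof
  assume u: "HB u M"
  then show "lin_test u" by (rule HB_lin)
  show "bdd_above ((\<lambda>\<phi>. \<bar>u \<phi>\<bar> / h1n \<phi>) ` {\<phi>. test \<phi> \<and> \<phi> \<noteq> (\<lambda>_. 0)})"
    by (rule bdd_aboveI2[of _ _ M]) (use HB_bound[OF u] h1n_pos in \<open>auto simp: divide_le_eq\<close>)
qed

text \<open>There are 27 component norms, and 27 M^2 \<le> (6 M)^2.\<close>

lemma ccnorm_le:
  assumes "\<And>i j. HB (\<delta> i j) M" "\<And>i j. HB (curlM \<delta> i j) M" "\<And>i j. HB (inc \<delta> i j) M"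
  shows "ccnorm \<delta> \<le> 6 * M"
proof -
  have M: "M \<ge> 0" by (rule HB_nonneg[OF assms(1)])
  have sq: "(Hm1norm u)\<^sup>2 \<le> M\<^sup>2" if "HB u M" for u
    by (rule power_mono[OF Hm1norm_le[OF that] Hm1norm_nonneg[OF HB_in_Hm1[OF that]]])
  have "ccnorm \<delta> \<le> sqrt ((\<Sum>i\<in>(UNIV::3 set). \<Sum>j\<in>(UNIV::3 set). M\<^sup>2) + (\<Sum>i\<in>(UNIV::3 set). \<Sum>j\<in>(UNIV::3 set). M\<^sup>2)
     + (\<Sum>i\<in>(UNIV::3 set). \<Sum>j\<in>(UNIV::3 set). M\<^sup>2))"
    unfolding ccnorm_def by (intro real_sqrt_le_mono add_mono sum_mono sq assms)
  also have "\<dots> \<le> sqrt ((6 * M)\<^sup>2)" by (intro real_sqrt_le_mono) (simp add: power_mult_distrib)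
  also have "\<dots> = 6 * M" by (rule real_sqrt_unique) (use M in simp_all)
  finally show ?thesis .
qed

text \<open>An arbitrary representative of the limit; two choices agree almost everywhere
  only.\<close>

definition L2_limit :: "(nat \<Rightarrow> R3 \<Rightarrow> real) \<Rightarrow> R3 \<Rightarrow> real" where
  "L2_limit \<Phi> = (SOME w. L2_lim \<Phi> w)"

lemma L2_lim_limit: "L2_lim \<Phi> w \<Longrightarrow> L2_lim \<Phi> (L2_limit \<Phi>)"
  unfolding L2_limit_def by (rule someI[of "L2_lim \<Phi>"])

lemma h10_seq_limit: "h10_seq \<Omega> M \<Phi> \<Longrightarrow> L2_lim \<Phi> (L2_limit \<Phi>)"
  unfolding h10_seq_def using L2_complete L2_lim_limit by metis

lemma L2_limit_linear:
  assumes \<Phi>: "h10_seq \<Omega> M \<Phi>" and \<Phi>': "h10_seq \<Omega> M' \<Phi>'"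
    and \<Theta>: "\<And>N x. \<Theta> N x = a * \<Phi> N x + b * \<Phi>' N x"
  shows "AE x in lborel. L2_limit \<Theta> x = a * L2_limit \<Phi> x + b * L2_limit \<Phi>' x"
proof -
  have eq: "\<Theta> = (\<lambda>N x. a * \<Phi> N x + b * \<Phi>' N x)" using \<Theta> by auto
  have lim: "L2_lim \<Theta> (\<lambda>x. a * L2_limit \<Phi> x + b * L2_limit \<Phi>' x)"
    unfolding eq by (intro L2_lim_lincomb h10_seq_L2[OF \<Phi>] h10_seq_L2[OF \<Phi>'] h10_seq_limit[OF \<Phi>] h10_seq_limit[OF \<Phi>'])
  have "L2 (\<Theta> N)" for N unfolding eq by (intro L2_add L2_cmult h10_seq_L2[OF \<Phi>] h10_seq_L2[OF \<Phi>'])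
  from L2_lim_unique[OF this L2_lim_limit[OF lim] lim] show ?thesis .
qed

lemma fd_limit: "h10_seq \<Omega> M \<Phi> \<Longrightarrow> test \<psi> \<Longrightarrow> (\<lambda>N. fd (\<Phi> N) \<psi>) \<longlonglongrightarrow> fd (L2_limit \<Phi>) \<psi>"
  unfolding fd_def by (intro L2_lim_integral h10_seq_L2 h10_seq_limit L2_test)

lemma fd_diff: "L2 f \<Longrightarrow> L2 g \<Longrightarrow> test \<psi> \<Longrightarrow> fd (\<lambda>x. f x - g x) \<psi> = fd f \<psi> - fd g \<psi>"
  unfolding fd_def using L2_mult_integrable[OF _ L2_test] by (simp add: left_diff_distrib)

context
  fixes \<Omega> X Y Z C
  assumes D: "decomposes \<Omega> (\<lambda>_. 1) X Y Z C"
begin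

lemma limit_decomposition:
  assumes g: "Hhat_cc \<Omega> g" and \<psi>: "test \<psi>"
  shows "g i j \<psi> = fd (L2_limit (\<lambda>N. X g N i j)) \<psi> + defV (\<lambda>k. fd (L2_limit (\<lambda>N. Y g N k))) i j \<psi> + hess (fd (L2_limit (Z g))) i j \<psi>"
proof (rule LIMSEQ_unique)
  note s = decomposes_h10_seq[OF D g]
  show "(\<lambda>N. fd (X g N i j) \<psi> + defV (\<lambda>k. fd (Y g N k)) i j \<psi> + hess (fd (Z g N)) i j \<psi>) \<longlonglongrightarrow> g i j \<psi>"
    using decomposes_limit[OF D g \<psi>] by simp
  show "(\<lambda>N. fd (X g N i j) \<psi> + defV (\<lambda>k. fd (Y g N k)) i j \<psi> + hess (fd (Z g N)) i j \<psi>) \<longlonglongrightarrow>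
     fd (L2_limit (\<lambda>N. X g N i j)) \<psi> + defV (\<lambda>k. fd (L2_limit (\<lambda>N. Y g N k))) i j \<psi> + hess (fd (L2_limit (Z g))) i j \<psi>"
    unfolding defV_def hess_def dd_def minus_minus
    by (intro tendsto_add tendsto_divide tendsto_minus tendsto_const fd_limit[OF s(1)] fd_limit[OF s(2)] fd_limit[OF s(3)] test_on_pd \<psi>) simp
qed

text \<open>The approximants inserted into the decomposition formula give a symmetric field of test
  functions in the domain. Its distance to \<open>g\<close> has the same form, with small
  potentials, and \<open>HB_curl_inc\<close> applies to it.\<close>

lemma Hhat_imp_Htilde:
  assumes g: "Hhat_cc \<Omega> g" shows "Htilde_cc \<Omega> g"
  unfolding Htilde_cc_def
proof (intro conjI allI impI g)
  fix e :: real assume e: "e > 0"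
  \<comment> \<open>Any divisor above 6 * 81 = 486 would do, the constants of
    \<open>ccnorm_le\<close> and of the estimate for \<open>inc\<close>.\<close>
  define e' where "e' = e / 1000"
  have e': "e' > 0" using e by (simp add: e'_def)
  note s = decomposes_h10_seq[OF D g]
  have "\<exists>N0. \<forall>N\<ge>N0. small2 (fd (\<lambda>x. L2_limit (\<lambda>N. X g N i j) x - X g N i j x)) e'" for i j
    by (rule small2_h10_seq[OF s(1) h10_seq_limit[OF s(1)] e'])
  then obtain N0 where N0: "\<And>i j N. N \<ge> N0 i j \<Longrightarrow> small2 (fd (\<lambda>x. L2_limit (\<lambda>N. X g N i j) x - X g N i j x)) e'" by metis
  have "\<exists>N1. \<forall>N\<ge>N1. small2 (fd (\<lambda>x. L2_limit (\<lambda>N. Y g N k) x - Y g N k x)) e'" for k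
    by (rule small2_h10_seq[OF s(2) h10_seq_limit[OF s(2)] e'])
  then obtain N1 where N1: "\<And>k N. N \<ge> N1 k \<Longrightarrow> small2 (fd (\<lambda>x. L2_limit (\<lambda>N. Y g N k) x - Y g N k x)) e'" by metis
  obtain N2 where N2: "\<And>N. N \<ge> N2 \<Longrightarrow> small2 (fd (\<lambda>x. L2_limit (Z g) x - Z g N x)) e'"
    using small2_h10_seq[OF s(3) h10_seq_limit[OF s(3)] e'] by blast
  \<comment> \<open>A sum of finitely many thresholds exceeds each of them, so one index serves all
    components.\<close>
  define N where "N = (\<Sum>i\<in>UNIV. \<Sum>j\<in>UNIV. N0 i j) + (\<Sum>k\<in>UNIV. N1 k) + N2"
  have "N0 i j \<le> (\<Sum>i\<in>UNIV. \<Sum>j\<in>UNIV. N0 i j)" for i j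
  proof -
    have "N0 i j \<le> (\<Sum>j\<in>UNIV. N0 i j)" by (rule member_le_sum) auto
    also have "\<dots> \<le> (\<Sum>i\<in>UNIV. \<Sum>j\<in>UNIV. N0 i j)" by (rule member_le_sum) auto
    finally show ?thesis .
  qed
  moreover have "N1 k \<le> (\<Sum>k\<in>UNIV. N1 k)" for k by (rule member_le_sum) auto
  ultimately have N: "N \<ge> N0 i j" "N \<ge> N1 k" "N \<ge> N2" for i j k
    unfolding N_def by (meson trans_le_add1 trans_le_add2 le_add2)+
  define \<psi> where "\<psi> i j = (\<lambda>x. X g N i j x + ((1/2) * (pd j (Y g N i) x + pd i (Y g N j) x) + pd i (pd j (Z g N)) x))" for i j
  have on: "test_on \<Omega> (X g N i j)" "test_on \<Omega> (Y g N k)" "test_on \<Omega> (Z g N)" for i j k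
    using s by (auto simp: h10_seq_def)
  have t: "test (X g N i j)" "test (Y g N k)" "test (Z g N)" for i j k using on test_on_test by blast+
  have L: "L2 (X g N i j)" "L2 (Y g N k)" "L2 (Z g N)" for i j k using t L2_test by blast+
  have lim: "L2 (L2_limit (\<lambda>N. X g N i j))" "L2 (L2_limit (\<lambda>N. Y g N k))" "L2 (L2_limit (Z g))" for i j k
    using h10_seq_limit[OF s(1)] h10_seq_limit[OF s(2)] h10_seq_limit[OF s(3)] by (auto simp: L2_lim_def)
  have fd\<psi>: "fd (\<psi> i j) \<phi> = fd (X g N i j) \<phi> + defV (\<lambda>k. fd (Y g N k)) i j \<phi> + hess (fd (Z g N)) i j \<phi>" if \<phi>: "test \<phi>" for i j \<phi>
  proof -
    have "fd (\<psi> i j) \<phi> = fd (\<lambda>x. 1 * X g N i j x + 1 * (\<lambda>x. (1/2) * (\<lambda>x. 1 * pd j (Y g N i) x + 1 * pd i (Y g N j) x) x + 1 * pd i (pd j (Z g N)) x) x) \<phi>"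
      by (simp add: \<psi>_def)
    also have "\<dots> = 1 * fd (X g N i j) \<phi> + 1 * ((1/2) * (1 * fd (pd j (Y g N i)) \<phi> + 1 * fd (pd i (Y g N j)) \<phi>) + 1 * fd (pd i (pd j (Z g N))) \<phi>)"
      by (subst fd_comb, (intro \<phi> test_on_add test_on_cmult test_on_pd t)+)+ (rule refl)
    also have "\<dots> = fd (X g N i j) \<phi> + defV (\<lambda>k. fd (Y g N k)) i j \<phi> + hess (fd (Z g N)) i j \<phi>"
      by (simp add: defV_def hess_def dd_def fd_pd t \<phi> test_on_pd)
    finally show ?thesis .
  qed
  define \<delta> where "\<delta> = (\<lambda>i j \<phi>. g i j \<phi> - fd (\<psi> i j) \<phi>)"
  define w0 where "w0 i j = fd (\<lambda>x. L2_limit (\<lambda>N. X g N i j) x - X g N i j x)" for i j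
  define w1 where "w1 k = fd (\<lambda>x. L2_limit (\<lambda>N. Y g N k) x - Y g N k x)" for k
  define w2 where "w2 = fd (\<lambda>x. L2_limit (Z g) x - Z g N x)"
  have dec: "\<delta> i j \<phi> = w0 i j \<phi> + defV w1 i j \<phi> + hess w2 i j \<phi>" if \<phi>: "test \<phi>" for i j \<phi>
    unfolding \<delta>_def limit_decomposition[OF g \<phi>] fd\<psi>[OF \<phi>] w0_def w1_def w2_def defV_def hess_def dd_def
    by (simp add: fd_diff lim L \<phi> test_on_pd field_simps)
  have sm: "small2 (w0 i j) e'" "small2 (w1 k) e'" "small2 w2 e'" for i j k
    unfolding w0_def w1_def w2_def by (intro N0 N1 N2 N)+
  have HBs: "HB (\<delta> i j) (81 * e')" "HB (curlM \<delta> i j) (81 * e')" "HB (inc \<delta> i j) (81 * e')" for i j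
    by (rule HB_mono[OF HB_curl_inc(1)[OF dec sm]] HB_mono[OF HB_curl_inc(2)[OF dec sm]] HB_curl_inc(3)[OF dec sm];
        use e' in simp)+
  have "ccnorm \<delta> \<le> 6 * (81 * e')" by (rule ccnorm_le[OF HBs])
  also have "\<dots> < e" using e by (simp add: e'_def)
  finally have small: "ccnorm (\<lambda>i j \<phi>. g i j \<phi> - fd (\<psi> i j) \<phi>) < e" by (simp add: \<delta>_def)
  have "test_on \<Omega> (\<psi> i j)" for i j
    unfolding \<psi>_def by (intro test_on_add test_on_cmult test_on_pd on)
  moreover have "\<psi> i j = \<psi> j i" for i j
    unfolding \<psi>_def decomposes_sym[OF D, of g N i j] pd_commute[OF t(3), of i j] by (simp add: add.commute)
  ultimately show "\<exists>\<psi>. (\<forall>i j. test_on \<Omega> (\<psi> i j) \<and> \<psi> i j = \<psi> j i) \<and> ccnorm (\<lambda>i j \<phi>. g i j \<phi> - fd (\<psi> i j) \<phi>) < e"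
    using small by blast
qed

end

theorem mainTheorem12:
  fixes \<Omega> :: "R3 set"
  assumes "open \<Omega>" and "bounded \<Omega>" and "connected \<Omega>" and "simply_connected \<Omega>"
    and "lipschitz_boundary \<Omega>" and "connected (frontier \<Omega>)"
  shows "(\<exists>(S0 :: (3 \<Rightarrow> 3 \<Rightarrow> distr) \<Rightarrow> 3 \<Rightarrow> 3 \<Rightarrow> R3 \<Rightarrow> real)
            (S1 :: (3 \<Rightarrow> 3 \<Rightarrow> distr) \<Rightarrow> 3 \<Rightarrow> R3 \<Rightarrow> real)
            (S2 :: (3 \<Rightarrow> 3 \<Rightarrow> distr) \<Rightarrow> R3 \<Rightarrow> real).
     (\<forall>g. Hhat_cc \<Omega> g \<longrightarrow>
        (\<forall>i j. H10 \<Omega> (S0 g i j) \<and> S0 g i j = S0 g j i) \<and>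
        (\<forall>k. H10 \<Omega> (S1 g k)) \<and> H10 \<Omega> (S2 g)) \<and>
     (\<forall>g h a b. Hhat_cc \<Omega> g \<longrightarrow> Hhat_cc \<Omega> h \<longrightarrow>
        (let gh = (\<lambda>i j \<phi>. a * g i j \<phi> + b * h i j \<phi>) in
          (\<forall>i j. AE x in lborel. S0 gh i j x = a * S0 g i j x + b * S0 h i j x) \<and>
          (\<forall>k. AE x in lborel. S1 gh k x = a * S1 g k x + b * S1 h k x) \<and>
          (AE x in lborel. S2 gh x = a * S2 g x + b * S2 h x))) \<and>
     (\<exists>C. \<forall>g. Hhat_cc \<Omega> g \<longrightarrow>
        (\<forall>i j. h1norm (S0 g i j) \<le> C * ccnorm g) \<and>
        (\<forall>k. h1norm (S1 g k) \<le> C * ccnorm g) \<and>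
        h1norm (S2 g) \<le> C * ccnorm g) \<and>
     (\<forall>g. Hhat_cc \<Omega> g \<longrightarrow> (\<forall>i j \<phi>. test \<phi> \<longrightarrow>
        g i j \<phi> = fd (S0 g i j) \<phi> + defV (\<lambda>k. fd (S1 g k)) i j \<phi> + hess (fd (S2 g)) i j \<phi>)))
   \<and> Hhat_cc \<Omega> = Htilde_cc \<Omega>"
proof -
  obtain X Y Z C where D: "decomposes \<Omega> (\<lambda>_. 1) X Y Z C"
    using decomposes_global[OF assms(1,2,5)] by (elim exE) (rule that)
  define S0 where "S0 g i j = L2_limit (\<lambda>N. X g N i j)" for g i j
  define S1 where "S1 g k = L2_limit (\<lambda>N. Y g N k)" for g k
  define S2 where "S2 g = L2_limit (Z g)" for g
  note s = decomposes_h10_seq[OF D]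
  \<comment> \<open>One inclusion is part of the definition of \<open>Htilde_cc\<close>; the other
    is the density result.\<close>
  have eq: "Hhat_cc \<Omega> = Htilde_cc \<Omega>"
  proof
    fix g show "Hhat_cc \<Omega> g = Htilde_cc \<Omega> g"
      using Hhat_imp_Htilde[OF D] by (auto simp: Htilde_cc_def)
  qed
  show ?thesis
  proof (rule conjI[OF _ eq], rule exI[of _ S0], rule exI[of _ S1], rule exI[of _ S2], unfold Let_def, intro conjI allI impI)
    fix g assume g: "Hhat_cc \<Omega> g"
    show "H10 \<Omega> (S0 g i j)" for i j
      unfolding S0_def by (rule H10_of_h10_seq[OF s(1)[OF g] h10_seq_limit[OF s(1)[OF g]]])
    show "S0 g i j = S0 g j i" for i j
      unfolding S0_def decomposes_sym[OF D, of g _ i j] ..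
    show "H10 \<Omega> (S1 g k)" for k
      unfolding S1_def by (rule H10_of_h10_seq[OF s(2)[OF g] h10_seq_limit[OF s(2)[OF g]]])
    show "H10 \<Omega> (S2 g)"
      unfolding S2_def by (rule H10_of_h10_seq[OF s(3)[OF g] h10_seq_limit[OF s(3)[OF g]]])
  next
    fix g h a b assume g: "Hhat_cc \<Omega> g" and h: "Hhat_cc \<Omega> h"
    show "AE x in lborel. S0 (\<lambda>i j \<phi>. a * g i j \<phi> + b * h i j \<phi>) i j x = a * S0 g i j x + b * S0 h i j x" for i j
      unfolding S0_def by (rule L2_limit_linear[OF s(1)[OF g] s(1)[OF h]]) (rule decomposes_linear(1)[OF D])
    show "AE x in lborel. S1 (\<lambda>i j \<phi>. a * g i j \<phi> + b * h i j \<phi>) k x = a * S1 g k x + b * S1 h k x" for k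
      unfolding S1_def by (rule L2_limit_linear[OF s(2)[OF g] s(2)[OF h]]) (rule decomposes_linear(2)[OF D])
    show "AE x in lborel. S2 (\<lambda>i j \<phi>. a * g i j \<phi> + b * h i j \<phi>) x = a * S2 g x + b * S2 h x"
      unfolding S2_def by (rule L2_limit_linear[OF s(3)[OF g] s(3)[OF h]]) (rule decomposes_linear(3)[OF D])
  next
    \<comment> \<open>The factor 2 comes from the four squares in the Sobolev norm.\<close>
    have le: "h1norm (L2_limit \<Phi>) \<le> (2 * C) * ccnorm g" if "h10_seq \<Omega> (C * ccnorm g) \<Phi>" for g \<Phi>
      using h1norm_le_of_h10_seq[OF that h10_seq_limit[OF that]] by simp
    show "\<exists>C. \<forall>g. Hhat_cc \<Omega> g \<longrightarrow> (\<forall>i j. h1norm (S0 g i j) \<le> C * ccnorm g) \<and>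
        (\<forall>k. h1norm (S1 g k) \<le> C * ccnorm g) \<and> h1norm (S2 g) \<le> C * ccnorm g"
      unfolding S0_def S1_def S2_def by (intro exI[of _ "2 * C"] allI impI conjI le s)
  next
    fix g i j \<phi> assume "Hhat_cc \<Omega> g" "test \<phi>"
    from limit_decomposition[OF D this]
    show "g i j \<phi> = fd (S0 g i j) \<phi> + defV (\<lambda>k. fd (S1 g k)) i j \<phi> + hess (fd (S2 g)) i j \<phi>"
      unfolding S0_def S1_def S2_def .
  qed
qed

end
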